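(* Let $d\ge 2$, $1\le k\le d$, and let $F:(\mathbb R^d)^k\to\mathbb R_{\ge 0}$ be bounded and compactly supported. Then $$\int_Y\widehat F(\Lambda)\,d\mu_Y(\Lambda)=\int_{(\mathbb R^d)^k}F\begin{pmatrix}\mathbf y_1\\ \vdots\\ \mathbf y_k\end{pmatrix}d\mathbf y_1\cdots d\mathbf y_k+\int_{\mathbb R^d}F\begin{pmatrix}\mathbf y_1\\ \vdots\\ \mathbf y_1\end{pmatrix}d\mathbf y_1+\sum_{m=2}^{k-1}\sum_{u=1}^\infty\sum_{\widetilde{D'}\in\mathfrak A^k_{m,u}}\frac{N(\widetilde{D'},u)^d}{u^{dm}}\int_{(\mathbb R^d)^m}F\left(\frac{\widetilde{D'}}{u}\begin{pmatrix}\mathbf y_1\\ \vdots\\ \mathbf y_m\end{pmatrix}\right)d\mathbf y_1\cdots d\mathbf y_m.$$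
   Context: $Y=\mathrm{ASL}_d(\mathbb Z)\backslash\mathrm{ASL}_d(\mathbb R)$ is the space of affine unimodular lattices $\mathbb Z^dg+\xi$ ($g\in\mathrm{SL}_d(\mathbb R)$, $\xi\in\mathbb R^d$), $\mu_Y$ its $\mathrm{ASL}_d(\mathbb R)$-invariant probability measure. We identify $(\mathbb R^d)^k$ with $\mathrm{Mat}_{k,d}(\mathbb R)$ (the $i$-th row is the $i$-th vector). For $F:(\mathbb R^d)^k\to\mathbb R$ and a (affine) lattice $\Lambda$, $\widehat F(\Lambda)=\sum_{\mathbf m_1,\dots,\mathbf m_k\in\Lambda}F(\mathbf m_1,\dots,\mathbf m_k)$. Rogers' notation: for $u\in\mathbb N$ and $1\le r\le k$, $\mathfrak D^k_{r,u}$ is the set of integer matrices $D=(d_{ij})\in\mathrm{Mat}_{k,r}(\mathbb Z)$ such that the gcd of all entries of $D$ is $1$ and there are indices $1\le i_1<\dots<i_r\le k$ with (i) the rows $i_1,\dots,i_r$ of $D$ form the matrix $u\,\mathrm{Id}_r$, and (ii) $d_{ij}=0$ for $1\le j\le r$ and $1\le i<i_j$. $N(D,u)$ is the number of $\mathbf v\in\{0,1,\dots,u-1\}^r$ with $\frac1uD\,\mathbf v^{T}\in\mathbb Z^k$. For $D\in\mathfrak D^{k-1}_{r,u}$ let $D'$ be the $k\times(r+1)$ matrix whose first row is $(u,0,\dots,0)$ and whose rows $2,\dots,k$ are $(u,\ \text{row } i-1 \text{ of } D)$; let $\widetilde{D'}$ be obtained from $D'$ by replacing its first column $[D']^1$ by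 $[D']^1-\sum_{\ell=2}^{r+1}[D']^\ell$ (other columns unchanged). $\mathfrak A^k_{r+1,u}$ is the set of all such $\widetilde{D'}$ with $D\in\mathfrak D^{k-1}_{r,u}$ (it is a subset of $\mathfrak D^k_{r+1,u}$).
   Formalization: For k=1 the second (diagonal) integral is dropped, since read literally the formula would give twice the integral of F, which is false; for k≥2 the formula is exactly as stated. F is taken to be Borel measurable. *)

theory Defs
  imports "HOL-Probability.Probability"
begin

definition aff_lattice :: "real^'n^'n \<Rightarrow> real^'n \<Rightarrow> (real^'n) set" where
  "aff_lattice g xi = {x v* g + xi | x. \<forall>i. x $ i \<in> \<int>}"

text \<open>Y = ASL_d(Z)\ASL_d(R), identified with the set of affine unimodular lattices.\<close>
definition Yspace :: "(real^'n) set set" where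
  "Yspace = {aff_lattice g xi | g xi. det g = 1}"

text \<open>Quotient sigma-algebra: A is measurable iff its preimage in ASL_d(R) is Borel.\<close>
definition Ysets :: "(real^'n) set set set" where
  "Ysets = {A. A \<subseteq> Yspace \<and>
     {p :: (real^'n^'n) \<times> (real^'n). det (fst p) = 1 \<and> aff_lattice (fst p) (snd p) \<in> A} \<in> sets borel}"

definition ASL_act :: "real^'n^'n \<Rightarrow> real^'n \<Rightarrow> (real^'n) set \<Rightarrow> (real^'n) set" where
  "ASL_act h eta L = (\<lambda>x. x v* h + eta) ` L"

definition is_muY :: "(real^'n) set measure \<Rightarrow> bool" where
  "is_muY M \<longleftrightarrow> space M = Yspace \<and> sets M = Ysets \<and> prob_space M \<and>
     (\<forall>h eta. det h = 1 \<longrightarrow>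
        (\<forall>A \<in> sets M. emeasure M {L \<in> space M. ASL_act h eta L \<in> A} = emeasure M A))"

text \<open>Siegel transform: F-hat(Lambda) = sum over (m_1..m_k) in Lambda^k of F(m_1..m_k)
  (a sum of nonnegative terms, valued in [0,\<infinity>]). k-tuples are extensional functions
  on {..<k}.\<close>
definition Fhat :: "nat \<Rightarrow> ((nat \<Rightarrow> real^'n) \<Rightarrow> real) \<Rightarrow> (real^'n) set \<Rightarrow> ennreal" where
  "Fhat k F L = (\<integral>\<^sup>+ m. ennreal (F m) \<partial>count_space (PiE {..<k} (\<lambda>_. L)))"

text \<open>Integer k x r matrices are functions nat \<Rightarrow> nat \<Rightarrow> int vanishing outside
  {..<k} x {..<r}; indices are 0-based.\<close>

definition Dset :: "nat \<Rightarrow> nat \<Rightarrow> nat \<Rightarrow> (nat \<Rightarrow> nat \<Rightarrow> int) set" where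
  "Dset k r u = {D. (\<forall>i j. (k \<le> i \<or> r \<le> j) \<longrightarrow> D i j = 0) \<and>
     Gcd {D i j | i j. i < k \<and> j < r} = 1 \<and>
     (\<exists>idx :: nat \<Rightarrow> nat. (\<forall>l<r. idx l < k) \<and>
        (\<forall>l l'. l < l' \<and> l' < r \<longrightarrow> idx l < idx l') \<and>
        (\<forall>l<r. \<forall>j<r. D (idx l) j = (if j = l then int u else 0)) \<and>
        (\<forall>j<r. \<forall>i<idx j. D i j = 0))}"

definition Ncount :: "nat \<Rightarrow> nat \<Rightarrow> (nat \<Rightarrow> nat \<Rightarrow> int) \<Rightarrow> nat \<Rightarrow> nat" where
  "Ncount k r D u = card {v :: nat \<Rightarrow> int. (\<forall>j<r. 0 \<le> v j \<and> v j < int u) \<and>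
      (\<forall>j. r \<le> j \<longrightarrow> v j = 0) \<and> (\<forall>i<k. int u dvd (\<Sum>j<r. D i j * v j))}"

definition Dprime :: "nat \<Rightarrow> nat \<Rightarrow> nat \<Rightarrow> (nat \<Rightarrow> nat \<Rightarrow> int) \<Rightarrow> nat \<Rightarrow> nat \<Rightarrow> int" where
  "Dprime k r u D i j = (if k \<le> i \<or> r + 1 \<le> j then 0
      else if j = 0 then int u else if i = 0 then 0 else D (i - 1) (j - 1))"

definition Dtilde :: "nat \<Rightarrow> nat \<Rightarrow> nat \<Rightarrow> (nat \<Rightarrow> nat \<Rightarrow> int) \<Rightarrow> nat \<Rightarrow> nat \<Rightarrow> int" where
  "Dtilde k r u D i j = (if k \<le> i \<or> r + 1 \<le> j then 0
      else if j = 0 then Dprime k r u D i 0 - (\<Sum>l\<in>{1..r}. Dprime k r u D i l)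
      else Dprime k r u D i j)"

definition Aset :: "nat \<Rightarrow> nat \<Rightarrow> nat \<Rightarrow> (nat \<Rightarrow> nat \<Rightarrow> int) set" where
  "Aset k m u = Dtilde k (m - 1) u ` Dset (k - 1) (m - 1) u"

definition matapp :: "nat \<Rightarrow> nat \<Rightarrow> (nat \<Rightarrow> nat \<Rightarrow> int) \<Rightarrow> nat \<Rightarrow> (nat \<Rightarrow> real^'n) \<Rightarrow> nat \<Rightarrow> real^'n" where
  "matapp k m D u y = restrict (\<lambda>i. \<Sum>j<m. (real_of_int (D i j) / real u) *\<^sub>R y j) {..<k}"

end

theory Submission
  imports Defs
begin

text \<open>Fix \<open>k = n + 1\<close>. Splitting a \<open>k\<close>-tuple of points of an affine lattice into its first
  point and the \<open>n\<close> differences, translation invariance turns the sum over the first point into a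
  Lebesgue integral, while the differences form an \<open>n\<close>-tuple of points of a random unimodular
  lattice. Such tuples are classified by the reduced matrix \<open>D / u\<close> that expresses them through
  their pivots, which are \<open>r \<le> n < d\<close> independent vectors. For each \<open>(r, u, D)\<close> the
  intensity measure of the pivots is invariant under \<open>SL\<close>, which acts transitively on independent
  \<open>r\<close>-tuples, so it is a multiple of Lebesgue measure. The factor is read off on large balls by
  lattice point counting, the passage to the limit being justified by the finiteness of the moment
  of order \<open>d - 1\<close> of the number of lattice points in a ball, which in turn comes from
  integrating over reduced bases.\<close>

section \<open>Row vectors, matrices and integer points\<close>

text \<open>The hypothesis \<open>k \<le> CARD('n)\<close> leaves at most \<open>d - 1\<close>
  differences, and this is used twice. Independent \<open>r\<close>-tuples with \<open>r < d\<close>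
  form one orbit of \<open>SL\<close>, because a spare vector absorbs the determinant; and the
  domination needs a moment of order \<open>r \<le> d - 1\<close>, the order at which the balance of
  exponents in \<open>log_inequality\<close> still leaves a margin of one. The factor
  \<open>N(D,u)^d / u^(d r)\<close> is a density: integral tuples \<open>B\<close> with
  \<open>D B / u\<close> integral fill a union of residue classes modulo \<open>u\<close>, and the
  condition splits over the \<open>d\<close> coordinates. Going from \<open>r\<close> differences to
  \<open>m = r + 1\<close> vectors multiplies \<open>N\<close> by \<open>u\<close>, which cancels
  the additional \<open>u^d\<close>; the column operation in \<open>Dtilde\<close> is the change
  from \<open>(y, X)\<close> to \<open>(y, y + X)\<close>. Fundamental domains of the group and of a
  lattice are replaced by weights shared evenly among points of least norm, which requires no
  choice. Invariance under \<open>SL\<close> is exploited through Lebesgue measure on matrices of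
  positive determinant, scaled to determinant one: its null sets are stable under multiplication,
  which is all that the Fubini arguments over the group require.\<close>

definition Zv :: "(real^'n) set" where
  "Zv = {x. \<forall>i. x $ i \<in> \<int>}"

definition lat :: "real^'n^'n \<Rightarrow> (real^'n) set" where
  "lat g = (\<lambda>x. x v* g) ` Zv"

text \<open>Vectors are treated as functions on the index type, so that countability and finiteness
  pass from \<open>PiE\<close> to sets of vectors and of matrices.\<close>

lemma vec_in_image_PiE:
  fixes x :: "'a^'m"
  assumes "\<And>i. x $ i \<in> S" shows "x \<in> vec_lambda ` (PiE UNIV (\<lambda>_. S))"
proof (rule image_eqI[of _ _ "vec_nth x"])
  show "x = vec_lambda (vec_nth x)" by simp
qed (use assms in auto)

lemma Zv_0 [simp]: "0 \<in> Zv" by (simp add: Zv_def)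
lemma Zv_add: "x \<in> Zv \<Longrightarrow> y \<in> Zv \<Longrightarrow> x + y \<in> Zv" by (simp add: Zv_def)
lemma Zv_diff: "x \<in> Zv \<Longrightarrow> y \<in> Zv \<Longrightarrow> x - y \<in> Zv" by (simp add: Zv_def)
lemma Zv_uminus: "x \<in> Zv \<Longrightarrow> - x \<in> Zv" by (simp add: Zv_def)
lemma Zv_scale: "x \<in> Zv \<Longrightarrow> c \<in> \<int> \<Longrightarrow> c *\<^sub>R x \<in> Zv" by (simp add: Zv_def)
lemma Zv_sum: "(\<And>i. i \<in> I \<Longrightarrow> f i \<in> Zv) \<Longrightarrow> (\<Sum>i\<in>I. f i) \<in> Zv"
  by (induction I rule: infinite_finite_induct) (auto intro: Zv_add)
lemma Zv_axis [simp]: "axis i (1::real) \<in> Zv"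
  by (auto simp: Zv_def axis_def)

lemma countable_Zv: "countable (Zv :: (real^'n) set)"
proof -
  have "Zv \<subseteq> vec_lambda ` (PiE (UNIV::'n set) (\<lambda>_. \<int>))"
  proof
    fix x :: "real^'n" assume "x \<in> Zv"
    then show "x \<in> vec_lambda ` (PiE (UNIV::'n set) (\<lambda>_. \<int>))" by (intro vec_in_image_PiE) (auto simp: Zv_def)
  qed
  moreover have "countable (\<int> :: real set)"
    unfolding Ints_def by (rule countable_image) simp
  then have "countable (PiE (UNIV::'n set) (\<lambda>_. \<int> :: real set))"
    by (intro countable_PiE) auto
  ultimately show ?thesis
    by (meson countable_image countable_subset)
qed

lemma aff_lattice_alt: "aff_lattice g xi = (\<lambda>x. x v* g + xi) ` Zv"
  by (auto simp: aff_lattice_def Zv_def)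

lemma matrix_row: "m $ i = axis i (1::real) v* m"
  by (simp add: vec_eq_iff vector_matrix_mult_def axis_def if_distrib if_distribR cong: if_cong)

lemma row_matrix_mult: "((A::real^'n^'n) ** B) $ i = A $ i v* B"
  by (simp add: vec_eq_iff vector_matrix_mult_def matrix_matrix_mult_def)

lemma vector_matrix_sum_rows: "(x::real^'n) v* m = (\<Sum>i\<in>UNIV. (x $ i) *\<^sub>R (m $ i))"
  by (simp add: vec_eq_iff vector_matrix_mult_def sum_component)

lemma det_1_inverse:
  assumes "det (g::real^'n^'n) \<noteq> 0"
  obtains g' where "g ** g' = mat 1" "g' ** g = mat 1" "det g' = inverse (det g)"
proof -
  obtain g' where g': "g ** g' = mat 1" "g' ** g = mat 1"
    using assms invertible_det_nz[of g] by (auto simp: invertible_def)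
  have "det g * det g' = 1" using g'(1) det_mul[of g g'] by simp
  then show thesis using that g' by (metis inverse_unique)
qed

lemma linear_vector_matrix: "linear (\<lambda>x. x v* (g::real^'n^'n))"
  by (intro linearI) (simp_all add: vector_matrix_left_distrib scaleR_vector_matrix_assoc)

lemma vector_matrix_sum: "(\<Sum>i\<in>I. f i) v* (g::real^'n^'n) = (\<Sum>i\<in>I. f i v* g)"
  using linear_sum[OF linear_vector_matrix] .

lemma inj_vector_matrix:
  assumes "det (g::real^'n^'n) \<noteq> 0" shows "inj (\<lambda>x. x v* g)"
proof -
  obtain g' where "g ** g' = mat 1" using det_1_inverse[OF assms] by blast
  then show ?thesis
    by (intro inj_on_inverseI[of _ "\<lambda>x. x v* g'"]) (simp add: vector_matrix_mul_assoc)
qed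

lemma continuous_on_vector_matrix:
  "continuous_on UNIV (\<lambda>p::(real^'n) \<times> (real^'n^'n). fst p v* snd p)"
  unfolding vector_matrix_mult_def by (intro continuous_intros)

lemma borel_measurable_vector_matrix [measurable]:
  fixes f :: "'a \<Rightarrow> real^'n" and h :: "'a \<Rightarrow> real^'n^'n"
  assumes [measurable]: "f \<in> borel_measurable M" "h \<in> borel_measurable M"
  shows "(\<lambda>x. f x v* h x) \<in> borel_measurable M"
  using borel_measurable_continuous_Pair[OF assms continuous_on_vector_matrix] .

lemma borel_measurable_matrix_matrix [measurable]:
  fixes f :: "'a \<Rightarrow> real^'n^'n" and h :: "'a \<Rightarrow> real^'n^'n"
  assumes [measurable]: "f \<in> borel_measurable M" "h \<in> borel_measurable M"
  shows "(\<lambda>x. f x ** h x) \<in> borel_measurable M"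
proof -
  have "continuous_on UNIV (\<lambda>p::(real^'n^'n) \<times> (real^'n^'n). fst p ** snd p)"
    unfolding matrix_matrix_mult_def by (intro continuous_intros)
  from borel_measurable_continuous_Pair[OF assms this] show ?thesis .
qed

lemma borel_measurable_det [measurable]:
  fixes h :: "'a \<Rightarrow> real^'n^'n"
  assumes [measurable]: "h \<in> borel_measurable M"
  shows "(\<lambda>x. det (h x)) \<in> borel_measurable M"
proof -
  have "continuous_on UNIV (\<lambda>m::real^'n^'n. det m)"
    unfolding det_def by (intro continuous_intros)
  then show ?thesis
    using assms borel_measurable_continuous_onI measurable_compose by blast
qed

lemma finite_matrices_rows:
  assumes "finite (S :: (real^'n) set)"
  shows "finite {m::real^'n^'m. \<forall>i. m $ i \<in> S}"
proof -
  have "{m::real^'n^'m. \<forall>i. m $ i \<in> S} \<subseteq> vec_lambda ` (PiE UNIV (\<lambda>_. S))"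
  proof
    fix m :: "real^'n^'m" assume "m \<in> {m. \<forall>i. m $ i \<in> S}"
    then show "m \<in> vec_lambda ` (PiE UNIV (\<lambda>_. S))" by (intro vec_in_image_PiE) (auto simp: Zv_def)
  qed
  moreover have "finite (PiE (UNIV::'m set) (\<lambda>_. S))" using assms by (intro finite_PiE) auto
  ultimately show ?thesis by (meson finite_imageI finite_subset)
qed

lemma finite_Zv_box: "finite {x::real^'n. x \<in> Zv \<and> (\<forall>i. \<bar>x $ i\<bar> \<le> R)}"
proof -
  let ?S = "{z::real. z \<in> \<int> \<and> \<bar>z\<bar> \<le> R}"
  have "finite ?S"
    using finite_abs_int_segment[where a="R::real"] by simp
  then have "finite (PiE (UNIV::'n set) (\<lambda>_. ?S))" by (intro finite_PiE) auto
  moreover have "{x::real^'n. x \<in> Zv \<and> (\<forall>i. \<bar>x $ i\<bar> \<le> R)} \<subseteq> vec_lambda ` (PiE UNIV (\<lambda>_. ?S))"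
  proof
    fix x :: "real^'n" assume "x \<in> {x. x \<in> Zv \<and> (\<forall>i. \<bar>x $ i\<bar> \<le> R)}"
    then show "x \<in> vec_lambda ` (PiE UNIV (\<lambda>_. ?S))" by (intro vec_in_image_PiE) (auto simp: Zv_def)
  qed
  ultimately show ?thesis by (meson finite_imageI finite_subset)
qed

text \<open>The inverse of \<open>g\<close> is bounded, so a bound on \<open>x v* g + xi\<close>
  bounds every coordinate of the integral vector \<open>x\<close>. This discreteness is what later
  makes minimal elements exist, in fibres, in Voronoi cells and in the construction of reduced
  bases.\<close>

lemma finite_Zv_preimage:
  assumes g: "det (g::real^'n^'n) \<noteq> 0"
  shows "finite {x. x \<in> Zv \<and> norm (x v* g + xi) \<le> R}"
proof -
  obtain g' where g': "g ** g' = mat 1" using det_1_inverse[OF g] by blast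
  obtain B where B: "\<And>y. norm (y v* g') \<le> B * norm y"
    using linear_bounded[OF linear_vector_matrix[of g']] by auto
  have "{x. x \<in> Zv \<and> norm (x v* g + xi) \<le> R} \<subseteq>
      {x. x \<in> Zv \<and> (\<forall>i. \<bar>x $ i\<bar> \<le> \<bar>B\<bar> * (\<bar>R\<bar> + norm xi))}"
  proof safe
    fix x :: "real^'n" and i assume x: "x \<in> Zv" "norm (x v* g + xi) \<le> R"
    have "\<bar>x $ i\<bar> \<le> norm x" by (rule component_le_norm_cart)
    also have "norm x = norm ((x v* g) v* g')" using g' by (simp add: vector_matrix_mul_assoc)
    also have "\<dots> \<le> B * norm (x v* g)" by (rule B)
    also have "\<dots> \<le> \<bar>B\<bar> * norm (x v* g)" by (simp add: mult_right_mono)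
    also have "\<dots> \<le> \<bar>B\<bar> * (\<bar>R\<bar> + norm xi)"
      using x(2) norm_triangle_ineq4[of "x v* g + xi" xi] by (intro mult_left_mono) auto
    finally show "\<bar>x $ i\<bar> \<le> \<bar>B\<bar> * (\<bar>R\<bar> + norm xi)" .
  qed
  then show ?thesis using finite_Zv_box finite_subset by blast
qed

lemma finite_lat_ball:
  assumes "det (g::real^'n^'n) \<noteq> 0"
  shows "finite {y \<in> lat g. norm (y + xi) \<le> R}"
proof -
  have "{y \<in> lat g. norm (y + xi) \<le> R} = (\<lambda>x. x v* g) ` {x. x \<in> Zv \<and> norm (x v* g + xi) \<le> R}"
    by (auto simp: lat_def)
  then show ?thesis using finite_Zv_preimage[OF assms] by simp
qed

section \<open>Lifting the measure to the group\<close>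

definition SLZ :: "(real^'n^'n) set" where
  "SLZ = {m. (\<forall>i. m $ i \<in> Zv) \<and> det m = 1}"

type_synonym 'n asl = "(real^'n^'n) \<times> (real^'n)"

text \<open>The arithmetic group \<open>ASL_d(Z)\<close> by which \<open>Y\<close> is a
  quotient.\<close>

definition gam :: "'n::finite asl set" where
  "gam = SLZ \<times> Zv"

text \<open>Both \<open>gact\<close> and \<open>ract\<close> are the product of the affine group
  acting on row vectors; the two names record which factor is regarded as moving the other. Left
  multiplication by \<open>gam\<close> changes the basis and the origin of a lattice, right
  multiplication moves the lattice itself.\<close>

definition gact :: "'n::finite asl \<Rightarrow> 'n asl \<Rightarrow> 'n asl" where
  "gact p q = (fst p ** fst q, snd p v* fst q + snd q)"

definition ract :: "'n::finite asl \<Rightarrow> 'n asl \<Rightarrow> 'n asl" where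
  "ract q p = (fst q ** fst p, snd q v* fst p + snd p)"

definition affl :: "'n::finite asl \<Rightarrow> (real^'n) set" where
  "affl q = aff_lattice (fst q) (snd q)"

definition fibL :: "(real^'n) set \<Rightarrow> 'n::finite asl set" where
  "fibL L = {q. det (fst q) = 1 \<and> affl q = L}"

lemma Zv_vector_matrix:
  assumes "x \<in> Zv" "\<And>i. (m::real^'n^'n) $ i \<in> Zv"
  shows "x v* m \<in> Zv"
  unfolding vector_matrix_sum_rows using assms
  by (intro Zv_sum Zv_scale) (auto simp: Zv_def)

lemma countable_SLZ: "countable (SLZ :: (real^'n^'n) set)"
proof -
  have "SLZ \<subseteq> vec_lambda ` (PiE (UNIV::'n set) (\<lambda>_. Zv :: (real^'n) set))"
  proof
    fix x :: "real^'n^'n" assume "x \<in> SLZ"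
    then show "x \<in> vec_lambda ` (PiE (UNIV::'n set) (\<lambda>_. Zv))" by (intro vec_in_image_PiE) (auto simp: Zv_def SLZ_def)
  qed
  moreover have "countable (PiE (UNIV::'n set) (\<lambda>_. Zv :: (real^'n) set))"
    by (intro countable_PiE) (auto simp: countable_Zv)
  ultimately show ?thesis
    by (meson countable_image countable_subset)
qed

lemma countable_gam: "countable gam"
  unfolding gam_def by (intro countable_SIGMA countable_SLZ countable_Zv)

text \<open>Each row of \<open>g'\<close> is an integral combination of the rows of
  \<open>g\<close>, and equal determinants force the transition matrix to have determinant one.
  Inclusion of the lattices therefore suffices.\<close>

lemma lat_eq_imp:
  assumes g: "det (g::real^'n^'n) = 1" "det g' = 1" and L: "lat g' \<subseteq> lat g"
  obtains m where "m \<in> SLZ" "g' = m ** g"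
proof -
  have "\<forall>i. \<exists>z\<in>Zv. g' $ i = z v* g"
    using L unfolding lat_def by (metis (no_types, lifting) Zv_axis image_iff matrix_row subsetD)
  then obtain z where z: "\<And>i. z i \<in> Zv" "\<And>i. g' $ i = z i v* g" by metis
  define m where "m = (\<chi> i. z i)"
  have g': "g' = m ** g" by (simp add: vec_eq_iff[of g'] row_matrix_mult z m_def)
  then have "det m = 1" using g by (simp add: det_mul)
  then have "m \<in> SLZ" using z by (simp add: SLZ_def m_def)
  then show thesis using that g' by blast
qed

text \<open>Cramer's rule with denominator \<open>det m = 1\<close>: every entry of the inverse is a
  determinant of integers. The rows of \<open>m'\<close> solve a system with the transposed matrix,
  because vectors multiply from the left.\<close>

lemma SLZ_inverse:
  assumes "m \<in> SLZ" obtains m' where "m' \<in> SLZ" "m ** m' = mat 1" "m' ** (m::real^'n^'n) = mat 1"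
proof -
  have m: "det m = 1" "\<And>i. m $ i \<in> Zv" using assms by (auto simp: SLZ_def)
  obtain m' where m': "m ** m' = mat 1" "m' ** m = mat 1" "det m' = 1" using det_1_inverse[of m] m by auto
  have fin: "m' $ i $ j \<in> \<int>" for i j
  proof -
    have "m' $ i v* m = axis i 1"
      using m'(2) by (metis matrix_row row_matrix_mult vector_matrix_mul_rid)
    then have "(\<chi> k l. m $ l $ k) *v (m' $ i) = axis i 1"
      by (simp add: vec_eq_iff matrix_vector_mult_def vector_matrix_mult_def mult.commute)
    moreover have "det (\<chi> k l. m $ l $ k) = 1" using m det_transpose[of m] by (simp add: transpose_def)
    ultimately have "m' $ i = (\<chi> k. det (\<chi> a b. if b = k then axis i 1 $ a else m $ b $ a))"
      using cramer[of "\<chi> k l. m $ l $ k" "m' $ i" "axis i 1"] by (simp cong: if_cong)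
    then have "m' $ i $ j = det (\<chi> a b. if b = j then axis i 1 $ a else m $ b $ a :: real^'n^'n)" by simp
    also have "\<dots> \<in> \<int>" unfolding det_def
      using m(2) by (intro Ints_sum Ints_mult Ints_prod) (auto simp: axis_def Zv_def sign_def)
    finally show ?thesis .
  qed
  then have "m' \<in> SLZ" using m'(3) by (simp add: SLZ_def Zv_def)
  then show thesis using that m' by blast
qed

lemma lat_SLZ:
  assumes "m \<in> SLZ" shows "lat (m ** g) = lat g"
proof -
  obtain m' where m': "m' \<in> SLZ" "m ** m' = mat 1" "m' ** m = mat 1" using SLZ_inverse[OF assms] .
  have 1: "lat (n ** g) \<subseteq> lat g" if "n \<in> SLZ" for n g :: "real^'a^'a"
    using that by (auto simp: lat_def SLZ_def vector_matrix_mul_assoc[symmetric] intro!: imageI Zv_vector_matrix)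
  have "lat (m' ** (m ** g)) = lat g" by (simp add: matrix_mul_assoc m')
  then show ?thesis using 1[OF assms, of g] 1[OF m'(1), of "m ** g"] by auto
qed

lemma affl_alt: "affl q = (\<lambda>y. y + snd q) ` lat (fst q)"
  by (auto simp: affl_def aff_lattice_alt lat_def)

text \<open>Differences forget the translation, so an affine lattice determines its linear part;
  \<open>affl_eq_lat\<close> draws this consequence.\<close>

lemma affl_diff: "{x - y | x y. x \<in> affl q \<and> y \<in> affl q} = lat (fst q)"
proof -
  have "x - y \<in> lat (fst q)" if "x \<in> lat (fst q)" "y \<in> lat (fst q)" for x y
  proof -
    from that obtain a b where "a \<in> Zv" "b \<in> Zv" "x = a v* fst q" "y = b v* fst q" by (auto simp: lat_def)
    then show ?thesis unfolding lat_def using Zv_diff[of a b]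
      by (auto simp: vector_matrix_mult_diff_distrib intro!: image_eqI[of _ _ "a - b"])
  qed
  moreover have "0 \<in> lat (fst q)" unfolding lat_def by (auto intro!: image_eqI[of _ _ 0])
  ultimately show ?thesis by (force simp: affl_alt)
qed

lemma affl_eq_lat: "affl q = affl q' \<Longrightarrow> lat (fst q) = lat (fst q')"
  using affl_diff[of q] affl_diff[of q'] by simp

lemma lat_add: "a \<in> lat g \<Longrightarrow> b \<in> lat g \<Longrightarrow> a + b \<in> lat g"
  unfolding lat_def using Zv_add by (auto simp: vector_matrix_left_distrib[symmetric] intro!: imageI)

lemma lat_diff: "a \<in> lat g \<Longrightarrow> b \<in> lat g \<Longrightarrow> a - b \<in> lat g"
  unfolding lat_def using Zv_diff by (auto simp: vector_matrix_mult_diff_distrib[symmetric] intro!: imageI)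

lemma lat_0 [simp]: "0 \<in> lat g"
  unfolding lat_def by (auto intro!: image_eqI[of _ _ 0])

lemma affl_gact:
  assumes "p \<in> gam" shows "affl (gact p q) = affl q"
proof -
  have z: "snd p v* fst q \<in> lat (fst q)" using assms by (auto simp: gam_def lat_def)
  have l: "lat (fst (gact p q)) = lat (fst q)" using assms by (auto simp: gam_def gact_def lat_SLZ)
  show ?thesis unfolding affl_alt l
  proof (intro set_eqI iffI)
    fix y assume "y \<in> (\<lambda>y. y + snd (gact p q)) ` lat (fst q)"
    then obtain a where "a \<in> lat (fst q)" "y = (a + snd p v* fst q) + snd q" by (auto simp: gact_def)
    then show "y \<in> (\<lambda>y. y + snd q) ` lat (fst q)" using z lat_add by blast
  next
    fix y assume "y \<in> (\<lambda>y. y + snd q) ` lat (fst q)"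
    then obtain a where "a \<in> lat (fst q)" "y = a + snd q" by auto
    then have "a - snd p v* fst q \<in> lat (fst q)" "y = (a - snd p v* fst q) + snd (gact p q)"
      using z lat_diff by (auto simp: gact_def)
    then show "y \<in> (\<lambda>y. y + snd (gact p q)) ` lat (fst q)" by blast
  qed
qed

text \<open>The fibres over \<open>Y\<close> are free orbits of the countable group
  \<open>gam\<close>. A sum over a fibre thus becomes a sum over the fixed index set
  \<open>gam\<close>, whose measurability in \<open>q\<close> is clear.\<close>

lemma fibL_affl:
  assumes q: "det (fst q) = 1"
  shows "bij_betw (\<lambda>p. gact p q) gam (fibL (affl q))"
proof (rule bij_betw_imageI)
  obtain g' where g': "fst q ** g' = mat 1" using det_1_inverse[of "fst q"] q by auto
  show "inj_on (\<lambda>p. gact p q) gam"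
  proof (rule inj_onI)
    fix p p' assume "gact p q = gact p' q"
    then have "(fst p ** fst q) ** g' = (fst p' ** fst q) ** g'"
       "(snd p v* fst q) v* g' = (snd p' v* fst q) v* g'" by (auto simp: gact_def)
    then show "p = p'"
      by (simp add: matrix_mul_assoc[symmetric] vector_matrix_mul_assoc g' prod_eq_iff)
  qed
  show "(\<lambda>p. gact p q) ` gam = fibL (affl q)"
  proof (intro set_eqI iffI)
    fix r assume "r \<in> (\<lambda>p. gact p q) ` gam"
    then show "r \<in> fibL (affl q)"
      using q by (auto simp: fibL_def affl_gact) (auto simp: gact_def gam_def SLZ_def det_mul)
  next
    fix r assume r: "r \<in> fibL (affl q)"
    then have "affl r = affl q" "det (fst r) = 1" by (auto simp: fibL_def)
    then obtain m where m: "m \<in> SLZ" "fst r = m ** fst q"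
      using lat_eq_imp[of "fst q" "fst r"] affl_eq_lat[of r q] q by auto
    have "snd r \<in> affl r" unfolding affl_alt by (auto intro!: image_eqI[of _ _ 0])
    then have "snd r \<in> affl q" using \<open>affl r = affl q\<close> by simp
    then obtain z where "z \<in> Zv" "snd r = z v* fst q + snd q" by (auto simp: affl_alt lat_def)
    then show "r \<in> (\<lambda>p. gact p q) ` gam"
      using m by (intro image_eqI[of _ _ "(m, z)"]) (auto simp: gact_def gam_def prod_eq_iff)
  qed
qed

lemma affl_in_Yspace: "det (fst q) = 1 \<Longrightarrow> affl q \<in> Yspace"
  by (auto simp: Yspace_def affl_def)

lemma Yspace_affl: "L \<in> Yspace \<Longrightarrow> \<exists>q. det (fst q) = 1 \<and> L = affl q"
  by (auto simp: Yspace_def affl_def)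

text \<open>In an element of the fibre the rows of the matrix are points of the linear lattice and
  the translation is a point of the affine lattice. A bound on the norm puts all of them into a
  ball, which holds only finitely many.\<close>

lemma finite_fib_ball:
  assumes q: "det (fst q) = 1"
  shows "finite {r \<in> fibL (affl q). norm r \<le> R}"
proof -
  have "{r \<in> fibL (affl q). norm r \<le> R} \<subseteq>
     {m. \<forall>i. m $ i \<in> {y \<in> lat (fst q). norm (y + 0) \<le> R}} \<times> {y \<in> affl q. norm y \<le> R}"
  proof
    fix r assume r: "r \<in> {r \<in> fibL (affl q). norm r \<le> R}"
    then have e: "affl r = affl q" by (auto simp: fibL_def)
    have "norm (fst r $ i) \<le> R" for i
    proof -
      have "norm (fst r $ i) \<le> norm (fst r)" by (rule Finite_Cartesian_Product.norm_nth_le)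
      also have "\<dots> \<le> norm r" using norm_fst_le[of "fst r" "snd r"] by simp
      finally show ?thesis using r by simp
    qed
    moreover have "fst r $ i \<in> lat (fst q)" for i
    proof -
      have "fst r $ i = axis i 1 v* fst r" by (rule matrix_row)
      then have "fst r $ i \<in> lat (fst r)" unfolding lat_def by auto
      then show ?thesis using affl_eq_lat[OF e] by simp
    qed
    moreover have "norm (snd r) \<le> R" using r norm_snd_le[of "snd r" "fst r"] by simp
    moreover have "snd r \<in> affl r" unfolding affl_alt by (auto intro!: image_eqI[of _ _ 0])
    then have "snd r \<in> affl q" using e by simp
    ultimately show "r \<in> {m. \<forall>i. m $ i \<in> {y \<in> lat (fst q). norm (y + 0) \<le> R}} \<times> {y \<in> affl q. norm y \<le> R}"
      by (auto simp: mem_Times_iff)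
  qed
  moreover have "{y \<in> affl q. norm y \<le> R} = (\<lambda>y. y + snd q) ` {y \<in> lat (fst q). norm (y + snd q) \<le> R}"
    by (auto simp: affl_alt)
  then have "finite {y \<in> affl q. norm y \<le> R}" using finite_lat_ball[of "fst q"] q by simp
  ultimately show ?thesis
    using finite_matrices_rows[OF finite_lat_ball[of "fst q" 0 R]] q
    by (intro finite_subset[OF _ finite_SigmaI]) auto
qed

lemma borel_measurable_fst [measurable]: "fst \<in> borel_measurable (borel :: ('a::second_countable_topology \<times> 'b::second_countable_topology) measure)"
  by (intro borel_measurable_continuous_onI continuous_intros)

lemma borel_measurable_snd [measurable]: "snd \<in> borel_measurable (borel :: ('a::second_countable_topology \<times> 'b::second_countable_topology) measure)"
  by (intro borel_measurable_continuous_onI continuous_intros)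

lemma borel_measurable_gact [measurable]: "gact p \<in> borel_measurable borel"
  unfolding gact_def[abs_def] by (intro borel_measurable_Pair) measurable

lemma borel_measurable_ract [measurable]: "(\<lambda>q. ract q p) \<in> borel_measurable borel"
  unfolding ract_def[abs_def] by (intro borel_measurable_Pair) measurable

lemma borel_measurable_countable_nn_integral [measurable]:
  assumes "countable A" "\<And>p. p \<in> A \<Longrightarrow> (\<lambda>x. f x p) \<in> borel_measurable N"
  shows "(\<lambda>x. \<integral>\<^sup>+ p. f x p \<partial>count_space A) \<in> borel_measurable N"
proof -
  interpret sigma_finite_measure "count_space A"
    using assms(1) by (rule sigma_finite_measure_count_space_countable)
  have "(\<lambda>(p, x). f x p) \<in> borel_measurable (count_space A \<Otimes>\<^sub>M N)"
    using assms by (intro measurable_pair_measure_countable1) auto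
  then have "(\<lambda>(x, p). f x p) \<in> borel_measurable (N \<Otimes>\<^sub>M count_space A)"
    by (subst measurable_pair_swap_iff) (simp add: case_prod_unfold)
  then show ?thesis by (rule borel_measurable_nn_integral)
qed

section \<open>Weights in place of a fundamental domain of the arithmetic group\<close>

definition gsum :: "('n::finite asl \<Rightarrow> ennreal) \<Rightarrow> 'n asl \<Rightarrow> ennreal" where
  "gsum f q = (\<integral>\<^sup>+ p. f (gact p q) \<partial>count_space gam)"

lemma gsum_fibL:
  assumes "det (fst q) = 1"
  shows "gsum f q = (\<integral>\<^sup>+ r. f r \<partial>count_space (fibL (affl q)))"
  unfolding gsum_def using fibL_affl[OF assms] by (rule nn_integral_bij_count_space)

lemma borel_measurable_gsum [measurable]:
  assumes [measurable]: "f \<in> borel_measurable borel"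
  shows "gsum f \<in> borel_measurable borel"
  unfolding gsum_def[abs_def]
  by (intro borel_measurable_countable_nn_integral countable_gam) measurable

definition minq :: "'n::finite asl \<Rightarrow> bool" where
  "minq q \<longleftrightarrow> (\<forall>p\<in>gam. norm q \<le> norm (gact p q))"

text \<open>A substitute for a Borel fundamental domain. Since no representative is singled out
  among ties, \<open>omega\<close> is a quotient of a Borel indicator by a countable sum of Borel
  functions.\<close>

definition omega :: "'n::finite asl \<Rightarrow> ennreal" where
  "omega q = indicator {q. minq q} q / gsum (indicator {q. minq q}) q"

lemma sets_minq [measurable]: "{q. minq q} \<in> sets borel"
proof -
  have "{q::'a asl. norm q \<le> norm (gact p q)} \<in> sets borel" for p
  proof -
    have [measurable]: "(\<lambda>q::'a asl. norm (gact p q)) \<in> borel_measurable borel"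
      by measurable
    show ?thesis by measurable
  qed
  then have "{q \<in> space borel. \<forall>p\<in>gam. norm (q::'a asl) \<le> norm (gact p q)} \<in> sets borel"
    by (intro sets.sets_Collect_countable_All' countable_gam) simp
  then show ?thesis unfolding minq_def by simp
qed

lemma borel_measurable_omega [measurable]: "omega \<in> borel_measurable borel"
  unfolding omega_def[abs_def] by measurable

lemma minq_fibL: "det (fst q) = 1 \<Longrightarrow> minq q \<longleftrightarrow> (\<forall>r\<in>fibL (affl q). norm q \<le> norm r)"
  unfolding minq_def by (subst bij_betw_imp_surj_on[OF fibL_affl[of q], symmetric]) auto

lemma fibL_det: "r \<in> fibL L \<Longrightarrow> det (fst r) = 1 \<and> affl r = L"
  by (auto simp: fibL_def)

text \<open>The weights \<open>omega\<close> are spread evenly over the elements of least norm in a fibre; there are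
  finitely many of them because fibres are discrete.\<close>

lemma nn_integral_omega:
  assumes q: "det (fst q) = 1"
  shows "(\<integral>\<^sup>+ r. omega r \<partial>count_space (fibL (affl q))) = 1"
proof -
  let ?F = "fibL (affl q)"
  let ?T = "{r \<in> ?F. minq r}"
  let ?S = "{r \<in> ?F. norm r \<le> norm q}"
  have qF: "q \<in> ?F" using q by (simp add: fibL_def)
  have S: "finite ?S" using finite_fib_ball[OF q] .
  have m: "minq r \<longleftrightarrow> (\<forall>r'\<in>?F. norm r \<le> norm r')" if "r \<in> ?F" for r
    using minq_fibL[of r] fibL_det[OF that] by simp
  \<comment> \<open>The minimum of the norm over the whole fibre is already attained on its finite
    part in the ball of radius \<open>norm q\<close>.\<close>
  define r0 where "r0 = arg_min_on norm ?S"
  have ne: "?S \<noteq> {}" using qF by blast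
  have r0: "r0 \<in> ?S" "\<And>r. r \<in> ?S \<Longrightarrow> norm r0 \<le> norm r"
    unfolding r0_def by (fact arg_min_if_finite(1)[OF S ne], fact arg_min_least[OF S ne])
  have "minq r0"
  proof -
    have "norm r0 \<le> norm r'" if "r' \<in> ?F" for r'
    proof (cases "norm r' \<le> norm q")
      case True then show ?thesis using r0(2) that by simp
    next
      case False then show ?thesis using r0(1) by simp
    qed
    then show ?thesis using m r0 by auto
  qed
  then have "r0 \<in> ?T" using r0 by simp
  moreover have T: "finite ?T"
    using S qF m by (auto intro!: finite_subset[OF _ S])
  ultimately have c: "card ?T > 0" using r0(1) by (subst card_gt_0_iff) blast
  have ties: "gsum (indicator {q. minq q}) r = of_nat (card ?T)" if "r \<in> ?F" for r
  proof -
    have "gsum (indicator {q. minq q}) r = (\<integral>\<^sup>+ x. indicator {q. minq q} x \<partial>count_space ?F)"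
      using fibL_det[OF that] gsum_fibL by metis
    also have "\<dots> = (\<integral>\<^sup>+ x. indicator ?T x \<partial>count_space ?F)"
      by (intro nn_integral_cong) (auto simp: indicator_def)
    also have "\<dots> = emeasure (count_space ?F) ?T"
      by (subst nn_integral_indicator) auto
    also have "\<dots> = of_nat (card ?T)" using T by (subst emeasure_count_space_finite) auto
    finally show ?thesis .
  qed
  have "(\<integral>\<^sup>+ r. omega r \<partial>count_space ?F) = (\<integral>\<^sup>+ r. indicator ?T r / of_nat (card ?T) \<partial>count_space ?F)"
    by (intro nn_integral_cong) (auto simp: omega_def ties indicator_def)
  also have "\<dots> = (\<integral>\<^sup>+ r. indicator ?T r \<partial>count_space ?F) / of_nat (card ?T)"
    by (subst nn_integral_divide) auto
  also have "\<dots> = of_nat (card ?T) / of_nat (card ?T)"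
  proof -
    have "(\<integral>\<^sup>+ r. indicator ?T r \<partial>count_space ?F) = emeasure (count_space ?F) ?T"
      by (subst nn_integral_indicator) auto
    also have "\<dots> = of_nat (card ?T)" using T by (subst emeasure_count_space_finite) auto
    finally show ?thesis by simp
  qed
  also have "\<dots> = 1" using c by (intro ennreal_divide_self) (auto simp: of_nat_less_top)
  finally show ?thesis .
qed

text \<open>\<open>Ysets\<close> is the quotient sigma-algebra, so a function on \<open>Y\<close> is
  measurable as soon as its pull-back agrees with a Borel function on the matrices of determinant
  one.\<close>

lemma measurable_muY:
  assumes M: "is_muY M" and psi: "psi \<in> borel_measurable borel"
    and eq: "\<And>q. det (fst q) = 1 \<Longrightarrow> phi (affl q) = psi q"
  shows "(phi :: _ \<Rightarrow> ennreal) \<in> borel_measurable M"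
proof (rule measurableI)
  fix A :: "ennreal set" assume A: "A \<in> sets borel"
  have sp: "space M = Yspace" "sets M = Ysets" using M by (auto simp: is_muY_def)
  have "{p. det (fst p) = 1 \<and> aff_lattice (fst p) (snd p) \<in> phi -` A \<inter> Yspace} =
     {p. det (fst p) = 1} \<inter> (psi -` A \<inter> space borel)"
    using eq affl_in_Yspace by (auto simp: affl_def[symmetric])
  also have "\<dots> \<in> sets borel"
    using psi A by (intro sets.Int measurable_sets[OF psi A]) measurable
  finally show "phi -` A \<inter> space M \<in> sets M" unfolding sp Ysets_def by auto
qed auto

section \<open>The action of the affine group on \<open>Y\<close> and the lifted measure\<close>

lemma ASL_act_affl: "ASL_act h eta (affl q) = affl (ract q (h, eta))"
  unfolding ASL_act_def affl_def aff_lattice_alt image_image ract_def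
  by (simp add: vector_matrix_left_distrib vector_matrix_mul_assoc add.assoc)

lemma measurable_ASL_act:
  assumes M: "is_muY (M :: (real^'n) set measure)" and h: "det h = 1"
  shows "ASL_act h eta \<in> measurable M M"
proof (rule measurableI)
  have sp: "space M = Yspace" "sets M = Ysets" using M by (auto simp: is_muY_def)
  have dr: "det (fst q) = 1 \<Longrightarrow> det (fst (ract q (h, eta))) = 1" for q :: "'n asl"
    using h by (simp add: ract_def det_mul)
  show "L \<in> space M \<Longrightarrow> ASL_act h eta L \<in> space M" for L
    using Yspace_affl[of L] dr affl_in_Yspace unfolding sp by (metis ASL_act_affl)
  fix A assume "A \<in> sets M"
  then have A: "A \<subseteq> Yspace" "{p. det (fst p) = 1 \<and> affl p \<in> A} \<in> sets borel"
    unfolding sp Ysets_def affl_def by auto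
  have "{p. det (fst p) = 1 \<and> affl p \<in> ASL_act h eta -` A \<inter> Yspace} =
     {p. det (fst p) = 1} \<inter> ((\<lambda>q. ract q (h, eta)) -` {p. det (fst p) = 1 \<and> affl p \<in> A} \<inter> space borel)"
    using dr by (auto simp: ASL_act_affl affl_in_Yspace)
  also have "\<dots> \<in> sets borel"
    by (intro sets.Int measurable_sets[OF borel_measurable_ract] A) measurable
  finally show "ASL_act h eta -` A \<inter> space M \<in> sets M"
    unfolding sp Ysets_def affl_def by auto
qed

lemma nn_integral_ASL_act:
  assumes M: "is_muY (M :: (real^'n) set measure)" and h: "det h = 1"
    and phi[measurable]: "phi \<in> borel_measurable M"
  shows "(\<integral>\<^sup>+ L. phi (ASL_act h eta L) \<partial>M) = (\<integral>\<^sup>+ L. phi L \<partial>M)"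
proof -
  note [measurable] = measurable_ASL_act[OF M h, of eta]
  have "distr M M (ASL_act h eta) = M"
  proof (rule measure_eqI)
    fix A assume "A \<in> sets (distr M M (ASL_act h eta))"
    then have A: "A \<in> sets M" by simp
    have "emeasure (distr M M (ASL_act h eta)) A = emeasure M (ASL_act h eta -` A \<inter> space M)"
      using A by (subst emeasure_distr) auto
    also have "ASL_act h eta -` A \<inter> space M = {L \<in> space M. ASL_act h eta L \<in> A}" by auto
    also have "emeasure M \<dots> = emeasure M A" using M h A by (auto simp: is_muY_def)
    finally show "emeasure (distr M M (ASL_act h eta)) A = emeasure M A" .
  qed simp
  then show ?thesis using nn_integral_distr[of "ASL_act h eta" M M phi] by simp
qed

text \<open>Each lattice spreads its mass over its fibre with the weights \<open>omega\<close>. The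
  result is a probability measure on the group that projects to \<open>M\<close>. Invariance will be
  claimed only for its integrals of functions that are constant on fibres.\<close>

definition liftm :: "(real^'n) set measure \<Rightarrow> 'n::finite asl measure" where
  "liftm M = measure_of UNIV (sets borel)
     (\<lambda>S. \<integral>\<^sup>+ L. (\<integral>\<^sup>+ q. omega q * indicator S q \<partial>count_space (fibL L)) \<partial>M)"

context
  fixes M :: "(real^'n) set measure"
  assumes M: "is_muY M"
begin

lemma measurable_fibL_sum:
  assumes [measurable]: "f \<in> borel_measurable borel"
  shows "(\<lambda>L. \<integral>\<^sup>+ q. f q \<partial>count_space (fibL L)) \<in> borel_measurable M"
  using M by (rule measurable_muY[where psi = "gsum f"]) (auto simp: gsum_fibL)

lemma sets_liftm [measurable_cong, simp]: "sets (liftm M) = sets borel"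
  unfolding liftm_def by (subst sets_measure_of) (auto simp: sets.sigma_sets_eq[of borel, simplified])

lemma space_liftm [simp]: "space (liftm M) = UNIV"
  unfolding liftm_def by (subst space_measure_of) auto

lemma emeasure_liftm:
  assumes S: "S \<in> sets borel"
  shows "emeasure (liftm M) S = (\<integral>\<^sup>+ L. (\<integral>\<^sup>+ q. omega q * indicator S q \<partial>count_space (fibL L)) \<partial>M)"
proof (rule emeasure_measure_of[OF liftm_def])
  show "sets borel \<subseteq> Pow (UNIV :: 'n asl set)" by simp
  show "S \<in> sets (liftm M)" using S by simp
  show "positive (sets (liftm M)) (\<lambda>S. \<integral>\<^sup>+ L. (\<integral>\<^sup>+ q. omega q * indicator S q \<partial>count_space (fibL L)) \<partial>M)"
    by (simp add: positive_def)
  show "countably_additive (sets (liftm M)) (\<lambda>S. \<integral>\<^sup>+ L. (\<integral>\<^sup>+ q. omega q * indicator S q \<partial>count_space (fibL L)) \<partial>M)"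
  proof (rule countably_additiveI)
    fix A :: "nat \<Rightarrow> 'n asl set"
    assume A: "range A \<subseteq> sets (liftm M)" "disjoint_family A"
    then have [measurable]: "A i \<in> sets borel" for i by auto
    have "(\<Sum>i. \<integral>\<^sup>+ L. (\<integral>\<^sup>+ q. omega q * indicator (A i) q \<partial>count_space (fibL L)) \<partial>M) =
      (\<integral>\<^sup>+ L. (\<Sum>i. \<integral>\<^sup>+ q. omega q * indicator (A i) q \<partial>count_space (fibL L)) \<partial>M)"
      by (intro nn_integral_suminf[symmetric] measurable_fibL_sum) measurable
    also have "\<dots> = (\<integral>\<^sup>+ L. \<integral>\<^sup>+ q. (\<Sum>i. omega q * indicator (A i) q) \<partial>count_space (fibL L) \<partial>M)"
      by (intro nn_integral_cong nn_integral_suminf[symmetric]) simp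
    also have "\<dots> = (\<integral>\<^sup>+ L. \<integral>\<^sup>+ q. omega q * indicator (\<Union>i. A i) q \<partial>count_space (fibL L) \<partial>M)"
      using A(2) by (intro nn_integral_cong) (simp add: suminf_indicator)
    finally show "(\<Sum>i. \<integral>\<^sup>+ L. (\<integral>\<^sup>+ q. omega q * indicator (A i) q \<partial>count_space (fibL L)) \<partial>M) =
      (\<integral>\<^sup>+ L. \<integral>\<^sup>+ q. omega q * indicator (\<Union>i. A i) q \<partial>count_space (fibL L) \<partial>M)" .
  qed
qed

lemma nn_integral_liftm_omega:
  assumes f: "f \<in> borel_measurable borel"
  shows "(\<integral>\<^sup>+ q. f q \<partial>liftm M) = (\<integral>\<^sup>+ L. (\<integral>\<^sup>+ q. omega q * f q \<partial>count_space (fibL L)) \<partial>M)"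
  using f
proof (induction rule: borel_measurable_induct)
  case (cong f g)
  then have "f = g" by (simp add: fun_eq_iff)
  then show ?case using cong by simp
next
  case (set A)
  then show ?case by (simp add: emeasure_liftm)
next
  case (mult u c)
  note [measurable] = mult(2)
  have "(\<integral>\<^sup>+ L. (\<integral>\<^sup>+ q. omega q * (c * u q) \<partial>count_space (fibL L)) \<partial>M) =
    (\<integral>\<^sup>+ L. c * (\<integral>\<^sup>+ q. omega q * u q \<partial>count_space (fibL L)) \<partial>M)"
    by (intro nn_integral_cong) (subst nn_integral_cmult[symmetric], auto simp: ac_simps)
  also have "\<dots> = c * (\<integral>\<^sup>+ L. (\<integral>\<^sup>+ q. omega q * u q \<partial>count_space (fibL L)) \<partial>M)"
    by (intro nn_integral_cmult measurable_fibL_sum) measurable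
  finally show ?case using mult by (simp add: nn_integral_cmult)
next
  case (add u v)
  note [measurable] = add(1,3)
  have "(\<integral>\<^sup>+ L. (\<integral>\<^sup>+ q. omega q * (v q + u q) \<partial>count_space (fibL L)) \<partial>M) =
    (\<integral>\<^sup>+ L. (\<integral>\<^sup>+ q. omega q * v q \<partial>count_space (fibL L)) + (\<integral>\<^sup>+ q. omega q * u q \<partial>count_space (fibL L)) \<partial>M)"
    by (intro nn_integral_cong) (subst nn_integral_add[symmetric], auto simp: distrib_left)
  also have "\<dots> = (\<integral>\<^sup>+ L. (\<integral>\<^sup>+ q. omega q * v q \<partial>count_space (fibL L)) \<partial>M) +
       (\<integral>\<^sup>+ L. (\<integral>\<^sup>+ q. omega q * u q \<partial>count_space (fibL L)) \<partial>M)"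
    by (intro nn_integral_add measurable_fibL_sum) measurable
  finally show ?case using add by (simp add: nn_integral_add)
next
  case (seq U)
  note [measurable] = seq(1)
  have *: "(SUP i. U i) q = (SUP i. U i q)" for q by (simp add: image_image)
  have "(\<integral>\<^sup>+ L. (\<integral>\<^sup>+ q. omega q * (SUP i. U i) q \<partial>count_space (fibL L)) \<partial>M) =
    (\<integral>\<^sup>+ L. (\<integral>\<^sup>+ q. (SUP i. omega q * U i q) \<partial>count_space (fibL L)) \<partial>M)"
    unfolding * by (simp add: SUP_mult_left_ennreal)
  also have "\<dots> = (\<integral>\<^sup>+ L. (SUP i. \<integral>\<^sup>+ q. omega q * U i q \<partial>count_space (fibL L)) \<partial>M)"
    using seq(3) by (intro nn_integral_cong nn_integral_monotone_convergence_SUP)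
      (auto simp: incseq_def le_fun_def intro!: mult_left_mono)
  also have "\<dots> = (SUP i. \<integral>\<^sup>+ L. \<integral>\<^sup>+ q. omega q * U i q \<partial>count_space (fibL L) \<partial>M)"
    using seq(3) by (intro nn_integral_monotone_convergence_SUP measurable_fibL_sum)
      (auto simp: incseq_def le_fun_def intro!: mult_left_mono nn_integral_mono)
  also have "\<dots> = (SUP i. \<integral>\<^sup>+ q. U i q \<partial>liftm M)" using seq by simp
  also have "\<dots> = (\<integral>\<^sup>+ q. (SUP i. U i q) \<partial>liftm M)"
    using seq(3) by (intro nn_integral_monotone_convergence_SUP[symmetric]) auto
  finally show ?case unfolding * by simp
qed

text \<open>The weights of a fibre sum to one, so a function constant on fibres has the same
  integral over the lift as over \<open>Y\<close>. From here on all work can take place on the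
  group.\<close>

lemma nn_integral_liftm:
  assumes psi: "psi \<in> borel_measurable borel" and eq: "\<And>q. det (fst q) = 1 \<Longrightarrow> phi (affl q) = psi q"
  shows "(\<integral>\<^sup>+ L. phi L \<partial>M) = (\<integral>\<^sup>+ q. psi q \<partial>liftm M)"
proof -
  have "(\<integral>\<^sup>+ q. psi q \<partial>liftm M) = (\<integral>\<^sup>+ L. (\<integral>\<^sup>+ q. omega q * psi q \<partial>count_space (fibL L)) \<partial>M)"
    using psi by (rule nn_integral_liftm_omega)
  also have "\<dots> = (\<integral>\<^sup>+ L. phi L \<partial>M)"
  proof (intro nn_integral_cong)
    fix L assume "L \<in> space M"
    then have "L \<in> Yspace" using M by (simp add: is_muY_def)
    then obtain q where q: "det (fst q) = 1" "L = affl q" using Yspace_affl by blast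
    have "(\<integral>\<^sup>+ r. omega r * psi r \<partial>count_space (fibL L)) = (\<integral>\<^sup>+ r. omega r * phi L \<partial>count_space (fibL L))"
      by (intro nn_integral_cong) (auto simp: eq[symmetric] dest!: fibL_det)
    also have "\<dots> = (\<integral>\<^sup>+ r. omega r \<partial>count_space (fibL L)) * phi L" by (simp add: nn_integral_multc)
    also have "\<dots> = phi L" using nn_integral_omega[OF q(1)] q(2) by simp
    finally show "(\<integral>\<^sup>+ r. omega r * psi r \<partial>count_space (fibL L)) = phi L" .
  qed
  finally show ?thesis by simp
qed

lemma prob_space_liftm: "prob_space (liftm M)"
proof
  have "emeasure (liftm M) (space (liftm M)) = (\<integral>\<^sup>+ q. 1 \<partial>liftm M)" by simp
  also have "\<dots> = (\<integral>\<^sup>+ L. 1 \<partial>M)" using nn_integral_liftm[of "\<lambda>_. 1" "\<lambda>_. 1"] by simp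
  also have "\<dots> = 1"
    using M prob_space.emeasure_space_1[of M] by (auto simp: is_muY_def)
  finally show "emeasure (liftm M) (space (liftm M)) = 1" .
qed

lemma AE_liftm_det: "AE q in liftm M. det (fst q) = 1"
proof -
  have [measurable]: "{q::'n asl. det (fst q) \<noteq> 1} \<in> sets borel" by measurable
  have "emeasure (liftm M) {q. det (fst q) \<noteq> 1} = (\<integral>\<^sup>+ q. indicator {q. det (fst q) \<noteq> 1} q \<partial>liftm M)"
    by (subst nn_integral_indicator) auto
  also have "\<dots> = (\<integral>\<^sup>+ L. 0 \<partial>M)"
    by (intro nn_integral_liftm[symmetric]) auto
  finally have "emeasure (liftm M) {q. det (fst q) \<noteq> 1} = 0" by simp
  then show ?thesis by (intro AE_I[of _ _ "{q. det (fst q) \<noteq> 1}"]) auto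
qed

lemma nn_integral_liftm_ract:
  assumes h: "det h = 1" and [measurable]: "psi \<in> borel_measurable borel"
    and inv: "\<And>q q'. det (fst q) = 1 \<Longrightarrow> det (fst q') = 1 \<Longrightarrow> affl q = affl q' \<Longrightarrow> psi q = psi q'"
  shows "(\<integral>\<^sup>+ q. psi (ract q (h, eta)) \<partial>liftm M) = (\<integral>\<^sup>+ q. psi q \<partial>liftm M)"
proof -
  \<comment> \<open>The choice of a representative is harmless because \<open>psi\<close> is
    constant on fibres; thus \<open>psi\<close> descends to \<open>Y\<close>, where the invariance
    of \<open>M\<close> applies.\<close>
  define phi where "phi L = psi (SOME q. q \<in> fibL L)" for L
  have eq: "phi (affl q) = psi q" if "det (fst q) = 1" for q
  proof -
    have "q \<in> fibL (affl q)" using that by (simp add: fibL_def)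
    then have "(SOME q'. q' \<in> fibL (affl q)) \<in> fibL (affl q)" by (rule someI)
    from fibL_det[OF this] show ?thesis unfolding phi_def using inv that by metis
  qed
  have m: "phi \<in> borel_measurable M" by (rule measurable_muY[OF M assms(2)]) (rule eq)
  have "(\<integral>\<^sup>+ q. psi q \<partial>liftm M) = (\<integral>\<^sup>+ L. phi L \<partial>M)"
    by (intro nn_integral_liftm[symmetric] eq) auto
  also have "\<dots> = (\<integral>\<^sup>+ L. phi (ASL_act h eta L) \<partial>M)" using nn_integral_ASL_act[OF M h m] by simp
  also have "\<dots> = (\<integral>\<^sup>+ q. psi (ract q (h, eta)) \<partial>liftm M)"
  proof (rule nn_integral_liftm)
    show "(\<lambda>q. psi (ract q (h, eta))) \<in> borel_measurable borel"
      using measurable_compose[OF borel_measurable_ract assms(2)] .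
    show "phi (ASL_act h eta (affl q)) = psi (ract q (h, eta))" if "det (fst q) = 1" for q
      unfolding ASL_act_affl using that h by (intro eq) (simp add: ract_def det_mul)
  qed
  finally show ?thesis by simp
qed

end

section \<open>Uniqueness of invariant measures on tuples\<close>

abbreviation TT :: "nat \<Rightarrow> (nat \<Rightarrow> real^'n) measure" where
  "TT r \<equiv> PiM {..<r} (\<lambda>_. lborel)"

definition tmul :: "nat \<Rightarrow> (nat \<Rightarrow> real^'n) \<Rightarrow> real^'n^'n \<Rightarrow> nat \<Rightarrow> real^'n" where
  "tmul r X h = restrict (\<lambda>i. X i v* h) {..<r}"

lemma space_TT: "space (TT r) = PiE {..<r} (\<lambda>_. UNIV)"
  by (simp add: space_PiM)

lemma tmul_in_space [simp]: "tmul r X h \<in> space (TT r)"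
  by (simp add: tmul_def space_PiM)

lemma tmul_tmul: "tmul r (tmul r X g) h = tmul r X (g ** h)"
  by (auto simp: tmul_def fun_eq_iff vector_matrix_mul_assoc)

lemma tmul_id: "X \<in> PiE {..<r} (\<lambda>_. A) \<Longrightarrow> tmul r X (mat 1) = X"
  by (auto simp: tmul_def fun_eq_iff PiE_def extensional_def)

lemma measurable_tmul [measurable]:
  assumes [measurable]: "f \<in> measurable N (TT r)" "h \<in> borel_measurable N"
  shows "(\<lambda>x. tmul r (f x) (h x)) \<in> measurable N (TT r)"
  unfolding tmul_def
proof (rule measurable_restrict)
  fix i assume i: "i \<in> {..<r}"
  then have "(\<lambda>x. f x i) \<in> measurable N lborel"
    using measurable_compose[OF assms(1) measurable_component_singleton[OF i]] by simp
  then have [measurable]: "(\<lambda>x. f x i) \<in> borel_measurable N" by simp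
  show "(\<lambda>x. f x i v* h x) \<in> measurable N lborel" by simp
qed

lemma borel_measurable_TT_component [measurable]:
  "i < r \<Longrightarrow> (\<lambda>X. X i) \<in> borel_measurable (TT r)"
  using measurable_component_singleton[of i "{..<r}" "\<lambda>_. lborel"] by simp

lemma det_scaleR: "det (c *\<^sub>R (A::real^'n^'n)) = c ^ CARD('n) * det A"
proof -
  have "c *\<^sub>R A = matrix ((*\<^sub>R) c) ** A"
    by (simp add: vec_eq_iff matrix_matrix_mult_def matrix_def axis_def if_distrib if_distribR cong: if_cong)
  then show ?thesis by (simp add: det_mul)
qed

text \<open>Sends matrices of positive determinant to \<open>SL\<close>. Lebesgue measure on
  matrices, seen through \<open>nrm\<close>, plays the part of Haar measure in the arguments below:
  only its null sets matter, and these are stable under left multiplication.\<close>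

definition nrm :: "real^'n^'n \<Rightarrow> real^'n^'n" where
  "nrm h = (1 / root CARD('n) (det h)) *\<^sub>R h"

lemma det_nrm: "det h > 0 \<Longrightarrow> det (nrm h :: real^'n^'n) = 1"
  by (simp add: nrm_def det_scaleR power_divide real_root_pow_pos2)

lemma matrix_mult_scaleR_right: "(g::real^'n^'n) ** (c *\<^sub>R h) = c *\<^sub>R (g ** h)"
  by (simp add: vec_eq_iff matrix_matrix_mult_def sum_distrib_left mult.left_commute)

lemma linear_matrix_mult: "linear (\<lambda>h::real^'n^'n. (g::real^'n^'n) ** h)"
  by (intro linearI) (simp_all add: matrix_add_ldistrib matrix_mult_scaleR_right)

lemma nrm_mult: "det g = 1 \<Longrightarrow> g ** nrm h = nrm (g ** h)"
  by (simp add: nrm_def det_mul matrix_mult_scaleR_right)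

lemma borel_measurable_nrm [measurable]:
  "nrm \<in> borel_measurable (borel :: (real^'n^'n) measure)"
proof -
  have "root CARD('n) \<in> borel_measurable borel"
    by (intro borel_measurable_continuous_onI continuous_intros)
  then have [measurable]: "(\<lambda>h::real^'n^'n. root CARD('n) (det h)) \<in> borel_measurable borel"
    by (rule measurable_compose[rotated]) measurable
  show ?thesis unfolding nrm_def by measurable
qed

text \<open>The new exceptional set is the image of the old one under the linear map given by the
  inverse of \<open>g\<close>, and differentiable maps send negligible sets to negligible
  sets.\<close>

lemma AE_left_mult:
  fixes g :: "real^'n^'n"
  assumes g: "det g \<noteq> 0" and R: "AE h::real^'n^'n in lborel. R h"
  shows "AE h in lborel. R (g ** h)"
proof -
  obtain N where N: "N \<in> null_sets lborel" "{h. \<not> R h} \<subseteq> N"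
    using R unfolding eventually_ae_filter by auto
  obtain g' where g': "g ** g' = mat 1" "g' ** g = mat 1" using det_1_inverse[OF g] by blast
  have [measurable]: "N \<in> sets borel" using N by auto
  define N' where "N' = {h. g ** h \<in> N}"
  have mN: "N' \<in> sets borel"
  proof -
    have "(\<lambda>h::real^'n^'n. g ** h) \<in> borel_measurable borel"
      using linear_linear[THEN iffD2, OF linear_matrix_mult[of g]]
      by (intro borel_measurable_continuous_onI linear_continuous_on) simp
    then have "(\<lambda>h::real^'n^'n. g ** h) -` N \<inter> space borel \<in> sets borel" by (rule measurable_sets) measurable
    then show ?thesis unfolding N'_def vimage_def by simp
  qed
  note lin = linear_matrix_mult[of g']
  have "negligible N" using N(1) by (simp add: negligible_iff_null_sets null_sets_completionI)
  then have "negligible ((\<lambda>h. g' ** h) ` N)"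
    using negligible_differentiable_image_negligible[OF order_refl _ linear_imp_differentiable_on[OF lin]] by blast
  moreover have "N' \<subseteq> (\<lambda>h. g' ** h) ` N"
  proof
    fix h assume "h \<in> N'"
    then show "h \<in> (\<lambda>h. g' ** h) ` N"
      by (intro image_eqI[of _ _ "g ** h"]) (simp_all add: N'_def matrix_mul_assoc g')
  qed
  ultimately have "negligible N'" using negligible_subset by blast
  then have "N' \<in> null_sets lborel"
    using mN by (auto simp: negligible_iff_null_sets null_sets_def)
  then show ?thesis
    using N(2) by (intro AE_I'[of N']) (auto simp: N'_def)
qed

text \<open>The matrices of positive determinant form a nonempty open set, and such a set is not
  negligible.\<close>

lemma ex_AE_det_pos:
  assumes "AE h in lborel. det (h::real^'n^'n) > 0 \<longrightarrow> P h"
  shows "\<exists>h. det h > 0 \<and> P h"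
proof (rule ccontr)
  assume "\<not> ?thesis"
  then have "AE h in lborel. h \<notin> {h::real^'n^'n. det h > 0}" using assms by auto
  moreover have cont: "continuous_on UNIV (\<lambda>m::real^'n^'n. det m)"
    unfolding det_def by (intro continuous_intros)
  have op: "open {h::real^'n^'n. det h > 0}"
    using continuous_on_open_vimage[OF open_UNIV, THEN iffD1, OF cont, rule_format, of "{0<..}"]
    by (simp add: vimage_def)
  ultimately have "{h::real^'n^'n. det h > 0} \<in> null_sets lborel"
    by (subst AE_iff_null_sets) auto
  then have "emeasure lborel {h::real^'n^'n. det h > 0} = 0" by auto
  moreover have "mat 1 \<in> {h::real^'n^'n. det h > 0}" by simp
  ultimately show False
    using op emeasure_lborel_cbox_finite open_not_negligible[of "{h::real^'n^'n. det h > 0}"]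
    by (metis empty_iff negligible_iff_null_sets null_setsI null_sets_completionI op borel_open sets_lborel)
qed

text \<open>\<open>P\<close> holds at almost every point of the orbit of \<open>X\<close>. This
  depends on the orbit only, as \<open>Tae_orbit\<close> shows, so under a transitive action it
  spreads from one point to all of them, which validity almost everywhere for \<open>nu\<close> or
  \<open>lam\<close> does not.\<close>

definition Tae :: "nat \<Rightarrow> ((nat \<Rightarrow> real^'n) \<Rightarrow> bool) \<Rightarrow> (nat \<Rightarrow> real^'n) \<Rightarrow> bool" where
  "Tae r P X \<longleftrightarrow> (AE h in lborel. det (h::real^'n^'n) > 0 \<longrightarrow> P (tmul r X (nrm h)))"

lemma Tae_orbit:
  assumes g: "det g = 1" and T: "Tae r P X" shows "Tae r P (tmul r X g)"
proof -
  have "AE h in lborel. det (g ** h) > 0 \<longrightarrow> P (tmul r X (nrm (g ** h)))"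
    using AE_left_mult[of g "\<lambda>h. det h > 0 \<longrightarrow> P (tmul r X (nrm h))"] T g unfolding Tae_def by simp
  then show ?thesis unfolding Tae_def using g by (simp add: tmul_tmul nrm_mult det_mul)
qed

text \<open>Two invariant sigma-finite measures carried by a single orbit \<open>Om\<close>. The
  setting is used twice: for bases of determinant one, with \<open>lamSL\<close> as second measure,
  and for independent \<open>r\<close>-tuples with \<open>r < d\<close>, with Lebesgue
  measure.\<close>

locale invariant_pair =
  fixes r :: nat and nu lam :: "(nat \<Rightarrow> real^'n) measure" and Om :: "(nat \<Rightarrow> real^'n) set"
  assumes sets_nu [measurable_cong]: "sets nu = sets (TT r)" and sets_lam [measurable_cong]: "sets lam = sets (TT r)"
    and sf_nu: "sigma_finite_measure nu" and sf_lam: "sigma_finite_measure lam"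
    and inv_nu: "\<And>h. det h = 1 \<Longrightarrow> distr nu (TT r) (\<lambda>X. tmul r X h) = nu"
    and inv_lam: "\<And>h. det h = 1 \<Longrightarrow> distr lam (TT r) (\<lambda>X. tmul r X h) = lam"
    and Om_nu: "AE X in nu. X \<in> Om" and Om_lam: "AE X in lam. X \<in> Om"
    and trans: "\<And>X Y. X \<in> Om \<Longrightarrow> Y \<in> Om \<Longrightarrow> \<exists>h. det h = 1 \<and> Y = tmul r X h"
    and lam_nz: "emeasure lam (space lam) \<noteq> 0"
begin

lemma AE_lam_ex: "AE X in lam. P X \<Longrightarrow> \<exists>X\<in>Om. P X"
proof (rule ccontr)
  assume P: "AE X in lam. P X" and n: "\<not> (\<exists>X\<in>Om. P X)"
  have "AE X in lam. False" using P Om_lam n by (auto elim: AE_mp)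
  then have "emeasure lam (space lam) = 0" by (subst (asm) AE_iff_measurable[where N = "space lam"]) auto
  then show False using lam_nz by simp
qed

lemma AE_tmul:
  assumes K: "sets K = sets (TT r)" "distr K (TT r) (\<lambda>X. tmul r X h) = K"
    and P: "{X \<in> space (TT r). P X} \<in> sets (TT r)" "AE X in K. P X"
  shows "AE X in K. P (tmul r X h)"
proof -
  have m: "(\<lambda>X. tmul r X h) \<in> measurable K (TT r)"
    using K(1) by (intro measurable_tmul) (auto intro: measurable_ident_sets)
  have "AE X in distr K (TT r) (\<lambda>X. tmul r X h). P X" unfolding K(2) by (rule P(2))
  then show ?thesis using m P(1) by (subst (asm) AE_distr_iff) auto
qed

lemma space_lam: "space lam = space (TT r)" using sets_eq_imp_space_eq[OF sets_lam] .

lemma AE_commute_tmul: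
  assumes K: "sets K = sets (TT r)" "sigma_finite_measure K"
    and P: "{p \<in> space (borel \<Otimes>\<^sub>M TT r). P (fst p) (snd p)} \<in> sets (borel \<Otimes>\<^sub>M TT r)"
  shows "(AE h in lborel. AE X in K. P h X) \<longleftrightarrow> (AE X in K. AE (h::real^'n^'n) in lborel. P h X)"
proof -
  interpret K: sigma_finite_measure K by fact
  interpret pair_sigma_finite "lborel :: (real^'n^'n) measure" K ..
  have s: "sets (lborel \<Otimes>\<^sub>M K) = sets (borel \<Otimes>\<^sub>M TT r)"
    using K(1) by (intro sets_pair_measure_cong) auto
  show ?thesis by (intro AE_commute) (unfold s sets_eq_imp_space_eq[OF s], rule P)
qed

text \<open>Fubini over the group: if \<open>A\<close> is null for \<open>lam\<close>, some point of
  \<open>Om\<close> has almost its whole orbit outside \<open>A\<close>, and by transitivity the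
  same holds at every point of \<open>Om\<close>. A second use of Fubini, now for \<open>nu\<close>,
  finds one group element that moves \<open>nu\<close>-almost every point off \<open>A\<close>; the
  invariance of \<open>nu\<close> removes this element.\<close>

lemma abs_cont: "absolutely_continuous lam nu"
  unfolding absolutely_continuous_def
proof
  fix A assume A: "A \<in> null_sets lam"
  then have Am[measurable]: "A \<in> sets (TT r)" using sets_lam by auto
  let ?P = "\<lambda>h X. det (h::real^'n^'n) > 0 \<longrightarrow> tmul r X (nrm h) \<notin> A"
  have mP: "{p \<in> space (borel \<Otimes>\<^sub>M TT r). ?P (fst p) (snd p)} \<in> sets (borel \<Otimes>\<^sub>M TT r)"
    by measurable
  have mA: "{X \<in> space (TT r). X \<notin> A} \<in> sets (TT r)" by measurable
  have "AE X in lam. X \<notin> A" using A by (rule AE_not_in)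
  then have "AE X in lam. ?P h X" for h
    using AE_tmul[OF sets_lam inv_lam[OF det_nrm[of h]] mA] by (cases "det h > 0") auto
  then have "AE h in lborel. AE X in lam. ?P h X" by auto
  then have "AE X in lam. AE h in lborel. ?P h X"
    using AE_commute_tmul[OF sets_lam sf_lam mP] by simp
  then obtain X1 where X1: "X1 \<in> Om" "Tae r (\<lambda>Y. Y \<notin> A) X1"
    using AE_lam_ex unfolding Tae_def by blast
  have "Tae r (\<lambda>Y. Y \<notin> A) X" if "X \<in> Om" for X
    using trans[OF X1(1) that] Tae_orbit[OF _ X1(2)] by auto
  then have "AE X in nu. AE h in lborel. ?P h X"
    using Om_nu unfolding Tae_def by auto
  then have "AE h in lborel. AE X in nu. ?P h X"
    by (rule AE_commute_tmul[OF sets_nu sf_nu mP, THEN iffD2])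
  then have "AE h in lborel. det (h::real^'n^'n) > 0 \<longrightarrow> (AE X in nu. tmul r X (nrm h) \<notin> A)"
    by eventually_elim auto
  from ex_AE_det_pos[OF this]
  obtain h :: "real^'n^'n" where h: "det h > 0" "AE X in nu. tmul r X (nrm h) \<notin> A" by blast
  have m: "(\<lambda>X. tmul r X (nrm h)) \<in> measurable nu (TT r)" by measurable
  have "AE X in distr nu (TT r) (\<lambda>X. tmul r X (nrm h)). X \<notin> A"
    by (subst AE_distr_iff[OF m mA]) (use h in auto)
  then have "AE X in nu. X \<notin> A" unfolding inv_nu[OF det_nrm[OF h(1)]] .
  then show "A \<in> null_sets nu" using Am sets_nu by (subst (asm) AE_iff_null_sets[symmetric]) auto
qed

text \<open>The density \<open>d nu / d lam\<close> is almost everywhere invariant under a transitive action; Fubini over the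
  group makes it constant.\<close>

theorem invariant_unique:
  "\<exists>c. c \<noteq> \<infinity> \<and> (\<forall>A\<in>sets (TT r). emeasure nu A = c * emeasure lam A)"
proof -
  interpret L: sigma_finite_measure lam by (rule sf_lam)
  define f where "f = RN_deriv lam nu"
  have fm[measurable]: "f \<in> borel_measurable lam" unfolding f_def by simp
  have fm'[measurable]: "f \<in> borel_measurable (TT r)" using fm sets_lam measurable_cong_sets by blast
  have nu: "density lam f = nu"
    unfolding f_def using abs_cont sets_nu sets_lam by (intro L.density_RN_deriv) auto
  have ffin: "AE X in lam. f X \<noteq> \<infinity>"
    unfolding f_def using abs_cont sets_nu sets_lam sf_nu by (intro L.RN_deriv_finite) auto
  have finv: "AE X in lam. f (tmul r X h) = f X" if h: "det h = 1" for h
  proof -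
    have m[measurable]: "(\<lambda>X. tmul r X h) \<in> measurable lam (TT r)" by measurable
    obtain h' where h': "h ** h' = mat 1" "det h' = 1" using det_1_inverse[of h] h by auto
    \<comment> \<open>Both sides are \<open>nu\<close>: invariance of \<open>lam\<close> shifts
      \<open>h\<close> from \<open>f\<close> to the indicator, where it appears as the inverse
      \<open>h'\<close>, and invariance of \<open>nu\<close> absorbs it. Uniqueness of densities
      then gives the invariance of \<open>f\<close>.\<close>
    have "density lam (\<lambda>X. f (tmul r X h)) = density lam f"
    proof (rule measure_eqI)
      fix A assume "A \<in> sets (density lam (\<lambda>X. f (tmul r X h)))"
      then have A[measurable]: "A \<in> sets (TT r)" "A \<in> sets lam" "A \<in> sets nu" using sets_lam sets_nu by auto
      have m'[measurable]: "(\<lambda>X. tmul r X h') \<in> measurable nu (TT r)"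
        "(\<lambda>X. tmul r X h') \<in> measurable (TT r) (TT r)" by measurable
      have "emeasure (density lam (\<lambda>X. f (tmul r X h))) A = (\<integral>\<^sup>+ X. f (tmul r X h) * indicator A X \<partial>lam)"
        by (subst emeasure_density) measurable
      also have "\<dots> = (\<integral>\<^sup>+ X. f (tmul r X h) * indicator A (tmul r (tmul r X h) h') \<partial>lam)"
        by (intro nn_integral_cong) (auto simp: tmul_tmul h' space_lam space_TT tmul_id)
      also have "\<dots> = (\<integral>\<^sup>+ X. f X * indicator A (tmul r X h') \<partial>distr lam (TT r) (\<lambda>X. tmul r X h))"
        by (subst nn_integral_distr) measurable
      also have "\<dots> = (\<integral>\<^sup>+ X. f X * indicator A (tmul r X h') \<partial>lam)" using inv_lam[OF h] by simp
      also have "\<dots> = (\<integral>\<^sup>+ X. indicator A (tmul r X h') \<partial>density lam f)"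
        by (subst nn_integral_density) (use fm in measurable)
      also have "\<dots> = (\<integral>\<^sup>+ X. indicator A (tmul r X h') \<partial>nu)" using nu by simp
      also have "\<dots> = (\<integral>\<^sup>+ X. indicator A X \<partial>distr nu (TT r) (\<lambda>X. tmul r X h'))"
        by (subst nn_integral_distr) measurable
      also have "\<dots> = emeasure nu A" using inv_nu[OF h'(2)] A(3) by simp
      finally show "emeasure (density lam (\<lambda>X. f (tmul r X h))) A = emeasure (density lam f) A"
        using nu by simp
    qed simp
    then show ?thesis by (subst (asm) L.density_unique_iff) measurable
  qed
  let ?P = "\<lambda>h X. det (h::real^'n^'n) > 0 \<longrightarrow> f (tmul r X (nrm h)) = f X"
  have mP: "{p \<in> space (borel \<Otimes>\<^sub>M TT r). ?P (fst p) (snd p)} \<in> sets (borel \<Otimes>\<^sub>M TT r)"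
    by measurable
  have "AE X in lam. ?P h X" for h
    using finv[OF det_nrm[of h]] by (cases "det h > 0") auto
  then have "AE h in lborel. AE X in lam. ?P h X" by auto
  then have inv: "AE X in lam. Tae r (\<lambda>Y. f Y = f X) X"
    using AE_commute_tmul[OF sets_lam sf_lam mP] by (simp add: Tae_def)
  have "AE X in lam. Tae r (\<lambda>Y. f Y = f X) X \<and> f X \<noteq> \<infinity>" using inv ffin by auto
  then obtain X1 where X1: "X1 \<in> Om" "Tae r (\<lambda>Y. f Y = f X1) X1" "f X1 \<noteq> \<infinity>"
    using AE_lam_ex by blast
  \<comment> \<open>Along the orbit of almost every \<open>X\<close> the density has two almost sure
    values, the one at \<open>X\<close> and the one at \<open>X1\<close>. They agree, since
    otherwise the matrices of positive determinant would be negligible.\<close>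
  have const: "AE X in lam. f X = f X1"
    using inv Om_lam
  proof eventually_elim
    case (elim X)
    obtain g where g: "det g = 1" "X = tmul r X1 g" using trans[OF X1(1) elim(2)] by blast
    have "Tae r (\<lambda>Y. f Y = f X1) X" using Tae_orbit[OF g(1) X1(2)] g(2) by simp
    with elim(1) have "AE h in lborel. det (h::real^'n^'n) > 0 \<longrightarrow> f X = f X1"
      unfolding Tae_def by eventually_elim auto
    then show ?case using ex_AE_det_pos[where P = "\<lambda>_::real^'n^'n. f X = f X1"] by blast
  qed
  have "emeasure nu A = f X1 * emeasure lam A" if A: "A \<in> sets (TT r)" for A
  proof -
    have Al: "A \<in> sets lam" using A sets_lam by simp
    have "emeasure nu A = (\<integral>\<^sup>+ X. f X * indicator A X \<partial>lam)"
      unfolding nu[symmetric] using Al by (intro emeasure_density fm)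
    also have "\<dots> = (\<integral>\<^sup>+ X. f X1 * indicator A X \<partial>lam)"
      using const by (intro nn_integral_cong_AE) auto
    also have "\<dots> = f X1 * emeasure lam A" using Al by (simp add: nn_integral_cmult_indicator)
    finally show ?thesis .
  qed
  then show ?thesis using X1(3) by blast
qed

end

section \<open>Linear changes of variables\<close>

lemma nn_integral_lborel_Basis:
  fixes f :: "'a::euclidean_space \<Rightarrow> ennreal"
  assumes [measurable]: "f \<in> borel_measurable borel"
  shows "(\<integral>\<^sup>+ x. f x \<partial>lborel) = (\<integral>\<^sup>+ y. f (\<Sum>b\<in>Basis. y b *\<^sub>R b) \<partial>PiM Basis (\<lambda>_. lborel))"
  by (subst lborel_eq, subst nn_integral_distr) auto

lemma product_sigma_finite_lborel: "product_sigma_finite (\<lambda>_. lborel)"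
  by standard

lemma nn_integral_lborel_translate:
  fixes f :: "'a::euclidean_space \<Rightarrow> ennreal"
  assumes [measurable]: "f \<in> borel_measurable borel"
  shows "(\<integral>\<^sup>+ x. f (c + x) \<partial>lborel) = (\<integral>\<^sup>+ x. f x \<partial>lborel)"
  by (subst lborel_distr_plus[of c, symmetric], subst nn_integral_distr) auto

text \<open>By Fubini in the coordinate \<open>b\<close>, the shear is a translation whose amount,
  the coordinate at \<open>b'\<close>, stays fixed while \<open>b\<close> varies.\<close>

lemma nn_integral_lborel_shear:
  fixes f :: "'a::euclidean_space \<Rightarrow> ennreal"
  assumes [measurable]: "f \<in> borel_measurable borel" and b: "b \<in> Basis" "b' \<in> Basis" "b \<noteq> b'"
  shows "(\<integral>\<^sup>+ x. f (x + (x \<bullet> b') *\<^sub>R b) \<partial>lborel) = (\<integral>\<^sup>+ x. f x \<partial>lborel)"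
proof -
  interpret product_sigma_finite "\<lambda>_::'a. lborel :: real measure" by (rule product_sigma_finite_lborel)
  let ?B = "Basis - {b}"
  have B: "Basis = insert b ?B" using b by auto
  have PB: "PiM Basis (\<lambda>_::'a. lborel :: real measure) = PiM (insert b ?B) (\<lambda>_. lborel)" using B by simp
  have split: "(\<Sum>a\<in>Basis. (y(b := t)) a *\<^sub>R a) = t *\<^sub>R b + (\<Sum>a\<in>?B. y a *\<^sub>R a)" for y :: "'a \<Rightarrow> real" and t
    by (subst sum.remove[of _ b]) (use b in \<open>auto intro!: sum.cong\<close>)
  have comp: "(t *\<^sub>R b + (\<Sum>a\<in>?B. y a *\<^sub>R a)) \<bullet> b' = y b'" for y :: "'a \<Rightarrow> real" and t
    using b by (simp add: inner_add_left inner_sum_left inner_Basis if_distrib sum.delta cong: if_cong)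
  have m: "(\<lambda>y. f (\<Sum>a\<in>Basis. y a *\<^sub>R a)) \<in> borel_measurable (PiM (insert b ?B) (\<lambda>_. lborel))"
    unfolding PB[symmetric] by measurable
  have m': "(\<lambda>y. f ((\<Sum>a\<in>Basis. y a *\<^sub>R a) + ((\<Sum>a\<in>Basis. y a *\<^sub>R a) \<bullet> b') *\<^sub>R b)) \<in> borel_measurable (PiM (insert b ?B) (\<lambda>_. lborel))"
    unfolding PB[symmetric] by measurable
  have "(\<integral>\<^sup>+ x. f (x + (x \<bullet> b') *\<^sub>R b) \<partial>lborel) =
     (\<integral>\<^sup>+ y. \<integral>\<^sup>+ t. f ((t *\<^sub>R b + (\<Sum>a\<in>?B. y a *\<^sub>R a)) + y b' *\<^sub>R b) \<partial>lborel \<partial>PiM ?B (\<lambda>_. lborel))"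
    by (subst nn_integral_lborel_Basis, measurable, subst PB, subst product_nn_integral_insert[OF _ _ m'])
       (simp_all only: split comp finite_Diff finite_Basis Diff_iff singletonI not_True_eq_False simp_thms)
  also have "\<dots> = (\<integral>\<^sup>+ y. \<integral>\<^sup>+ t. f (t *\<^sub>R b + (\<Sum>a\<in>?B. y a *\<^sub>R a)) \<partial>lborel \<partial>PiM ?B (\<lambda>_. lborel))"
  proof (rule nn_integral_cong)
    fix y :: "'a \<Rightarrow> real"
    have "(\<integral>\<^sup>+ t. f ((y b' + t) *\<^sub>R b + (\<Sum>a\<in>?B. y a *\<^sub>R a)) \<partial>lborel) =
        (\<integral>\<^sup>+ t. f (t *\<^sub>R b + (\<Sum>a\<in>?B. y a *\<^sub>R a)) \<partial>lborel)"
      by (rule nn_integral_lborel_translate[of "\<lambda>t. f (t *\<^sub>R b + (\<Sum>a\<in>?B. y a *\<^sub>R a))"]) measurable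
    then show "(\<integral>\<^sup>+ t. f ((t *\<^sub>R b + (\<Sum>a\<in>?B. y a *\<^sub>R a)) + y b' *\<^sub>R b) \<partial>lborel) =
        (\<integral>\<^sup>+ t. f (t *\<^sub>R b + (\<Sum>a\<in>?B. y a *\<^sub>R a)) \<partial>lborel)"
      by (simp add: algebra_simps)
  qed
  also have "\<dots> = (\<integral>\<^sup>+ x. f x \<partial>lborel)"
    by (subst nn_integral_lborel_Basis, measurable, subst PB, subst product_nn_integral_insert[OF _ _ m])
       (simp_all only: split finite_Diff finite_Basis Diff_iff singletonI not_True_eq_False simp_thms)
  finally show ?thesis .
qed

lemma prod_Basis_vec: "(\<Prod>b\<in>Basis. (x::real^'n) \<bullet> b) = (\<Prod>i\<in>UNIV. x $ i)"
proof -
  have "Basis = (\<lambda>i::'n. axis i (1::real)) ` UNIV" by (auto simp: Basis_vec_def)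
  then show ?thesis
    by (subst prod.reindex[of "\<lambda>i::'n. axis i (1::real)" UNIV, folded \<open>Basis = _\<close>])
       (simp_all add: inj_on_def axis_eq_axis inner_axis)
qed

text \<open>Lebesgue measure is determined by its values on boxes, and a permutation of coordinates
  permutes the sides of a box. The involutions treated here include the transpositions among the
  elementary matrices.\<close>

lemma nn_integral_lborel_permute:
  fixes f :: "real^'n \<Rightarrow> ennreal"
  assumes [measurable]: "f \<in> borel_measurable borel" and t: "t permutes UNIV" "\<And>i. t (t i) = i"
  shows "(\<integral>\<^sup>+ x. f (\<chi> i. x $ t i) \<partial>lborel) = (\<integral>\<^sup>+ x. f x \<partial>lborel)"
proof -
  let ?s = "\<lambda>x::real^'n. \<chi> i. x $ t i"
  have [measurable]: "?s \<in> borel_measurable borel"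
    by (intro borel_measurable_continuous_onI continuous_intros)
  have "lborel = distr lborel borel ?s"
  proof (rule lborel_eqI)
    fix l u :: "real^'n" assume lu: "\<And>b. b \<in> Basis \<Longrightarrow> l \<bullet> b \<le> u \<bullet> b"
    have lu': "l $ i \<le> u $ i" for i using lu[of "axis i 1"] by (simp add: inner_axis)
    have "?s -` box l u = box (?s l) (?s u)"
      by (auto simp: mem_box_cart) (metis t(2))+
    then have "emeasure (distr lborel borel ?s) (box l u) = emeasure lborel (box (?s l) (?s u))"
      by (subst emeasure_distr) auto
    also have "\<dots> = (\<Prod>b\<in>Basis. (?s u - ?s l) \<bullet> b)"
      by (intro emeasure_lborel_box) (auto simp: Basis_vec_def inner_axis lu')
    also have "(\<Prod>b\<in>Basis. (?s u - ?s l) \<bullet> b) = (\<Prod>i\<in>UNIV. (u - l) $ t i)"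
      unfolding prod_Basis_vec by simp
    also have "\<dots> = (\<Prod>i\<in>UNIV. (u - l) $ i)"
      using prod.permute[OF t(1), of "\<lambda>i. (u - l) $ i"] by (simp add: o_def)
    finally show "emeasure (distr lborel borel ?s) (box l u) = ennreal (\<Prod>b\<in>Basis. (u - l) \<bullet> b)"
      unfolding prod_Basis_vec .
  qed simp
  then have "(\<integral>\<^sup>+ x. f x \<partial>lborel) = (\<integral>\<^sup>+ x. f x \<partial>distr lborel borel ?s)" by simp
  also have "\<dots> = (\<integral>\<^sup>+ x. f (?s x) \<partial>lborel)" by (subst nn_integral_distr) auto
  finally show ?thesis by simp
qed

lemma borel_measurable_matrix_vector: "(\<lambda>x. (A::real^'n^'n) *v x) \<in> borel_measurable borel"
  by (intro borel_measurable_continuous_onI matrix_vector_mult_linear_continuous_on)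

text \<open>Induction along a factorisation into elementary matrices. Both sides are multiplicative,
  a zero row contradicts \<open>det A \<noteq> 0\<close>, and diagonal matrices, transpositions and
  shears remain. The function \<open>f\<close> is generalised because the product case substitutes a
  linear map into it.\<close>

lemma nn_integral_lborel_matrix:
  fixes A :: "real^'n^'n"
  shows "det A \<noteq> 0 \<Longrightarrow> f \<in> borel_measurable borel \<Longrightarrow>
    ennreal \<bar>det A\<bar> * (\<integral>\<^sup>+ x. f (A *v x) \<partial>lborel) = (\<integral>\<^sup>+ x. f x \<partial>lborel)"
proof (induction A arbitrary: f rule: induct_matrix_elementary_alt)
  case (1 A B)
  note [measurable] = \<open>f \<in> borel_measurable borel\<close> borel_measurable_matrix_vector
  have nz: "det A \<noteq> 0" "det B \<noteq> 0" using 1(3) by (auto simp: det_mul)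
  have "ennreal \<bar>det (A ** B)\<bar> * (\<integral>\<^sup>+ x. f ((A ** B) *v x) \<partial>lborel) =
     ennreal \<bar>det A\<bar> * (ennreal \<bar>det B\<bar> * (\<integral>\<^sup>+ x. f (A *v (B *v x)) \<partial>lborel))"
    by (simp add: det_mul abs_mult ennreal_mult matrix_vector_mul_assoc mult.assoc)
  also have "ennreal \<bar>det B\<bar> * (\<integral>\<^sup>+ x. f (A *v (B *v x)) \<partial>lborel) = (\<integral>\<^sup>+ x. f (A *v x) \<partial>lborel)"
    using 1(2)[of "\<lambda>x. f (A *v x)"] nz by simp
  also have "ennreal \<bar>det A\<bar> * \<dots> = (\<integral>\<^sup>+ x. f x \<partial>lborel)" using 1 nz by simp
  finally show ?case .
next
  case (2 A i)
  then show ?case using det_zero_row(2)[of i A] by simp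
next
  case (3 A)
  note [measurable] = \<open>f \<in> borel_measurable borel\<close>
  have d: "det A = (\<Prod>i\<in>UNIV. A $ i $ i)" using 3(1) by (rule det_diagonal)
  define c where "c b = A $ axis_index b $ axis_index b" for b :: "real^'n"
  have ca: "c (axis i 1) = A $ i $ i" for i by (simp add: c_def axis_index_axis)
  have bas: "Basis = (\<lambda>i::'n. axis i (1::real)) ` UNIV" by (auto simp: Basis_vec_def)
  have c: "c b \<noteq> 0" if "b \<in> Basis" for b using that 3(2) unfolding d bas by (auto simp: ca)
  have T: "0 + (\<Sum>j\<in>Basis. (c j * (x \<bullet> j)) *\<^sub>R j) = A *v x" for x
  proof -
    have "(\<Sum>j\<in>Basis. (c j * (x \<bullet> j)) *\<^sub>R j) = (\<Sum>i\<in>UNIV. (A $ i $ i * x $ i) *\<^sub>R axis i 1)"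
      unfolding bas by (subst sum.reindex) (simp_all add: inj_on_def axis_eq_axis ca inner_axis)
    also have "\<dots> = A *v x"
    proof (subst vec_eq_iff, rule allI)
      fix k
      have "(\<Sum>i\<in>UNIV. (A $ i $ i * x $ i) *\<^sub>R axis i 1) $ k = (\<Sum>i\<in>UNIV. if i = k then A $ k $ k * x $ k else 0)"
        unfolding sum_component by (intro sum.cong) (simp_all add: axis_def)
      moreover have "(A *v x) $ k = (\<Sum>i\<in>UNIV. if i = k then A $ k $ k * x $ k else 0)"
        unfolding matrix_vector_mult_def vec_lambda_beta using 3(1)[of k] by (intro sum.cong) auto
      ultimately show "(\<Sum>i\<in>UNIV. (A $ i $ i * x $ i) *\<^sub>R axis i 1) $ k = (A *v x) $ k" by simp
    qed
    finally show ?thesis by simp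
  qed
  have "(\<Prod>j\<in>Basis. \<bar>c j\<bar>) = \<bar>det A\<bar>"
    unfolding d bas by (subst prod.reindex) (auto simp: inj_on_def axis_eq_axis ca abs_prod)
  then have L: "lborel = density (distr lborel borel (\<lambda>x. A *v x)) (\<lambda>_. ennreal \<bar>det A\<bar>)"
    using lborel_affine_euclidean[of c 0, OF c] unfolding T by simp
  have "(\<integral>\<^sup>+ x. f x \<partial>lborel) = (\<integral>\<^sup>+ x. f x \<partial>density (distr lborel borel (\<lambda>x. A *v x)) (\<lambda>_. ennreal \<bar>det A\<bar>))"
    using L by simp
  also have "\<dots> = (\<integral>\<^sup>+ x. ennreal \<bar>det A\<bar> * f x \<partial>distr lborel borel (\<lambda>x. A *v x))"
    by (subst nn_integral_density) auto
  also have "\<dots> = (\<integral>\<^sup>+ x. ennreal \<bar>det A\<bar> * f (A *v x) \<partial>lborel)"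
    using borel_measurable_matrix_vector[of A] by (subst nn_integral_distr) auto
  also have "\<dots> = ennreal \<bar>det A\<bar> * (\<integral>\<^sup>+ x. f (A *v x) \<partial>lborel)"
    using measurable_compose[OF borel_measurable_matrix_vector[of A] 3(3)] by (subst nn_integral_cmult) auto
  finally show ?case by simp
next
  case (4 m n)
  let ?t = "Transposition.transpose m n"
  let ?A = "(\<chi> i j. mat 1 $ i $ ?t j) :: real^'n^'n"
  have A: "?A *v x = (\<chi> i. x $ ?t i)" for x
  proof -
    have "(\<Sum>j\<in>UNIV. mat 1 $ i $ ?t j * x $ j) = x $ ?t i" for i
    proof -
      have "(\<Sum>j\<in>UNIV. mat 1 $ i $ ?t j * x $ j) = (\<Sum>j\<in>UNIV. if j = ?t i then x $ j else 0)"
        by (intro sum.cong) (auto simp: mat_def Transposition.transpose_def)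
      then show ?thesis by simp
    qed
    then show ?thesis by (simp add: vec_eq_iff matrix_vector_mult_def)
  qed
  have "det ?A = of_int (sign ?t) * det (mat 1 :: real^'n^'n)"
    by (rule det_permute_columns) (simp add: permutes_swap_id)
  then have d: "\<bar>det ?A\<bar> = 1" by (auto simp: sign_def)
  show ?case unfolding A d
    using nn_integral_lborel_permute[OF 4(3), of ?t] by (simp add: permutes_swap_id)
next
  case (5 m n)
  let ?A = "(\<chi> i j. of_bool (i = m \<and> j = n \<or> i = j)) :: real^'n^'n"
  have A: "?A *v x = x + (x \<bullet> axis n 1) *\<^sub>R axis m 1" for x
  proof -
    have "(\<Sum>j\<in>UNIV. of_bool (i = m \<and> j = n \<or> i = j) * x $ j) = x $ i + (if i = m then x $ n else 0)" for i
    proof -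
      have "(\<Sum>j\<in>UNIV. of_bool (i = m \<and> j = n \<or> i = j) * x $ j) =
         (\<Sum>j\<in>UNIV. (if j = i then x $ j else 0) + (if i = m then (if j = n then x $ j else 0) else 0))"
        using 5(1) by (intro sum.cong) auto
      then show ?thesis by (simp add: sum.distrib)
    qed
    then show ?thesis by (simp add: vec_eq_iff matrix_vector_mult_def inner_axis) (simp add: axis_def)
  qed
  have "?A = (\<chi> k. if k = m then row m (mat 1) + 1 *s row n (mat 1) else row k (mat 1))"
    using 5(1) by (auto simp: vec_eq_iff mat_def row_def)
  then have d: "det ?A = 1" using det_row_operation[OF 5(1), of "mat 1 :: real^'n^'n" 1] by simp
  show ?case unfolding A d
    using nn_integral_lborel_shear[OF 5(3), of "axis m 1" "axis n 1"] 5(1) by (simp add: axis_eq_axis)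
qed

lemma nn_integral_lborel_vm:
  fixes g :: "real^'n^'n"
  assumes g: "\<bar>det g\<bar> = 1" and f: "f \<in> borel_measurable borel"
  shows "(\<integral>\<^sup>+ x. f (x v* g) \<partial>lborel) = (\<integral>\<^sup>+ x. f x \<partial>lborel)"
proof -
  have "transpose g *v x = x v* g" for x by simp
  then show ?thesis
    using nn_integral_lborel_matrix[of "transpose g" f] f g by (auto simp: det_transpose)
qed

lemma emeasure_lborel_vm:
  fixes g :: "real^'n^'n"
  assumes g: "\<bar>det g\<bar> = 1" and A: "A \<in> sets borel"
  shows "emeasure lborel {x. x v* g \<in> A} = emeasure lborel A"
proof -
  have m: "{x. x v* g \<in> A} \<in> sets borel"
    using measurable_sets[OF borel_measurable_vector_matrix[of "\<lambda>x. x" borel "\<lambda>_. g"] A]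
    by (simp add: vimage_def)
  have "emeasure lborel {x. x v* g \<in> A} = (\<integral>\<^sup>+ x. indicator {x. x v* g \<in> A} x \<partial>lborel)"
    using m by (subst nn_integral_indicator) auto
  also have "\<dots> = (\<integral>\<^sup>+ x. indicator A (x v* g) \<partial>lborel)"
    by (intro nn_integral_cong) (auto simp: indicator_def)
  also have "\<dots> = (\<integral>\<^sup>+ x. indicator A x \<partial>lborel)"
    using A by (intro nn_integral_lborel_vm g) auto
  finally show ?thesis using A by simp
qed

lemma sigma_finite_TT: "sigma_finite_measure (TT r)"
  by (rule product_sigma_finite.sigma_finite[OF product_sigma_finite_lborel]) simp

lemma distr_TT_tmul:
  fixes h :: "real^'n^'n"
  assumes h: "\<bar>det h\<bar> = 1"
  shows "distr (TT r) (TT r) (\<lambda>X. tmul r X h) = TT r"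
proof -
  interpret product_sigma_finite "\<lambda>_::nat. lborel :: (real^'n) measure" by (rule product_sigma_finite_lborel)
  show ?thesis
  proof (rule PiM_eqI)
    fix A :: "nat \<Rightarrow> (real^'n) set" assume A: "\<And>i. i \<in> {..<r} \<Longrightarrow> A i \<in> sets lborel"
    have m: "(\<lambda>X. tmul r X h) \<in> measurable (TT r) (TT r)"
      by (intro measurable_tmul) auto
    have m': "{x. x v* h \<in> A i} \<in> sets borel" if "i < r" for i
      using measurable_sets[OF borel_measurable_vector_matrix[of "\<lambda>x. x" borel "\<lambda>_. h"], of "A i"] A that
      by (simp add: vimage_def)
    have "(\<lambda>X. tmul r X h) -` Pi\<^sub>E {..<r} A \<inter> space (TT r) = Pi\<^sub>E {..<r} (\<lambda>i. {x. x v* h \<in> A i})"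
    proof (rule set_eqI)
      fix X
      have "tmul r X h \<in> Pi\<^sub>E {..<r} A \<longleftrightarrow> (\<forall>i<r. X i v* h \<in> A i)"
        by (auto simp: tmul_def restrict_PiE_iff Pi_iff)
      then show "X \<in> (\<lambda>X. tmul r X h) -` Pi\<^sub>E {..<r} A \<inter> space (TT r) \<longleftrightarrow> X \<in> Pi\<^sub>E {..<r} (\<lambda>i. {x. x v* h \<in> A i})"
        unfolding space_PiM by (simp add: PiE_iff Ball_def)
    qed
    then have "emeasure (distr (TT r) (TT r) (\<lambda>X. tmul r X h)) (Pi\<^sub>E {..<r} A) =
       emeasure (TT r) (Pi\<^sub>E {..<r} (\<lambda>i. {x. x v* h \<in> A i}))"
      using A by (subst emeasure_distr[OF m]) (auto intro!: sets_PiM_I_finite)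
    also have "\<dots> = (\<Prod>i<r. emeasure lborel {x. x v* h \<in> A i})"
      using m' by (subst emeasure_PiM) auto
    also have "\<dots> = (\<Prod>i<r. emeasure lborel (A i))"
      using A h by (intro prod.cong emeasure_lborel_vm) auto
    finally show "emeasure (distr (TT r) (TT r) (\<lambda>X. tmul r X h)) (Pi\<^sub>E {..<r} A) =
       (\<Prod>i<r. emeasure lborel (A i))" .
  qed auto
qed

section \<open>Gram-Schmidt orthogonalisation of tuples\<close>

declare sum.cong [fundef_cong]

text \<open>Gram-Schmidt without normalisation. Since division by zero yields \<open>0\<close>, a
  vector that depends on its predecessors contributes nothing to later steps, and orthogonality
  holds for every tuple, independent or not.\<close>

function gs :: "(nat \<Rightarrow> real^'n) \<Rightarrow> nat \<Rightarrow> real^'n" where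
  "gs v i = v i - (\<Sum>j<i. ((v i \<bullet> gs v j) / (gs v j \<bullet> gs v j)) *\<^sub>R gs v j)"
  by pat_completeness auto
termination by (relation "Wellfounded.measure snd") auto

declare gs.simps [simp del]

definition mu :: "(nat \<Rightarrow> real^'n) \<Rightarrow> nat \<Rightarrow> nat \<Rightarrow> real" where
  "mu v i j = (v i \<bullet> gs v j) / (gs v j \<bullet> gs v j)"

lemma gs_mu: "gs v i = v i - (\<Sum>j<i. mu v i j *\<^sub>R gs v j)"
  unfolding mu_def by (rule gs.simps)

lemma gs_cong: "(\<And>j. j \<le> i \<Longrightarrow> v j = w j) \<Longrightarrow> gs v i = gs w i"
proof (induction i rule: less_induct)
  case (less i)
  then have "gs v j = gs w j" if "j < i" for j using that by auto
  then show ?case unfolding gs.simps[of v i] gs.simps[of w i] using less(2) by auto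
qed

lemma gs_orth_less: "j < i \<Longrightarrow> gs v i \<bullet> gs v j = 0"
proof (induction i arbitrary: j rule: less_induct)
  case (less i)
  have 0: "gs v l \<bullet> gs v j = 0" if "l < i" "l \<noteq> j" for l
    using less.IH[of l j] less.IH[of j l] that less.prems by (metis inner_commute linorder_neqE_nat)
  have "gs v i \<bullet> gs v j = v i \<bullet> gs v j - (\<Sum>l<i. mu v i l * (gs v l \<bullet> gs v j))"
    unfolding gs_mu[of v i] by (simp add: inner_diff_left inner_sum_left)
  also have "(\<Sum>l<i. mu v i l * (gs v l \<bullet> gs v j)) = (\<Sum>l<i. if l = j then mu v i j * (gs v j \<bullet> gs v j) else 0)"
    using 0 by (intro sum.cong) auto
  also have "\<dots> = mu v i j * (gs v j \<bullet> gs v j)" using less.prems by simp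
  also have "\<dots> = v i \<bullet> gs v j" by (simp add: mu_def)
  finally show ?case by simp
qed

lemma gs_orth: "i \<noteq> j \<Longrightarrow> gs v i \<bullet> gs v j = 0"
  using gs_orth_less[of i j] gs_orth_less[of j i] by (metis inner_commute linorder_neqE_nat)

lemma gs_in_span: "gs v i \<in> span (v ` {..i})"
proof (induction i rule: less_induct)
  case (less i)
  have "gs v j \<in> span (v ` {..i})" if "j < i" for j
    using less[OF that] span_mono[OF image_mono[of "{..j}" "{..i}" v]] that by (auto simp: subset_eq)
  then show ?case unfolding gs_mu[of v i]
    by (intro span_diff span_sum span_scale) (auto intro: span_base)
qed

lemma span_gs: "span (gs v ` {..<i}) = span (v ` {..<i})"
proof
  have "gs v j \<in> span (v ` {..<i})" if "j < i" for j
    using gs_in_span[of v j] span_mono[OF image_mono[of "{..j}" "{..<i}" v]] that by (auto simp: subset_eq)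
  then show "span (gs v ` {..<i}) \<subseteq> span (v ` {..<i})"
    by (intro span_minimal subspace_span) auto
  have "v j \<in> span (gs v ` {..<i})" if "j < i" for j
  proof -
    have "v j = gs v j + (\<Sum>l<j. mu v j l *\<^sub>R gs v l)" using gs_mu[of v j] by simp
    also have "\<dots> \<in> span (gs v ` {..<i})"
      using that by (intro span_add span_sum span_scale span_base) auto
    finally show ?thesis .
  qed
  then show "span (v ` {..<i}) \<subseteq> span (gs v ` {..<i})"
    by (intro span_minimal subspace_span) auto
qed

lemma gs_orth_span: "w \<in> span (v ` {..<i}) \<Longrightarrow> gs v i \<bullet> w = 0"
proof -
  assume "w \<in> span (v ` {..<i})"
  then have "w \<in> span (gs v ` {..<i})" by (simp add: span_gs)
  then have "orthogonal (gs v i) w"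
    by (rule orthogonal_to_span) (auto simp: orthogonal_def gs_orth_less)
  then show ?thesis by (simp add: orthogonal_def)
qed

lemma v_minus_gs_span: "v i - gs v i \<in> span (v ` {..<i})"
proof -
  have "v i - gs v i = (\<Sum>j<i. mu v i j *\<^sub>R gs v j)" by (simp add: gs_mu[of v i])
  also have "\<dots> \<in> span (gs v ` {..<i})" by (intro span_sum span_scale span_base) auto
  finally show ?thesis by (simp add: span_gs)
qed

lemma gs_eq_0_iff: "gs v i = 0 \<longleftrightarrow> v i \<in> span (v ` {..<i})"
proof
  assume "gs v i = 0" then show "v i \<in> span (v ` {..<i})" using v_minus_gs_span[of v i] by simp
next
  assume "v i \<in> span (v ` {..<i})"
  then have "v i - (v i - gs v i) \<in> span (v ` {..<i})" by (intro span_diff v_minus_gs_span)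
  then have "gs v i \<bullet> gs v i = 0" using gs_orth_span[of "gs v i" v i] by simp
  then show "gs v i = 0" by simp
qed

text \<open>The inner product with \<open>gs v i\<close> does not see the span of the earlier
  vectors, so Cauchy-Schwarz applies with any \<open>w\<close> from it. Thus the length of
  \<open>gs v i\<close> is the distance of \<open>v i\<close> from that span.\<close>

lemma gs_le_dist: "w \<in> span (v ` {..<i}) \<Longrightarrow> norm (gs v i) \<le> norm (v i - w)"
proof -
  assume w: "w \<in> span (v ` {..<i})"
  have "gs v i \<bullet> (v i - w) = gs v i \<bullet> gs v i + gs v i \<bullet> (v i - gs v i) - gs v i \<bullet> w"
    by (simp add: inner_diff_right)
  also have "\<dots> = gs v i \<bullet> gs v i" using gs_orth_span[OF w] gs_orth_span[OF v_minus_gs_span] by simp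
  finally have "(norm (gs v i))\<^sup>2 \<le> norm (gs v i) * norm (v i - w)"
    using Cauchy_Schwarz_ineq2[of "gs v i" "v i - w"] by (simp add: power2_norm_eq_inner)
  then show ?thesis
    by (cases "gs v i = 0") (auto simp: power2_eq_square)
qed

lemma gs_inner_v: "gs v i \<bullet> v i = gs v i \<bullet> gs v i"
  using gs_orth_span[OF v_minus_gs_span[of v i]] by (simp add: inner_diff_right)

lemma gs_scale: "c \<noteq> 0 \<Longrightarrow> gs (\<lambda>i. c *\<^sub>R v i) i = c *\<^sub>R gs v i"
proof (induction i rule: less_induct)
  case (less i)
  have "(\<Sum>j<i. ((c *\<^sub>R v i \<bullet> gs (\<lambda>i. c *\<^sub>R v i) j) / (gs (\<lambda>i. c *\<^sub>R v i) j \<bullet> gs (\<lambda>i. c *\<^sub>R v i) j)) *\<^sub>R gs (\<lambda>i. c *\<^sub>R v i) j) =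
    (\<Sum>j<i. c *\<^sub>R ((v i \<bullet> gs v j) / (gs v j \<bullet> gs v j)) *\<^sub>R gs v j)"
    using less by (intro sum.cong) (auto simp: field_simps)
  then show ?case unfolding gs.simps[of _ i] by (simp add: scaleR_diff_right scaleR_sum_right)
qed

lemma borel_measurable_gs [measurable]:
  "i < r \<Longrightarrow> (\<lambda>X. gs X i :: real^'n) \<in> borel_measurable (TT r)"
proof (induction i rule: less_induct)
  case (less i)
  note [measurable] = borel_measurable_TT_component[OF less(2)]
  have [measurable]: "(\<lambda>X. gs X j :: real^'n) \<in> borel_measurable (TT r)" if "j \<in> {..<i}" for j
    using less.IH[of j] less(2) that by auto
  show ?case unfolding gs.simps[of _ i]
    by (intro borel_measurable_diff borel_measurable_sum borel_measurable_scaleR borel_measurable_divide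
        borel_measurable_inner) measurable
qed

section \<open>Independent tuples, determinants and transitivity\<close>

definition indep :: "nat \<Rightarrow> (nat \<Rightarrow> real^'n) \<Rightarrow> bool" where
  "indep r X \<longleftrightarrow> (\<forall>i<r. X i \<notin> span (X ` {..<i}))"

text \<open>This form makes independence a measurable condition and connects it with the determinant
  in \<open>det_mat_of_nz\<close>.\<close>

lemma indep_gs: "indep r X \<longleftrightarrow> (\<forall>i<r. gs X i \<noteq> 0)"
  by (simp add: indep_def gs_eq_0_iff)

lemma pred_indep [measurable]: "Measurable.pred (TT r) (indep r :: (nat \<Rightarrow> real^'n) \<Rightarrow> bool)"
  unfolding indep_gs[abs_def]
proof -
  have "Measurable.pred (TT r) (\<lambda>X. \<forall>i\<in>{..<r}. gs X i \<noteq> (0::real^'n))"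
  proof (intro pred_intros_finite(3))
    fix i assume "i \<in> {..<r}"
    then have [measurable]: "(\<lambda>X. gs X i :: real^'n) \<in> borel_measurable (TT r)" by simp
    show "Measurable.pred (TT r) (\<lambda>X. gs X i \<noteq> (0::real^'n))" by measurable
  qed simp
  then show "Measurable.pred (TT r) (\<lambda>X. \<forall>i<r. gs X i \<noteq> (0::real^'n))" by (simp add: Ball_def)
qed

lemma indep_extend1:
  assumes X: "indep r X" and r: "r < CARD('n)"
  shows "\<exists>z::real^'n. indep (Suc r) (X(r := z))"
proof -
  have "dim (span (X ` {..<r})) \<le> card (X ` {..<r})" by (intro dim_le_card) auto
  also have "\<dots> \<le> r" using card_image_le[of "{..<r}" X] by simp
  finally have "span (X ` {..<r}) \<noteq> UNIV" using r by (metis dim_UNIV DIM_cart DIM_real mult.right_neutral not_less)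
  then obtain z where z: "z \<notin> span (X ` {..<r})" by auto
  have im: "(X(r := z)) ` {..<i} = X ` {..<i}" if "i \<le> r" for i using that by auto
  have "(X(r := z)) i \<notin> span ((X(r := z)) ` {..<i})" if "i < Suc r" for i
    using X z that im[of i] by (cases "i = r") (auto simp: indep_def simp del: fun_upd_image)
  then show ?thesis unfolding indep_def by blast
qed

lemma indep_extend:
  assumes X: "indep r X" and r: "r \<le> CARD('n)"
  shows "\<exists>Y. indep CARD('n) (Y :: nat \<Rightarrow> real^'n) \<and> (\<forall>i<r. Y i = X i)"
  using r X
proof (induction r arbitrary: X rule: inc_induct)
  case base then show ?case by auto
next
  case (step r)
  obtain z where z: "indep (Suc r) (X(r := z))" using indep_extend1[OF step.prems step.hyps(2)] by blast
  from step.IH[OF z] obtain Y where Y: "indep CARD('n) Y" "\<forall>i<Suc r. Y i = (X(r := z)) i" by blast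
  then have "\<forall>i<r. Y i = X i" by auto
  then show ?case using Y(1) by blast
qed

text \<open>Gram-Schmidt needs an order, which the index type of vectors does not provide. A fixed
  enumeration links tuples indexed by numbers with square matrices.\<close>

definition idx :: "'n::finite \<Rightarrow> nat" where
  "idx = (SOME f. bij_betw f UNIV {..<CARD('n)})"

lemma bij_idx: "bij_betw (idx :: 'n::finite \<Rightarrow> nat) UNIV {..<CARD('n)}"
proof -
  have "\<exists>f. bij_betw f (UNIV :: 'n set) {..<CARD('n)}"
    using ex_bij_betw_finite_nat[of "UNIV :: 'n set"] by (simp add: atLeast0LessThan)
  then show ?thesis unfolding idx_def by (rule someI_ex)
qed

lemma idx_less [simp]: "idx (i::'n::finite) < CARD('n)"
  using bij_idx bij_betwE by blast

lemma idx_inj [simp]: "idx i = idx j \<longleftrightarrow> i = j"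
  using bij_idx by (auto simp: bij_betw_def inj_on_def)

lemma idx_ex: "k < CARD('n) \<Longrightarrow> \<exists>i::'n::finite. idx i = k"
  using bij_idx by (metis bij_betw_imp_surj_on imageE lessThan_iff)

definition mat_of :: "(nat \<Rightarrow> real^'n) \<Rightarrow> real^'n^'n" where
  "mat_of v = (\<chi> i. v (idx i))"

lemma mat_of_tmul: "mat_of (tmul CARD('n) X h) = mat_of X ** (h::real^'n^'n)"
  unfolding vec_eq_iff[of "mat_of _"] by (simp add: row_matrix_mult mat_of_def tmul_def)

text \<open>Rows are replaced from the last to the first. When row \<open>p\<close> is changed, all
  earlier rows are still the original vectors, and the change lies in their span, so the determinant
  stays the same.\<close>

lemma det_mat_of_gs_step:
  fixes v :: "nat \<Rightarrow> real^'n"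
  assumes "m \<le> CARD('n)"
  shows "det (\<chi> i. if CARD('n) - m \<le> idx i then gs v (idx i) else v (idx i)) = det (mat_of v)"
  using assms
proof (induction m)
  case 0
  then show ?case by (simp add: mat_of_def not_le[THEN iffD2])
next
  case (Suc m)
  let ?A = "(\<chi> i. if CARD('n) - m \<le> idx i then gs v (idx i) else v (idx i)) :: real^'n^'n"
  define p where "p = CARD('n) - Suc m"
  have p: "p < CARD('n)" "CARD('n) - m = Suc p" using Suc.prems by (auto simp: p_def)
  obtain k :: 'n where k: "idx k = p" using idx_ex[OF p(1)] by blast
  let ?x = "gs v p - v p"
  have "- (v p - gs v p) \<in> span (v ` {..<p})" by (intro span_neg v_minus_gs_span)
  then have x: "?x \<in> span (v ` {..<p})" by simp
  have sub: "v ` {..<p} \<subseteq> {row j ?A |j. j \<noteq> k}"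
  proof
    fix y assume "y \<in> v ` {..<p}"
    then obtain q where q: "q < p" "y = v q" by auto
    obtain j :: 'n where j: "idx j = q" using idx_ex[where 'n = 'n, of q] q p by auto
    have "j \<noteq> k" using j k q by auto
    moreover have "row j ?A = y" using j q p(2) by (simp add: row_def vec_eq_iff)
    ultimately show "y \<in> {row j ?A |j. j \<noteq> k}" by blast
  qed
  have "?x \<in> vec.span {row j ?A |j. j \<noteq> k}"
    unfolding span_vec_eq using x span_mono[OF sub] by blast
  from det_row_span[OF this]
  have "det (\<chi> i. if i = k then row k ?A + ?x else row i ?A) = det ?A" .
  moreover have "(\<chi> i. if i = k then row k ?A + ?x else row i ?A) =
     (\<chi> i. if CARD('n) - Suc m \<le> idx i then gs v (idx i) else v (idx i))"
  proof -
    have r: "row i ?A = (if Suc p \<le> idx i then gs v (idx i) else v (idx i))" for i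
      by (simp add: row_def vec_eq_iff p(2))
    have "(if i = k then row k ?A + ?x else row i ?A) =
      (if p \<le> idx i then gs v (idx i) else v (idx i))" for i
    proof (cases "i = k")
      case True then show ?thesis unfolding r using k by simp
    next
      case False
      then have "idx i \<noteq> p" using k by (metis idx_inj)
      then show ?thesis unfolding r using False by (simp add: not_le le_less Suc_le_eq)
    qed
    then show ?thesis unfolding p_def[symmetric] by simp
  qed
  ultimately show ?case using Suc by simp
qed

text \<open>The Gram matrix of the orthogonalised rows is diagonal, so the square of the determinant
  is the product of the squared lengths.\<close>

lemma abs_det_mat_of:
  fixes v :: "nat \<Rightarrow> real^'n"
  shows "\<bar>det (mat_of v)\<bar> = (\<Prod>i<CARD('n). norm (gs v i))"
proof -
  let ?G = "(\<chi> i. gs v (idx i)) :: real^'n^'n"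
  have d: "det (mat_of v) = det ?G" using det_mat_of_gs_step[of "CARD('n)" v] by simp
  have "?G ** transpose ?G = (\<chi> i j. gs v (idx i) \<bullet> gs v (idx j))"
    unfolding matrix_mult_transpose_dot_row by (simp add: row_def vec_lambda_eta)
  then have "det (?G ** transpose ?G) = (\<Prod>i\<in>UNIV. gs v (idx i) \<bullet> gs v (idx (i::'n)))"
    by (subst det_diagonal) (auto simp: gs_orth)
  also have "\<dots> = (\<Prod>i<CARD('n). gs v i \<bullet> gs v i)"
    using prod.reindex_bij_betw[OF bij_idx, of "\<lambda>i. gs v i \<bullet> gs v i"] .
  also have "\<dots> = (\<Prod>i<CARD('n). norm (gs v i))\<^sup>2"
    by (simp add: prod_power_distrib power2_norm_eq_inner)
  finally have "(det ?G)\<^sup>2 = (\<Prod>i<CARD('n). norm (gs v i))\<^sup>2"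
    by (simp add: det_mul power2_eq_square)
  then have "\<bar>det ?G\<bar> = \<bar>\<Prod>i<CARD('n). norm (gs v i)\<bar>" by (simp only: power2_eq_iff abs_eq_iff)
  then show ?thesis using d by (simp add: prod_nonneg)
qed

lemma det_mat_of_nz: "det (mat_of (v :: nat \<Rightarrow> real^'n)) \<noteq> 0 \<longleftrightarrow> indep CARD('n) v"
proof -
  have "det (mat_of v) \<noteq> 0 \<longleftrightarrow> \<bar>det (mat_of v)\<bar> \<noteq> 0" by simp
  also have "\<dots> \<longleftrightarrow> indep CARD('n) v" unfolding abs_det_mat_of by (auto simp: indep_gs)
  finally show ?thesis .
qed

lemma indep_tmul:
  fixes h :: "real^'n^'n"
  assumes h: "det h \<noteq> 0" shows "indep r (tmul r X h) \<longleftrightarrow> indep r X"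
proof -
  have inj: "inj (\<lambda>x. x v* h)" using inj_vector_matrix[OF h] .
  have "tmul r X h i \<in> span (tmul r X h ` {..<i}) \<longleftrightarrow> X i \<in> span (X ` {..<i})" if "i < r" for i
  proof -
    have "tmul r X h ` {..<i} = (\<lambda>x. x v* h) ` X ` {..<i}"
      using that by (auto simp: tmul_def image_iff)
    then have "span (tmul r X h ` {..<i}) = (\<lambda>x. x v* h) ` span (X ` {..<i})"
      using linear_span_image[OF linear_vector_matrix] by metis
    then show ?thesis using that inj_image_mem_iff[OF inj, of "X i" "span (X ` {..<i})"] by (simp add: tmul_def)
  qed
  then show ?thesis by (simp add: indep_def)
qed

lemma mat_of_eq_tmul:
  fixes X Y :: "nat \<Rightarrow> real^'n"
  assumes X: "det (mat_of X) \<noteq> 0"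
  obtains h where "det h = det (mat_of Y) / det (mat_of X)" "\<And>i. i < CARD('n) \<Longrightarrow> Y i = X i v* h"
proof -
  obtain A where A: "mat_of X ** A = mat 1" "det A = inverse (det (mat_of X))"
    using det_1_inverse[OF X] by metis
  define h where "h = A ** mat_of Y"
  have "mat_of X ** h = mat_of Y" unfolding h_def by (simp add: matrix_mul_assoc A)
  then have rows: "(mat_of X ** h) $ i = mat_of Y $ i" for i by simp
  have "Y i = X i v* h" if i: "i < CARD('n)" for i
  proof -
    obtain k :: 'n where "idx k = i" using idx_ex[OF i] by blast
    then show ?thesis using rows[of k] by (simp add: row_matrix_mult mat_of_def)
  qed
  moreover have "det h = det (mat_of Y) / det (mat_of X)" by (simp add: h_def det_mul A divide_inverse)
  ultimately show thesis using that by blast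
qed

lemma transitive_det_1:
  fixes X Y :: "nat \<Rightarrow> real^'n"
  assumes "X \<in> PiE {..<CARD('n)} (\<lambda>_. UNIV)" "Y \<in> PiE {..<CARD('n)} (\<lambda>_. UNIV)"
    "det (mat_of X) = 1" "det (mat_of Y) = 1"
  shows "\<exists>h. det h = 1 \<and> Y = tmul CARD('n) X h"
proof -
  obtain h where h: "det h = 1" "\<And>i. i < CARD('n) \<Longrightarrow> Y i = X i v* h"
    using mat_of_eq_tmul[of X Y] assms by auto
  have "Y = tmul CARD('n) X h"
    using assms(2) h(2) by (auto simp: tmul_def fun_eq_iff PiE_def extensional_def)
  then show ?thesis using h by blast
qed

text \<open>Both tuples are extended to bases, and the last vector of the second basis is multiplied
  by \<open>c\<close> to make the determinants equal. Because \<open>r < CARD('n)\<close>, the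
  rescaled vector is not a member of the given tuple.\<close>

lemma transitive_indep:
  fixes X Y :: "nat \<Rightarrow> real^'n"
  assumes r: "r < CARD('n)" and XY: "X \<in> PiE {..<r} (\<lambda>_. UNIV)" "Y \<in> PiE {..<r} (\<lambda>_. UNIV)"
    "indep r X" "indep r Y"
  shows "\<exists>h. det h = 1 \<and> Y = tmul r X h"
proof -
  let ?d = "CARD('n) - 1"
  obtain X' where X': "indep CARD('n) X'" "\<And>i. i < r \<Longrightarrow> X' i = X i"
    using indep_extend[OF XY(3)] r by auto
  obtain Y' where Y': "indep CARD('n) Y'" "\<And>i. i < r \<Longrightarrow> Y' i = Y i"
    using indep_extend[OF XY(4)] r by auto
  have nz: "det (mat_of X') \<noteq> 0" "det (mat_of Y') \<noteq> 0" using X' Y' by (simp_all add: det_mat_of_nz)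
  define c where "c = det (mat_of X') / det (mat_of Y')"
  define Z where "Z = Y'(?d := c *\<^sub>R Y' ?d)"
  obtain k :: 'n where k: "idx k = ?d" using idx_ex[where 'n = 'n, of ?d] r by auto
  have "mat_of Z = (\<chi> i. if i = k then c *s Y' (idx i) else Y' (idx i))"
    unfolding mat_of_def Z_def vec_eq_iff using k by (auto simp: scalar_mult_eq_scaleR) (metis idx_inj k)+
  then have "det (mat_of Z) = c * det (mat_of Y')"
    unfolding mat_of_def using det_row_mul[of k c "\<lambda>i. Y' (idx i)" "\<lambda>i. Y' (idx i)"] by simp
  then have "det (mat_of Z) = det (mat_of X')" using nz by (simp add: c_def)
  then obtain h where h: "det h = 1" "\<And>i. i < CARD('n) \<Longrightarrow> Z i = X' i v* h"
    using mat_of_eq_tmul[OF nz(1), of Z] nz by auto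
  have "Y i = X i v* h" if "i < r" for i
  proof -
    have "i \<noteq> ?d" "i < CARD('n)" using that r by linarith+
    then show ?thesis using h(2)[of i] X'(2)[OF that] Y'(2)[OF that] by (simp add: Z_def)
  qed
  then have "Y = tmul r X h"
    using XY(2) by (auto simp: tmul_def fun_eq_iff PiE_def extensional_def)
  then show ?thesis using h by blast
qed

text \<open>With the other vectors fixed, dependence at \<open>i\<close> confines the vector
  \<open>i\<close> to the span of \<open>i < d\<close> vectors, a proper subspace and hence a null
  set.\<close>

lemma AE_indep:
  assumes r: "r \<le> CARD('n)"
  shows "AE X in TT r. indep r (X :: nat \<Rightarrow> real^'n)"
proof -
  interpret product_sigma_finite "\<lambda>_::nat. lborel :: (real^'n) measure" by (rule product_sigma_finite_lborel)
  have "AE X in TT r. gs X i \<noteq> (0::real^'n)" if i: "i < r" for i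
  proof -
    let ?J = "{..<r} - {i}"
    have ins: "{..<r} = insert i ?J" using i by auto
    have m: "(\<lambda>X. gs X i :: real^'n) \<in> borel_measurable (PiM (insert i ?J) (\<lambda>_. lborel))"
      unfolding ins[symmetric] using i by (rule borel_measurable_gs)
    have m': "(\<lambda>X. indicator {0} (gs X i :: real^'n) :: ennreal) \<in> borel_measurable (PiM (insert i ?J) (\<lambda>_. lborel))"
      using m by measurable
    have "(\<integral>\<^sup>+ X. indicator {0} (gs X i :: real^'n) \<partial>TT r) =
      (\<integral>\<^sup>+ X. \<integral>\<^sup>+ y. indicator {0} (gs (X(i := y)) i :: real^'n) \<partial>lborel \<partial>PiM ?J (\<lambda>_. lborel))"
      by (subst ins, subst product_nn_integral_insert[OF _ _ m']) auto
    also have "\<dots> = (\<integral>\<^sup>+ X. 0 \<partial>PiM ?J (\<lambda>_. lborel :: (real^'n) measure))"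
    proof (rule nn_integral_cong)
      fix X :: "nat \<Rightarrow> real^'n"
      let ?S = "span (X ` {..<i})"
      have im: "(X(i := y)) ` {..<i} = X ` {..<i}" for y by auto
      have e: "indicator {0} (gs (X(i := y)) i) = (indicator ?S y :: ennreal)" for y
        using gs_eq_0_iff[of "X(i := y)" i] unfolding im by (simp add: indicator_def)
      have "dim ?S \<le> card (X ` {..<i})" by (intro dim_le_card) auto
      also have "\<dots> \<le> i" using card_image_le[of "{..<i}" X] by simp
      finally have "negligible ?S" using i r by (intro negligible_lowdim) simp
      then have "emeasure lborel ?S = 0"
        using closed_subspace[OF subspace_span, of "X ` {..<i}"]
        by (auto simp: negligible_iff_null_sets null_sets_completion_iff)
      then have "(\<integral>\<^sup>+ y. indicator ?S y \<partial>lborel) = 0"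
        using closed_subspace[OF subspace_span, of "X ` {..<i}"] by (subst nn_integral_indicator) auto
      then show "(\<integral>\<^sup>+ y. indicator {0} (gs (X(i := y)) i) \<partial>lborel) = 0" unfolding e .
    qed
    finally have "(\<integral>\<^sup>+ X. indicator {0} (gs X i :: real^'n) \<partial>TT r) = 0" by simp
    then have "AE X in TT r. indicator {0} (gs X i :: real^'n) = (0::ennreal)"
      using m' ins by (subst (asm) nn_integral_0_iff_AE) auto
    then show ?thesis by eventually_elim (auto simp: indicator_def split: if_splits)
  qed
  then have "AE X in (TT r :: (nat \<Rightarrow> real^'n) measure). \<forall>i\<in>{..<r}. gs X i \<noteq> 0"
    by (intro AE_finite_allI) auto
  then show ?thesis by eventually_elim (auto simp: indep_gs)
qed

section \<open>Invariant random affine lattices\<close>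

text \<open>Collects what is needed of \<open>liftm M\<close>. In the last assumption
  \<open>psi\<close> is a function of the affine lattice alone; only for such functions does right
  translation leave the integral unchanged.\<close>

locale asl_measure =
  fixes P :: "'n::finite asl measure"
  assumes prob_P: "prob_space P" and sets_P [measurable_cong, simp]: "sets P = sets borel"
    and AE_det: "AE q in P. det (fst q) = 1"
    and inv_P: "\<And>h eta psi. det h = 1 \<Longrightarrow> psi \<in> borel_measurable borel \<Longrightarrow>
       (\<And>q q'. det (fst q) = 1 \<Longrightarrow> det (fst q') = 1 \<Longrightarrow> affl q = affl q' \<Longrightarrow> psi q = psi q') \<Longrightarrow>
       (\<integral>\<^sup>+ q. psi (ract q (h, eta)) \<partial>P) = (\<integral>\<^sup>+ q. psi q \<partial>P)"

lemma asl_measure_liftm: "is_muY M \<Longrightarrow> asl_measure (liftm M)"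
  by (rule asl_measure.intro)
    (assumption | rule prob_space_liftm AE_liftm_det sets_liftm nn_integral_liftm_ract)+

text \<open>Stability under \<open>SLZ\<close> makes the set of lattice tuples with coordinates in
  \<open>C\<close> independent of the chosen basis, so that sums over it are functions on the space
  of lattices.\<close>

definition SLZ_inv :: "nat \<Rightarrow> (nat \<Rightarrow> real^'n) set \<Rightarrow> bool" where
  "SLZ_inv r C \<longleftrightarrow> C \<subseteq> PiE {..<r} (\<lambda>_. Zv) \<and> (\<forall>m\<in>SLZ. \<forall>A\<in>C. tmul r A m \<in> C)"

lemma countable_PiE_Zv: "countable (PiE {..<r::nat} (\<lambda>_. Zv :: (real^'n) set))"
  by (intro countable_PiE) (auto simp: countable_Zv)

lemma SLZ_inv_countable: "SLZ_inv r C \<Longrightarrow> countable C"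
  unfolding SLZ_inv_def using countable_subset[OF _ countable_PiE_Zv[of r]] by auto

lemma SLZ_inv_bij:
  assumes C: "SLZ_inv r C" and m: "m \<in> SLZ"
  shows "bij_betw (\<lambda>A. tmul r A m) C C"
proof -
  obtain m' where m': "m' \<in> SLZ" "m ** m' = mat 1" "m' ** m = mat 1" using SLZ_inverse[OF m] .
  have id: "tmul r (tmul r A n) n' = A" if "A \<in> C" "n ** n' = mat 1" for A n n'
    using that C by (auto simp: tmul_tmul SLZ_inv_def intro: tmul_id)
  show ?thesis
    by (rule bij_betw_byWitness[where f' = "\<lambda>A. tmul r A m'"])
      (use C m m' id in \<open>auto simp: SLZ_inv_def\<close>)
qed

lemma nn_integral_SLZ_inv:
  assumes "SLZ_inv r C" "m \<in> SLZ"
  shows "(\<integral>\<^sup>+ A. f (tmul r A (m ** g)) \<partial>count_space C) = (\<integral>\<^sup>+ A. f (tmul r A g) \<partial>count_space C)"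
  using nn_integral_bij_count_space[OF SLZ_inv_bij[OF assms], of "\<lambda>A. f (tmul r A g)"]
  by (simp add: tmul_tmul)

context asl_measure
begin

sublocale prob_space P by (rule prob_P)

lemma space_P [simp]: "space P = UNIV"
  using sets_eq_imp_space_eq[OF sets_P] by simp

text \<open>Two elements over the same affine lattice have linear parts that differ by
  \<open>SLZ\<close>, so a function of the linear part with this symmetry is a function of the
  affine lattice.\<close>

lemma inv_linear:
  assumes h: "det h = 1" and psi: "psi \<in> borel_measurable borel"
    and inv: "\<And>m g. m \<in> SLZ \<Longrightarrow> det g = 1 \<Longrightarrow> psi (m ** g) = psi g"
  shows "(\<integral>\<^sup>+ q. psi (fst q ** h) \<partial>P) = (\<integral>\<^sup>+ q. psi (fst q) \<partial>P)"
proof -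
  have "(\<integral>\<^sup>+ q. (\<lambda>q::'n asl. psi (fst q)) (ract q (h, 0)) \<partial>P) = (\<integral>\<^sup>+ q. psi (fst q) \<partial>P)"
  proof (rule inv_P[OF h])
    show "(\<lambda>q::'n asl. psi (fst q)) \<in> borel_measurable borel"
      using measurable_compose[OF borel_measurable_fst psi] .
    fix q q' :: "'n asl" assume q: "det (fst q) = 1" "det (fst q') = 1" "affl q = affl q'"
    obtain m where "m \<in> SLZ" "fst q' = m ** fst q"
      using lat_eq_imp[of "fst q" "fst q'"] affl_eq_lat[OF q(3)] q by auto
    then show "psi (fst q) = psi (fst q')" using inv q by simp
  qed
  then show ?thesis by (simp add: ract_def)
qed

text \<open>The intensity measure of those \<open>r\<close>-tuples of lattice points whose coordinates lie in \<open>C\<close>.\<close>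

definition nuC :: "nat \<Rightarrow> (nat \<Rightarrow> real^'n) set \<Rightarrow> (nat \<Rightarrow> real^'n) measure" where
  "nuC r C = distr (P \<Otimes>\<^sub>M count_space C) (TT r) (\<lambda>(q, A). tmul r A (fst q))"

lemma sets_nuC [measurable_cong, simp]: "sets (nuC r C) = sets (TT r)"
  by (simp add: nuC_def)

lemma measurable_nuC_map:
  assumes C: "SLZ_inv r C"
  shows "(\<lambda>(q, A). tmul r A (fst q)) \<in> measurable (P \<Otimes>\<^sub>M count_space C) (TT r)"
proof -
  have "(\<lambda>(A, q). tmul r A (fst q)) \<in> measurable (count_space C \<Otimes>\<^sub>M P) (TT r)"
  proof (intro measurable_pair_measure_countable1 SLZ_inv_countable[OF C])
    fix A assume "A \<in> C"
    then have "A \<in> space (TT r)" using C by (auto simp: SLZ_inv_def space_PiM PiE_def)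
    then show "(\<lambda>q. case (A, q) of (A, q) \<Rightarrow> tmul r A (fst q)) \<in> measurable P (TT r)"
      by (auto intro!: measurable_tmul)
  qed
  then show ?thesis by (subst measurable_pair_swap_iff) (simp add: case_prod_unfold)
qed

lemma nn_integral_nuC:
  assumes C: "SLZ_inv r C" and f: "f \<in> borel_measurable (TT r)"
  shows "(\<integral>\<^sup>+ X. f X \<partial>nuC r C) = (\<integral>\<^sup>+ q. (\<integral>\<^sup>+ A. f (tmul r A (fst q)) \<partial>count_space C) \<partial>P)"
proof -
  interpret C: sigma_finite_measure "count_space C"
    using SLZ_inv_countable[OF C] by (rule sigma_finite_measure_count_space_countable)
  note m = measurable_nuC_map[OF C]
  have "(\<integral>\<^sup>+ X. f X \<partial>nuC r C) = (\<integral>\<^sup>+ p. f (case p of (q, A) \<Rightarrow> tmul r A (fst q)) \<partial>(P \<Otimes>\<^sub>M count_space C))"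
    unfolding nuC_def by (subst nn_integral_distr[OF m]) (use f in simp_all)
  also have "\<dots> = (\<integral>\<^sup>+ q. (\<integral>\<^sup>+ A. f (tmul r A (fst q)) \<partial>count_space C) \<partial>P)"
    using measurable_compose[OF m f] by (subst C.nn_integral_fst[symmetric]) auto
  finally show ?thesis .
qed

lemma borel_measurable_sum_C:
  assumes C: "SLZ_inv r C" and f: "f \<in> borel_measurable (TT r)"
  shows "(\<lambda>g. \<integral>\<^sup>+ A. f (tmul r A g) \<partial>count_space C) \<in> borel_measurable borel"
proof (intro borel_measurable_countable_nn_integral SLZ_inv_countable[OF C])
  fix A assume "A \<in> C"
  then have "A \<in> space (TT r)" using C by (auto simp: SLZ_inv_def space_PiM PiE_def)
  then have "(\<lambda>g. tmul r A g) \<in> measurable borel (TT r)" by (intro measurable_tmul) auto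
  then show "(\<lambda>g. f (tmul r A g)) \<in> borel_measurable borel" using f by (rule measurable_compose)
qed

lemma emeasure_nuC:
  assumes C: "SLZ_inv r C" and S: "S \<in> sets (TT r)"
  shows "emeasure (nuC r C) S = (\<integral>\<^sup>+ q. (\<integral>\<^sup>+ A. indicator S (tmul r A (fst q)) \<partial>count_space C) \<partial>P)"
  using nn_integral_nuC[OF C, of "indicator S"] S by simp

text \<open>Moving the tuple by \<open>h\<close> is the same as moving the lattice by
  \<open>h\<close>, and the sum over \<open>C\<close> depends on the lattice only.\<close>

lemma nuC_invariant:
  assumes C: "SLZ_inv r C" and h: "det h = 1"
  shows "distr (nuC r C) (TT r) (\<lambda>X. tmul r X h) = nuC r C"
proof (rule measure_eqI)
  have m: "(\<lambda>X. tmul r X h) \<in> measurable (nuC r C) (TT r)" "(\<lambda>X. tmul r X h) \<in> measurable (TT r) (TT r)"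
    by measurable
  fix S assume "S \<in> sets (distr (nuC r C) (TT r) (\<lambda>X. tmul r X h))"
  then have S[measurable]: "S \<in> sets (TT r)" by simp
  have S': "(\<lambda>X. tmul r X h) -` S \<inter> space (TT r) \<in> sets (TT r)" using m(2) S by (rule measurable_sets)
  have "emeasure (distr (nuC r C) (TT r) (\<lambda>X. tmul r X h)) S = emeasure (nuC r C) ((\<lambda>X. tmul r X h) -` S \<inter> space (TT r))"
    using S sets_eq_imp_space_eq[OF sets_nuC[of r C]] by (subst emeasure_distr[OF m(1)]) auto
  also have "\<dots> = (\<integral>\<^sup>+ q. (\<integral>\<^sup>+ A. indicator S (tmul r A (fst q ** h)) \<partial>count_space C) \<partial>P)"
    unfolding emeasure_nuC[OF C S'] by (intro nn_integral_cong) (simp add: indicator_def tmul_tmul del: space_PiM)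
  also have "\<dots> = (\<integral>\<^sup>+ q. (\<integral>\<^sup>+ A. indicator S (tmul r A (fst q)) \<partial>count_space C) \<partial>P)"
    by (rule inv_linear[OF h borel_measurable_sum_C[OF C]]) (simp_all add: nn_integral_SLZ_inv[OF C])
  also have "\<dots> = emeasure (nuC r C) S" using emeasure_nuC[OF C S] by simp
  finally show "emeasure (distr (nuC r C) (TT r) (\<lambda>X. tmul r X h)) S = emeasure (nuC r C) S" .
qed simp

end

section \<open>Unfolding the translations\<close>

lemma Zv_uminus_bij: "bij_betw uminus Zv Zv"
  by (rule bij_betw_byWitness[where f' = uminus]) (auto intro: Zv_uminus)

lemma Zv_add_bij: "a \<in> Zv \<Longrightarrow> bij_betw (\<lambda>z. z + a) Zv Zv"
  by (rule bij_betw_byWitness[where f' = "\<lambda>z. z - a"]) (auto intro: Zv_add Zv_diff)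

lemma Zv_SLZ_bij: "m \<in> SLZ \<Longrightarrow> bij_betw (\<lambda>z. z v* m) Zv Zv"
proof -
  assume m: "m \<in> SLZ"
  obtain m' where m': "m' \<in> SLZ" "m ** m' = mat 1" "m' ** m = mat 1" using SLZ_inverse[OF m] .
  show ?thesis
    by (rule bij_betw_byWitness[where f' = "\<lambda>z. z v* m'"])
      (use m m' in \<open>auto simp: vector_matrix_mul_assoc SLZ_def intro!: Zv_vector_matrix\<close>)
qed

definition unit_cell :: "(real^'n) set" where
  "unit_cell = {y. \<forall>i. 0 \<le> y $ i \<and> y $ i < 1}"

lemma sets_unit_cell [measurable]: "unit_cell \<in> sets borel"
proof -
  have [measurable]: "(\<lambda>y::real^'a. y $ i) \<in> borel_measurable borel" for i
    by (intro borel_measurable_continuous_onI continuous_intros)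
  have "{y::real^'a. \<forall>i\<in>UNIV. 0 \<le> y $ i \<and> y $ i < 1} \<in> sets borel"
    using sets.sets_Collect_finite_All[of UNIV borel "\<lambda>y i. 0 \<le> y $ i \<and> y $ i < 1"] by simp
  then show ?thesis by (simp add: unit_cell_def)
qed

lemma emeasure_unit_cell: "emeasure lborel (unit_cell :: (real^'n) set) = 1"
proof -
  let ?o = "(\<chi> i. 1) :: real^'n"
  have b: "emeasure lborel (box 0 ?o) = 1"
    by (subst emeasure_lborel_box, force simp: Basis_vec_def inner_axis, subst prod_Basis_vec) simp
  have c: "emeasure lborel (cbox 0 ?o) = 1"
    by (subst emeasure_lborel_cbox, force simp: Basis_vec_def inner_axis, subst prod_Basis_vec) simp
  have "emeasure lborel (box 0 ?o) \<le> emeasure lborel (unit_cell :: (real^'n) set)"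
    by (intro emeasure_mono) (auto simp: unit_cell_def mem_box_cart less_imp_le)
  moreover have "emeasure lborel (unit_cell :: (real^'n) set) \<le> emeasure lborel (cbox 0 ?o)"
    by (intro emeasure_mono) (auto simp: unit_cell_def mem_box_cart less_imp_le)
  ultimately show ?thesis using b c by simp
qed

lemma unit_cell_translate:
  fixes y :: "real^'n"
  shows "(\<integral>\<^sup>+ z. indicator unit_cell (y - z) \<partial>count_space Zv) = 1"
proof -
  define n :: "real^'n" where "n = (\<chi> i. of_int \<lfloor>y $ i\<rfloor>)"
  have n: "n \<in> Zv" by (simp add: n_def Zv_def)
  have iff: "y - z \<in> unit_cell \<longleftrightarrow> z = n" if z: "z \<in> Zv" for z
  proof
    assume "y - z \<in> unit_cell"
    then have "z $ i = n $ i" for i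
      using z by (auto simp: unit_cell_def Zv_def n_def Ints_def image_iff) (smt (verit) floor_unique)
    then show "z = n" by (simp add: vec_eq_iff)
  next
    assume "z = n" then show "y - z \<in> unit_cell"
      by (auto simp: unit_cell_def n_def) linarith+
  qed
  have "(\<integral>\<^sup>+ z. indicator unit_cell (y - z) \<partial>count_space Zv) = (\<integral>\<^sup>+ z. indicator {n} z \<partial>count_space Zv)"
    using iff by (intro nn_integral_cong) (auto simp: indicator_def)
  also have "\<dots> = 1" using n by (subst nn_integral_indicator) auto
  finally show ?thesis .
qed

text \<open>Exactly one integral translate brings a point into the unit cell. The factor
  \<open>1\<close> is inserted in this form, as a sum over \<open>Zv\<close>, and each summand is
  translated back.\<close>

lemma nn_integral_lborel_unfold:
  fixes f :: "real^'n \<Rightarrow> ennreal"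
  assumes [measurable]: "f \<in> borel_measurable borel"
  shows "(\<integral>\<^sup>+ y. f y \<partial>lborel) = (\<integral>\<^sup>+ y. (\<integral>\<^sup>+ z. f (y + z) \<partial>count_space Zv) * indicator unit_cell y \<partial>lborel)"
proof -
  have mz: "(\<lambda>y. \<integral>\<^sup>+ z. F z y \<partial>count_space (Zv :: (real^'n) set)) \<in> borel_measurable borel"
    if "\<And>z. F z \<in> borel_measurable borel" for F :: "real^'n \<Rightarrow> real^'n \<Rightarrow> ennreal"
    using that by (intro borel_measurable_countable_nn_integral countable_Zv)
  have swap: "(\<integral>\<^sup>+ y. \<integral>\<^sup>+ z. F z y \<partial>count_space (Zv :: (real^'n) set) \<partial>lborel) =
      (\<integral>\<^sup>+ z. \<integral>\<^sup>+ y. F z y \<partial>lborel \<partial>count_space Zv)"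
    if "\<And>z. F z \<in> borel_measurable borel" for F :: "real^'n \<Rightarrow> real^'n \<Rightarrow> ennreal"
    using that countable_Zv by (intro nn_integral_count_space_nn_integral) auto
  have "(\<integral>\<^sup>+ y. f y \<partial>lborel) = (\<integral>\<^sup>+ y. \<integral>\<^sup>+ z. f y * indicator unit_cell (y - z) \<partial>count_space Zv \<partial>lborel)"
    by (simp add: nn_integral_cmult unit_cell_translate)
  also have "\<dots> = (\<integral>\<^sup>+ z. \<integral>\<^sup>+ y. f y * indicator unit_cell (y - z) \<partial>lborel \<partial>count_space Zv)"
    by (rule swap) measurable
  also have "\<dots> = (\<integral>\<^sup>+ z. \<integral>\<^sup>+ y. f (y + z) * indicator unit_cell y \<partial>lborel \<partial>count_space Zv)"
  proof (rule nn_integral_cong)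
    fix z :: "real^'n"
    show "(\<integral>\<^sup>+ y. f y * indicator unit_cell (y - z) \<partial>lborel) = (\<integral>\<^sup>+ y. f (y + z) * indicator unit_cell y \<partial>lborel)"
      by (subst nn_integral_lborel_translate[of "\<lambda>y. f y * indicator unit_cell (y - z)" z, symmetric])
        (measurable, simp add: add.commute)
  qed
  also have "\<dots> = (\<integral>\<^sup>+ y. \<integral>\<^sup>+ z. f (y + z) * indicator unit_cell y \<partial>count_space Zv \<partial>lborel)"
    by (rule swap[symmetric]) measurable
  also have "\<dots> = (\<integral>\<^sup>+ y. (\<integral>\<^sup>+ z. f (y + z) \<partial>count_space Zv) * indicator unit_cell y \<partial>lborel)"
    by (simp add: nn_integral_multc)
  finally show ?thesis .
qed

text \<open>Voronoi weights: \<open>rho\<close> spreads the indicator of the Voronoi cell of a lattice evenly over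
  ties, so that its lattice translates form a partition of unity.\<close>

definition vor :: "'n::finite asl \<Rightarrow> bool" where
  "vor p \<longleftrightarrow> (\<forall>z\<in>Zv. norm (snd p) \<le> norm (snd p + z v* fst p))"

definition cntv :: "'n::finite asl \<Rightarrow> ennreal" where
  "cntv p = (\<integral>\<^sup>+ z. indicator {p. vor p} (fst p, snd p + z v* fst p) \<partial>count_space Zv)"

definition rho :: "'n::finite asl \<Rightarrow> ennreal" where
  "rho p = indicator {p. vor p} p / cntv p"

lemma sets_vor [measurable]: "{p. vor p} \<in> sets borel"
proof -
  have "{p::'a asl. norm (snd p) \<le> norm (snd p + z v* fst p)} \<in> sets borel" for z
    by measurable
  then have "{p \<in> space borel. \<forall>z\<in>Zv. norm (snd (p::'a asl)) \<le> norm (snd p + z v* fst p)} \<in> sets borel"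
    by (intro sets.sets_Collect_countable_All' countable_Zv) simp
  then show ?thesis unfolding vor_def by simp
qed

lemma borel_measurable_cntv [measurable]: "cntv \<in> borel_measurable borel"
  unfolding cntv_def[abs_def]
proof (intro borel_measurable_countable_nn_integral countable_Zv)
  fix z :: "real^'a"
  have [measurable]: "(\<lambda>p::'a asl. (fst p, snd p + z v* fst p)) \<in> borel_measurable borel"
    by (intro borel_measurable_Pair) measurable
  show "(\<lambda>p::'a asl. indicator {p. vor p} (fst p, snd p + z v* fst p) :: ennreal) \<in> borel_measurable borel"
    by measurable
qed

lemma borel_measurable_rho [measurable]: "rho \<in> borel_measurable borel"
  unfolding rho_def[abs_def] by measurable

lemma cntv_translate: "w \<in> Zv \<Longrightarrow> cntv (g, x + w v* g) = cntv (g, x)"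
  using nn_integral_bij_count_space[OF Zv_add_bij[of w], of "\<lambda>z. indicator {p. vor p} (g, x + z v* g) :: ennreal"]
  by (simp add: cntv_def vector_matrix_left_distrib algebra_simps)

text \<open>The reason for Voronoi cells instead of images of \<open>unit_cell\<close>: such an
  image depends on the basis \<open>g\<close>, while \<open>rho\<close> depends on the lattice alone
  and may therefore occur in functions to which \<open>inv_P\<close> applies.\<close>

lemma rho_SLZ:
  assumes m: "m \<in> SLZ" shows "rho (m ** g, x) = rho (g, x)"
proof -
  have vor: "vor (m ** g, x) \<longleftrightarrow> vor (g, x)" for x
    unfolding vor_def fst_conv snd_conv
    by (subst bij_betw_imp_surj_on[OF Zv_SLZ_bij[OF m], symmetric]) (simp add: vector_matrix_mul_assoc)
  have "cntv (m ** g, x) = cntv (g, x)"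
    unfolding cntv_def fst_conv snd_conv
    using nn_integral_bij_count_space[OF Zv_SLZ_bij[OF m], of "\<lambda>z. indicator {p. vor p} (g, x + z v* g) :: ennreal"]
    by (simp add: vor indicator_def vector_matrix_mul_assoc)
  then show ?thesis using vor by (simp add: rho_def indicator_def)
qed

text \<open>By discreteness the coset \<open>x + lat g\<close> has points of least norm, and all of
  them lie in the ball of radius \<open>norm x\<close>, which meets the coset in a finite
  set.\<close>

lemma cntv_pos_finite:
  assumes g: "det g = 1" shows "cntv (g, x) \<noteq> 0" "cntv (g, x) \<noteq> \<infinity>"
proof -
  let ?S = "{z. z \<in> Zv \<and> norm (z v* g + x) \<le> norm x}"
  let ?T = "{z \<in> Zv. vor (g, x + z v* g)}"
  have S: "finite ?S" using finite_Zv_preimage[of g x "norm x"] g by simp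
  have ne: "?S \<noteq> {}" using Zv_0 by (auto intro!: exI[of _ 0])
  define z0 where "z0 = arg_min_on (\<lambda>z. norm (z v* g + x)) ?S"
  have z0: "z0 \<in> ?S" "\<And>z. z \<in> ?S \<Longrightarrow> norm (z0 v* g + x) \<le> norm (z v* g + x)"
    unfolding z0_def by (fact arg_min_if_finite(1)[OF S ne], fact arg_min_least[OF S ne])
  have min: "norm (z0 v* g + x) \<le> norm (z v* g + x)" if "z \<in> Zv" for z
    using z0 that by (cases "norm (z v* g + x) \<le> norm x") auto
  have "norm (x + z0 v* g) \<le> norm ((x + z0 v* g) + z v* g)" if "z \<in> Zv" for z
    using min[of "z0 + z"] that z0(1) by (simp add: vector_matrix_left_distrib Zv_add algebra_simps)
  then have "z0 \<in> ?T" using z0(1) by (simp add: vor_def)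
  moreover have "?T \<subseteq> ?S"
  proof
    fix z assume z: "z \<in> ?T"
    then have "norm (x + z v* g) \<le> norm ((x + z v* g) + (- z) v* g)"
      using Zv_uminus[of z] by (auto simp: vor_def)
    also have "(x + z v* g) + (- z) v* g = x + (z + - z) v* g" unfolding vector_matrix_left_distrib by simp
    finally show "z \<in> ?S" using z by (simp add: add.commute)
  qed
  then have T: "finite ?T" using S finite_subset by blast
  moreover have "cntv (g, x) = (\<integral>\<^sup>+ z. indicator ?T z \<partial>count_space Zv)"
    unfolding cntv_def by (intro nn_integral_cong) (auto simp: indicator_def)
  then have c: "cntv (g, x) = of_nat (card ?T)"
    using T by (subst (asm) nn_integral_indicator) (auto simp: emeasure_count_space_finite)
  ultimately show "cntv (g, x) \<noteq> 0" "cntv (g, x) \<noteq> \<infinity>" unfolding c by (auto simp: of_nat_less_top)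
qed

lemma sum_rho:
  assumes g: "det g = 1"
  shows "(\<integral>\<^sup>+ z. rho (g, x + z v* g) \<partial>count_space Zv) = 1"
proof -
  have "(\<integral>\<^sup>+ z. rho (g, x + z v* g) \<partial>count_space Zv) =
     (\<integral>\<^sup>+ z. indicator {p. vor p} (g, x + z v* g) / cntv (g, x) \<partial>count_space Zv)"
    by (intro nn_integral_cong) (simp add: rho_def cntv_translate)
  also have "\<dots> = cntv (g, x) / cntv (g, x)" by (simp add: nn_integral_divide cntv_def)
  also have "\<dots> = 1" using cntv_pos_finite[OF g, of x] by (intro ennreal_divide_self) (auto simp: less_top)
  finally show ?thesis .
qed

lemma borel_measurable_rho_snd [measurable]: "(\<lambda>x. rho (g, x)) \<in> borel_measurable borel"
  by (rule measurable_compose[OF _ borel_measurable_rho]) (intro borel_measurable_Pair, auto)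

text \<open>\<open>g\<close> preserves volume, and after unfolding over \<open>Zv\<close> the
  lattice translates of \<open>rho\<close> sum to one on a cell of volume one.\<close>

lemma integral_rho:
  fixes g :: "real^'n^'n"
  assumes g: "det g = 1"
  shows "(\<integral>\<^sup>+ x. rho (g, x) \<partial>lborel) = 1"
proof -
  have m: "(\<lambda>y. rho (g, y v* g)) \<in> borel_measurable borel"
    by (rule measurable_compose[OF _ borel_measurable_rho_snd]) measurable
  have "(\<integral>\<^sup>+ x. rho (g, x) \<partial>lborel) = (\<integral>\<^sup>+ y. rho (g, y v* g) \<partial>lborel)"
    using g by (intro nn_integral_lborel_vm[symmetric]) auto
  also have "\<dots> = (\<integral>\<^sup>+ y. (\<integral>\<^sup>+ z. rho (g, (y + z) v* g) \<partial>count_space Zv) * indicator unit_cell y \<partial>lborel)"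
    using m by (rule nn_integral_lborel_unfold)
  also have "\<dots> = (\<integral>\<^sup>+ y. indicator unit_cell (y::real^'n) \<partial>lborel)"
    using sum_rho[OF g] by (simp add: vector_matrix_left_distrib)
  also have "\<dots> = 1" using emeasure_unit_cell by simp
  finally show ?thesis .
qed

context asl_measure
begin

lemma AE_P_cong:
  assumes "\<And>q. det (fst q) = 1 \<Longrightarrow> f q = h q"
  shows "(\<integral>\<^sup>+ q. f q \<partial>P) = (\<integral>\<^sup>+ q. h q \<partial>P)"
  using AE_det by (intro nn_integral_cong_AE) (rule eventually_mono, auto intro: assms)

text \<open>The factor \<open>1\<close> is inserted as the integral of \<open>rho\<close> over a
  shift \<open>eta\<close>, the integrals are exchanged, the lattice is moved by \<open>eta\<close>
  using invariance, and the integrals are exchanged back. Now \<open>eta\<close> runs over a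
  fundamental cell with weights and \<open>z\<close> over the lattice, and together they cover the
  whole space once.\<close>

theorem translation_unfold:
  fixes Q :: "'n asl \<Rightarrow> ennreal"
  assumes Q[measurable]: "Q \<in> borel_measurable borel"
    and inv: "\<And>m g y. m \<in> SLZ \<Longrightarrow> det g = 1 \<Longrightarrow> Q (m ** g, y) = Q (g, y)"
  shows "(\<integral>\<^sup>+ q. (\<integral>\<^sup>+ z. Q (fst q, z v* fst q + snd q) \<partial>count_space Zv) \<partial>P) =
     (\<integral>\<^sup>+ q. (\<integral>\<^sup>+ y. Q (fst q, y) \<partial>lborel) \<partial>P)"
proof -
  interpret pair_sigma_finite P "lborel :: (real^'n) measure" ..
  define G where "G q = (\<integral>\<^sup>+ z. Q (fst q, z v* fst q + snd q) \<partial>count_space Zv)" for q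
  have mQz: "(\<lambda>q::'n asl. Q (fst q, z v* fst q + snd q)) \<in> borel_measurable borel" for z
    by (rule measurable_compose[OF _ Q]) (intro borel_measurable_Pair, measurable)
  have mG[measurable]: "G \<in> borel_measurable borel"
    unfolding G_def[abs_def] by (intro borel_measurable_countable_nn_integral countable_Zv mQz)
  have mp1: "(\<lambda>x::'n asl \<times> (real^'n). (fst (fst x), snd x)) \<in> borel_measurable (P \<Otimes>\<^sub>M lborel)"
    by (intro borel_measurable_Pair measurable_compose[OF measurable_fst]) (auto intro: measurable_snd'')
  have "G \<in> borel_measurable P" using mG by simp
  then have mG1: "(\<lambda>x::'n asl \<times> (real^'n). G (fst x)) \<in> borel_measurable (P \<Otimes>\<^sub>M lborel)"
    by (rule measurable_compose[OF measurable_fst])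
  have mp2: "(\<lambda>x::'n asl \<times> (real^'n). (fst (fst x), snd (fst x) + snd x)) \<in> borel_measurable (P \<Otimes>\<^sub>M lborel)"
    by (intro borel_measurable_Pair borel_measurable_add measurable_compose[OF measurable_fst]) (auto intro: measurable_snd'')
  have QSLZ: "Q (fst q', z v* fst q' + y) = Q (fst q, (z v* m) v* fst q + y)"
    if "m \<in> SLZ" "fst q' = m ** fst q" "det (fst q) = 1" for m z y and q q' :: "'n asl"
    using that inv by (simp add: vector_matrix_mul_assoc)
  have Ginv: "G q = G q'" if q: "det (fst q) = 1" "det (fst q') = 1" "affl q = affl q'" for q q'
  proof -
    have "G r = (\<integral>\<^sup>+ y. Q (fst r, y) \<partial>count_space (affl r))" if "det (fst r) = 1" for r
    proof -
      have "inj_on (\<lambda>z. z v* fst r + snd r) Zv"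
        using inj_vector_matrix[of "fst r"] that by (auto simp: inj_on_def)
      then have "bij_betw (\<lambda>z. z v* fst r + snd r) Zv (affl r)"
        unfolding bij_betw_def affl_def aff_lattice_alt by auto
      from nn_integral_bij_count_space[OF this] show ?thesis by (simp add: G_def)
    qed
    moreover obtain m where "m \<in> SLZ" "fst q' = m ** fst q"
      using lat_eq_imp[of "fst q" "fst q'"] affl_eq_lat[OF q(3)] q by auto
    ultimately show ?thesis using q inv by simp
  qed
  \<comment> \<open>\<open>rho\<close> sees only the linear part, which a pure translation leaves
    alone; so the shift enters only the argument of \<open>G\<close>.\<close>
  have step: "(\<integral>\<^sup>+ q. rho (fst q, eta) * G q \<partial>P) = (\<integral>\<^sup>+ q. rho (fst q, eta) * G (fst q, snd q + eta) \<partial>P)" for eta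
  proof -
    have m1: "(\<lambda>q::'n asl. rho (fst q, eta) * G q) \<in> borel_measurable borel"
      by (intro borel_measurable_times_ennreal mG measurable_compose[OF _ borel_measurable_rho] borel_measurable_Pair) measurable
    have "(\<integral>\<^sup>+ q. (\<lambda>q. rho (fst q, eta) * G q) (ract q (mat 1, eta)) \<partial>P) = (\<integral>\<^sup>+ q. rho (fst q, eta) * G q \<partial>P)"
    proof (rule inv_P[OF _ m1])
      fix q q' :: "'n asl" assume q: "det (fst q) = 1" "det (fst q') = 1" "affl q = affl q'"
      obtain m where "m \<in> SLZ" "fst q' = m ** fst q"
        using lat_eq_imp[of "fst q" "fst q'"] affl_eq_lat[OF q(3)] q by auto
      then show "rho (fst q, eta) * G q = rho (fst q', eta) * G q'"
        using Ginv[OF q] rho_SLZ[of m "fst q" eta] by simp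
    qed simp
    then show ?thesis by (simp add: ract_def)
  qed
  have "(\<integral>\<^sup>+ q. G q \<partial>P) = (\<integral>\<^sup>+ q. (\<integral>\<^sup>+ eta. rho (fst q, eta) * G q \<partial>lborel) \<partial>P)"
    by (rule AE_P_cong) (simp add: nn_integral_multc integral_rho)
  also have "\<dots> = (\<integral>\<^sup>+ eta. (\<integral>\<^sup>+ q. rho (fst q, eta) * G q \<partial>P) \<partial>lborel)"
    using measurable_compose[OF mp1 borel_measurable_rho] mG1
    by (intro Fubini'[symmetric]) (simp add: case_prod_unfold borel_measurable_times_ennreal)
  also have "\<dots> = (\<integral>\<^sup>+ eta. (\<integral>\<^sup>+ q. rho (fst q, eta) * G (fst q, snd q + eta) \<partial>P) \<partial>lborel)"
    by (simp only: step)
  also have "\<dots> = (\<integral>\<^sup>+ q. (\<integral>\<^sup>+ eta. rho (fst q, eta) * G (fst q, snd q + eta) \<partial>lborel) \<partial>P)"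
    using measurable_compose[OF mp1 borel_measurable_rho] measurable_compose[OF mp2 mG]
    by (intro Fubini') (simp add: case_prod_unfold borel_measurable_times_ennreal)
  also have "\<dots> = (\<integral>\<^sup>+ q. (\<integral>\<^sup>+ y. Q (fst q, y) \<partial>lborel) \<partial>P)"
  proof (rule AE_P_cong)
    fix q :: "'n asl" assume q: "det (fst q) = 1"
    obtain g xi where qq: "q = (g, xi)" by (cases q)
    have mQg: "(\<lambda>y. Q (g, h y)) \<in> borel_measurable borel" if "h \<in> borel_measurable borel" for h :: "real^'n \<Rightarrow> real^'n"
      by (rule measurable_compose[OF _ Q]) (intro borel_measurable_Pair that, simp)
    have mrg: "(\<lambda>y. rho (g, h y)) \<in> borel_measurable borel" if "h \<in> borel_measurable borel" for h :: "real^'n \<Rightarrow> real^'n"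
      by (rule measurable_compose[OF that borel_measurable_rho_snd])
    have "(\<integral>\<^sup>+ eta. rho (g, eta) * G (g, xi + eta) \<partial>lborel) =
      (\<integral>\<^sup>+ eta. (\<integral>\<^sup>+ z. rho (g, eta) * Q (g, (z v* g + xi) + eta) \<partial>count_space Zv) \<partial>lborel)"
      by (simp add: G_def nn_integral_cmult add.assoc)
    also have "\<dots> = (\<integral>\<^sup>+ z. (\<integral>\<^sup>+ eta. rho (g, eta) * Q (g, (z v* g + xi) + eta) \<partial>lborel) \<partial>count_space Zv)"
      by (intro nn_integral_count_space_nn_integral countable_Zv) (simp add: mQg mrg)
    also have "\<dots> = (\<integral>\<^sup>+ z. (\<integral>\<^sup>+ y. rho (g, y - (z v* g + xi)) * Q (g, y) \<partial>lborel) \<partial>count_space Zv)"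
    proof (rule nn_integral_cong)
      fix z
      have "(\<integral>\<^sup>+ y. rho (g, y - (z v* g + xi)) * Q (g, y) \<partial>lborel) =
         (\<integral>\<^sup>+ y. rho (g, ((z v* g + xi) + y) - (z v* g + xi)) * Q (g, (z v* g + xi) + y) \<partial>lborel)"
        by (rule nn_integral_lborel_translate[symmetric]) (simp add: mQg mrg)
      then show "(\<integral>\<^sup>+ eta. rho (g, eta) * Q (g, (z v* g + xi) + eta) \<partial>lborel) =
         (\<integral>\<^sup>+ y. rho (g, y - (z v* g + xi)) * Q (g, y) \<partial>lborel)" by simp
    qed
    also have "\<dots> = (\<integral>\<^sup>+ y. (\<integral>\<^sup>+ z. rho (g, y - (z v* g + xi)) * Q (g, y) \<partial>count_space Zv) \<partial>lborel)"
      by (intro nn_integral_count_space_nn_integral[symmetric] countable_Zv) (simp add: mQg mrg)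
    also have "\<dots> = (\<integral>\<^sup>+ y. Q (g, y) \<partial>lborel)"
    proof (rule nn_integral_cong)
      fix y
      have "(\<integral>\<^sup>+ z. rho (g, y - (z v* g + xi)) \<partial>count_space Zv) = (\<integral>\<^sup>+ z. rho (g, (y - xi) + (- z) v* g) \<partial>count_space Zv)"
        using linear_neg[OF linear_vector_matrix[of g]] by (intro nn_integral_cong) (simp add: algebra_simps)
      also have "\<dots> = (\<integral>\<^sup>+ z. rho (g, (y - xi) + z v* g) \<partial>count_space Zv)"
        by (rule nn_integral_bij_count_space[OF Zv_uminus_bij])
      also have "\<dots> = 1" using sum_rho q qq by simp
      finally show "(\<integral>\<^sup>+ z. rho (g, y - (z v* g + xi)) * Q (g, y) \<partial>count_space Zv) = Q (g, y)"
        by (simp add: nn_integral_multc)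
    qed
    finally show "(\<integral>\<^sup>+ eta. rho (fst q, eta) * G (fst q, snd q + eta) \<partial>lborel) = (\<integral>\<^sup>+ y. Q (fst q, y) \<partial>lborel)"
      by (simp add: qq)
  qed
  finally show ?thesis unfolding G_def .
qed

end

section \<open>Reduced bases\<close>

lemma card_int_interval:
  fixes a b :: real
  assumes "a \<le> b"
  shows "finite {t::int. a \<le> of_int t \<and> of_int t \<le> b}"
    "real (card {t::int. a \<le> of_int t \<and> of_int t \<le> b}) \<le> 1 + (b - a)"
proof -
  have e: "{t::int. a \<le> of_int t \<and> of_int t \<le> b} = {\<lceil>a\<rceil>..\<lfloor>b\<rfloor>}"
    by (auto simp: ceiling_le_iff le_floor_iff)
  show "finite {t::int. a \<le> of_int t \<and> of_int t \<le> b}" unfolding e by simp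
  have "real_of_int \<lfloor>b\<rfloor> \<le> b" "a \<le> real_of_int \<lceil>a\<rceil>" by (rule of_int_floor_le, rule le_of_int_ceiling)
  then show "real (card {t::int. a \<le> of_int t \<and> of_int t \<le> b}) \<le> 1 + (b - a)"
    unfolding e card_atLeastAtMost_int using assms
    by (cases "\<lceil>a\<rceil> \<le> \<lfloor>b\<rfloor> + 1") (simp_all, linarith)
qed

text \<open>The centre \<open>y\<close> is present for the induction, where it absorbs the vectors
  whose coefficients are already fixed.\<close>

definition coeffset :: "(nat \<Rightarrow> real^'n) \<Rightarrow> nat \<Rightarrow> real^'n \<Rightarrow> (nat \<Rightarrow> int) set" where
  "coeffset v j y = {n \<in> PiE {..<j} (\<lambda>_. UNIV). norm (y + (\<Sum>i<j. of_int (n i) *\<^sub>R v i)) \<le> 1}"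

text \<open>The inner product with \<open>gs v j\<close> sees only the last coefficient and confines
  it to an interval of length \<open>2 / norm (gs v j)\<close>. For each of its values the other
  coefficients are counted by the induction hypothesis with a shifted centre.\<close>

lemma coeffset_bound:
  assumes "indep j v"
  shows "finite (coeffset v j y) \<and> real (card (coeffset v j y)) \<le> (\<Prod>i<j. 1 + 2 / norm (gs v i))"
  using assms
proof (induction j arbitrary: y)
  case 0
  have "coeffset v 0 y \<subseteq> {\<lambda>_. undefined}" by (auto simp: coeffset_def)
  moreover have "finite {\<lambda>_::nat. undefined :: int}" by simp
  ultimately have "finite (coeffset v 0 y)" "card (coeffset v 0 y) \<le> card {\<lambda>_::nat. undefined :: int}"
    by (fact finite_subset, fact card_mono[rotated])
  then show ?case by simp
next
  case (Suc j)
  have ind: "indep j v" "gs v j \<noteq> 0" using Suc.prems by (auto simp: indep_gs)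
  let ?a = "norm (gs v j)"
  have a: "?a > 0" using ind by simp
  let ?T = "{t::int. (- ?a - y \<bullet> gs v j) / ?a\<^sup>2 \<le> of_int t \<and> of_int t \<le> (?a - y \<bullet> gs v j) / ?a\<^sup>2}"
  have T: "finite ?T" "real (card ?T) \<le> 1 + 2 / ?a"
  proof -
    have le: "(- ?a - y \<bullet> gs v j) / ?a\<^sup>2 \<le> (?a - y \<bullet> gs v j) / ?a\<^sup>2"
      by (intro divide_right_mono) auto
    have "(?a - y \<bullet> gs v j) / ?a\<^sup>2 - (- ?a - y \<bullet> gs v j) / ?a\<^sup>2 = 2 / ?a"
      using a by (simp add: field_simps power2_eq_square)
    then show "finite ?T" "real (card ?T) \<le> 1 + 2 / ?a"
      using card_int_interval[OF le] by auto
  qed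
  have sub: "coeffset v (Suc j) y \<subseteq> (\<Union>t\<in>?T. (\<lambda>n. n(j := t)) ` coeffset v j (y + of_int t *\<^sub>R v j))"
  proof
    fix n assume n: "n \<in> coeffset v (Suc j) y"
    let ?s = "\<Sum>i<j. of_int (n i) *\<^sub>R v i"
    have nn: "norm ((y + of_int (n j) *\<^sub>R v j) + ?s) \<le> 1"
      using n by (simp add: coeffset_def algebra_simps)
    have "?s \<in> span (v ` {..<j})" by (intro span_sum span_scale span_base) auto
    then have "gs v j \<bullet> ?s = 0" by (rule gs_orth_span)
    then have "gs v j \<bullet> ((y + of_int (n j) *\<^sub>R v j) + ?s) = y \<bullet> gs v j + of_int (n j) * ?a\<^sup>2"
      using gs_inner_v[of v j] by (simp add: inner_add_right power2_norm_eq_inner inner_commute[of y])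
    moreover have "\<bar>gs v j \<bullet> ((y + of_int (n j) *\<^sub>R v j) + ?s)\<bar> \<le> ?a * 1"
      using Cauchy_Schwarz_ineq2[of "gs v j" "(y + of_int (n j) *\<^sub>R v j) + ?s"] nn a
      by (meson mult_left_mono norm_ge_zero order_trans)
    ultimately have "\<bar>y \<bullet> gs v j + of_int (n j) * ?a\<^sup>2\<bar> \<le> ?a" by simp
    then have t: "n j \<in> ?T" using a by (auto simp: field_simps abs_le_iff)
    define n' where "n' = restrict n {..<j}"
    have "(\<Sum>i<j. of_int (n' i) *\<^sub>R v i) = ?s" by (intro sum.cong) (auto simp: n'_def)
    then have "n' \<in> coeffset v j (y + of_int (n j) *\<^sub>R v j)"
      using nn by (simp add: coeffset_def) (simp add: n'_def)
    moreover have "n = n'(j := n j)"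
      using n by (auto simp: n'_def coeffset_def fun_eq_iff PiE_def extensional_def)
    ultimately show "n \<in> (\<Union>t\<in>?T. (\<lambda>n. n(j := t)) ` coeffset v j (y + of_int t *\<^sub>R v j))"
      using t by blast
  qed
  have fin: "finite ((\<lambda>n. n(j := t)) ` coeffset v j (y + of_int t *\<^sub>R v j))" for t
    using Suc.IH[OF ind(1)] by simp
  have "card (\<Union>t\<in>?T. (\<lambda>n. n(j := t)) ` coeffset v j (y + of_int t *\<^sub>R v j))
     \<le> (\<Sum>t\<in>?T. card ((\<lambda>n. n(j := t)) ` coeffset v j (y + of_int t *\<^sub>R v j)))"
    using T(1) by (rule card_UN_le)
  also have "\<dots> \<le> (\<Sum>t\<in>?T. card (coeffset v j (y + of_int t *\<^sub>R v j)))"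
    using Suc.IH[OF ind(1)] by (intro sum_mono card_image_le) auto
  finally have "card (coeffset v (Suc j) y) \<le> (\<Sum>t\<in>?T. card (coeffset v j (y + of_int t *\<^sub>R v j)))"
    using card_mono[OF finite_UN_I[OF T(1) fin] sub] by (rule le_trans[rotated])
  from of_nat_mono[OF this]
  have "real (card (coeffset v (Suc j) y)) \<le> (\<Sum>t\<in>?T. real (card (coeffset v j (y + of_int t *\<^sub>R v j))))"
    by simp
  also have "\<dots> \<le> (\<Sum>t\<in>?T. (\<Prod>i<j. 1 + 2 / norm (gs v i)))"
    using Suc.IH[OF ind(1)] by (intro sum_mono) auto
  also have "\<dots> = real (card ?T) * (\<Prod>i<j. 1 + 2 / norm (gs v i))" by simp
  also have "\<dots> \<le> (1 + 2 / ?a) * (\<Prod>i<j. 1 + 2 / norm (gs v i))"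
    using T by (intro mult_right_mono prod_nonneg) auto
  finally have "real (card (coeffset v (Suc j) y)) \<le> (\<Prod>i<Suc j. 1 + 2 / norm (gs v i))" by (simp add: mult.commute)
  moreover have "finite (coeffset v (Suc j) y)" using finite_subset[OF sub finite_UN_I[OF T(1) fin]] .
  ultimately show ?case by blast
qed

section \<open>Projections of a candidate vector and size reduction\<close>

definition proj_coeff :: "(nat \<Rightarrow> real^'n) \<Rightarrow> real^'n \<Rightarrow> nat \<Rightarrow> real" where
  "proj_coeff V x j = (x \<bullet> gs V j) / (gs V j \<bullet> gs V j)"

text \<open>\<open>proj_coeff\<close> and \<open>rcomp\<close> are \<open>mu\<close> and
  \<open>gs\<close> for a vector that might be placed at position \<open>m\<close> but is not yet
  part of the tuple; \<open>mu_upd\<close> and \<open>gs_upd\<close> make the link.\<close>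

definition rcomp :: "(nat \<Rightarrow> real^'n) \<Rightarrow> nat \<Rightarrow> real^'n \<Rightarrow> real^'n" where
  "rcomp V m x = x - (\<Sum>j<m. proj_coeff V x j *\<^sub>R gs V j)"

lemma gs_fun_upd_less: "j < m \<Longrightarrow> gs (V(m := x)) j = gs V j"
  by (rule gs_cong) auto

lemma gs_upd: "gs (V(m := x)) m = rcomp V m x"
  unfolding gs.simps[of _ m] rcomp_def proj_coeff_def by (auto simp: gs_fun_upd_less intro!: sum.cong)

lemma mu_upd: "j < m \<Longrightarrow> mu (V(m := x)) m j = proj_coeff V x j"
  by (simp add: mu_def proj_coeff_def gs_fun_upd_less)

lemma fun_upd_image_lessThan: "(V(m := x)) ` {..<m::nat} = V ` {..<m}"
  by (rule image_cong) auto

lemma rcomp_le_dist: "w \<in> span (V ` {..<m}) \<Longrightarrow> norm (rcomp V m x) \<le> norm (x - w)"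
  using gs_le_dist[of w "V(m := x)" m] unfolding gs_upd fun_upd_image_lessThan by simp

lemma minus_rcomp_span: "x - rcomp V m x \<in> span (V ` {..<m})"
  using v_minus_gs_span[of "V(m := x)" m] unfolding gs_upd fun_upd_image_lessThan by simp

lemma rcomp_eq_of_span: "x - x' \<in> span (V ` {..<m}) \<Longrightarrow> norm (rcomp V m x) = norm (rcomp V m x')"
proof (rule antisym)
  assume s: "x - x' \<in> span (V ` {..<m})"
  have "x - rcomp V m x' \<in> span (V ` {..<m})"
    using span_add[OF s minus_rcomp_span[of x' V m]] by simp
  then show "norm (rcomp V m x) \<le> norm (rcomp V m x')" using rcomp_le_dist[of _ V m x] by fastforce
  have "x' - rcomp V m x \<in> span (V ` {..<m})"
    using span_diff[OF minus_rcomp_span[of x V m] s] by simp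
  then show "norm (rcomp V m x') \<le> norm (rcomp V m x)" using rcomp_le_dist[of _ V m x'] by fastforce
qed

lemma rcomp_eq_0_iff: "rcomp V m x = 0 \<longleftrightarrow> x \<in> span (V ` {..<m})"
  using gs_eq_0_iff[of "V(m := x)" m] unfolding gs_upd fun_upd_image_lessThan by simp

lemma proj_coeff_add: "proj_coeff V (x - c *\<^sub>R y) j = proj_coeff V x j - c * proj_coeff V y j"
  by (simp add: proj_coeff_def inner_diff_left diff_divide_distrib)

lemma proj_coeff_upper: "k < j \<Longrightarrow> proj_coeff V (V k) j = 0"
proof -
  assume "k < j"
  then have "V k \<in> span (V ` {..<j})" by (intro span_base) auto
  then show ?thesis using gs_orth_span[of "V k" V j] by (simp add: proj_coeff_def inner_commute)
qed

lemma proj_coeff_diag: "gs V k \<noteq> 0 \<Longrightarrow> proj_coeff V (V k) k = 1"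
  using gs_inner_v[of V k] by (simp add: proj_coeff_def inner_commute)

text \<open>Coefficients are rounded from the highest index down. Subtracting a multiple of
  \<open>V k\<close> leaves the coefficients at \<open>j > k\<close> unchanged, because
  \<open>V k\<close> has no component along \<open>gs V j\<close>.\<close>

lemma size_reduce:
  assumes ind: "indep m V"
  shows "\<exists>n::nat \<Rightarrow> int. \<forall>j<m. \<bar>proj_coeff V (x - (\<Sum>i<m. of_int (n i) *\<^sub>R V i)) j\<bar> \<le> 1/2"
proof -
  have "\<exists>n::nat \<Rightarrow> int. \<forall>j. k \<le> j \<and> j < m \<longrightarrow> \<bar>proj_coeff V (x - (\<Sum>i\<in>{k..<m}. of_int (n i) *\<^sub>R V i)) j\<bar> \<le> 1/2"
    if "k \<le> m" for k
    using that
  proof (induction k rule: inc_induct)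
    case base then show ?case by auto
  next
    case (step k)
    then obtain n where n: "\<And>j. Suc k \<le> j \<Longrightarrow> j < m \<Longrightarrow>
      \<bar>proj_coeff V (x - (\<Sum>i\<in>{Suc k..<m}. of_int (n i) *\<^sub>R V i)) j\<bar> \<le> 1/2" by blast
    let ?y = "x - (\<Sum>i\<in>{Suc k..<m}. of_int (n i) *\<^sub>R V i)"
    define t where "t = round (proj_coeff V ?y k)"
    let ?n = "n(k := t)"
    have "(\<Sum>i\<in>{k..<m}. of_int (?n i) *\<^sub>R V i) = of_int t *\<^sub>R V k + (\<Sum>i\<in>{Suc k..<m}. of_int (n i) *\<^sub>R V i)"
      using step.hyps by (subst sum.atLeast_Suc_lessThan) (auto intro!: sum.cong)
    then have e: "x - (\<Sum>i\<in>{k..<m}. of_int (?n i) *\<^sub>R V i) = ?y - of_int t *\<^sub>R V k" by simp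
    have "\<bar>proj_coeff V (?y - of_int t *\<^sub>R V k) j\<bar> \<le> 1/2" if j: "k \<le> j" "j < m" for j
    proof (cases "j = k")
      case True
      have "gs V k \<noteq> 0" using ind step.hyps by (auto simp: indep_gs)
      then have "proj_coeff V (?y - of_int t *\<^sub>R V k) k = proj_coeff V ?y k - of_int t"
        by (simp add: proj_coeff_add proj_coeff_diag)
      then show ?thesis unfolding True using of_int_round_abs_le[of "proj_coeff V ?y k"]
        by (simp add: t_def abs_minus_commute)
    next
      case False
      then show ?thesis using n[of j] j by (simp add: proj_coeff_add proj_coeff_upper)
    qed
    then show ?case unfolding e[symmetric] by blast
  qed
  from this[of 0] show ?thesis by (auto simp: atLeast0LessThan)
qed

lemma norm_le_rcomp:
  assumes "\<And>j. j < m \<Longrightarrow> \<bar>proj_coeff V x j\<bar> \<le> 1/2"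
  shows "norm x \<le> norm (rcomp V m x) + (\<Sum>j<m. norm (gs V j))"
proof -
  have "norm x = norm (rcomp V m x + (\<Sum>j<m. proj_coeff V x j *\<^sub>R gs V j))" by (simp add: rcomp_def)
  also have "\<dots> \<le> norm (rcomp V m x) + (\<Sum>j<m. norm (proj_coeff V x j *\<^sub>R gs V j))"
    by (rule order_trans[OF norm_triangle_ineq add_left_mono[OF norm_sum]])
  also have "(\<Sum>j<m. norm (proj_coeff V x j *\<^sub>R gs V j)) \<le> (\<Sum>j<m. norm (gs V j))"
  proof (rule sum_mono)
    fix j assume "j \<in> {..<m}"
    then have "\<bar>proj_coeff V x j\<bar> \<le> 1" using assms[of j] by simp
    then show "norm (proj_coeff V x j *\<^sub>R gs V j) \<le> norm (gs V j)"
      by (simp add: mult_left_le_one_le)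
  qed
  finally show ?thesis by simp
qed

text \<open>Korkine-Zolotarev reduction: every vector is size-reduced and has the least possible
  nonzero distance from the span of its predecessors among all lattice vectors.\<close>

definition greedy :: "real^'n^'n \<Rightarrow> nat \<Rightarrow> (nat \<Rightarrow> real^'n) \<Rightarrow> bool" where
  "greedy g m V \<longleftrightarrow> indep m V \<and> (\<forall>i<m. V i \<in> lat g \<and> (\<forall>j<i. \<bar>mu V i j\<bar> \<le> 1/2) \<and>
     (\<forall>x\<in>lat g. x \<notin> span (V ` {..<i}) \<longrightarrow> norm (gs V i) \<le> norm (rcomp V i x)))"

lemma lat_scale_int: "x \<in> lat g \<Longrightarrow> of_int n *\<^sub>R x \<in> lat g"
  unfolding lat_def by (auto simp: scaleR_vector_matrix_assoc[symmetric] intro!: imageI Zv_scale)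

lemma lat_sum: "(\<And>i. i \<in> I \<Longrightarrow> f i \<in> lat g) \<Longrightarrow> (\<Sum>i\<in>I. f i) \<in> lat g"
  by (induction I rule: infinite_finite_induct) (auto intro: lat_add)

lemma rcomp_upd: "i \<le> m \<Longrightarrow> rcomp (V(m := z)) i x = rcomp V i x"
  unfolding rcomp_def proj_coeff_def by (auto simp: gs_fun_upd_less intro!: sum.cong)

text \<open>A distance from a span is to be minimised over infinitely many lattice vectors. Size
  reduction keeps this distance and bounds the whole vector in terms of it, so only finitely many
  vectors compete. A candidate outside the span exists because the rows of \<open>g\<close> span the
  space.\<close>

lemma greedy_exists:
  fixes g :: "real^'n^'n"
  assumes g: "det g = 1"
  shows "m \<le> CARD('n) \<Longrightarrow> \<exists>V. greedy g m V"
proof (induction m)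
  case 0
  then show ?case by (auto simp: greedy_def indep_def)
next
  case (Suc m)
  then obtain V where V: "greedy g m V" by auto
  then have ind: "indep m V" and VL: "\<And>i. i < m \<Longrightarrow> V i \<in> lat g" by (auto simp: greedy_def)
  let ?S = "span (V ` {..<m})"
  have "dim ?S \<le> card (V ` {..<m})" by (intro dim_le_card) auto
  also have "\<dots> \<le> m" using card_image_le[of "{..<m}" V] by simp
  finally have dimS: "dim ?S < CARD('n)" using Suc.prems by simp
  have "\<exists>x\<in>lat g. x \<notin> ?S"
  proof (rule ccontr)
    assume "\<not> ?thesis"
    then have rows: "g $ i \<in> ?S" for i
      unfolding lat_def using matrix_row[of g i] by auto
    obtain g' where g': "g' ** g = mat 1" using det_1_inverse[of g] g by auto
    have "x \<in> ?S" for x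
    proof -
      have "x = (x v* g') v* g" by (simp add: vector_matrix_mul_assoc g')
      also have "\<dots> \<in> ?S" unfolding vector_matrix_sum_rows by (intro span_sum span_scale rows)
      finally show ?thesis .
    qed
    then have "?S = UNIV" by auto
    then show False using dimS by simp
  qed
  then obtain x0 where x0: "x0 \<in> lat g" "x0 \<notin> ?S" by blast
  define red where "red x \<longleftrightarrow> x \<in> lat g \<and> x \<notin> ?S \<and> (\<forall>j<m. \<bar>proj_coeff V x j\<bar> \<le> 1/2)" for x
  have reduce: "\<exists>x'. red x' \<and> norm (rcomp V m x') = norm (rcomp V m x)" if x: "x \<in> lat g" "x \<notin> ?S" for x
  proof -
    obtain n :: "nat \<Rightarrow> int" where n: "\<forall>j<m. \<bar>proj_coeff V (x - (\<Sum>i<m. of_int (n i) *\<^sub>R V i)) j\<bar> \<le> 1/2"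
      using size_reduce[OF ind] by blast
    let ?s = "\<Sum>i<m. of_int (n i) *\<^sub>R V i"
    have s: "?s \<in> ?S" by (intro span_sum span_scale span_base) auto
    have "?s \<in> lat g" using VL by (intro lat_sum lat_scale_int) auto
    then have "x - ?s \<in> lat g" using x by (intro lat_diff)
    moreover have "x - ?s \<notin> ?S" using span_add[OF _ s, of "x - ?s"] x(2) by auto
    moreover have "norm (rcomp V m (x - ?s)) = norm (rcomp V m x)"
      using s by (intro rcomp_eq_of_span[symmetric]) simp
    ultimately show ?thesis using n unfolding red_def by blast
  qed
  obtain x1 where x1: "red x1" using reduce[OF x0] by blast
  let ?F = "{x. red x \<and> norm (rcomp V m x) \<le> norm (rcomp V m x1)}"
  have "?F \<subseteq> {y \<in> lat g. norm (y + 0) \<le> norm (rcomp V m x1) + (\<Sum>j<m. norm (gs V j))}"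
  proof
    fix x assume x: "x \<in> ?F"
    then have "norm x \<le> norm (rcomp V m x) + (\<Sum>j<m. norm (gs V j))"
      by (intro norm_le_rcomp) (auto simp: red_def)
    then show "x \<in> {y \<in> lat g. norm (y + 0) \<le> norm (rcomp V m x1) + (\<Sum>j<m. norm (gs V j))}"
      using x by (auto simp: red_def)
  qed
  then have F: "finite ?F" using finite_lat_ball[of g 0] g by (auto intro: finite_subset)
  have ne: "?F \<noteq> {}" using x1 by blast
  define z where "z = arg_min_on (\<lambda>x. norm (rcomp V m x)) ?F"
  have z: "z \<in> ?F" "\<And>x. x \<in> ?F \<Longrightarrow> norm (rcomp V m z) \<le> norm (rcomp V m x)"
    unfolding z_def by (fact arg_min_if_finite(1)[OF F ne], fact arg_min_least[OF F ne])
  have zmin: "norm (rcomp V m z) \<le> norm (rcomp V m x)" if x: "x \<in> lat g" "x \<notin> ?S" for x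
  proof -
    obtain x' where "red x'" "norm (rcomp V m x') = norm (rcomp V m x)" using reduce[OF x] by blast
    then show ?thesis using z(1) z(2)[of x'] by (cases "norm (rcomp V m x') \<le> norm (rcomp V m x1)") auto
  qed
  let ?V = "V(m := z)"
  have zr: "red z" using z by simp
  have im: "?V ` {..<i} = V ` {..<i}" if "i \<le> m" for i using that by auto
  have "greedy g (Suc m) ?V"
    unfolding greedy_def
  proof (intro conjI allI impI ballI)
    have "?V i \<notin> span (?V ` {..<i})" if "i < Suc m" for i
    proof (cases "i = m")
      case True then show ?thesis using zr im[of m] by (simp add: red_def del: fun_upd_image)
    next
      case False
      then show ?thesis using ind that im[of i] by (simp add: indep_def del: fun_upd_image)
    qed
    then show "indep (Suc m) ?V" unfolding indep_def by blast
    fix i assume i: "i < Suc m"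
    show "?V i \<in> lat g" using i VL zr by (auto simp: red_def less_Suc_eq)
    show "\<bar>mu ?V i j\<bar> \<le> 1/2" if j: "j < i" for j
    proof (cases "i = m")
      case True then show ?thesis using zr mu_upd[of j m V z] j by (simp add: red_def)
    next
      case False
      then have "mu ?V i j = mu V i j" using i j by (simp add: mu_def gs_fun_upd_less)
      then show ?thesis using V False i j by (auto simp: greedy_def)
    qed
    fix x assume x: "x \<in> lat g" "x \<notin> span (?V ` {..<i})"
    show "norm (gs ?V i) \<le> norm (rcomp ?V i x)"
    proof (cases "i = m")
      case True
      then show ?thesis using zmin[OF x(1)] x(2) im[of m] by (simp add: gs_upd rcomp_upd del: fun_upd_image)
    next
      case False
      then have "i < m" using i by simp
      then show ?thesis
        using V x im[of i] by (auto simp: greedy_def gs_fun_upd_less rcomp_upd simp del: fun_upd_image)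
    qed
  qed
  then show ?case by blast
qed

text \<open>\<open>V (Suc i)\<close> was a competitor for place \<open>i\<close>. Its component
  orthogonal to the first \<open>i\<close> vectors is at most \<open>norm (gs V (Suc i))\<close>
  plus half of \<open>norm (gs V i)\<close>, whence the factor \<open>2\<close>.\<close>

lemma greedy_lovasz:
  assumes V: "greedy g m V" and i: "Suc i < m"
  shows "norm (gs V i) \<le> 2 * norm (gs V (Suc i))"
proof -
  have ind: "indep m V" and VL: "V (Suc i) \<in> lat g" and mu: "\<bar>mu V (Suc i) i\<bar> \<le> 1/2"
    and min: "\<And>x. x \<in> lat g \<Longrightarrow> x \<notin> span (V ` {..<i}) \<Longrightarrow> norm (gs V i) \<le> norm (rcomp V i x)"
    using V i by (auto simp: greedy_def)
  have "V (Suc i) \<notin> span (V ` {..<i})"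
    using ind i span_mono[OF image_mono[of "{..<i}" "{..<Suc i}" V]] by (auto simp: indep_def subset_eq)
  then have 1: "norm (gs V i) \<le> norm (rcomp V i (V (Suc i)))" using min VL by blast
  let ?w = "V (Suc i) - (gs V (Suc i) + mu V (Suc i) i *\<^sub>R gs V i)"
  have "?w = (\<Sum>j<i. mu V (Suc i) j *\<^sub>R gs V j)"
    using gs_mu[of V "Suc i"] by (simp add: algebra_simps)
  also have "\<dots> \<in> span (gs V ` {..<i})" by (intro span_sum span_scale span_base) auto
  finally have "?w \<in> span (V ` {..<i})" by (simp add: span_gs)
  from rcomp_le_dist[OF this, of "V (Suc i)"]
  have "norm (gs V i) \<le> norm (gs V (Suc i) + mu V (Suc i) i *\<^sub>R gs V i)" using 1 by simp
  also have "\<dots> \<le> norm (gs V (Suc i)) + norm (mu V (Suc i) i *\<^sub>R gs V i)" by (rule norm_triangle_ineq)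
  also have "norm (mu V (Suc i) i *\<^sub>R gs V i) \<le> 1/2 * norm (gs V i)"
    using mult_right_mono[OF mu, of "norm (gs V i)"] by simp
  finally show ?thesis by simp
qed

text \<open>Let \<open>y\<close> be a size-reduced remainder. If it were not zero, then at the
  highest index \<open>j\<close> with a nonzero component its distance from the span of the first
  \<open>j\<close> vectors would be at most half of \<open>norm (gs V j)\<close>, against the
  minimality of \<open>V j\<close>.\<close>

lemma greedy_generates:
  fixes V :: "nat \<Rightarrow> real^'n"
  assumes V: "greedy g CARD('n) V" and x: "x \<in> lat g"
  shows "\<exists>n::nat \<Rightarrow> int. x = (\<Sum>i<CARD('n). of_int (n i) *\<^sub>R V i)"
proof -
  let ?d = "CARD('n)"
  have ind: "indep ?d V" and VL: "\<And>i. i < ?d \<Longrightarrow> V i \<in> lat g" using V by (auto simp: greedy_def)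
  obtain n :: "nat \<Rightarrow> int" where n: "\<forall>j<?d. \<bar>proj_coeff V (x - (\<Sum>i<?d. of_int (n i) *\<^sub>R V i)) j\<bar> \<le> 1/2"
    using size_reduce[OF ind] by blast
  define y where "y = x - (\<Sum>i<?d. of_int (n i) *\<^sub>R V i)"
  have yL: "y \<in> lat g" unfolding y_def using x VL by (intro lat_diff lat_sum lat_scale_int) auto
  have pj: "\<bar>proj_coeff V y j\<bar> \<le> 1/2" if "j < ?d" for j using n that by (simp add: y_def)
  have "y \<in> span (V ` {..<j})" if "j \<le> ?d" for j
    using that
  proof (induction j rule: inc_induct)
    \<comment> \<open>A full independent tuple spans the space: otherwise appending \<open>y\<close>
      would produce one more nonzero orthogonal vector than the dimension allows.\<close>
    case base
    have "rcomp V ?d y = 0"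
    proof (rule ccontr)
      assume "rcomp V ?d y \<noteq> 0"
      then have "y \<notin> span (V ` {..<?d})" by (simp add: rcomp_eq_0_iff)
      then have "indep (Suc ?d) (V(?d := y))"
        using ind fun_upd_image_lessThan[of V _ y]
        unfolding indep_gs by (auto simp: less_Suc_eq gs_fun_upd_less gs_upd rcomp_eq_0_iff)
      then have gsn: "gs (V(?d := y)) i \<noteq> 0" if "i < Suc ?d" for i using that by (simp add: indep_gs)
      let ?G = "gs (V(?d := y)) ` {..<Suc ?d}"
      have inj: "inj_on (gs (V(?d := y))) {..<Suc ?d}"
        using gs_orth[of _ _ "V(?d := y)"] gsn by (intro inj_onI) (metis inner_eq_zero_iff lessThan_iff)
      have "pairwise orthogonal ?G"
        by (auto simp: pairwise_def orthogonal_def intro!: gs_orth)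
      moreover have "0 \<notin> ?G" using gsn by auto
      ultimately have "independent ?G" by (rule pairwise_orthogonal_independent)
      then have "card ?G \<le> DIM(real^'n)" using independent_bound by blast
      then show False using card_image[OF inj] by simp
    qed
    then show ?case by (simp add: rcomp_eq_0_iff)
  next
    case (step j)
    show ?case
    proof (rule ccontr)
      assume nin: "y \<notin> span (V ` {..<j})"
      then have le: "norm (gs V j) \<le> norm (rcomp V j y)" using V yL step.hyps by (auto simp: greedy_def)
      have "rcomp V (Suc j) y = 0" using step.IH by (simp add: rcomp_eq_0_iff)
      then have "rcomp V j y = proj_coeff V y j *\<^sub>R gs V j" by (simp add: rcomp_def algebra_simps)
      then have "norm (rcomp V j y) \<le> 1/2 * norm (gs V j)"
        using mult_right_mono[OF pj[of j], of "norm (gs V j)"] step.hyps by simp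
      moreover have "gs V j \<noteq> 0" using ind step.hyps by (auto simp: indep_gs)
      ultimately show False using le by (simp add: norm_le_zero_iff[symmetric] del: norm_le_zero_iff)
    qed
  qed
  from this[of 0] have "y = 0" by simp
  then show ?thesis unfolding y_def by (intro exI[of _ n]) simp
qed

text \<open>Keeps those consequences of greediness that the volume estimate uses. They mention no
  lattice and are measurable conditions on the tuple alone.\<close>

definition reduced :: "(nat \<Rightarrow> real^'n) \<Rightarrow> bool" where
  "reduced V \<longleftrightarrow> (\<forall>i<CARD('n). gs V i \<noteq> 0) \<and> (\<forall>i<CARD('n). \<forall>j<i. \<bar>mu V i j\<bar> \<le> 1/2) \<and>
     (\<forall>i. Suc i < CARD('n) \<longrightarrow> norm (gs V i) \<le> 2 * norm (gs V (Suc i)))"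

text \<open>The coordinates of the positively oriented bases of a lattice.\<close>

definition Cdet :: "(nat \<Rightarrow> real^'n) set" where
  "Cdet = {A \<in> PiE {..<CARD('n)} (\<lambda>_. Zv). det (mat_of A) = 1}"

lemma det_Ints: "(\<And>i. (m::real^'n^'n) $ i \<in> Zv) \<Longrightarrow> det m \<in> \<int>"
  unfolding det_def by (intro Ints_sum Ints_mult Ints_prod) (auto simp: Zv_def sign_def)

lemma reduced_cong: "(\<And>i. i < CARD('n) \<Longrightarrow> V i = W i) \<Longrightarrow> reduced (V :: nat \<Rightarrow> real^'n) \<longleftrightarrow> reduced W"
proof -
  assume e: "\<And>i. i < CARD('n) \<Longrightarrow> V i = W i"
  have "gs V i = gs W i" if "i < CARD('n)" for i using that e by (intro gs_cong) auto
  then show ?thesis using e by (auto simp: reduced_def mu_def)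
qed

text \<open>Together with \<open>det_flip_last\<close> this corrects the orientation of a reduced
  basis: a sign change of the last vector affects neither the lengths nor the absolute values of the
  coefficients.\<close>

lemma reduced_flip_last:
  fixes V :: "nat \<Rightarrow> real^'n"
  assumes V: "reduced V"
  shows "reduced (V(CARD('n) - 1 := - V (CARD('n) - 1)))"
proof -
  let ?m = "CARD('n) - 1"
  let ?W = "V(?m := - V ?m)"
  have gm: "gs ?W ?m = - gs V ?m"
  proof -
    have "proj_coeff V (- V ?m) j = - proj_coeff V (V ?m) j" for j by (simp add: proj_coeff_def)
    then have "rcomp V ?m (- V ?m) = - rcomp V ?m (V ?m)"
      by (simp add: rcomp_def sum_negf)
    then show ?thesis using gs_upd[of V ?m "- V ?m"] gs_upd[of V ?m "V ?m"] by simp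
  qed
  have gl: "gs ?W j = gs V j" if "j < ?m" for j using that by (rule gs_fun_upd_less)
  have n: "norm (gs ?W i) = norm (gs V i)" if "i < CARD('n)" for i
    using that gm gl[of i] by (cases "i = ?m") auto
  have mu: "\<bar>mu ?W i j\<bar> = \<bar>mu V i j\<bar>" if "j < i" "i < CARD('n)" for i j
    using that gl[of j] by (cases "i = ?m") (auto simp: mu_def)
  have "gs ?W i \<noteq> 0 \<longleftrightarrow> gs V i \<noteq> 0" if "i < CARD('n)" for i using n[OF that] by (metis norm_eq_zero)
  then show ?thesis using V n mu unfolding reduced_def by auto
qed

lemma det_flip_last:
  fixes V :: "nat \<Rightarrow> real^'n"
  shows "det (mat_of (V(CARD('n) - 1 := - V (CARD('n) - 1)))) = - det (mat_of V)"
proof -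
  obtain k :: 'n where k: "idx k = CARD('n) - 1" using idx_ex[where 'n = 'n, of "CARD('n) - 1"] by auto
  have "idx i = CARD('n) - 1 \<longleftrightarrow> i = k" for i :: 'n using k idx_inj[of i k] by simp
  then have "mat_of (V(CARD('n) - 1 := - V (CARD('n) - 1))) =
     (\<chi> i. if i = k then (-1) *s V (idx i) else V (idx i))"
    unfolding mat_of_def by (simp add: vec_eq_iff k)
  then show ?thesis
    unfolding mat_of_def using det_row_mul[of k "-1" "\<lambda>i. V (idx i)" "\<lambda>i. V (idx i)"] by simp
qed

lemma reduced_basis_exists:
  fixes g :: "real^'n^'n"
  assumes g: "det g = 1"
  shows "\<exists>A\<in>Cdet. reduced (tmul CARD('n) A g)"
proof -
  let ?d = "CARD('n)"
  obtain V where V: "greedy g ?d V" using greedy_exists[OF g order_refl] by blast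
  have redV: "reduced V"
    using V greedy_lovasz[OF V] unfolding reduced_def by (auto simp: greedy_def indep_gs)
  have VL: "\<And>i. i < ?d \<Longrightarrow> V i \<in> lat g" using V by (auto simp: greedy_def)
  then obtain a where a: "\<And>i. i < ?d \<Longrightarrow> a i \<in> Zv \<and> V i = a i v* g" unfolding lat_def image_iff by metis
  define A where "A = restrict a {..<?d}"
  have AZ: "A \<in> PiE {..<?d} (\<lambda>_. Zv)" using a by (auto simp: A_def)
  have VA: "mat_of V = mat_of A ** g"
    unfolding vec_eq_iff[of "mat_of V"] by (simp add: row_matrix_mult mat_of_def A_def a)
  have "\<exists>n::nat \<Rightarrow> int. g $ i = (\<Sum>j<?d. of_int (n j) *\<^sub>R V j)" for i
    by (rule greedy_generates[OF V]) (metis Zv_axis image_eqI lat_def matrix_row)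
  then obtain n :: "'n \<Rightarrow> nat \<Rightarrow> int" where n: "\<And>i. g $ i = (\<Sum>j<?d. of_int (n i j) *\<^sub>R V j)" by metis
  define B :: "real^'n^'n" where "B = (\<chi> i k. of_int (n i (idx k)))"
  have "g = B ** mat_of V"
  proof (subst vec_eq_iff, rule allI)
    fix i
    have "(B ** mat_of V) $ i = (\<Sum>k\<in>UNIV. of_int (n i (idx (k::'n))) *\<^sub>R V (idx k))"
      unfolding row_matrix_mult vector_matrix_sum_rows by (simp add: B_def mat_of_def)
    also have "\<dots> = (\<Sum>j<?d. of_int (n i j) *\<^sub>R V j)"
      using sum.reindex_bij_betw[OF bij_idx, of "\<lambda>j. of_int (n i j) *\<^sub>R V j"] .
    finally show "g $ i = (B ** mat_of V) $ i" using n by simp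
  qed
  \<comment> \<open>The two transition matrices are integral, so their determinants are integers
    with product one, that is, signs.\<close>
  from arg_cong[where f = det, OF this]
  have 1: "det B * det (mat_of A) = 1" unfolding VA using g by (simp add: det_mul)
  have "det B \<in> \<int>" "det (mat_of A) \<in> \<int>"
    using AZ by (auto intro!: det_Ints simp: B_def mat_of_def Zv_def PiE_iff)
  then obtain b c :: int where bc: "det B = of_int b" "det (mat_of A) = of_int c" by (auto elim!: Ints_cases)
  have "of_int (b * c) = (1::real)" using 1 bc by simp
  then have "b * c = 1" by linarith
  then have "c = 1 \<or> c = -1" using zmult_eq_1_iff by blast
  then have dA: "det (mat_of A) = 1 \<or> det (mat_of A) = -1" using bc by auto
  have red: "reduced (tmul ?d A g)"
    using redV by (subst reduced_cong[where W = V]) (auto simp: tmul_def A_def a)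
  show ?thesis
  proof (cases "det (mat_of A) = 1")
    case True then show ?thesis using AZ red by (auto simp: Cdet_def)
  next
    case False
    let ?A = "A(?d - 1 := - A (?d - 1))"
    have "?A \<in> PiE {..<?d} (\<lambda>_. Zv)" using AZ by (auto simp: PiE_iff extensional_def Zv_uminus)
    moreover have "det (mat_of ?A) = 1" using det_flip_last[of A] dA False by simp
    moreover have "reduced (tmul ?d ?A g)"
    proof -
      let ?V = "tmul ?d A g"
      have "reduced (?V(?d - 1 := - ?V (?d - 1)))" using red by (rule reduced_flip_last)
      moreover have "tmul ?d ?A g i = (?V(?d - 1 := - ?V (?d - 1))) i" if "i < ?d" for i
        using that linear_neg[OF linear_vector_matrix[of g]] by (simp add: tmul_def)
      ultimately show ?thesis using reduced_cong by blast
    qed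
    ultimately show ?thesis by (auto simp: Cdet_def)
  qed
qed

section \<open>Counting lattice points by means of a reduced basis\<close>

definition Nlat :: "real^'n^'n \<Rightarrow> real \<Rightarrow> nat" where
  "Nlat g R = card {z \<in> Zv. norm (z v* g) \<le> R}"

lemma finite_Nlat: "det g \<noteq> 0 \<Longrightarrow> finite {z \<in> Zv. norm (z v* (g::real^'n^'n)) \<le> R}"
  using finite_Zv_preimage[of g 0 R] by simp

text \<open>Integral coordinates with respect to the basis \<open>A\<close> embed the lattice points
  of the unit ball into \<open>coeffset\<close> with centre \<open>0\<close>.\<close>

lemma Nlat_bound:
  fixes g :: "real^'n^'n"
  assumes g: "det g = 1" and A: "A \<in> Cdet"
  shows "real (Nlat g 1) \<le> (\<Prod>i<CARD('n). 1 + 2 / norm (gs (tmul CARD('n) A g) i))"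
proof -
  let ?d = "CARD('n)"
  let ?V = "tmul ?d A g"
  have "det (mat_of ?V) = 1" using g A by (simp add: mat_of_tmul det_mul Cdet_def)
  then have "indep ?d ?V" using det_mat_of_nz[of ?V] by simp
  note cb = coeffset_bound[OF this, of 0]
  have "mat_of A \<in> SLZ" using A by (auto simp: SLZ_def Cdet_def mat_of_def PiE_iff)
  then obtain m' where m': "m' \<in> SLZ" "m' ** mat_of A = mat 1" using SLZ_inverse by metis
  define c where "c z = restrict (\<lambda>i. \<lfloor>(z v* m') $ (inv idx i)\<rfloor>) {..<?d}" for z :: "real^'n"
  have inv: "inv idx (idx k) = k" for k :: 'n by (intro inv_f_f) (simp add: inj_def)
  have z: "z = (\<Sum>i<?d. of_int (c z i) *\<^sub>R A i)" if "z \<in> Zv" for z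
  proof -
    have zm: "z v* m' \<in> Zv" using that m'(1) by (auto simp: SLZ_def intro!: Zv_vector_matrix)
    have "z = (z v* m') v* mat_of A" by (simp add: vector_matrix_mul_assoc m')
    also have "\<dots> = (\<Sum>k\<in>UNIV. ((z v* m') $ k) *\<^sub>R A (idx k))"
      by (simp add: vector_matrix_sum_rows mat_of_def)
    also have "\<dots> = (\<Sum>k\<in>UNIV. of_int (c z (idx (k::'n))) *\<^sub>R A (idx k))"
    proof -
      have "of_int (c z (idx k)) = (z v* m') $ k" for k :: 'n
        using zm by (simp add: c_def inv Zv_def)
      then show ?thesis by simp
    qed
    also have "\<dots> = (\<Sum>i<?d. of_int (c z i) *\<^sub>R A i)"
      using sum.reindex_bij_betw[OF bij_idx, of "\<lambda>i. of_int (c z i) *\<^sub>R A i"] .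
    finally show ?thesis .
  qed
  have "c ` {z \<in> Zv. norm (z v* g) \<le> 1} \<subseteq> coeffset ?V ?d 0"
  proof
    fix n assume "n \<in> c ` {z \<in> Zv. norm (z v* g) \<le> 1}"
    then obtain y where y: "y \<in> Zv" "norm (y v* g) \<le> 1" "n = c y" by auto
    have "y v* g = (\<Sum>i<?d. of_int (c y i) *\<^sub>R ?V i)"
      by (subst z[OF y(1)]) (simp add: vector_matrix_sum scaleR_vector_matrix_assoc tmul_def)
    then show "n \<in> coeffset ?V ?d 0" using y by (auto simp: coeffset_def c_def)
  qed
  then have "card (c ` {z \<in> Zv. norm (z v* g) \<le> 1}) \<le> card (coeffset ?V ?d 0)"
    using cb by (intro card_mono) auto
  moreover have "inj_on c {z \<in> Zv. norm (z v* g) \<le> 1}" 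
    using z[symmetric] by (intro inj_on_inverseI[of _ "\<lambda>n. \<Sum>i<?d. of_int (n i) *\<^sub>R A i"]) auto
  ultimately have "Nlat g 1 \<le> card (coeffset ?V ?d 0)" by (simp add: Nlat_def card_image)
  then show ?thesis using cb by linarith
qed

section \<open>Volume of the set of reduced tuples\<close>

text \<open>An index \<open>i\<close> is the smaller one in \<open>d - 1 - i\<close> pairs and the
  larger one in \<open>i\<close> pairs.\<close>

lemma sum_pairs_diff:
  fixes z :: "nat \<Rightarrow> real"
  shows "(\<Sum>i<d. (real d - 1 - 2 * real i) * z i) = (\<Sum>j<d. \<Sum>i<j. z i - z j)"
proof (induction d)
  case (Suc d)
  have "(\<Sum>i<Suc d. (real (Suc d) - 1 - 2 * real i) * z i) =
     (\<Sum>i<d. (real d - 1 - 2 * real i) * z i + z i) - real d * z d"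
    by (simp add: algebra_simps)
  also have "\<dots> = (\<Sum>j<d. \<Sum>i<j. z i - z j) + ((\<Sum>i<d. z i) - real d * z d)"
    by (simp only: sum.distrib Suc.IH)
  also have "(\<Sum>i<d. z i) - real d * z d = (\<Sum>i<d. z i - z d)" by (simp add: sum_subtractf)
  finally show ?case by simp
qed simp

text \<open>For a nondecreasing sequence every pair contributes at most zero, and only the pairs of
  a negative and a nonnegative entry are kept. Their total is \<open>d\<close> times the negative
  mass, up to the number of negative entries times the sum of the sequence.\<close>

lemma sum_pairs_bound:
  fixes z :: "nat \<Rightarrow> real"
  assumes mono: "\<And>i j. i \<le> j \<Longrightarrow> j < d \<Longrightarrow> z i \<le> z j"
  shows "(\<Sum>i<d. (real d - 1 - 2 * real i) * z i) \<le>
    - real d * (\<Sum>i<d. max 0 (- z i)) + real d * \<bar>\<Sum>i<d. z i\<bar>"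
proof -
  define n p where "n i = max 0 (- z i)" and "p i = max 0 (z i)" for i
  define neg where "neg i = (if z i < 0 then 1 else 0 :: real)" for i
  \<comment> \<open>\<open>T i j\<close> is \<open>z j - z i\<close> if
    \<open>z i < 0 \<le> z j\<close>. For any other two indices it vanishes by monotonicity, so the
    sum over pairs extends to all indices and factors into products of single sums.\<close>
  define T where "T i j = p j * neg i + n i * (1 - neg j)" for i j
  have pn: "p i = n i + z i" for i by (auto simp: p_def n_def)
  have 1: "z i - z j \<le> - T i j" if "i < j" "j < d" for i j
    using mono[of i j] that by (auto simp: T_def p_def n_def neg_def)
  have 0: "T i j = 0" if "j \<le> i" "i < d" for i j
    using mono[of j i] that by (auto simp: T_def p_def n_def neg_def)
  have "(\<Sum>j<d. \<Sum>i<j. z i - z j) \<le> (\<Sum>j<d. \<Sum>i<j. - T i j)"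
    using 1 by (intro sum_mono) auto
  also have "\<dots> = (\<Sum>j<d. \<Sum>i<d. - T i j)"
    using 0 by (intro sum.cong refl sum.mono_neutral_left) auto
  also have "\<dots> = - ((\<Sum>j<d. p j) * (\<Sum>i<d. neg i) + (\<Sum>i<d. n i) * (\<Sum>j<d. 1 - neg j))"
  proof -
    have "(\<Sum>j<d. \<Sum>i<d. - T i j) = - ((\<Sum>j<d. \<Sum>i<d. p j * neg i) + (\<Sum>j<d. \<Sum>i<d. (1 - neg j) * n i))"
      by (simp only: T_def sum_negf sum.distrib mult.commute)
    also have "\<dots> = - ((\<Sum>j<d. p j) * (\<Sum>i<d. neg i) + (\<Sum>j<d. 1 - neg j) * (\<Sum>i<d. n i))"
      by (simp only: sum_product)
    finally show ?thesis by (simp only: mult.commute[of "\<Sum>j<d. 1 - neg j"])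
  qed
  also have "\<dots> = - real d * (\<Sum>i<d. n i) - (\<Sum>i<d. neg i) * (\<Sum>i<d. z i)"
    by (simp add: pn sum.distrib sum_subtractf algebra_simps)
  finally have A: "(\<Sum>j<d. \<Sum>i<j. z i - z j) \<le> - real d * (\<Sum>i<d. n i) - (\<Sum>i<d. neg i) * (\<Sum>i<d. z i)" .
  have "- ((\<Sum>i<d. neg i) * (\<Sum>i<d. z i)) \<le> real d * \<bar>\<Sum>i<d. z i\<bar>"
  proof -
    have "0 \<le> (\<Sum>i<d. neg i)" by (intro sum_nonneg) (auto simp: neg_def)
    moreover have "(\<Sum>i<d. neg i) \<le> (\<Sum>i<d. 1)" by (intro sum_mono) (auto simp: neg_def)
    ultimately have "\<bar>(\<Sum>i<d. neg i) * (\<Sum>i<d. z i)\<bar> \<le> real d * \<bar>\<Sum>i<d. z i\<bar>"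
      unfolding abs_mult by (intro mult_right_mono) auto
    then show ?thesis by linarith
  qed
  then show ?thesis using A unfolding sum_pairs_diff n_def by linarith
qed

text \<open>Let \<open>x i\<close> be the logarithm of the \<open>i\<close>th Gram-Schmidt length.
  The second sum is the exponent of the Lebesgue density of reduced tuples in these coordinates, the
  first one that of the moment of order \<open>d - 1\<close>. The shift \<open>z\<close> of
  \<open>x\<close> is monotone, and \<open>sum_pairs_bound\<close> gives \<open>- d\<close> times
  the negative mass against \<open>d - 1\<close> times it from the moment. The remaining unit
  controls the sum of absolute values, which is where the \<open>1/2\<close> comes from.\<close>

lemma log_inequality:
  fixes x :: "nat \<Rightarrow> real"
  assumes L: "L \<ge> 0" and d: "d \<ge> 1"
    and step: "\<And>i. Suc i < d \<Longrightarrow> x i \<le> x (Suc i) + L"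
    and s: "0 \<le> (\<Sum>i<d. x i)" "(\<Sum>i<d. x i) \<le> real d * L"
  shows "(real d - 1) * (\<Sum>i<d. max 0 (- x i)) + (\<Sum>i<d. (2 * (real d - 1 - real i) + 1) * x i)
     \<le> 7 * real d ^ 3 * L - 1/2 * (\<Sum>i<d. \<bar>x i\<bar>)"
proof -
  define z where "z i = x i + real i * L" for i
  have zs: "z i \<le> z (Suc i)" if "Suc i < d" for i using step[OF that] by (simp add: z_def algebra_simps)
  have mono: "z i \<le> z j" if "i \<le> j" "j < d" for i j
    using that by (induction j rule: dec_induct) (auto intro: order_trans zs)
  define S m where "S = (\<Sum>i<d. z i)" and "m = (\<Sum>i<d. max 0 (- z i))"
  have iL: "0 \<le> real i * L" "real i * L \<le> real d * L" if "i < d" for i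
    using that L by (auto intro!: mult_right_mono)
  have dL: "real d * L \<le> real d * real d * L" "real d * real d * L \<le> real d * real d * real d * L" "0 \<le> real d * L"
  proof -
    have d1: "1 \<le> real d" using d by simp
    show 0: "0 \<le> real d * L" using L by simp
    show 1: "real d * L \<le> real d * real d * L"
      using mult_right_mono[OF d1 0] by (simp add: mult.assoc)
    show "real d * real d * L \<le> real d * real d * real d * L"
      using mult_left_mono[OF 1, of "real d"] by (simp add: mult.assoc)
  qed
  have sum_iL: "0 \<le> (\<Sum>i<d. real i * L)" "(\<Sum>i<d. real i * L) \<le> real d * real d * L"
    using sum_nonneg[of "{..<d}" "\<lambda>i. real i * L"] sum_mono[of "{..<d}" "\<lambda>i. real i * L" "\<lambda>_. real d * L"] iL
    by (auto simp: mult.assoc)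
  have Sb: "0 \<le> S" "S \<le> 2 * (real d * real d * L)"
    using s sum_iL dL unfolding S_def z_def sum.distrib by linarith+
  have m0: "0 \<le> m" unfolding m_def by (intro sum_nonneg) auto
  have A: "(\<Sum>i<d. max 0 (- x i)) \<le> m + real d * real d * L"
  proof -
    have "(\<Sum>i<d. max 0 (- x i)) \<le> (\<Sum>i<d. max 0 (- z i) + real i * L)"
      using iL by (intro sum_mono) (auto simp: z_def max_def)
    then show ?thesis using sum_iL by (simp add: sum.distrib m_def)
  qed
  have B: "(\<Sum>i<d. (2 * (real d - 1 - real i) + 1) * x i) \<le> - real d * m + 2 * real d * S"
  proof -
    have "(\<Sum>i<d. (2 * (real d - 1 - real i) + 1) * x i) \<le> (\<Sum>i<d. (2 * (real d - 1 - real i) + 1) * z i)"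
      using iL by (intro sum_mono mult_left_mono) (auto simp: z_def)
    also have "\<dots> = (\<Sum>i<d. (real d - 1 - 2 * real i) * z i) + real d * S"
      by (simp add: S_def sum_distrib_left sum.distrib[symmetric] algebra_simps)
    also have "(\<Sum>i<d. (real d - 1 - 2 * real i) * z i) \<le> - real d * m + real d * \<bar>S\<bar>"
      unfolding m_def S_def by (rule sum_pairs_bound) (rule mono)
    finally show ?thesis using Sb by (simp add: mult.assoc mult.left_commute) (simp add: algebra_simps)
  qed
  have C: "(\<Sum>i<d. \<bar>x i\<bar>) \<le> 2 * m + S + real d * real d * L"
  proof -
    have "(\<Sum>i<d. \<bar>x i\<bar>) \<le> (\<Sum>i<d. 2 * max 0 (- z i) + z i + real i * L)"
    proof (rule sum_mono)
      fix i assume "i \<in> {..<d}"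
      then have "0 \<le> real i * L" using iL by simp
      moreover define t where "t = real i * L"
      ultimately have "0 \<le> t" by simp
      then show "\<bar>x i\<bar> \<le> 2 * max 0 (- z i) + z i + real i * L"
        unfolding z_def t_def[symmetric] max_def abs_if by auto
    qed
    then show ?thesis using sum_iL by (simp add: sum.distrib m_def S_def sum_distrib_left)
  qed
  have "(real d - 1) * (\<Sum>i<d. max 0 (- x i)) \<le> (real d - 1) * (m + real d * real d * L)"
    using A d by (intro mult_left_mono) auto
  also have "\<dots> = real d * m - m + real d * real d * real d * L - real d * real d * L" by (simp add: algebra_simps)
  finally have A': "(real d - 1) * (\<Sum>i<d. max 0 (- x i)) \<le> \<dots>" .
  have "real d * S \<le> real d * (2 * (real d * real d * L))" using Sb by (intro mult_left_mono) auto
  then have "2 * real d * S \<le> 4 * (real d * real d * real d * L)" by (simp add: algebra_simps)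
  \<comment> \<open>The errors are at most \<open>d^3 L\<close> from \<open>A'\<close>,
    \<open>4 d^3 L\<close> from \<open>B\<close> and \<open>3/2 d^2 L\<close> from \<open>C\<close>;
    the constant \<open>7\<close> leaves room.\<close>
  moreover have "7 * real d ^ 3 * L = 7 * (real d * real d * real d * L)" by (simp add: power3_eq_cube)
  moreover have "- real d * m = - (real d * m)" by simp
  ultimately show ?thesis using A' B C Sb dL by linarith
qed

text \<open>The exponential of \<open>log_inequality\<close>. The \<open>5\<close> comes from
  bounding \<open>1 + 4 / a\<close> by five times the larger of \<open>1\<close> and
  \<open>1 / a\<close>; the bounds on the product are those of the determinant on
  \<open>shell\<close>.\<close>

lemma reduced_weight_bound:
  fixes a :: "nat \<Rightarrow> real"
  assumes d: "d \<ge> 1" and a: "\<And>i. i < d \<Longrightarrow> a i > 0"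
    and step: "\<And>i. Suc i < d \<Longrightarrow> a i \<le> 2 * a (Suc i)"
    and prod: "1 \<le> (\<Prod>i<d. a i)" "(\<Prod>i<d. a i) \<le> 2 ^ d"
  shows "(\<Prod>i<d. 1 + 4 / a i) ^ (d - 1) \<le>
    5 ^ (d * (d - 1)) * exp (7 * real d ^ 3 * ln 2) *
      (\<Prod>i<d. exp (- (1/2) * \<bar>ln (a i)\<bar> - (2 * (real d - 1 - real i) + 1) * ln (a i)))"
proof -
  define x where "x i = ln (a i)" for i
  have ls: "ln (\<Prod>i<d. a i) = (\<Sum>i<d. x i)" unfolding x_def using a by (subst ln_prod) (auto, metis less_irrefl)
  have pos: "0 < (\<Prod>i<d. a i)" using a by (intro prod_pos) auto
  have s: "0 \<le> (\<Sum>i<d. x i)" "(\<Sum>i<d. x i) \<le> real d * ln 2"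
    using prod pos unfolding ls[symmetric] by (simp_all add: ln_realpow[symmetric])
  have st: "x i \<le> x (Suc i) + ln 2" if "Suc i < d" for i
  proof -
    have "ln (a i) \<le> ln (2 * a (Suc i))" using step[OF that] a that by (subst ln_le_cancel_iff) auto
    also have "\<dots> = ln (a (Suc i)) + ln 2" using a[OF that] by (simp add: ln_mult_pos)
    finally show ?thesis by (simp add: x_def)
  qed
  have 1: "1 + 4 / a i \<le> 5 * exp (max 0 (- x i))" if "i < d" for i
  proof -
    have e: "exp (- x i) = 1 / a i" using a[OF that] by (simp add: x_def exp_minus inverse_eq_divide)
    have "1 \<le> exp (max 0 (- x i))" by simp
    moreover have "1 / a i \<le> exp (max 0 (- x i))" unfolding e[symmetric] by simp
    moreover have "4 / a i = 4 * (1 / a i)" by simp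
    ultimately show ?thesis by linarith
  qed
  have nn: "0 \<le> 1 + 4 / a i" if "i < d" for i using a[OF that] by simp
  have "(\<Prod>i<d. 1 + 4 / a i) ^ (d - 1) \<le> (\<Prod>i<d. 5 * exp (max 0 (- x i))) ^ (d - 1)"
    using 1 nn by (intro power_mono prod_mono prod_nonneg) auto
  also have "(\<Prod>i<d. 5 * exp (max 0 (- x i))) = 5 ^ d * exp (\<Sum>i<d. max 0 (- x i))"
    by (simp add: prod.distrib exp_sum)
  also have "(5 ^ d * exp (\<Sum>i<d. max 0 (- x i))) ^ (d - 1) =
     5 ^ (d * (d - 1)) * exp ((real d - 1) * (\<Sum>i<d. max 0 (- x i)))"
    using d by (simp add: power_mult_distrib power_mult[symmetric] exp_of_nat_mult[symmetric] of_nat_diff)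
  also have "\<dots> \<le> 5 ^ (d * (d - 1)) * exp (7 * real d ^ 3 * ln 2 +
      (\<Sum>i<d. - (1/2) * \<bar>x i\<bar> - (2 * (real d - 1 - real i) + 1) * x i))"
    using log_inequality[of "ln 2" d x, OF _ d st s]
    by (intro mult_left_mono) (simp_all add: sum_subtractf sum_distrib_left sum_negf)
  also have "\<dots> = 5 ^ (d * (d - 1)) * exp (7 * real d ^ 3 * ln 2) *
      (\<Prod>i<d. exp (- (1/2) * \<bar>x i\<bar> - (2 * (real d - 1 - real i) + 1) * x i))"
    by (simp only: exp_add exp_sum mult.assoc finite_lessThan)
  finally show ?thesis unfolding x_def .
qed

lemma int_exp_sum_finite:
  assumes c: "c > 0"
  shows "(\<integral>\<^sup>+ n. ennreal (exp (- c * real_of_int \<bar>n::int\<bar>)) \<partial>count_space UNIV) < \<infinity>"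
proof -
  let ?f = "\<lambda>n::int. ennreal (exp (- c * real_of_int \<bar>n\<bar>))"
  let ?g = "\<lambda>n::nat. ennreal (exp (- c * real n))"
  have g: "(\<integral>\<^sup>+ n. ?g n \<partial>count_space UNIV) < \<infinity>"
  proof -
    have e: "exp (- c * real n) = exp (- c) ^ n" for n by (simp add: exp_of_nat2_mult[symmetric] mult.commute)
    have "summable (\<lambda>n. exp (- c * real n))" unfolding e using c by (intro summable_geometric) simp
    then show ?thesis unfolding nn_integral_count_space_nat
      by (subst suminf_ennreal2) (auto)
  qed
  have 1: "(\<integral>\<^sup>+ n. ?f n \<partial>count_space (range int)) = (\<integral>\<^sup>+ n. ?g n \<partial>count_space UNIV)"
    by (subst nn_integral_bij_count_space[of int UNIV "range int", symmetric]) (auto simp: bij_betw_def inj_on_def)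
  have 2: "(\<integral>\<^sup>+ n. ?f n \<partial>count_space (range (\<lambda>n. - int n))) = (\<integral>\<^sup>+ n. ?g n \<partial>count_space UNIV)"
    by (subst nn_integral_bij_count_space[of "\<lambda>n. - int n" UNIV "range (\<lambda>n. - int n)", symmetric]) (auto simp: bij_betw_def inj_on_def)
  have "(\<integral>\<^sup>+ n. ?f n \<partial>count_space UNIV) \<le>
     (\<integral>\<^sup>+ n. ?f n * indicator (range int) n + ?f n * indicator (range (\<lambda>n. - int n)) n \<partial>count_space UNIV)"
  proof (rule nn_integral_mono)
    fix n :: int
    show "?f n \<le> ?f n * indicator (range int) n + ?f n * indicator (range (\<lambda>n. - int n)) n"
    proof (cases "n \<ge> 0")
      case True
      then have "n \<in> range int" using nonneg_int_cases[of n] by blast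
      then show ?thesis by simp
    next
      case False
      then have "n \<in> range (\<lambda>n. - int n)" by (intro range_eqI[of _ _ "nat (- n)"]) simp
      then show ?thesis by simp
    qed
  qed
  also have "\<dots> = (\<integral>\<^sup>+ n. ?g n \<partial>count_space UNIV) + (\<integral>\<^sup>+ n. ?g n \<partial>count_space UNIV)"
  proof -
    have e1: "(\<integral>\<^sup>+ n. ?f n * indicator (range int) n \<partial>count_space UNIV) = (\<integral>\<^sup>+ n. ?g n \<partial>count_space UNIV)"
      using 1 by (subst (asm) nn_integral_count_space_indicator) (simp_all add: infinite_UNIV_int)
    have e2: "(\<integral>\<^sup>+ n. ?f n * indicator (range (\<lambda>n. - int n)) n \<partial>count_space UNIV) = (\<integral>\<^sup>+ n. ?g n \<partial>count_space UNIV)"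
      using 2 by (subst (asm) nn_integral_count_space_indicator) simp_all
    show ?thesis by (subst nn_integral_add) (simp_all only: e1 e2, auto)
  qed
  also have "\<dots> < \<infinity>" using g by simp
  finally show ?thesis .
qed

section \<open>Integration over one vector of a reduced tuple\<close>

lemma orthonormal_frame:
  fixes V :: "nat \<Rightarrow> real^'n"
  assumes V: "indep CARD('n) V"
  defines "F \<equiv> transpose (\<chi> k. (1 / norm (gs V (idx k))) *\<^sub>R gs V (idx k))"
  shows "\<bar>det F\<bar> = 1" "(y v* F) $ k = (y \<bullet> gs V (idx k)) / norm (gs V (idx k))"
proof -
  let ?G = "(\<chi> k. (1 / norm (gs V (idx k))) *\<^sub>R gs V (idx k)) :: real^'n^'n"
  have nz: "gs V (idx k) \<noteq> 0" for k :: 'n using V by (simp add: indep_gs)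
  have "?G ** transpose ?G = mat 1"
  proof -
    have r: "row k ?G = (1 / norm (gs V (idx k))) *\<^sub>R gs V (idx k)" for k
      by (simp add: row_def vec_eq_iff)
    have "row i ?G \<bullet> row j ?G = (if i = j then 1 else 0)" for i j
      unfolding r using nz[of i] gs_orth[of "idx i" "idx j" V]
      by (auto simp: power2_norm_eq_inner[symmetric] power2_eq_square)
    then show ?thesis unfolding matrix_mult_transpose_dot_row by (simp add: vec_eq_iff mat_def)
  qed
  then have "det ?G * det ?G = 1" using det_mul[of ?G "transpose ?G"] by simp
  then have "(det ?G)\<^sup>2 = 1\<^sup>2" by (simp add: power2_eq_square)
  then show "\<bar>det F\<bar> = 1" unfolding F_def det_transpose by (simp only: power2_eq_iff abs_eq_iff) auto
  have "y v* F = ?G *v y" unfolding F_def by simp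
  then show "(y v* F) $ k = (y \<bullet> gs V (idx k)) / norm (gs V (idx k))"
    by (simp add: matrix_vector_mul_component inner_commute divide_inverse)
qed

text \<open>In the orthonormal frame of the completed Gram-Schmidt vectors the conditions describe a
  subset of a box. A coefficient of size at most \<open>1/2\<close> gives the side
  \<open>norm (gs x l)\<close> for each \<open>l < i\<close>, and the orthogonal component gives the
  side \<open>2 * b\<close> in the other directions.\<close>

lemma slab_volume:
  fixes x :: "nat \<Rightarrow> real^'n"
  assumes x: "indep i x" and i: "i \<le> CARD('n)" and b: "b > 0"
  shows "\<exists>T\<in>sets borel. (\<forall>y. (\<forall>j<i. \<bar>proj_coeff x y j\<bar> \<le> 1/2) \<and> norm (rcomp x i y) \<le> b \<longrightarrow> y \<in> T) \<and>
     emeasure lborel T = ennreal ((\<Prod>l<i. norm (gs x l)) * (2 * b) ^ (CARD('n) - i))"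
proof -
  obtain V where V: "indep CARD('n) V" "\<And>l. l < i \<Longrightarrow> V l = x l" using indep_extend[OF x i] by blast
  have gsV: "gs V l = gs x l" if "l < i" for l using that V(2) by (intro gs_cong) auto
  define F :: "real^'n^'n" where "F = transpose (\<chi> k. (1 / norm (gs V (idx k))) *\<^sub>R gs V (idx k))"
  note F = orthonormal_frame[OF V(1), folded F_def]
  define w where "w l = (if l < i then norm (gs x l) / 2 else b)" for l
  let ?c = "(\<chi> k. w (idx k)) :: real^'n"
  let ?T = "{y. y v* F \<in> cbox (- ?c) ?c}"
  have w0: "0 \<le> w l" for l using b by (simp add: w_def)
  have mT: "?T \<in> sets borel"
    using measurable_sets[OF borel_measurable_vector_matrix[of "\<lambda>y. y" borel "\<lambda>_. F"], of "cbox (- ?c) ?c"]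
    by (simp add: vimage_def)
  have "emeasure lborel ?T = emeasure lborel (cbox (- ?c) ?c)" using F(1) by (rule emeasure_lborel_vm) simp
  also have "\<dots> = (\<Prod>a\<in>Basis. (?c - - ?c) \<bullet> a)"
    using w0 by (intro emeasure_lborel_cbox) (auto simp: Basis_vec_def inner_axis intro: order_trans[of _ 0])
  also have "(\<Prod>a\<in>Basis. (?c - - ?c) \<bullet> a) = (\<Prod>k\<in>UNIV. 2 * w (idx (k::'n)))"
    unfolding prod_Basis_vec by simp
  also have "\<dots> = (\<Prod>l<CARD('n). 2 * w l)" using prod.reindex_bij_betw[OF bij_idx, of "\<lambda>l. 2 * w l"] .
  also have "{..<CARD('n)} = {..<i} \<union> {i..<CARD('n)}" using i by auto
  also have "(\<Prod>l\<in>{..<i} \<union> {i..<CARD('n)}. 2 * w l) = (\<Prod>l<i. 2 * w l) * (\<Prod>l\<in>{i..<CARD('n)}. 2 * w l)"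
    by (rule prod.union_disjoint) auto
  also have "\<dots> = (\<Prod>l<i. norm (gs x l)) * (2 * b) ^ (CARD('n) - i)"
    by (simp add: w_def)
  finally have em: "emeasure lborel ?T = ennreal ((\<Prod>l<i. norm (gs x l)) * (2 * b) ^ (CARD('n) - i))" .
  have "y \<in> ?T" if y: "\<And>j. j < i \<Longrightarrow> \<bar>proj_coeff x y j\<bar> \<le> 1/2" "norm (rcomp x i y) \<le> b" for y
  proof -
    have "\<bar>(y v* F) $ k\<bar> \<le> w (idx k)" for k
    proof (cases "idx k < i")
      case True
      have nz: "gs x (idx k) \<noteq> 0" using x True by (simp add: indep_gs)
      have "(y v* F) $ k = proj_coeff x y (idx k) * norm (gs x (idx k))"
        using F(2) True nz by (simp add: gsV proj_coeff_def power2_norm_eq_inner[symmetric] power2_eq_square)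
      then show ?thesis using mult_right_mono[OF y(1)[OF True], of "norm (gs x (idx k))"] True
        by (simp add: w_def abs_mult)
    next
      case False
      have im: "V ` {..<i} = x ` {..<i}" using V(2) by (intro image_cong) auto
      have "y - rcomp x i y \<in> span (V ` {..<i})" unfolding im by (rule minus_rcomp_span)
      then have "y - rcomp x i y \<in> span (V ` {..<idx k})"
        using span_mono[OF image_mono[of "{..<i}" "{..<idx k}" V]] False by (auto simp: subset_eq)
      then have "gs V (idx k) \<bullet> (y - rcomp x i y) = 0" by (rule gs_orth_span)
      then have "y \<bullet> gs V (idx k) = rcomp x i y \<bullet> gs V (idx k)"
        by (simp add: inner_diff_right inner_commute)
      then have "\<bar>(y v* F) $ k\<bar> = \<bar>rcomp x i y \<bullet> gs V (idx k)\<bar> / norm (gs V (idx k))" by (simp add: F(2))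
      also have "\<dots> \<le> norm (rcomp x i y)"
        using Cauchy_Schwarz_ineq2[of "rcomp x i y" "gs V (idx k)"] V(1)
        by (simp add: divide_le_eq indep_gs)
      finally show ?thesis using y(2) False by (simp add: w_def)
    qed
    then show ?thesis by (auto simp: mem_box_cart abs_le_iff minus_le_iff)
  qed
  then show ?thesis using mT em by (intro bexI[of _ ?T]) auto
qed

text \<open>The weight of a new vector \<open>y\<close> at place \<open>i\<close>. The power
  \<open>p\<close> is meant to cancel the growth of volume in the orthogonal component, and the term
  with \<open>1/2\<close> leaves a decay at both ends of the logarithmic scale.\<close>

definition hw :: "(nat \<Rightarrow> real^'n) \<Rightarrow> nat \<Rightarrow> real \<Rightarrow> real^'n \<Rightarrow> ennreal" where
  "hw x i p y = (if (\<forall>j<i. \<bar>proj_coeff x y j\<bar> \<le> 1/2) \<and> rcomp x i y \<noteq> 0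
     then ennreal (exp (- (1/2) * \<bar>ln (norm (rcomp x i y))\<bar> - p * ln (norm (rcomp x i y)))) else 0)"

text \<open>A two-sided geometric series over dyadic shells. The factor
  \<open>exp (ln 2 / 2)\<close> pays for rounding the logarithm, and
  \<open>exp (2 * d * ln 2)\<close> for enclosing a shell in a box whose sides are four times its
  inner radius.\<close>

definition kap :: "nat \<Rightarrow> ennreal" where
  "kap d = ennreal (exp (ln 2 / 2 + 2 * real d * ln 2)) *
     (\<integral>\<^sup>+ n. ennreal (exp (- (ln 2 / 2) * real_of_int \<bar>n::int\<bar>)) \<partial>count_space UNIV)"

lemma kap_finite: "kap d < \<infinity>"
  unfolding kap_def using int_exp_sum_finite[of "ln 2 / 2"] by (simp add: ennreal_mult_less_top)

text \<open>The integral over the orthogonal component is split into shells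
  \<open>2 ^ n \<le> norm (rcomp x i y) < 2 ^ (n + 1)\<close>, each contained in a rotated box.\<close>

lemma inner_bound:
  fixes x :: "nat \<Rightarrow> real^'n"
  assumes x: "indep i x" and i: "i \<le> CARD('n)"
  shows "(\<integral>\<^sup>+ y. hw x i (real (CARD('n) - i)) y \<partial>lborel) \<le> kap CARD('n) * ennreal (\<Prod>l<i. norm (gs x l))"
proof -
  define L where "L = ln (2::real)"
  define e where "e = CARD('n) - i"
  let ?A = "\<Prod>l<i. norm (gs x l)"
  have L: "L > 0" "exp L = 2" by (simp_all add: L_def)
  define b where "b n = exp ((real_of_int n + 1) * L)" for n :: int
  have "\<exists>T\<in>sets borel. (\<forall>y. (\<forall>j<i. \<bar>proj_coeff x y j\<bar> \<le> 1/2) \<and> norm (rcomp x i y) \<le> b n \<longrightarrow> y \<in> T) \<and>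
     emeasure lborel T = ennreal (?A * (2 * b n) ^ e)" for n
    unfolding e_def by (rule slab_volume[OF x i]) (simp add: b_def)
  then obtain T where T: "\<And>n. T n \<in> sets borel"
    "\<And>n y. (\<forall>j<i. \<bar>proj_coeff x y j\<bar> \<le> 1/2) \<Longrightarrow> norm (rcomp x i y) \<le> b n \<Longrightarrow> y \<in> T n"
    "\<And>n. emeasure lborel (T n) = ennreal (?A * (2 * b n) ^ e)" by metis
  note [measurable] = T(1)
  \<comment> \<open>Bounds the weight on shell \<open>n\<close>: the logarithm is replaced by
    \<open>n * L\<close>, and \<open>1/2 * L\<close> covers the error of at most \<open>L\<close> in
    its absolute value.\<close>
  define B where "B n = exp (- (1/2) * (real_of_int \<bar>n\<bar> * L) + 1/2 * L - real e * (real_of_int n * L))" for n :: int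
  have pt: "hw x i (real e) y \<le> (\<integral>\<^sup>+ n. ennreal (B n) * indicator (T n) y \<partial>count_space UNIV)" for y
  proof (cases "(\<forall>j<i. \<bar>proj_coeff x y j\<bar> \<le> 1/2) \<and> rcomp x i y \<noteq> 0")
    case False then show ?thesis by (auto simp: hw_def)
  next
    case True
    define c where "c = norm (rcomp x i y)"
    define n where "n = \<lfloor>ln c / L\<rfloor>"
    have c: "c > 0" using True by (simp add: c_def)
    have n1: "real_of_int n * L \<le> ln c" "ln c < (real_of_int n + 1) * L"
    proof -
      have "real_of_int n \<le> ln c / L" "ln c / L < real_of_int n + 1" unfolding n_def by linarith+
      then show "real_of_int n * L \<le> ln c" "ln c < (real_of_int n + 1) * L"
        using L by (simp_all add: pos_le_divide_eq pos_divide_less_eq)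
    qed
    have "c = exp (ln c)" using c by simp
    also have "\<dots> \<le> b n" unfolding b_def using n1 by simp
    finally have yT: "y \<in> T n" using T(2) True by (simp add: c_def)
    have abs: "real_of_int \<bar>n\<bar> * L \<le> \<bar>ln c\<bar> + L"
    proof (cases "n \<ge> 0")
      case True then show ?thesis using n1 L by simp
    next
      case False
      then have "real_of_int \<bar>n\<bar> * L = - (real_of_int n * L)" by simp
      also have "\<dots> \<le> L - ln c" using n1 by (simp add: algebra_simps)
      finally show ?thesis by linarith
    qed
    have "real e * (real_of_int n * L) \<le> real e * ln c" using n1 by (intro mult_left_mono) auto
    then have "exp (- (1/2) * \<bar>ln c\<bar> - real e * ln c) \<le> B n"
      using abs unfolding B_def by simp
    then have "hw x i (real e) y \<le> ennreal (B n) * indicator (T n) y"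
      using True yT unfolding hw_def c_def[symmetric] by (simp add: ennreal_leI)
    also have "\<dots> = (\<integral>\<^sup>+ m. ennreal (B m) * indicator (T m) y * indicator {n} m \<partial>count_space UNIV)"
      by (simp add: nn_integral_indicator_singleton)
    also have "\<dots> \<le> (\<integral>\<^sup>+ m. ennreal (B m) * indicator (T m) y \<partial>count_space UNIV)"
      by (intro nn_integral_mono) (auto simp: indicator_def)
    finally show ?thesis .
  qed
  have "(\<integral>\<^sup>+ y. hw x i (real e) y \<partial>lborel) \<le>
     (\<integral>\<^sup>+ y. (\<integral>\<^sup>+ n. ennreal (B n) * indicator (T n) y \<partial>count_space UNIV) \<partial>lborel)"
    by (intro nn_integral_mono pt)
  also have "\<dots> = (\<integral>\<^sup>+ n. (\<integral>\<^sup>+ y. ennreal (B n) * indicator (T n) y \<partial>lborel) \<partial>count_space UNIV)"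
    by (intro nn_integral_count_space_nn_integral) auto
  also have "\<dots> = (\<integral>\<^sup>+ n. ennreal (B n) * ennreal (?A * (2 * b n) ^ e) \<partial>count_space UNIV)"
    by (simp add: nn_integral_cmult_indicator T)
  also have "\<dots> = (\<integral>\<^sup>+ n. ennreal (exp (L / 2 + 2 * real e * L)) * ennreal ?A * ennreal (exp (- (L / 2) * real_of_int \<bar>n\<bar>)) \<partial>count_space UNIV)"
  proof (rule nn_integral_cong)
    fix n :: int
    have "2 * b n = exp (L + (real_of_int n + 1) * L)" by (simp add: b_def exp_add L)
    then have "(2 * b n) ^ e = exp (real e * (L + (real_of_int n + 1) * L))" by (simp add: exp_of_nat_mult)
    then have "B n * (?A * (2 * b n) ^ e) = ?A * (B n * exp (real e * (L + (real_of_int n + 1) * L)))" by simp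
    also have "B n * exp (real e * (L + (real_of_int n + 1) * L)) =
        exp (L / 2 + 2 * real e * L) * exp (- (L / 2) * real_of_int \<bar>n\<bar>)"
      unfolding B_def exp_add[symmetric] by (rule arg_cong[where f = exp]) (simp add: algebra_simps)
    finally have eq: "B n * (?A * (2 * b n) ^ e) = exp (L / 2 + 2 * real e * L) * ?A * exp (- (L / 2) * real_of_int \<bar>n\<bar>)"
      by (simp add: mult_ac)
    have "0 \<le> ?A" "0 \<le> B n" "0 \<le> b n" by (auto simp: prod_nonneg B_def b_def)
    then have l: "ennreal (B n) * ennreal (?A * (2 * b n) ^ e) = ennreal (B n * (?A * (2 * b n) ^ e))"
      by (intro ennreal_mult[symmetric]) auto
    have r: "ennreal (exp (L / 2 + 2 * real e * L) * ?A * exp (- (L / 2) * real_of_int \<bar>n\<bar>)) =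
       ennreal (exp (L / 2 + 2 * real e * L)) * ennreal ?A * ennreal (exp (- (L / 2) * real_of_int \<bar>n\<bar>))"
      using \<open>0 \<le> ?A\<close> by (simp only: ennreal_mult' mult_nonneg_nonneg exp_ge_zero)
    show "ennreal (B n) * ennreal (?A * (2 * b n) ^ e) =
       ennreal (exp (L / 2 + 2 * real e * L)) * ennreal ?A * ennreal (exp (- (L / 2) * real_of_int \<bar>n\<bar>))"
      unfolding l eq r ..
  qed
  also have "\<dots> = ennreal (exp (L / 2 + 2 * real e * L)) * ennreal ?A *
      (\<integral>\<^sup>+ n. ennreal (exp (- (L / 2) * real_of_int \<bar>n\<bar>)) \<partial>count_space UNIV)"
    by (rule nn_integral_cmult) simp
  also have "\<dots> \<le> ennreal (exp (L / 2 + 2 * real CARD('n) * L)) * ennreal ?A *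
      (\<integral>\<^sup>+ n. ennreal (exp (- (L / 2) * real_of_int \<bar>n\<bar>)) \<partial>count_space UNIV)"
    using L by (intro mult_right_mono ennreal_leI) (auto simp: e_def)
  finally show ?thesis unfolding kap_def e_def[symmetric] L_def by (simp add: mult_ac)
qed

definition wt :: "(nat \<Rightarrow> real^'n) \<Rightarrow> nat \<Rightarrow> real \<Rightarrow> ennreal" where
  "wt X l p = (if (\<forall>j<l. \<bar>mu X l j\<bar> \<le> 1/2) \<and> gs X l \<noteq> 0
     then ennreal (exp (- (1/2) * \<bar>ln (norm (gs X l))\<bar> - p * ln (norm (gs X l)))) else 0)"

lemma wt_upd: "wt (x(i := y)) i p = hw x i p y"
  by (simp add: wt_def hw_def gs_upd mu_upd cong: conj_cong)

lemma wt_upd_less: "l < i \<Longrightarrow> wt (x(i := y)) l p = wt x l p"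
  by (simp add: wt_def gs_fun_upd_less mu_def)

text \<open>Integrating out a later vector produces a factor \<open>norm (gs x l)\<close>; it is
  absorbed by lowering the exponent at place \<open>l\<close> by one.\<close>

lemma wt_mult: "wt x l (p + 1) * ennreal (norm (gs x l)) = wt x l p"
proof (cases "(\<forall>j<l. \<bar>mu x l j\<bar> \<le> 1/2) \<and> gs x l \<noteq> 0")
  case True
  then have "norm (gs x l) > 0" by simp
  then have "exp (- (1/2) * \<bar>ln (norm (gs x l))\<bar> - (p + 1) * ln (norm (gs x l))) * norm (gs x l) =
     exp (- (1/2) * \<bar>ln (norm (gs x l))\<bar> - (p + 1) * ln (norm (gs x l))) * exp (ln (norm (gs x l)))" by simp
  also have "\<dots> = exp (- (1/2) * \<bar>ln (norm (gs x l))\<bar> - p * ln (norm (gs x l)))"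
    unfolding exp_add[symmetric] by (simp add: algebra_simps)
  finally show ?thesis using True by (simp add: wt_def ennreal_mult'[symmetric])
qed (auto simp: wt_def)

lemma borel_measurable_wt [measurable]:
  assumes "l < r" shows "(\<lambda>X. wt X l p) \<in> borel_measurable (TT r)"
proof -
  have [measurable]: "(\<lambda>X. gs X j :: real^'a) \<in> borel_measurable (TT r)" if "j \<le> l" for j
    using assms that by simp
  have [measurable]: "(\<lambda>X. X l :: real^'a) \<in> borel_measurable (TT r)" using assms by simp
  have [measurable]: "(\<lambda>X. mu (X :: nat \<Rightarrow> real^'a) l j) \<in> borel_measurable (TT r)" if "j < l" for j
    unfolding mu_def using that by (intro borel_measurable_divide borel_measurable_inner) auto
  have "{X \<in> space (TT r). \<forall>j\<in>{..<l}. \<bar>mu (X :: nat \<Rightarrow> real^'a) l j\<bar> \<le> 1/2} \<in> sets (TT r)"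
  proof (intro sets.sets_Collect_finite_All)
    fix j assume "j \<in> {..<l}"
    then have [measurable]: "(\<lambda>X. mu (X :: nat \<Rightarrow> real^'a) l j) \<in> borel_measurable (TT r)" by simp
    show "{X \<in> space (TT r). \<bar>mu (X :: nat \<Rightarrow> real^'a) l j\<bar> \<le> 1/2} \<in> sets (TT r)" by measurable
  qed simp
  then have [measurable]: "Measurable.pred (TT r) (\<lambda>X. \<forall>j<l. \<bar>mu (X :: nat \<Rightarrow> real^'a) l j\<bar> \<le> 1/2)"
    by (simp add: pred_def Ball_def)
  show ?thesis unfolding wt_def by measurable
qed

text \<open>The last vector is integrated out first. At stage \<open>Suc i\<close> the exponent at
  \<open>l = i\<close> equals \<open>d - i\<close>, the dimension of the orthogonal complement, so
  \<open>inner_bound\<close> applies; the volume of the box of coefficients that it leaves behind is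
  absorbed by \<open>wt_mult\<close>. At stage \<open>d\<close> the exponents are
  \<open>2 * (d - 1 - l) + 1\<close>, those of \<open>log_inequality\<close>.\<close>

lemma weight_integral:
  fixes i :: nat
  assumes "i \<le> CARD('n)"
  shows "(\<integral>\<^sup>+ X. (\<Prod>l<i. wt X l (real CARD('n) + real i - 1 - 2 * real l)) \<partial>(TT i :: (nat \<Rightarrow> real^'n) measure)) \<le> kap CARD('n) ^ i"
  using assms
proof (induction i)
  case 0
  show ?case by (simp add: PiM_empty)
next
  case (Suc i)
  interpret product_sigma_finite "\<lambda>_::nat. lborel :: (real^'n) measure" by (rule product_sigma_finite_lborel)
  let ?d = "CARD('n)"
  let ?f = "\<lambda>X :: nat \<Rightarrow> real^'n. \<Prod>l<Suc i. wt X l (real ?d + real (Suc i) - 1 - 2 * real l)"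
  let ?g = "\<lambda>X :: nat \<Rightarrow> real^'n. \<Prod>l<i. wt X l (real ?d + real i - 1 - 2 * real l)"
  have m: "?f \<in> borel_measurable (PiM (insert i {..<i}) (\<lambda>_. lborel))"
    unfolding lessThan_Suc[symmetric] by (intro borel_measurable_prod_ennreal borel_measurable_wt) simp
  have f: "?f (x(i := y)) = (\<Prod>l<i. wt x l ((real ?d + real i - 1 - 2 * real l) + 1)) * hw x i (real (?d - i)) y" for x y
  proof -
    have "(\<Prod>l<i. wt (x(i := y)) l (real ?d + real (Suc i) - 1 - 2 * real l)) =
       (\<Prod>l<i. wt x l ((real ?d + real i - 1 - 2 * real l) + 1))"
      by (intro prod.cong) (auto simp: wt_upd_less intro!: arg_cong[where f = "wt x _"])
    moreover have "real ?d + real (Suc i) - 1 - 2 * real i = real (?d - i)"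
      using Suc.prems by (simp add: of_nat_diff)
    ultimately show ?thesis by (simp only: prod.lessThan_Suc wt_upd)
  qed
  have inner: "(\<integral>\<^sup>+ y. ?f (x(i := y)) \<partial>lborel) \<le> kap ?d * ?g x" for x
  proof (cases "indep i x")
    case True
    have hm: "(\<lambda>y. hw x i (real (?d - i)) y) \<in> borel_measurable borel"
    proof -
      have [measurable]: "(\<lambda>y. proj_coeff x y j) \<in> borel_measurable borel" for j
        unfolding proj_coeff_def by measurable
      have [measurable]: "(\<lambda>y. rcomp x i y) \<in> borel_measurable borel"
        unfolding rcomp_def by measurable
      have "{y \<in> space borel. \<forall>j\<in>{..<i}. \<bar>proj_coeff x y j\<bar> \<le> 1/2} \<in> sets borel"
        by (intro sets.sets_Collect_finite_All) auto
      then have [measurable]: "Measurable.pred borel (\<lambda>y. \<forall>j<i. \<bar>proj_coeff x y j\<bar> \<le> 1/2)"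
        by (simp add: pred_def Ball_def)
      show ?thesis unfolding hw_def by measurable
    qed
    have "(\<integral>\<^sup>+ y. ?f (x(i := y)) \<partial>lborel) =
       (\<Prod>l<i. wt x l ((real ?d + real i - 1 - 2 * real l) + 1)) * (\<integral>\<^sup>+ y. hw x i (real (?d - i)) y \<partial>lborel)"
      unfolding f using hm by (intro nn_integral_cmult) simp
    also have "\<dots> \<le> (\<Prod>l<i. wt x l ((real ?d + real i - 1 - 2 * real l) + 1)) * (kap ?d * ennreal (\<Prod>l<i. norm (gs x l)))"
      using Suc.prems by (intro mult_left_mono inner_bound True) auto
    also have "ennreal (\<Prod>l<i. norm (gs x l)) = (\<Prod>l<i. ennreal (norm (gs x l)))"
      by (rule prod_ennreal[symmetric]) simp
    also have "(\<Prod>l<i. wt x l ((real ?d + real i - 1 - 2 * real l) + 1)) * (kap ?d * (\<Prod>l<i. ennreal (norm (gs x l)))) =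
       kap ?d * (\<Prod>l<i. wt x l ((real ?d + real i - 1 - 2 * real l) + 1) * ennreal (norm (gs x l)))"
      by (simp add: prod.distrib mult_ac)
    finally show ?thesis by (simp only: wt_mult)
  next
    \<comment> \<open>A dependent prefix has weight zero by the default value in \<open>wt\<close>,
      so the whole integrand vanishes.\<close>
    case False
    then obtain l where l: "l < i" "gs x l = 0" by (auto simp: indep_gs)
    then have e0: "(\<Prod>l<i. wt x l ((real ?d + real i - 1 - 2 * real l) + 1)) = 0"
      by (intro prod_zero bexI[of _ l]) (auto simp: wt_def)
    show ?thesis unfolding f e0 by simp
  qed
  have gm: "?g \<in> borel_measurable (TT i)"
    by (intro borel_measurable_prod_ennreal borel_measurable_wt) simp
  have "(\<integral>\<^sup>+ X. ?f X \<partial>TT (Suc i)) = (\<integral>\<^sup>+ x. \<integral>\<^sup>+ y. ?f (x(i := y)) \<partial>lborel \<partial>TT i)"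
    unfolding lessThan_Suc[of i] using m by (subst product_nn_integral_insert) (simp_all add: lessThan_Suc)
  also have "\<dots> \<le> (\<integral>\<^sup>+ x. kap ?d * ?g x \<partial>TT i)" by (intro nn_integral_mono inner)
  also have "\<dots> = kap ?d * (\<integral>\<^sup>+ x. ?g x \<partial>TT i)" using gm by (rule nn_integral_cmult)
  also have "\<dots> \<le> kap ?d * kap ?d ^ i" using Suc by (intro mult_left_mono) auto
  finally show ?case by simp
qed

text \<open>By \<open>reduced_weight_bound\<close> the integrand is at most a constant times the
  product of weights whose integral has just been bounded.\<close>

lemma reduced_volume_finite:
  "(\<integral>\<^sup>+ V. (if reduced V \<and> 1 \<le> \<bar>det (mat_of V)\<bar> \<and> \<bar>det (mat_of V)\<bar> \<le> 2 ^ CARD('n)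
      then ennreal ((\<Prod>i<CARD('n). 1 + 4 / norm (gs V i)) ^ (CARD('n) - 1)) else 0)
    \<partial>(TT CARD('n) :: (nat \<Rightarrow> real^'n) measure)) < \<infinity>"
proof -
  let ?d = "CARD('n)"
  let ?C = "5 ^ (?d * (?d - 1)) * exp (7 * real ?d ^ 3 * ln 2)"
  let ?g = "\<lambda>V :: nat \<Rightarrow> real^'n. \<Prod>l<?d. wt V l (real ?d + real ?d - 1 - 2 * real l)"
  have pt: "(if reduced V \<and> 1 \<le> \<bar>det (mat_of V)\<bar> \<and> \<bar>det (mat_of V)\<bar> \<le> 2 ^ ?d
      then ennreal ((\<Prod>i<?d. 1 + 4 / norm (gs V i)) ^ (?d - 1)) else 0) \<le> ennreal ?C * ?g V" for V :: "nat \<Rightarrow> real^'n"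
  proof (cases "reduced V \<and> 1 \<le> \<bar>det (mat_of V)\<bar> \<and> \<bar>det (mat_of V)\<bar> \<le> 2 ^ ?d")
    case True
    then have r: "\<And>i. i < ?d \<Longrightarrow> gs V i \<noteq> 0" "\<And>i j. i < ?d \<Longrightarrow> j < i \<Longrightarrow> \<bar>mu V i j\<bar> \<le> 1/2"
      "\<And>i. Suc i < ?d \<Longrightarrow> norm (gs V i) \<le> 2 * norm (gs V (Suc i))"
      by (auto simp: reduced_def)
    have "(\<Prod>i<?d. 1 + 4 / norm (gs V i)) ^ (?d - 1) \<le>
      ?C * (\<Prod>i<?d. exp (- (1/2) * \<bar>ln (norm (gs V i))\<bar> - (2 * (real ?d - 1 - real i) + 1) * ln (norm (gs V i))))"
      using True r unfolding abs_det_mat_of by (intro reduced_weight_bound) (auto simp: Suc_leI)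
    also have "(\<Prod>i<?d. exp (- (1/2) * \<bar>ln (norm (gs V i))\<bar> - (2 * (real ?d - 1 - real i) + 1) * ln (norm (gs V i)))) =
       (\<Prod>i<?d. exp (- (1/2) * \<bar>ln (norm (gs V i))\<bar> - (real ?d + real ?d - 1 - 2 * real i) * ln (norm (gs V i))))"
      by (intro prod.cong refl arg_cong[where f = exp]) (simp add: algebra_simps)
    finally have le: "(\<Prod>i<?d. 1 + 4 / norm (gs V i)) ^ (?d - 1) \<le> ?C * \<dots>" .
    have "?g V = (\<Prod>i<?d. ennreal (exp (- (1/2) * \<bar>ln (norm (gs V i))\<bar> - (real ?d + real ?d - 1 - 2 * real i) * ln (norm (gs V i)))))"
      using r by (intro prod.cong) (auto simp: wt_def)
    also have "\<dots> = ennreal (\<Prod>i<?d. exp (- (1/2) * \<bar>ln (norm (gs V i))\<bar> - (real ?d + real ?d - 1 - 2 * real i) * ln (norm (gs V i))))"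
      by (rule prod_ennreal) simp
    finally have g: "?g V = \<dots>" .
    show ?thesis unfolding g using True ennreal_leI[OF le]
      by (simp only: if_True simp_thms) (subst ennreal_mult'[symmetric], auto)
  qed auto
  have "(\<integral>\<^sup>+ V. (if reduced V \<and> 1 \<le> \<bar>det (mat_of V)\<bar> \<and> \<bar>det (mat_of V)\<bar> \<le> 2 ^ ?d
      then ennreal ((\<Prod>i<?d. 1 + 4 / norm (gs V i)) ^ (?d - 1)) else 0) \<partial>(TT ?d :: (nat \<Rightarrow> real^'n) measure))
    \<le> (\<integral>\<^sup>+ V. ennreal ?C * ?g V \<partial>(TT ?d :: (nat \<Rightarrow> real^'n) measure))"
    by (intro nn_integral_mono pt)
  also have "\<dots> = ennreal ?C * (\<integral>\<^sup>+ V. ?g V \<partial>(TT ?d :: (nat \<Rightarrow> real^'n) measure))"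
    by (intro nn_integral_cmult borel_measurable_prod_ennreal borel_measurable_wt) simp
  also have "\<dots> \<le> ennreal ?C * kap ?d ^ ?d" by (intro mult_left_mono weight_integral) auto
  also have "\<dots> < \<infinity>" using kap_finite[of ?d] by (simp add: ennreal_mult_less_top power_less_top_ennreal)
  finally show ?thesis .
qed

section \<open>Finite moments of the lattice point count\<close>

lemma SLZ_inv_Cdet: "SLZ_inv CARD('n) (Cdet :: (nat \<Rightarrow> real^'n) set)"
proof -
  have "tmul CARD('n) A m \<in> Cdet" if A: "A \<in> Cdet" and m: "m \<in> SLZ" for A and m :: "real^'n^'n"
  proof -
    have "tmul CARD('n) A m i \<in> Zv" if "i < CARD('n)" for i
      using A m that by (auto simp: tmul_def Cdet_def SLZ_def PiE_iff intro!: Zv_vector_matrix)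
    then have "tmul CARD('n) A m \<in> PiE {..<CARD('n)} (\<lambda>_. Zv)" by (auto simp: PiE_iff tmul_def)
    then show ?thesis using A m by (simp add: Cdet_def mat_of_tmul det_mul SLZ_def)
  qed
  then show ?thesis by (auto simp: SLZ_inv_def Cdet_def)
qed

lemma borel_measurable_mat_of [measurable]:
  "(\<lambda>X. mat_of X :: real^'n^'n) \<in> borel_measurable (TT CARD('n))"
proof -
  have "(\<lambda>X :: nat \<Rightarrow> real^'n. mat_of X \<bullet> b) \<in> borel_measurable (TT CARD('n))" if b: "b \<in> Basis" for b
  proof -
    obtain i c where b': "b = axis i c" using b by (auto simp: Basis_vec_def)
    have "(\<lambda>X :: nat \<Rightarrow> real^'n. X (idx i) \<bullet> c) \<in> borel_measurable (TT CARD('n))"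
      by (intro borel_measurable_inner borel_measurable_TT_component) auto
    then show ?thesis by (simp add: b' inner_axis mat_of_def)
  qed
  then show ?thesis by (subst borel_measurable_euclidean_space) auto
qed

text \<open>Hadamard's inequality: orthogonalisation does not lengthen a vector.\<close>

lemma abs_det_le_norms:
  fixes v :: "nat \<Rightarrow> real^'n"
  shows "\<bar>det (mat_of v)\<bar> \<le> (\<Prod>i<CARD('n). norm (v i))"
  unfolding abs_det_mat_of
proof (rule prod_mono)
  fix i show "0 \<le> norm (gs v i) \<and> norm (gs v i) \<le> norm (v i)"
    using gs_le_dist[of 0 v i] by (simp add: span_zero)
qed

definition bdd_tuples :: "nat \<Rightarrow> real \<Rightarrow> (nat \<Rightarrow> real^'n) set" where
  "bdd_tuples r R = PiE {..<r} (\<lambda>_. cball 0 R)"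

lemma sets_bdd_tuples [measurable]: "bdd_tuples r R \<in> sets (TT r)"
  unfolding bdd_tuples_def by (intro sets_PiM_I_finite) auto

lemma UN_bdd_tuples: "(\<Union>R::nat. bdd_tuples r (real R) :: (nat \<Rightarrow> real^'n) set) = space (TT r)"
proof
  show "space (TT r) \<subseteq> (\<Union>R::nat. bdd_tuples r (real R) :: (nat \<Rightarrow> real^'n) set)"
  proof
    fix X :: "nat \<Rightarrow> real^'n" assume X: "X \<in> space (TT r)"
    obtain R :: nat where R: "(\<Sum>i<r. norm (X i)) \<le> real R" using real_arch_simple by blast
    have "norm (X i) \<le> real R" if "i < r" for i
      using member_le_sum[of i "{..<r}" "\<lambda>i. norm (X i)"] that R by simp
    then show "X \<in> (\<Union>R::nat. bdd_tuples r (real R))"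
      using X by (auto simp: bdd_tuples_def space_PiM PiE_iff)
  qed
qed (auto simp: bdd_tuples_def space_PiM)

lemma sigma_finite_bdd_tuples:
  assumes "sets K = sets (TT r)" "\<And>R::nat. emeasure K (bdd_tuples r (real R)) \<noteq> \<infinity>"
  shows "sigma_finite_measure (K :: (nat \<Rightarrow> real^'n) measure)"
proof
  let ?A = "range (\<lambda>R::nat. bdd_tuples r (real R) :: (nat \<Rightarrow> real^'n) set)"
  have "countable ?A" "?A \<subseteq> sets K" "\<Union>?A = space K" "\<forall>a\<in>?A. emeasure K a \<noteq> \<infinity>"
    using assms UN_bdd_tuples[where 'n = 'n, of r] sets_eq_imp_space_eq[OF assms(1)] by auto
  then show "\<exists>A. countable A \<and> A \<subseteq> sets K \<and> \<Union>A = space K \<and> (\<forall>a\<in>A. emeasure K a \<noteq> \<infinity>)" by blast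
qed

text \<open>Relative to one bounded basis \<open>A0\<close> every other bounded basis has an
  integral transition matrix, whose entries are bounded by Cramer's rule and Hadamard's inequality.
  The bound does not depend on \<open>g\<close>, and this makes the intensity measure of bases
  finite on bounded sets.\<close>

lemma card_Cdet_bdd:
  fixes R :: real
  shows "\<exists>K::nat. \<forall>g::real^'n^'n. det g = 1 \<longrightarrow>
    (\<integral>\<^sup>+ A. indicator (bdd_tuples CARD('n) R) (tmul CARD('n) A g) \<partial>count_space Cdet) \<le> of_nat K"
proof -
  let ?d = "CARD('n)"
  let ?Z = "{z::real^'n. z \<in> Zv \<and> (\<forall>j. \<bar>z $ j\<bar> \<le> \<bar>R\<bar> ^ ?d)}"
  let ?G = "{m::real^'n^'n. \<forall>i. m $ i \<in> ?Z}"
  have G: "finite ?G" by (intro finite_matrices_rows finite_Zv_box)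
  have "(\<integral>\<^sup>+ A. indicator (bdd_tuples ?d R) (tmul ?d A g) \<partial>count_space Cdet) \<le> of_nat (card ?G)"
    if g: "det g = 1" for g :: "real^'n^'n"
  proof -
    let ?S = "{A \<in> Cdet. tmul ?d A g \<in> bdd_tuples ?d R}"
    have S: "finite ?S \<and> card ?S \<le> card ?G"
    proof (cases "?S = {}")
      case False
      then obtain A0 where A0: "A0 \<in> Cdet" "tmul ?d A0 g \<in> bdd_tuples ?d R" by blast
      have "mat_of A0 \<in> SLZ" using A0(1) by (auto simp: SLZ_def Cdet_def mat_of_def PiE_iff)
      then obtain m' where m': "m' \<in> SLZ" "mat_of A0 ** m' = mat 1" "m' ** mat_of A0 = mat 1" using SLZ_inverse by blast
      have "mat_of A ** m' \<in> ?G" if A: "A \<in> ?S" for A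
      proof -
        let ?m = "mat_of A ** m'"
        have mZ: "?m $ i \<in> Zv" for i
          using A m'(1) by (auto simp: row_matrix_mult Cdet_def PiE_iff mat_of_def SLZ_def intro!: Zv_vector_matrix)
        have "\<bar>?m $ i $ j\<bar> \<le> \<bar>R\<bar> ^ ?d" for i j
        proof -
          let ?U = "mat_of A0 ** g"
          let ?V = "mat_of A ** g"
          have "?m ** ?U = ?V"
          proof -
            have "?m ** ?U = mat_of A ** (m' ** mat_of A0) ** g" by (simp only: matrix_mul_assoc)
            then show ?thesis using m'(3) by simp
          qed
          then have "?V $ i = (\<Sum>k\<in>UNIV. (?m $ i) $ k *s row k ?U)"
          proof -
            have "?V $ i = (?m ** ?U) $ i" using \<open>?m ** ?U = ?V\<close> by simp
            also have "\<dots> = ?m $ i v* ?U" by (rule row_matrix_mult)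
            also have "\<dots> = (\<Sum>k\<in>UNIV. (?m $ i) $ k *s row k ?U)"
              unfolding vector_matrix_sum_rows by (simp add: scalar_mult_eq_scaleR row_def)
            finally show ?thesis .
          qed
          then have "det (\<chi> l. if l = j then ?V $ i else row l ?U) = ?m $ i $ j * det ?U"
            using cramer_lemma_transpose[of j "?m $ i" ?U] by (simp only:)
          moreover have "det ?U = 1" using g A0(1) by (simp add: det_mul Cdet_def)
          ultimately have md: "?m $ i $ j = det (\<chi> l. if l = j then ?V $ i else row l ?U)" by simp
          \<comment> \<open>\<open>W\<close> is the basis given by \<open>A0\<close> with its vector
            at \<open>j\<close> replaced by the vector at \<open>i\<close> of the other basis. Its
            determinant is the entry of the transition matrix.\<close>
          define W where "W k = (if k = idx j then tmul ?d A g (idx i) else tmul ?d A0 g k)" for k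
          have "(\<chi> l. if l = j then ?V $ i else row l ?U) = mat_of W"
            by (simp add: vec_eq_iff mat_of_def W_def row_def row_matrix_mult tmul_def)
          then have "\<bar>?m $ i $ j\<bar> \<le> (\<Prod>k<?d. norm (W k))" using md abs_det_le_norms[of W] by simp
          also have "\<dots> \<le> (\<Prod>k<?d. \<bar>R\<bar>)"
          proof (rule prod_mono)
            fix k assume k: "k \<in> {..<?d}"
            have "tmul ?d A g (idx i) \<in> cball 0 R" "tmul ?d A0 g k \<in> cball 0 R"
              using A A0(2) k PiE_mem[of _ "{..<?d}" "\<lambda>_. cball 0 R"] by (auto simp: bdd_tuples_def)
            then show "0 \<le> norm (W k) \<and> norm (W k) \<le> \<bar>R\<bar>"
              by (auto simp: W_def)
          qed
          finally show ?thesis by simp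
        qed
        then show ?thesis using mZ by blast
      qed
      then have sub: "(\<lambda>A. mat_of A ** m') ` ?S \<subseteq> ?G" by blast
      have inj: "inj_on (\<lambda>A. mat_of A ** m') ?S"
      proof (rule inj_onI)
        fix A B assume AB: "A \<in> ?S" "B \<in> ?S" "mat_of A ** m' = mat_of B ** m'"
        then have "(mat_of A ** m') ** mat_of A0 = (mat_of B ** m') ** mat_of A0" by simp
        then have e: "mat_of A = mat_of B" by (simp add: matrix_mul_assoc[symmetric] m')
        have "A k = B k" if k: "k < ?d" for k
        proof -
          obtain i :: 'n where "idx i = k" using idx_ex[OF k] by blast
          then show ?thesis using e by (auto simp: mat_of_def vec_eq_iff)
        qed
        then show "A = B" using AB by (intro PiE_ext[of A "{..<?d}" "\<lambda>_. Zv" B]) (auto simp: Cdet_def)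
      qed
      show ?thesis using finite_subset[OF sub G] card_mono[OF G sub] finite_imageD[OF _ inj] card_image[OF inj] by auto
    next
      case True then show ?thesis by (simp only: True finite.emptyI card.empty zero_le simp_thms)
    qed
    have "(\<integral>\<^sup>+ A. indicator (bdd_tuples ?d R) (tmul ?d A g) \<partial>count_space Cdet) = (\<integral>\<^sup>+ A. indicator ?S A \<partial>count_space Cdet)"
      by (intro nn_integral_cong) (auto simp: indicator_def)
    also have "\<dots> = of_nat (card ?S)"
      using S by (subst nn_integral_indicator) (auto simp: emeasure_count_space_finite)
    finally show ?thesis using S by simp
  qed
  then show ?thesis by blast
qed

context asl_measure
begin

lemma AE_nuC:
  assumes C: "SLZ_inv r C" and m: "{X \<in> space (TT r). Q X} \<in> sets (TT r)"
    and Q: "\<And>A g. A \<in> C \<Longrightarrow> det g = 1 \<Longrightarrow> Q (tmul r A g)"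
  shows "AE X in nuC r C. Q X"
proof -
  have s: "space (nuC r C) = space (TT r)" using sets_eq_imp_space_eq[OF sets_nuC] .
  let ?N = "space (TT r) - {X \<in> space (TT r). Q X}"
  have N: "?N \<in> sets (TT r)" using m by auto
  have "emeasure (nuC r C) ?N = (\<integral>\<^sup>+ q. 0 \<partial>P)"
    unfolding emeasure_nuC[OF C N]
  proof (rule AE_P_cong)
    fix q :: "'n asl" assume "det (fst q) = 1"
    then have "(\<integral>\<^sup>+ A. indicator ?N (tmul r A (fst q)) \<partial>count_space C) = (\<integral>\<^sup>+ A. 0 \<partial>count_space C)"
      using Q by (intro nn_integral_cong) (auto simp: indicator_def)
    then show "(\<integral>\<^sup>+ A. indicator ?N (tmul r A (fst q)) \<partial>count_space C) = 0" by simp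
  qed
  then show ?thesis using N s by (intro AE_I[of _ _ ?N]) auto
qed

lemma sigma_finite_nuC_Cdet: "sigma_finite_measure (nuC CARD('n) Cdet)"
proof (rule sigma_finite_bdd_tuples[OF sets_nuC])
  fix R :: nat
  obtain K :: nat where K: "\<And>g::real^'n^'n. det g = 1 \<Longrightarrow>
    (\<integral>\<^sup>+ A. indicator (bdd_tuples CARD('n) R) (tmul CARD('n) A g) \<partial>count_space Cdet) \<le> of_nat K"
    using card_Cdet_bdd[of "real R"] by auto
  have "emeasure (nuC CARD('n) Cdet) (bdd_tuples CARD('n) (real R)) \<le> (\<integral>\<^sup>+ q. of_nat K \<partial>P)"
    unfolding emeasure_nuC[OF SLZ_inv_Cdet sets_bdd_tuples]
    using AE_det by (intro nn_integral_mono_AE) (auto elim!: eventually_mono intro: K)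
  also have "\<dots> = of_nat K" using emeasure_space_1 by simp
  finally show "emeasure (nuC CARD('n) Cdet) (bdd_tuples CARD('n) (real R)) \<noteq> \<infinity>"
    by (auto simp: top_unique)
qed

end

text \<open>Haar measure on \<open>SL\<close>: the image of Lebesgue measure on \<open>1 \<le> det \<le> 2 ^ d\<close> under radial
  projection to \<open>det = 1\<close>.\<close>

definition shell :: "(nat \<Rightarrow> real^'n) set" where
  "shell = {X \<in> space (TT CARD('n)). 1 \<le> det (mat_of X) \<and> det (mat_of X) \<le> 2 ^ CARD('n)}"

definition rad :: "(nat \<Rightarrow> real^'n) \<Rightarrow> nat \<Rightarrow> real^'n" where
  "rad X = restrict (\<lambda>i. (1 / root CARD('n) (det (mat_of X))) *\<^sub>R X i) {..<CARD('n)}"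

definition lamSL :: "(nat \<Rightarrow> real^'n) measure" where
  "lamSL = distr (density (TT CARD('n)) (indicator shell)) (TT CARD('n)) rad"

lemma sets_shell [measurable]: "(shell :: (nat \<Rightarrow> real^'n) set) \<in> sets (TT CARD('n))"
  unfolding shell_def by measurable

lemma measurable_rad [measurable]: "rad \<in> measurable (TT CARD('n)) (TT CARD('n) :: (nat \<Rightarrow> real^'n) measure)"
  unfolding rad_def[abs_def]
proof (rule measurable_restrict)
  fix i assume "i \<in> {..<CARD('n)}"
  then have [measurable]: "(\<lambda>X :: nat \<Rightarrow> real^'n. X i) \<in> borel_measurable (TT CARD('n))" by simp
  have "root CARD('n) \<in> borel_measurable borel"
    by (intro borel_measurable_continuous_onI continuous_intros)
  then have [measurable]: "(\<lambda>X :: nat \<Rightarrow> real^'n. root CARD('n) (det (mat_of X))) \<in> borel_measurable (TT CARD('n))"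
    by (rule measurable_compose[rotated]) measurable
  show "(\<lambda>X :: nat \<Rightarrow> real^'n. (1 / root CARD('n) (det (mat_of X))) *\<^sub>R X i) \<in> measurable (TT CARD('n)) lborel"
    unfolding measurable_lborel2 by measurable
qed

lemma sets_lamSL [simp, measurable_cong]: "sets (lamSL :: (nat \<Rightarrow> real^'n) measure) = sets (TT CARD('n))"
  by (simp add: lamSL_def)

lemma nn_integral_lamSL:
  fixes f :: "(nat \<Rightarrow> real^'n) \<Rightarrow> ennreal"
  assumes f: "f \<in> borel_measurable (TT CARD('n))"
  shows "(\<integral>\<^sup>+ X. f X \<partial>lamSL) = (\<integral>\<^sup>+ X. indicator shell X * f (rad X) \<partial>TT CARD('n))"
proof -
  have m: "rad \<in> measurable (density (TT CARD('n)) (indicator shell)) (TT CARD('n) :: (nat \<Rightarrow> real^'n) measure)"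
    using measurable_rad by simp
  have "(\<integral>\<^sup>+ X. f X \<partial>lamSL) = (\<integral>\<^sup>+ X. f (rad X) \<partial>density (TT CARD('n)) (indicator shell))"
    unfolding lamSL_def by (subst nn_integral_distr[OF m]) (use f in simp_all)
  also have "\<dots> = (\<integral>\<^sup>+ X. indicator shell X * f (rad X) \<partial>TT CARD('n))"
    by (rule nn_integral_density) (use measurable_compose[OF measurable_rad f] in simp_all)
  finally show ?thesis .
qed

lemma root_shell:
  assumes "X \<in> (shell :: (nat \<Rightarrow> real^'n) set)"
  shows "1 \<le> root CARD('n) (det (mat_of X))" "root CARD('n) (det (mat_of X)) \<le> 2"
proof -
  have d: "1 \<le> det (mat_of X)" "det (mat_of X) \<le> 2 ^ CARD('n)" using assms by (auto simp: shell_def)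
  show "1 \<le> root CARD('n) (det (mat_of X))"
    using real_root_le_mono[OF _ d(1), of "CARD('n)"] by simp
  show "root CARD('n) (det (mat_of X)) \<le> 2"
    using real_root_le_mono[OF _ d(2), of "CARD('n)"] by (simp add: real_root_power_cancel)
qed

lemma mat_of_restrict_scale:
  "mat_of (restrict (\<lambda>i. c *\<^sub>R X i) {..<CARD('n)}) = c *\<^sub>R mat_of (X :: nat \<Rightarrow> real^'n)"
  by (simp add: mat_of_def vec_eq_iff)

lemma det_rad:
  assumes "det (mat_of X) > 0" shows "det (mat_of (rad (X :: nat \<Rightarrow> real^'n))) = 1"
  using assms by (simp add: rad_def mat_of_restrict_scale det_scaleR power_divide real_root_pow_pos2)

lemma tmul_shell:
  assumes "det (h::real^'n^'n) = 1" "X \<in> space (TT CARD('n))"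
  shows "tmul CARD('n) X h \<in> shell \<longleftrightarrow> X \<in> shell"
  using assms by (simp add: shell_def mat_of_tmul det_mul)

lemma rad_tmul:
  assumes "det (h::real^'n^'n) = 1"
  shows "rad (tmul CARD('n) X h) = tmul CARD('n) (rad X) h"
proof -
  have d: "det (mat_of (tmul CARD('n) X h)) = det (mat_of X)" using assms by (simp add: mat_of_tmul det_mul)
  show ?thesis unfolding rad_def d by (auto simp: tmul_def fun_eq_iff scaleR_vector_matrix_assoc)
qed

text \<open>Right multiplication by \<open>h\<close> preserves Lebesgue measure and the determinant,
  hence the shell, and it commutes with the radial projection.\<close>

lemma lamSL_invariant:
  assumes h: "det (h::real^'n^'n) = 1"
  shows "distr lamSL (TT CARD('n)) (\<lambda>X. tmul CARD('n) X h) = lamSL"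
proof (rule measure_eqI)
  let ?d = "CARD('n)"
  have m: "(\<lambda>X. tmul ?d X h) \<in> measurable lamSL (TT ?d)" "(\<lambda>X. tmul ?d X h) \<in> measurable (TT ?d) (TT ?d)"
    by (intro measurable_tmul, auto intro: measurable_ident_sets)+
  fix S assume "S \<in> sets (distr lamSL (TT ?d) (\<lambda>X. tmul ?d X h))"
  then have S[measurable]: "S \<in> sets (TT ?d)" by simp
  have mi: "(\<lambda>X. indicator S (tmul ?d X h) :: ennreal) \<in> borel_measurable (TT ?d)"
    using measurable_compose[OF m(2)] by simp
  have mS: "(\<lambda>X. indicator shell X * indicator S (rad X) :: ennreal) \<in> borel_measurable (TT ?d)"
    using measurable_compose[OF measurable_rad, of "indicator S"] by simp
  have "emeasure (distr lamSL (TT ?d) (\<lambda>X. tmul ?d X h)) S = (\<integral>\<^sup>+ X. indicator S X \<partial>distr lamSL (TT ?d) (\<lambda>X. tmul ?d X h))"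
    by simp
  also have "\<dots> = (\<integral>\<^sup>+ X. indicator S (tmul ?d X h) \<partial>lamSL)"
    by (subst nn_integral_distr[OF m(1)]) simp_all
  also have "\<dots> = (\<integral>\<^sup>+ X. indicator shell X * indicator S (tmul ?d (rad X) h) \<partial>TT ?d)"
    by (rule nn_integral_lamSL[OF mi])
  also have "\<dots> = (\<integral>\<^sup>+ X. indicator shell (tmul ?d X h) * indicator S (rad (tmul ?d X h)) \<partial>TT ?d)"
    using h by (intro nn_integral_cong) (simp add: rad_tmul indicator_def tmul_shell del: space_PiM)
  also have "\<dots> = (\<integral>\<^sup>+ X. indicator shell X * indicator S (rad X) \<partial>distr (TT ?d) (TT ?d) (\<lambda>X. tmul ?d X h))"
    by (rule nn_integral_distr[OF m(2), symmetric]) (use mS in simp)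
  also have "\<dots> = (\<integral>\<^sup>+ X. indicator shell X * indicator S (rad X) \<partial>TT ?d)" using h by (simp add: distr_TT_tmul)
  also have "\<dots> = (\<integral>\<^sup>+ X. indicator S X \<partial>lamSL)" by (rule nn_integral_lamSL[symmetric]) simp
  also have "\<dots> = emeasure lamSL S" by simp
  finally show "emeasure (distr lamSL (TT ?d) (\<lambda>X. tmul ?d X h)) S = emeasure lamSL S" .
qed simp

lemma emeasure_bdd_tuples:
  "emeasure (TT r) (bdd_tuples r R :: (nat \<Rightarrow> real^'n) set) = emeasure lborel (cball (0::real^'n) R) ^ r"
proof -
  interpret product_sigma_finite "\<lambda>_::nat. lborel :: (real^'n) measure" by (rule product_sigma_finite_lborel)
  show ?thesis unfolding bdd_tuples_def by (subst emeasure_PiM) auto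
qed

text \<open>On the shell the radial projection divides by a number between \<open>1\<close> and
  \<open>2\<close>, so bounded sets have bounded preimages there.\<close>

lemma sigma_finite_lamSL: "sigma_finite_measure (lamSL :: (nat \<Rightarrow> real^'n) measure)"
proof (rule sigma_finite_bdd_tuples[OF sets_lamSL])
  let ?d = "CARD('n)"
  fix R :: nat
  have "emeasure (lamSL :: (nat \<Rightarrow> real^'n) measure) (bdd_tuples ?d (real R)) = (\<integral>\<^sup>+ X. indicator (bdd_tuples ?d (real R)) X \<partial>(lamSL :: (nat \<Rightarrow> real^'n) measure))"
    by simp
  also have "\<dots> = (\<integral>\<^sup>+ X. indicator shell X * indicator (bdd_tuples ?d (real R)) (rad X) \<partial>(TT ?d :: (nat \<Rightarrow> real^'n) measure))"
    by (rule nn_integral_lamSL) simp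
  also have "\<dots> \<le> (\<integral>\<^sup>+ X. indicator (bdd_tuples ?d (2 * real R)) X \<partial>(TT ?d :: (nat \<Rightarrow> real^'n) measure))"
  proof (rule nn_integral_mono)
    fix X :: "nat \<Rightarrow> real^'n" assume Xs: "X \<in> space (TT ?d)"
    show "indicator shell X * indicator (bdd_tuples ?d (real R)) (rad X) \<le> (indicator (bdd_tuples ?d (2 * real R)) X :: ennreal)"
    proof (cases "X \<in> shell \<and> rad X \<in> bdd_tuples ?d (real R)")
      case True
      define t where "t = root ?d (det (mat_of X))"
      have t: "1 \<le> t" "t \<le> 2" using root_shell[of X] True by (auto simp: t_def)
      have "norm (X i) \<le> 2 * real R" if i: "i < ?d" for i
      proof -
        have "norm ((1 / t) *\<^sub>R X i) \<le> real R" using True i by (auto simp: rad_def bdd_tuples_def t_def PiE_iff)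
        then have "norm (X i) \<le> real R * t" using t by (simp add: divide_le_eq)
        also have "\<dots> \<le> real R * 2" using t by (intro mult_left_mono) auto
        finally show ?thesis by simp
      qed
      then have "X \<in> bdd_tuples ?d (2 * real R)" using Xs by (auto simp: bdd_tuples_def space_PiM PiE_iff)
      then show ?thesis by (simp add: indicator_def)
    qed (auto simp: indicator_def)
  qed
  also have "\<dots> = emeasure (TT ?d :: (nat \<Rightarrow> real^'n) measure) (bdd_tuples ?d (2 * real R))" by simp
  also have "\<dots> < \<infinity>" unfolding emeasure_bdd_tuples
    using emeasure_lborel_cball_finite[of "0::real^'n" "2 * real R"] by (simp add: power_less_top_ennreal)
  finally show "emeasure (lamSL :: (nat \<Rightarrow> real^'n) measure) (bdd_tuples ?d (real R)) \<noteq> \<infinity>" by simp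
qed

lemma norm_matrix_le_rows: "norm (m :: real^'n^'n) \<le> (\<Sum>i\<in>UNIV. norm (m $ i))"
  unfolding norm_vec_def[of m] by (rule L2_set_le_sum) simp

text \<open>The identity scaled by \<open>3/2\<close> has determinant \<open>(3/2) ^ d\<close>,
  strictly inside the range of the shell, so a product of small balls around its rows lies in the
  shell.\<close>

lemma lamSL_nonzero: "emeasure (lamSL :: (nat \<Rightarrow> real^'n) measure) (space lamSL) \<noteq> 0"
proof -
  interpret product_sigma_finite "\<lambda>_::nat. lborel :: (real^'n) measure" by (rule product_sigma_finite_lborel)
  let ?d = "CARD('n)"
  let ?m = "(3/2) *\<^sub>R mat 1 :: real^'n^'n"
  have dm: "det ?m = (3/2) ^ ?d" by (simp add: det_scaleR)
  have pos: "1 < det ?m" "det ?m < 2 ^ ?d" unfolding dm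
    by (auto intro: one_less_power power_strict_mono)
  have "continuous_on UNIV (\<lambda>m::real^'n^'n. det m)" unfolding det_def by (intro continuous_intros)
  then have op: "open ((\<lambda>m::real^'n^'n. det m) -` {1<..<2 ^ ?d})"
    by (intro open_vimage) auto
  then obtain e where e: "e > 0" "\<And>m. dist m ?m < e \<Longrightarrow> det m \<in> {1<..<2 ^ ?d}"
    using pos unfolding open_dist by (metis greaterThanLessThan_iff vimageE vimageI2)
  define c where "c k = (?m $ (inv idx k))" for k
  have inv: "inv idx (idx i) = i" for i :: 'n by (intro inv_f_f) (simp add: inj_def)
  let ?S = "PiE {..<?d} (\<lambda>k. ball (c k) (e / (2 * real ?d)))"
  have S: "?S \<in> sets (TT ?d)" by (intro sets_PiM_I_finite) auto
  have e': "e / (2 * real ?d) > 0" using e by simp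
  have "?S \<subseteq> shell"
  proof
    fix X assume X: "X \<in> ?S"
    have "dist (mat_of X) ?m \<le> (\<Sum>i\<in>UNIV. norm ((mat_of X - ?m) $ i))"
      unfolding dist_norm by (rule norm_matrix_le_rows)
    also have "\<dots> \<le> (\<Sum>i\<in>(UNIV::'n set). e / (2 * real ?d))"
    proof (rule sum_mono)
      fix i :: 'n
      have "dist (c (idx i)) (X (idx i)) < e / (2 * real ?d)" using X idx_less[of i] by (auto simp: PiE_iff)
      then show "norm ((mat_of X - ?m) $ i) \<le> e / (2 * real ?d)"
        by (simp add: c_def inv mat_of_def dist_norm norm_minus_commute del: vector_scaleR_component)
    qed
    also have "\<dots> = e / 2" by simp
    also have "\<dots> < e" using e by simp
    finally have "det (mat_of X) \<in> {1<..<2 ^ ?d}" using e(2) by blast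
    then show "X \<in> shell" using X by (auto simp: shell_def space_PiM PiE_iff)
  qed
  then have "emeasure (TT ?d) ?S \<le> emeasure (TT ?d) (shell :: (nat \<Rightarrow> real^'n) set)"
    by (intro emeasure_mono sets_shell)
  moreover have "emeasure (TT ?d) ?S = (\<Prod>k<?d. emeasure lborel (ball (c k) (e / (2 * real ?d))))"
    by (rule emeasure_PiM) auto
  moreover have "(\<Prod>k<?d. emeasure lborel (ball (c k) (e / (2 * real ?d)))) \<noteq> 0"
    using e' unit_ball_vol_pos[of "real ?d"] by (simp add: emeasure_ball less_imp_neq[symmetric])
  moreover have "emeasure (lamSL :: (nat \<Rightarrow> real^'n) measure) (space lamSL) = emeasure (TT ?d) (shell :: (nat \<Rightarrow> real^'n) set)"
  proof -
    have "emeasure (lamSL :: (nat \<Rightarrow> real^'n) measure) (space lamSL) = (\<integral>\<^sup>+ X. 1 \<partial>(lamSL :: (nat \<Rightarrow> real^'n) measure))" by simp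
    also have "\<dots> = (\<integral>\<^sup>+ X. indicator shell X * 1 \<partial>(TT ?d :: (nat \<Rightarrow> real^'n) measure))"
      by (rule nn_integral_lamSL) simp
    finally show ?thesis by simp
  qed
  ultimately show ?thesis by (auto simp: le_zero_eq)
qed

lemma AE_lamSL_det: "AE X in (lamSL :: (nat \<Rightarrow> real^'n) measure). X \<in> space (TT CARD('n)) \<and> det (mat_of X) = 1"
proof -
  let ?d = "CARD('n)"
  let ?N = "{X \<in> space (TT ?d). det (mat_of (X :: nat \<Rightarrow> real^'n)) \<noteq> 1}"
  have N: "?N \<in> sets (TT ?d)" by measurable
  have "emeasure (lamSL :: (nat \<Rightarrow> real^'n) measure) ?N = (\<integral>\<^sup>+ X. indicator ?N X \<partial>(lamSL :: (nat \<Rightarrow> real^'n) measure))"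
    using N by simp
  also have "\<dots> = (\<integral>\<^sup>+ X. indicator shell X * indicator ?N (rad X) \<partial>(TT ?d :: (nat \<Rightarrow> real^'n) measure))"
    by (rule nn_integral_lamSL) (use N in simp)
  also have "\<dots> = (\<integral>\<^sup>+ X. 0 \<partial>(TT ?d :: (nat \<Rightarrow> real^'n) measure))"
  proof (rule nn_integral_cong)
    fix X :: "nat \<Rightarrow> real^'n"
    have "X \<in> shell \<Longrightarrow> det (mat_of (rad X)) = 1" by (rule det_rad) (auto simp: shell_def)
    then show "indicator shell X * indicator ?N (rad X) = (0::ennreal)" by (auto simp: indicator_def)
  qed
  finally have "emeasure (lamSL :: (nat \<Rightarrow> real^'n) measure) ?N = 0" by simp
  moreover have "space (lamSL :: (nat \<Rightarrow> real^'n) measure) = space (TT ?d)" using sets_eq_imp_space_eq[OF sets_lamSL] .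
  ultimately show ?thesis using N by (intro AE_I[of _ _ ?N]) auto
qed

section \<open>The moment of order \<open>d - 1\<close>\<close>

definition NL :: "real^'n^'n \<Rightarrow> real \<Rightarrow> ennreal" where
  "NL g R = (\<integral>\<^sup>+ z. indicator (cball 0 R) (z v* g) \<partial>count_space Zv)"

lemma NL_Nlat: "det (g::real^'n^'n) \<noteq> 0 \<Longrightarrow> NL g R = of_nat (Nlat g R)"
proof -
  assume g: "det g \<noteq> 0"
  have "NL g R = (\<integral>\<^sup>+ z. indicator {z \<in> Zv. norm (z v* g) \<le> R} z \<partial>count_space Zv)"
    unfolding NL_def by (intro nn_integral_cong) (auto simp: indicator_def)
  also have "\<dots> = of_nat (card {z \<in> Zv. norm (z v* g) \<le> R})"
    using finite_Nlat[OF g, of R] by (subst nn_integral_indicator) (auto simp: emeasure_count_space_finite)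
  finally show ?thesis by (simp add: Nlat_def)
qed

lemma borel_measurable_NL [measurable]: "(\<lambda>g. NL g R) \<in> borel_measurable borel"
  unfolding NL_def
proof (intro borel_measurable_countable_nn_integral countable_Zv)
  fix z :: "real^'a"
  have "(\<lambda>g::real^'a^'a. z v* g) \<in> borel_measurable borel"
    by (rule borel_measurable_vector_matrix) auto
  then show "(\<lambda>g::real^'a^'a. indicator (cball 0 R) (z v* g) :: ennreal) \<in> borel_measurable borel"
    by (rule measurable_compose) (rule borel_measurable_indicator, simp)
qed

text \<open>The bound of \<open>Nlat_bound\<close> raised to the power \<open>d - 1\<close>,
  switched off for bases that are not reduced.\<close>

definition redw :: "(nat \<Rightarrow> real^'n) \<Rightarrow> ennreal" where
  "redw X = (if reduced X then ennreal ((\<Prod>i<CARD('n). 1 + 2 / norm (gs X i)) ^ (CARD('n) - 1)) else 0)"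

lemma pred_reduced [measurable]: "Measurable.pred (TT CARD('n)) (reduced :: (nat \<Rightarrow> real^'n) \<Rightarrow> bool)"
proof -
  let ?d = "CARD('n)"
  have a: "{X \<in> space (TT ?d). \<forall>i\<in>{..<?d}. gs (X :: nat \<Rightarrow> real^'n) i \<noteq> 0} \<in> sets (TT ?d)"
  proof (intro sets.sets_Collect_finite_All)
    fix i assume "i \<in> {..<?d}"
    then have [measurable]: "(\<lambda>X. gs X i :: real^'n) \<in> borel_measurable (TT ?d)" by simp
    show "{X \<in> space (TT ?d). gs (X :: nat \<Rightarrow> real^'n) i \<noteq> 0} \<in> sets (TT ?d)" by measurable
  qed simp
  have b: "{X \<in> space (TT ?d). \<forall>i\<in>{..<?d}. \<forall>j\<in>{..<i}. \<bar>mu (X :: nat \<Rightarrow> real^'n) i j\<bar> \<le> 1/2} \<in> sets (TT ?d)"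
  proof (intro sets.sets_Collect_finite_All)
    fix i j assume "i \<in> {..<?d}" "j \<in> {..<i}"
    then have [measurable]: "(\<lambda>X. gs X j :: real^'n) \<in> borel_measurable (TT ?d)"
      "(\<lambda>X. X i :: real^'n) \<in> borel_measurable (TT ?d)" by simp_all
    show "{X \<in> space (TT ?d). \<bar>mu (X :: nat \<Rightarrow> real^'n) i j\<bar> \<le> 1/2} \<in> sets (TT ?d)"
      unfolding mu_def by measurable
  qed simp_all
  have c: "{X \<in> space (TT ?d). \<forall>i\<in>{..<?d - 1}. norm (gs (X :: nat \<Rightarrow> real^'n) i) \<le> 2 * norm (gs X (Suc i))} \<in> sets (TT ?d)"
  proof (intro sets.sets_Collect_finite_All)
    fix i assume i: "i \<in> {..<?d - 1}"
    then have "i < ?d" "Suc i < ?d" by auto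
    then have [measurable]: "(\<lambda>X. gs X i :: real^'n) \<in> borel_measurable (TT ?d)"
      "(\<lambda>X. gs X (Suc i) :: real^'n) \<in> borel_measurable (TT ?d)" by simp_all
    show "{X \<in> space (TT ?d). norm (gs (X :: nat \<Rightarrow> real^'n) i) \<le> 2 * norm (gs X (Suc i))} \<in> sets (TT ?d)"
      by measurable
  qed simp
  have "{X \<in> space (TT ?d). reduced (X :: nat \<Rightarrow> real^'n)} =
    {X \<in> space (TT ?d). \<forall>i\<in>{..<?d}. gs (X :: nat \<Rightarrow> real^'n) i \<noteq> 0} \<inter>
    {X \<in> space (TT ?d). \<forall>i\<in>{..<?d}. \<forall>j\<in>{..<i}. \<bar>mu (X :: nat \<Rightarrow> real^'n) i j\<bar> \<le> 1/2} \<inter>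
    {X \<in> space (TT ?d). \<forall>i\<in>{..<?d - 1}. norm (gs (X :: nat \<Rightarrow> real^'n) i) \<le> 2 * norm (gs X (Suc i))}"
    by (auto simp: reduced_def less_diff_conv)
  then show ?thesis unfolding pred_def using a b c by (simp only: sets.Int)
qed

lemma borel_measurable_redw [measurable]: "redw \<in> borel_measurable (TT CARD('n) :: (nat \<Rightarrow> real^'n) measure)"
proof -
  have [measurable]: "(\<lambda>X. gs X i :: real^'n) \<in> borel_measurable (TT CARD('n))" if "i \<in> {..<CARD('n)}" for i
    using that by simp
  have "(\<lambda>X. (\<Prod>i<CARD('n). 1 + 2 / norm (gs X i :: real^'n)) ^ (CARD('n) - 1)) \<in> borel_measurable (TT CARD('n))"
    by (intro borel_measurable_power borel_measurable_prod) measurable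
  then show ?thesis unfolding redw_def[abs_def] by measurable
qed

text \<open>Division by \<open>t\<close> changes neither the coefficients \<open>mu\<close> nor the
  comparison of successive lengths, so being reduced is unaffected. Since \<open>t \<le> 2\<close>,
  the numerator \<open>2\<close> turns into at most \<open>4\<close>.\<close>

lemma reduced_rad:
  assumes X: "X \<in> (shell :: (nat \<Rightarrow> real^'n) set)"
  shows "redw (rad X) \<le> (if reduced X \<and> 1 \<le> \<bar>det (mat_of X)\<bar> \<and> \<bar>det (mat_of X)\<bar> \<le> 2 ^ CARD('n)
      then ennreal ((\<Prod>i<CARD('n). 1 + 4 / norm (gs X i)) ^ (CARD('n) - 1)) else 0)"
proof (cases "reduced (rad X)")
  case True
  let ?d = "CARD('n)"
  define t where "t = root ?d (det (mat_of X))"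
  have t: "1 \<le> t" "t \<le> 2" using root_shell[OF X] by (auto simp: t_def)
  have gsr: "gs (rad X) i = (1 / t) *\<^sub>R gs X i" if i: "i < ?d" for i
  proof -
    have "gs (rad X) i = gs (\<lambda>i. (1 / t) *\<^sub>R X i) i"
      using i by (intro gs_cong) (auto simp: rad_def t_def)
    then show ?thesis using t by (simp add: gs_scale)
  qed
  have mur: "mu (rad X) i j = mu X i j" if "j < i" "i < ?d" for i j
    using that t gsr[of j] by (simp add: mu_def rad_def t_def[symmetric])
  have ng: "norm (gs (rad X) i) = norm (gs X i) / t" if "i < ?d" for i
    using gsr[OF that] t by simp
  have red: "reduced X"
    using True t unfolding reduced_def by (auto simp: ng mur gsr divide_le_cancel)
  have nz: "norm (gs X i) > 0" if "i < ?d" for i using red that by (simp add: reduced_def)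
  have "(\<Prod>i<?d. 1 + 2 / norm (gs (rad X) i)) ^ (?d - 1) \<le> (\<Prod>i<?d. 1 + 4 / norm (gs X i)) ^ (?d - 1)"
  proof (intro power_mono prod_mono prod_nonneg)
    fix i assume i: "i \<in> {..<?d}"
    have "2 / norm (gs (rad X) i) = 2 * t / norm (gs X i)" using i t by (simp add: ng)
    also have "\<dots> \<le> 4 / norm (gs X i)" using t nz i by (intro divide_right_mono) auto
    finally show "0 \<le> 1 + 2 / norm (gs (rad X) i) \<and> 1 + 2 / norm (gs (rad X) i) \<le> 1 + 4 / norm (gs X i)"
      by (simp add: add_nonneg_nonneg)
  qed (simp add: add_nonneg_nonneg)
  moreover have "1 \<le> \<bar>det (mat_of X)\<bar>" "\<bar>det (mat_of X)\<bar> \<le> 2 ^ ?d" using X by (auto simp: shell_def)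
  ultimately show ?thesis using True red by (simp add: redw_def ennreal_leI)
qed (simp add: redw_def)

lemma integral_redw_finite: "(\<integral>\<^sup>+ X. redw X \<partial>(lamSL :: (nat \<Rightarrow> real^'n) measure)) < \<infinity>"
proof -
  have "(\<integral>\<^sup>+ X. redw X \<partial>(lamSL :: (nat \<Rightarrow> real^'n) measure)) =
    (\<integral>\<^sup>+ X. indicator shell X * redw (rad X) \<partial>(TT CARD('n) :: (nat \<Rightarrow> real^'n) measure))"
    by (rule nn_integral_lamSL[OF borel_measurable_redw])
  also have "\<dots> \<le> (\<integral>\<^sup>+ X. (if reduced X \<and> 1 \<le> \<bar>det (mat_of X)\<bar> \<and> \<bar>det (mat_of X)\<bar> \<le> 2 ^ CARD('n)
      then ennreal ((\<Prod>i<CARD('n). 1 + 4 / norm (gs X i)) ^ (CARD('n) - 1)) else 0) \<partial>(TT CARD('n) :: (nat \<Rightarrow> real^'n) measure))"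
  proof (rule nn_integral_mono)
    fix X :: "nat \<Rightarrow> real^'n"
    show "indicator shell X * redw (rad X) \<le> (if reduced X \<and> 1 \<le> \<bar>det (mat_of X)\<bar> \<and> \<bar>det (mat_of X)\<bar> \<le> 2 ^ CARD('n)
      then ennreal ((\<Prod>i<CARD('n). 1 + 4 / norm (gs X i)) ^ (CARD('n) - 1)) else 0)"
      using reduced_rad[of X] by (cases "X \<in> shell") auto
  qed
  also have "\<dots> < \<infinity>" by (rule reduced_volume_finite)
  finally show ?thesis .
qed

context asl_measure
begin

lemma invariant_pair_nn_integral:
  assumes "invariant_pair r K lam Om"
  shows "\<exists>c. c \<noteq> \<infinity> \<and> (\<forall>f\<in>borel_measurable (TT r). (\<integral>\<^sup>+ X. f X \<partial>K) = c * (\<integral>\<^sup>+ X. f X \<partial>(lam :: (nat \<Rightarrow> real^'n) measure)))"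
proof -
  interpret invariant_pair r K lam Om by fact
  obtain c where c: "c \<noteq> \<infinity>" "\<And>A. A \<in> sets (TT r) \<Longrightarrow> emeasure K A = c * emeasure lam A"
    using invariant_unique by blast
  have "K = scale_measure c lam"
    by (rule measure_eqI) (use c sets_nu sets_lam in \<open>auto\<close>)
  then have "(\<integral>\<^sup>+ X. f X \<partial>K) = c * (\<integral>\<^sup>+ X. f X \<partial>lam)" if "f \<in> borel_measurable (TT r)" for f
    using that measurable_cong_sets[OF sets_lam refl, of borel] by (simp add: nn_integral_scale_measure)
  then show ?thesis using c(1) by blast
qed

text \<open>Every lattice has at least one reduced positively oriented basis, so the sum of
  \<open>redw\<close> over all such bases dominates the power of the counting function. The mean of
  this sum is an integral against the intensity measure of bases, which by uniqueness is a finite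
  multiple of \<open>lamSL\<close>.\<close>

theorem finite_moment: "(\<integral>\<^sup>+ q. NL (fst q) 1 ^ (CARD('n) - 1) \<partial>P) < \<infinity>"
proof -
  let ?d = "CARD('n)"
  let ?Om = "{X \<in> space (TT ?d). det (mat_of (X :: nat \<Rightarrow> real^'n)) = 1}"
  have "invariant_pair ?d (nuC ?d Cdet) lamSL ?Om"
  proof
    show "AE X in nuC ?d Cdet. X \<in> ?Om"
    proof (rule AE_nuC[OF SLZ_inv_Cdet])
      show "{X \<in> space (TT ?d). X \<in> ?Om} \<in> sets (TT ?d)" by measurable
    qed (auto simp: mat_of_tmul det_mul Cdet_def simp del: space_PiM)
    show "AE X in lamSL. X \<in> ?Om" using AE_lamSL_det by simp
    show "\<And>X Y. X \<in> ?Om \<Longrightarrow> Y \<in> ?Om \<Longrightarrow> \<exists>h. det h = 1 \<and> Y = tmul ?d X h"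
      by (rule transitive_det_1) (auto simp: space_TT)
    show "\<And>h. det h = 1 \<Longrightarrow> distr (nuC ?d Cdet) (TT ?d) (\<lambda>X. tmul ?d X h) = nuC ?d Cdet"
      by (rule nuC_invariant[OF SLZ_inv_Cdet])
    show "\<And>h::real^'n^'n. det h = 1 \<Longrightarrow> distr lamSL (TT ?d) (\<lambda>X. tmul ?d X h) = lamSL"
      by (rule lamSL_invariant)
    show "\<exists>A. countable A \<and> A \<subseteq> sets (nuC ?d Cdet) \<and> \<Union>A = space (nuC ?d Cdet) \<and> (\<forall>a\<in>A. emeasure (nuC ?d Cdet) a \<noteq> \<infinity>)"
      using sigma_finite_nuC_Cdet unfolding sigma_finite_measure_def .
    show "\<exists>A. countable A \<and> A \<subseteq> sets lamSL \<and> \<Union>A = space lamSL \<and> (\<forall>a\<in>A. emeasure (lamSL :: (nat \<Rightarrow> real^'n) measure) a \<noteq> \<infinity>)"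
      using sigma_finite_lamSL unfolding sigma_finite_measure_def .
    show "emeasure lamSL (space lamSL :: (nat \<Rightarrow> real^'n) set) \<noteq> 0" by (rule lamSL_nonzero)
  qed simp_all
  then obtain c where c: "c \<noteq> \<infinity>" "\<And>f. f \<in> borel_measurable (TT ?d) \<Longrightarrow>
      (\<integral>\<^sup>+ X. f X \<partial>nuC ?d Cdet) = c * (\<integral>\<^sup>+ X. f X \<partial>(lamSL :: (nat \<Rightarrow> real^'n) measure))"
    using invariant_pair_nn_integral by blast
  have "(\<integral>\<^sup>+ q. NL (fst q) 1 ^ (?d - 1) \<partial>P) \<le> (\<integral>\<^sup>+ q. (\<integral>\<^sup>+ A. redw (tmul ?d A (fst q)) \<partial>count_space Cdet) \<partial>P)"
  proof (rule nn_integral_mono_AE, rule eventually_mono[OF AE_det])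
    fix q :: "'n asl" assume q: "det (fst q) = 1"
    obtain A where A: "A \<in> Cdet" "reduced (tmul ?d A (fst q))" using reduced_basis_exists[OF q] by blast
    have "real (Nlat (fst q) 1) ^ (?d - 1) \<le> (\<Prod>i<?d. 1 + 2 / norm (gs (tmul ?d A (fst q)) i)) ^ (?d - 1)"
      using Nlat_bound[OF q A(1)] by (intro power_mono) auto
    then have "NL (fst q) 1 ^ (?d - 1) \<le> redw (tmul ?d A (fst q))"
      using A q by (simp add: NL_Nlat redw_def ennreal_of_nat_eq_real_of_nat ennreal_power ennreal_leI)
    also have "\<dots> = (\<integral>\<^sup>+ B. redw (tmul ?d B (fst q)) * indicator {A} B \<partial>count_space Cdet)"
      using A by (subst nn_integral_indicator_singleton) auto
    also have "\<dots> \<le> (\<integral>\<^sup>+ B. redw (tmul ?d B (fst q)) \<partial>count_space Cdet)"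
      by (intro nn_integral_mono) (auto simp: indicator_def)
    finally show "NL (fst q) 1 ^ (?d - 1) \<le> (\<integral>\<^sup>+ A. redw (tmul ?d A (fst q)) \<partial>count_space Cdet)" .
  qed
  also have "\<dots> = (\<integral>\<^sup>+ X. redw X \<partial>nuC ?d Cdet)"
    by (rule nn_integral_nuC[OF SLZ_inv_Cdet borel_measurable_redw, symmetric])
  also have "\<dots> = c * (\<integral>\<^sup>+ X. redw X \<partial>(lamSL :: (nat \<Rightarrow> real^'n) measure))" by (rule c(2)) measurable
  also have "\<dots> < \<infinity>" using c(1) integral_redw_finite[where 'n = 'n] by (simp add: ennreal_mult_less_top less_top)
  finally show ?thesis .
qed

end

section \<open>Counting lattice points\<close>

lemma card_le_fibres:
  assumes "finite T" "f ` S \<subseteq> T" "\<And>t. t \<in> T \<Longrightarrow> finite {x \<in> S. f x = t} \<and> card {x \<in> S. f x = t} \<le> m"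
  shows "finite S \<and> card S \<le> card T * m"
proof -
  have S: "S = (\<Union>t\<in>T. {x \<in> S. f x = t})" using assms(2) by auto
  have "card S \<le> (\<Sum>t\<in>T. card {x \<in> S. f x = t})"
    by (subst S) (rule card_UN_le[OF assms(1)])
  also have "\<dots> \<le> (\<Sum>t\<in>T. m)" using assms(3) by (intro sum_mono) auto
  finally have "card S \<le> card T * m" by simp
  moreover have "finite S" by (subst S) (use assms in auto)
  ultimately show ?thesis by blast
qed

lemma card_Zv_box:
  assumes "M \<ge> 0"
  shows "real (card {z::real^'n. z \<in> Zv \<and> (\<forall>i. \<bar>z $ i\<bar> \<le> M)}) \<le> (2 * M + 1) ^ CARD('n)"
proof -
  let ?T = "{t::int. - M \<le> of_int t \<and> of_int t \<le> M}"
  have T: "finite ?T" "real (card ?T) \<le> 1 + (M - - M)" using card_int_interval[of "- M" M] assms by auto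
  let ?P = "PiE (UNIV::'n set) (\<lambda>_. ?T)"
  have "inj_on (\<lambda>z i. \<lfloor>z $ i\<rfloor>) {z::real^'n. z \<in> Zv \<and> (\<forall>i. \<bar>z $ i\<bar> \<le> M)}"
  proof (rule inj_onI)
    fix x y :: "real^'n" assume xy: "x \<in> {z. z \<in> Zv \<and> (\<forall>i. \<bar>z $ i\<bar> \<le> M)}" "y \<in> {z. z \<in> Zv \<and> (\<forall>i. \<bar>z $ i\<bar> \<le> M)}"
      and e: "(\<lambda>i. \<lfloor>x $ i\<rfloor>) = (\<lambda>i. \<lfloor>y $ i\<rfloor>)"
    have "x $ i = y $ i" for i
    proof -
      have "\<lfloor>x $ i\<rfloor> = \<lfloor>y $ i\<rfloor>" using fun_cong[OF e, of i] by simp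
      moreover have "x $ i \<in> \<int>" "y $ i \<in> \<int>" using xy by (auto simp: Zv_def)
      ultimately show ?thesis by (auto elim!: Ints_cases)
    qed
    then show "x = y" by (simp add: vec_eq_iff)
  qed
  moreover have "(\<lambda>z i. \<lfloor>z $ i\<rfloor>) ` {z::real^'n. z \<in> Zv \<and> (\<forall>i. \<bar>z $ i\<bar> \<le> M)} \<subseteq> ?P"
    by (auto simp: Zv_def PiE_iff abs_le_iff minus_le_iff)
  moreover have P: "finite ?P" using T(1) by (intro finite_PiE) auto
  ultimately have "card {z::real^'n. z \<in> Zv \<and> (\<forall>i. \<bar>z $ i\<bar> \<le> M)} \<le> card ?P"
    by (rule card_inj_on_le)
  also have "card ?P = card ?T ^ CARD('n)" by (simp add: card_PiE)
  finally have "real (card {z::real^'n. z \<in> Zv \<and> (\<forall>i. \<bar>z $ i\<bar> \<le> M)}) \<le> real (card ?T) ^ CARD('n)"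
    by (simp flip: of_nat_power)
  also have "\<dots> \<le> (2 * M + 1) ^ CARD('n)" using T(2) by (intro power_mono) auto
  finally show ?thesis .
qed

text \<open>Let \<open>w\<close> be a normal vector of a hyperplane containing \<open>W\<close>. A
  coordinate at which \<open>w\<close> is nonzero is determined by the others, which saves one
  factor.\<close>

lemma card_Zv_box_hyperplane:
  fixes W :: "(real^'n) set"
  assumes "M \<ge> 0" and W: "dim W < CARD('n)"
  shows "real (card {z \<in> W. z \<in> Zv \<and> (\<forall>i. \<bar>z $ i\<bar> \<le> M)}) \<le> (2 * M + 1) ^ (CARD('n) - 1)"
proof -
  obtain w where w: "w \<noteq> 0" "W \<subseteq> {x. w \<bullet> x = 0}"
    using lowdim_subset_hyperplane[of W] W span_superset[of W] by auto
  obtain k where k: "w $ k \<noteq> 0" using w(1) by (auto simp: vec_eq_iff)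
  let ?T = "{t::int. - M \<le> of_int t \<and> of_int t \<le> M}"
  have T: "finite ?T" "real (card ?T) \<le> 1 + (M - - M)" using card_int_interval[of "- M" M] assms by auto
  let ?P = "PiE (UNIV - {k}) (\<lambda>_. ?T)"
  let ?S = "{z \<in> W. z \<in> Zv \<and> (\<forall>i. \<bar>z $ i\<bar> \<le> M)}"
  have "inj_on (\<lambda>z. restrict (\<lambda>i. \<lfloor>z $ i\<rfloor>) (UNIV - {k})) ?S"
  proof (rule inj_onI)
    fix x y assume xy: "x \<in> ?S" "y \<in> ?S"
      and e: "restrict (\<lambda>i. \<lfloor>x $ i\<rfloor>) (UNIV - {k}) = restrict (\<lambda>i. \<lfloor>y $ i\<rfloor>) (UNIV - {k})"
    have ne: "x $ i = y $ i" if "i \<noteq> k" for i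
    proof -
      have "\<lfloor>x $ i\<rfloor> = \<lfloor>y $ i\<rfloor>" using fun_cong[OF e, of i] that by simp
      moreover have "x $ i \<in> \<int>" "y $ i \<in> \<int>" using xy by (auto simp: Zv_def)
      ultimately show ?thesis by (auto elim!: Ints_cases)
    qed
    have "w \<bullet> x = 0" "w \<bullet> y = 0" using xy w(2) by auto
    then have "w \<bullet> (x - y) = 0" by (simp add: inner_diff_right)
    moreover have "w \<bullet> (x - y) = w $ k * (x $ k - y $ k)"
      unfolding inner_vec_def using ne by (subst sum.remove[of _ k]) (auto intro!: sum.neutral)
    ultimately have "x $ k = y $ k" using k by simp
    then have "x $ i = y $ i" for i using ne by (cases "i = k") auto
    then show "x = y" by (simp add: vec_eq_iff)
  qed
  moreover have "(\<lambda>z. restrict (\<lambda>i. \<lfloor>z $ i\<rfloor>) (UNIV - {k})) ` ?S \<subseteq> ?P"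
    by (auto simp: Zv_def PiE_iff abs_le_iff minus_le_iff)
  moreover have P: "finite ?P" using T(1) by (intro finite_PiE) auto
  ultimately have "card ?S \<le> card ?P" by (rule card_inj_on_le)
  also have "card ?P = card ?T ^ (CARD('n) - 1)" by (simp add: card_PiE)
  finally have "real (card ?S) \<le> real (card ?T) ^ (CARD('n) - 1)"
    by (simp flip: of_nat_power)
  also have "\<dots> \<le> (2 * M + 1) ^ (CARD('n) - 1)" using T(2) by (intro power_mono) auto
  finally show ?thesis .
qed

text \<open>Space is cut into cubes of side \<open>1 / d\<close>. Two lattice points in one cube
  differ by a lattice vector of norm at most \<open>1\<close>, so a cube holds at most
  \<open>Nlat g 1\<close> of them, and the ball meets only about \<open>(d T)^d\<close> cubes up to
  a constant.\<close>

lemma Nlat_scale: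
  fixes g :: "real^'n^'n"
  assumes g: "det g = 1" and T: "T \<ge> 1"
  shows "real (Nlat g T) \<le> (2 * real CARD('n) + 3) ^ CARD('n) * T ^ CARD('n) * real (Nlat g 1)"
proof -
  let ?d = "CARD('n)"
  define f :: "real^'n \<Rightarrow> real^'n" where "f z = (\<chi> i. of_int \<lfloor>(z v* g) $ i * real ?d\<rfloor>)" for z
  let ?B = "{z::real^'n. z \<in> Zv \<and> (\<forall>i. \<bar>z $ i\<bar> \<le> real ?d * T + 1)}"
  let ?S = "{z \<in> Zv. norm (z v* g) \<le> T}"
  have g0: "det g \<noteq> 0" using g by simp
  have "f ` ?S \<subseteq> ?B"
  proof
    fix w assume "w \<in> f ` ?S"
    then obtain z where z: "norm (z v* g) \<le> T" "w = f z" by auto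
    have "\<bar>w $ i\<bar> \<le> real ?d * T + 1" for i
    proof -
      have "\<bar>(z v* g) $ i\<bar> \<le> T" using component_le_norm_cart[of "z v* g" i] z by linarith
      then have "\<bar>(z v* g) $ i * real ?d\<bar> \<le> T * real ?d" unfolding abs_mult by (intro mult_mono) auto
      then show ?thesis using z(2) by (simp add: f_def mult.commute) linarith
    qed
    moreover have "w \<in> Zv" using z(2) by (simp add: f_def Zv_def)
    ultimately show "w \<in> ?B" by simp
  qed
  moreover have "finite {z \<in> ?S. f z = t} \<and> card {z \<in> ?S. f z = t} \<le> Nlat g 1" for t
  proof (cases "{z \<in> ?S. f z = t} = {}")
    case False
    then obtain z0 where z0: "z0 \<in> Zv" "f z0 = t" by auto
    have "(\<lambda>z. z - z0) ` {z \<in> ?S. f z = t} \<subseteq> {z \<in> Zv. norm (z v* g) \<le> 1}"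
    proof
      fix y assume "y \<in> (\<lambda>z. z - z0) ` {z \<in> ?S. f z = t}"
      then obtain z where z: "z \<in> Zv" "f z = t" "y = z - z0" by auto
      have "\<bar>(y v* g) $ i\<bar> \<le> 1 / real ?d" for i
      proof -
        have "f z $ i = f z0 $ i" using z z0 by simp
        then have "real_of_int \<lfloor>(z v* g) $ i * real ?d\<rfloor> = real_of_int \<lfloor>(z0 v* g) $ i * real ?d\<rfloor>" by (simp add: f_def)
        then have "\<bar>(z v* g) $ i * real ?d - (z0 v* g) $ i * real ?d\<bar> \<le> 1" by linarith
        then have "\<bar>((z v* g) $ i - (z0 v* g) $ i) * real ?d\<bar> \<le> 1" by (simp only: left_diff_distrib)
        then have "\<bar>(z v* g) $ i - (z0 v* g) $ i\<bar> \<le> 1 / real ?d"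
          by (simp only: abs_mult abs_of_nat pos_le_divide_eq zero_less_card_finite of_nat_0_less_iff)
        then show ?thesis using z(3) by (simp add: vector_matrix_mult_diff_distrib)
      qed
      then have "(\<Sum>i\<in>UNIV. \<bar>(y v* g) $ i\<bar>) \<le> (\<Sum>i\<in>(UNIV::'n set). 1 / real ?d)" by (intro sum_mono)
      then have "norm (y v* g) \<le> 1" using norm_le_l1_cart[of "y v* g"] by simp
      then show "y \<in> {z \<in> Zv. norm (z v* g) \<le> 1}" using z z0 Zv_diff by auto
    qed
    moreover have "inj_on (\<lambda>z. z - z0) {z \<in> ?S. f z = t}" by (intro inj_onI) simp
    ultimately have "card {z \<in> ?S. f z = t} \<le> Nlat g 1"
      unfolding Nlat_def using finite_Nlat[OF g0, of 1] by (intro card_inj_on_le)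
    moreover have "finite {z \<in> ?S. f z = t}" by (rule finite_subset[OF _ finite_Nlat[OF g0, of T]]) auto
    ultimately show ?thesis by blast
  next
    case True then show ?thesis by (simp only: True finite.emptyI card.empty zero_le simp_thms)
  qed
  ultimately have "card ?S \<le> card ?B * Nlat g 1"
    using card_le_fibres[OF finite_Zv_box[of "real ?d * T + 1"], of f ?S "Nlat g 1"] by blast
  from of_nat_mono[OF this]
  have "real (Nlat g T) \<le> real (card ?B) * real (Nlat g 1)" by (simp add: Nlat_def[of g T])
  also have "real (card ?B) \<le> (2 * (real ?d * T + 1) + 1) ^ ?d" using T by (intro card_Zv_box) auto
  also have "(2 * (real ?d * T + 1) + 1) ^ ?d \<le> ((2 * real ?d + 3) * T) ^ ?d"
    using T by (intro power_mono) (auto simp: algebra_simps)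
  finally show ?thesis by (simp add: power_mult_distrib mult_right_mono)
qed

section \<open>Lattice points in a residue class\<close>

definition resc :: "real^'n^'n \<Rightarrow> nat \<Rightarrow> real^'n \<Rightarrow> real \<Rightarrow> nat" where
  "resc g u a T = card {b \<in> Zv. (\<exists>z\<in>Zv. b = a + real u *\<^sub>R z) \<and> norm (b v* g) \<le> T}"

lemma resc_ennreal:
  fixes g :: "real^'n^'n"
  assumes g: "det g = 1" and u: "u \<ge> 1" and a: "a \<in> Zv"
  shows "of_nat (resc g u a T) = (\<integral>\<^sup>+ z. indicator (cball 0 T) ((a + real u *\<^sub>R z) v* g) \<partial>count_space Zv)"
proof -
  let ?S = "{b \<in> Zv. (\<exists>z\<in>Zv. b = a + real u *\<^sub>R z) \<and> norm (b v* g) \<le> T}"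
  let ?Z = "{z \<in> Zv. norm ((a + real u *\<^sub>R z) v* g) \<le> T}"
  have bij: "bij_betw (\<lambda>z. a + real u *\<^sub>R z) ?Z ?S"
    by (rule bij_betw_imageI) (use u a in \<open>auto simp: inj_on_def intro!: Zv_add Zv_scale\<close>)
  have "finite ?S" by (rule finite_subset[OF _ finite_Nlat[of g T]]) (use g in auto)
  then have "finite ?Z" using bij_betw_finite[OF bij] by simp
  then have "of_nat (card ?Z) = (\<integral>\<^sup>+ z. indicator ?Z z \<partial>count_space Zv)"
    by (subst nn_integral_indicator) (auto simp: emeasure_count_space_finite)
  also have "\<dots> = (\<integral>\<^sup>+ z. indicator (cball 0 T) ((a + real u *\<^sub>R z) v* g) \<partial>count_space Zv)"
    by (intro nn_integral_cong) (auto simp: indicator_def)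
  finally show ?thesis using bij_betw_same_card[OF bij] by (simp add: resc_def)
qed

text \<open>Each point of the class is replaced by a cell of volume \<open>u ^ d\<close> whose
  points are at distance at most \<open>K\<close> from it. The cells belonging to the ball of radius
  \<open>T\<close> cover the ball of radius \<open>T - K\<close> and stay inside that of radius
  \<open>T + K\<close>.\<close>

lemma resc_bounds:
  fixes g :: "real^'n^'n"
  assumes g: "det g = 1" and u: "u \<ge> 1" and a: "a \<in> Zv"
  shows "\<exists>K\<ge>0. \<forall>T\<ge>K. unit_ball_vol (real CARD('n)) * ((T - K) / real u) ^ CARD('n) \<le> real (resc g u a T) \<and>
     real (resc g u a T) \<le> unit_ball_vol (real CARD('n)) * ((T + K) / real u) ^ CARD('n)"
proof -
  let ?d = "CARD('n)"
  obtain B where B: "B > 0" "\<And>y. norm (y v* g) \<le> B * norm y"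
    using linear_bounded_pos[OF linear_vector_matrix[of g]] by blast
  define K where "K = B * (real u * real ?d) + norm (a v* g)"
  have K0: "K \<ge> 0" using B by (simp add: K_def)
  have cell: "norm ((real u *\<^sub>R y) v* g) + norm (a v* g) \<le> K" if y: "y \<in> unit_cell" for y
  proof -
    have "norm y \<le> (\<Sum>i\<in>UNIV. \<bar>y $ i\<bar>)" by (rule norm_le_l1_cart)
    also have "\<dots> \<le> (\<Sum>i\<in>(UNIV::'n set). 1)" using y by (intro sum_mono) (auto simp: unit_cell_def less_imp_le)
    finally have "norm y \<le> real ?d" by simp
    then have "B * (real u * norm y) \<le> B * (real u * real ?d)" using B by (intro mult_left_mono) auto
    moreover have "norm ((real u *\<^sub>R y) v* g) \<le> B * norm (real u *\<^sub>R y)" by (rule B)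
    ultimately show ?thesis by (simp add: K_def)
  qed
  have V: "(\<integral>\<^sup>+ y. indicator (cball 0 S) ((real u *\<^sub>R y) v* g) \<partial>lborel) = ennreal (unit_ball_vol (real ?d) * (S / real u) ^ ?d)"
    if S: "S \<ge> 0" for S
  proof -
    have "(\<integral>\<^sup>+ y. indicator (cball 0 S) ((real u *\<^sub>R y) v* g) \<partial>lborel) = (\<integral>\<^sup>+ y. indicator (cball 0 (S / real u)) (y v* g) \<partial>lborel)"
      using u by (intro nn_integral_cong) (auto simp: indicator_def scaleR_vector_matrix_assoc field_simps)
    also have "\<dots> = (\<integral>\<^sup>+ y. indicator (cball 0 (S / real u)) (y::real^'n) \<partial>lborel)"
      using g by (intro nn_integral_lborel_vm borel_measurable_indicator) auto
    also have "\<dots> = emeasure lborel (cball (0::real^'n) (S / real u))" by simp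
    also have "\<dots> = ennreal (unit_ball_vol (real ?d) * (S / real u) ^ ?d)"
      using S by (subst emeasure_cball) auto
    finally show ?thesis .
  qed
  have mS: "(\<lambda>y. indicator (cball 0 S) ((real u *\<^sub>R y) v* g) :: ennreal) \<in> borel_measurable borel" for S
  proof -
    have "(\<lambda>y. (real u *\<^sub>R y) v* g) \<in> borel_measurable borel"
      by (intro borel_measurable_vector_matrix) auto
    then show ?thesis by (rule measurable_compose) (rule borel_measurable_indicator, simp)
  qed
  have unf: "ennreal (unit_ball_vol (real ?d) * (S / real u) ^ ?d) =
    (\<integral>\<^sup>+ y. (\<integral>\<^sup>+ z. indicator (cball 0 S) ((real u *\<^sub>R (y + z)) v* g) \<partial>count_space Zv) * indicator unit_cell y \<partial>lborel)"
    if "S \<ge> 0" for S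
    unfolding V[OF that, symmetric] by (rule nn_integral_lborel_unfold[OF mS])
  have const: "of_nat (resc g u a T) = (\<integral>\<^sup>+ y. of_nat (resc g u a T) * indicator (unit_cell :: (real^'n) set) y \<partial>lborel)" for T
    by (simp add: nn_integral_cmult_indicator emeasure_unit_cell)
  have split: "(real u *\<^sub>R (y + z)) v* g = (real u *\<^sub>R y) v* g + ((a + real u *\<^sub>R z) v* g - a v* g)" for y z
    by (simp add: scaleR_add_right vector_matrix_left_distrib)
  show ?thesis
  proof (intro exI[of _ K] conjI allI impI)
    show "K \<ge> 0" by (rule K0)
    fix T assume T: "T \<ge> K"
    have "ennreal (unit_ball_vol (real ?d) * ((T - K) / real u) ^ ?d) \<le> of_nat (resc g u a T)"
    proof (subst unf, use T in simp, subst const, rule nn_integral_mono)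
      fix y :: "real^'n"
      show "(\<integral>\<^sup>+ z. indicator (cball 0 (T - K)) ((real u *\<^sub>R (y + z)) v* g) \<partial>count_space Zv) * indicator unit_cell y
         \<le> of_nat (resc g u a T) * indicator unit_cell y"
      proof (cases "y \<in> unit_cell")
        case True
        have "norm ((a + real u *\<^sub>R z) v* g) \<le> T" if "norm ((real u *\<^sub>R (y + z)) v* g) \<le> T - K" for z
        proof -
          have "(a + real u *\<^sub>R z) v* g = (real u *\<^sub>R (y + z)) v* g + (a v* g - (real u *\<^sub>R y) v* g)"
            unfolding split by simp
          also have "norm \<dots> \<le> (T - K) + (norm (a v* g) + norm ((real u *\<^sub>R y) v* g))"
            by (intro norm_triangle_le add_mono that norm_triangle_ineq4)
          finally show ?thesis using cell[OF True] by simp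
        qed
        then have "(\<integral>\<^sup>+ z. indicator (cball 0 (T - K)) ((real u *\<^sub>R (y + z)) v* g) \<partial>count_space Zv) \<le> of_nat (resc g u a T)"
          unfolding resc_ennreal[OF g u a] by (intro nn_integral_mono) (auto simp: indicator_def)
        then show ?thesis using True by simp
      qed simp
    qed
    then show "unit_ball_vol (real ?d) * ((T - K) / real u) ^ ?d \<le> real (resc g u a T)"
      by (simp add: ennreal_of_nat_eq_real_of_nat)
    have "of_nat (resc g u a T) \<le> ennreal (unit_ball_vol (real ?d) * ((T + K) / real u) ^ ?d)"
    proof (subst unf, use T K0 in simp, subst const, rule nn_integral_mono)
      fix y :: "real^'n"
      show "of_nat (resc g u a T) * indicator unit_cell y \<le>
        (\<integral>\<^sup>+ z. indicator (cball 0 (T + K)) ((real u *\<^sub>R (y + z)) v* g) \<partial>count_space Zv) * indicator unit_cell y"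
      proof (cases "y \<in> unit_cell")
        case True
        have "norm ((real u *\<^sub>R (y + z)) v* g) \<le> T + K" if "norm ((a + real u *\<^sub>R z) v* g) \<le> T" for z
        proof -
          have "(real u *\<^sub>R (y + z)) v* g = (a + real u *\<^sub>R z) v* g + ((real u *\<^sub>R y) v* g - a v* g)"
            unfolding split by simp
          also have "norm \<dots> \<le> T + (norm ((real u *\<^sub>R y) v* g) + norm (a v* g))"
            by (intro norm_triangle_le add_mono that norm_triangle_ineq4)
          finally show ?thesis using cell[OF True] by simp
        qed
        then have "of_nat (resc g u a T) \<le> (\<integral>\<^sup>+ z. indicator (cball 0 (T + K)) ((real u *\<^sub>R (y + z)) v* g) \<partial>count_space Zv)"
          unfolding resc_ennreal[OF g u a] by (intro nn_integral_mono) (auto simp: indicator_def)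
        then show ?thesis using True by simp
      qed simp
    qed
    then show "real (resc g u a T) \<le> unit_ball_vol (real ?d) * ((T + K) / real u) ^ ?d"
      using T K0 u by (simp add: ennreal_of_nat_eq_real_of_nat)
  qed
qed

lemma resc_asymptotic:
  fixes g :: "real^'n^'n"
  assumes g: "det g = 1" and u: "u \<ge> 1" and a: "a \<in> Zv"
  shows "(\<lambda>k. real (resc g u a (real k)) / real k ^ CARD('n)) \<longlonglongrightarrow> unit_ball_vol (real CARD('n)) / real u ^ CARD('n)"
proof -
  let ?d = "CARD('n)"
  let ?v = "unit_ball_vol (real ?d)"
  obtain K where K: "K \<ge> 0" "\<And>T. T \<ge> K \<Longrightarrow> ?v * ((T - K) / real u) ^ ?d \<le> real (resc g u a T)"
    "\<And>T. T \<ge> K \<Longrightarrow> real (resc g u a T) \<le> ?v * ((T + K) / real u) ^ ?d"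
    using resc_bounds[OF assms] by blast
  have lim: "(\<lambda>k::nat. ?v * ((1 + c / real k) / real u) ^ ?d) \<longlonglongrightarrow> ?v * ((1 + 0) / real u) ^ ?d" for c
    using u by (intro tendsto_intros lim_const_over_n) auto
  have e: "?v * ((real k + c) / real u) ^ ?d / real k ^ ?d = ?v * ((1 + c / real k) / real u) ^ ?d" if "k \<ge> 1" for k c
  proof -
    have "(1 + c / real k) / real u = ((real k + c) / real u) / real k" using that by (simp add: field_simps)
    then show ?thesis by (simp add: power_divide power_mult_distrib)
  qed
  have "eventually (\<lambda>k::nat. real k \<ge> K \<and> k \<ge> 1) sequentially"
    using eventually_ge_at_top[of "max 1 (nat \<lceil>K\<rceil>)"] by eventually_elim linarith
  then have ev: "eventually (\<lambda>k::nat. ?v * ((1 + - K / real k) / real u) ^ ?d \<le> real (resc g u a (real k)) / real k ^ ?d \<and>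
     real (resc g u a (real k)) / real k ^ ?d \<le> ?v * ((1 + K / real k) / real u) ^ ?d) sequentially"
  proof eventually_elim
    case (elim k)
    then have k: "K \<le> real k" "k \<ge> 1" by auto
    have "?v * ((real k + - K) / real u) ^ ?d / real k ^ ?d \<le> real (resc g u a (real k)) / real k ^ ?d"
      using K(2)[OF k(1)] by (intro divide_right_mono) auto
    moreover have "real (resc g u a (real k)) / real k ^ ?d \<le> ?v * ((real k + K) / real u) ^ ?d / real k ^ ?d"
      using K(3)[OF k(1)] by (intro divide_right_mono) auto
    ultimately show ?case unfolding e[OF k(2)] by blast
  qed
  show ?thesis
  proof (rule real_tendsto_sandwich)
    show "(\<lambda>k::nat. ?v * ((1 + - K / real k) / real u) ^ ?d) \<longlonglongrightarrow> ?v / real u ^ ?d"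
      using lim[of "- K"] by (simp add: power_divide)
    show "(\<lambda>k::nat. ?v * ((1 + K / real k) / real u) ^ ?d) \<longlonglongrightarrow> ?v / real u ^ ?d"
      using lim[of K] by (simp add: power_divide)
  qed (use ev in \<open>auto elim: eventually_mono\<close>)
qed

section \<open>Counting the admissible pivot tuples\<close>

definition Dsol :: "nat \<Rightarrow> nat \<Rightarrow> (nat \<Rightarrow> nat \<Rightarrow> int) \<Rightarrow> nat \<Rightarrow> (nat \<Rightarrow> real^'n) \<Rightarrow> bool" where
  "Dsol r n D u B \<longleftrightarrow> (\<forall>i<n. \<exists>w\<in>Zv. (\<Sum>j<r. real_of_int (D i j) *\<^sub>R B j) = real u *\<^sub>R w)"

text \<open>The coordinates of the tuples that can occur as pivots for \<open>(D, u)\<close>.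
  Independence is what allows \<open>B\<close> and \<open>D / u\<close> to be recovered from
  \<open>matapp\<close> later.\<close>

definition CD :: "nat \<Rightarrow> nat \<Rightarrow> (nat \<Rightarrow> nat \<Rightarrow> int) \<Rightarrow> nat \<Rightarrow> (nat \<Rightarrow> real^'n) set" where
  "CD r n D u = {B \<in> PiE {..<r} (\<lambda>_. Zv). Dsol r n D u B \<and> indep r B}"

lemma SLZ_inv_CD: "SLZ_inv r (CD r n D u :: (nat \<Rightarrow> real^'n) set)"
proof -
  have "tmul r B m \<in> CD r n D u" if B: "B \<in> CD r n D u" and m: "m \<in> SLZ" for B and m :: "real^'n^'n"
  proof -
    have mr: "m $ i \<in> Zv" for i using m by (simp add: SLZ_def)
    have "tmul r B m \<in> PiE {..<r} (\<lambda>_. Zv)"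
      using B mr by (auto simp: tmul_def CD_def PiE_iff intro!: Zv_vector_matrix)
    moreover have "indep r (tmul r B m)" using B m by (simp add: indep_tmul CD_def SLZ_def)
    moreover have "Dsol r n D u (tmul r B m)"
      unfolding Dsol_def
    proof (intro allI impI)
      fix i assume "i < n"
      then obtain w where w: "w \<in> Zv" "(\<Sum>j<r. real_of_int (D i j) *\<^sub>R B j) = real u *\<^sub>R w"
        using B by (auto simp: CD_def Dsol_def)
      have "(\<Sum>j<r. real_of_int (D i j) *\<^sub>R tmul r B m j) = (\<Sum>j<r. real_of_int (D i j) *\<^sub>R B j) v* m"
        by (simp add: vector_matrix_sum scaleR_vector_matrix_assoc tmul_def)
      also have "\<dots> = real u *\<^sub>R (w v* m)" unfolding w by (simp add: scaleR_vector_matrix_assoc)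
      finally show "\<exists>w\<in>Zv. (\<Sum>j<r. real_of_int (D i j) *\<^sub>R tmul r B m j) = real u *\<^sub>R w"
        using Zv_vector_matrix[OF w(1) mr] by blast
    qed
    ultimately show ?thesis by (simp add: CD_def)
  qed
  then show ?thesis by (auto simp: SLZ_inv_def CD_def)
qed

definition cellu :: "nat \<Rightarrow> (real^'n) set" where
  "cellu u = {a \<in> Zv. \<forall>i. 0 \<le> a $ i \<and> a $ i < real u}"

definition Res :: "nat \<Rightarrow> nat \<Rightarrow> (nat \<Rightarrow> nat \<Rightarrow> int) \<Rightarrow> nat \<Rightarrow> (nat \<Rightarrow> real^'n) set" where
  "Res r n D u = {\<rho> \<in> PiE {..<r} (\<lambda>_. cellu u). Dsol r n D u \<rho>}"

text \<open>The vector condition is one system of congruences for each of the \<open>d\<close>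
  coordinates separately. This is the origin of the exponent \<open>CARD('n)\<close> on
  \<open>Ncount\<close>.\<close>

lemma Dsol_components:
  fixes B :: "nat \<Rightarrow> real^'n"
  assumes B: "\<And>j k. j < r \<Longrightarrow> B j $ k = of_int (b k j)"
  shows "Dsol r n D u B \<longleftrightarrow> (\<forall>i<n. \<forall>k. int u dvd (\<Sum>j<r. D i j * b k j))"
proof -
  have c: "(\<Sum>j<r. real_of_int (D i j) *\<^sub>R B j) $ k = of_int (\<Sum>j<r. D i j * b k j)" for i k
    by (simp add: sum_component B)
  have "(\<exists>w\<in>Zv. (\<Sum>j<r. real_of_int (D i j) *\<^sub>R B j) = real u *\<^sub>R w) \<longleftrightarrow> (\<forall>k. int u dvd (\<Sum>j<r. D i j * b k j))" for i
  proof
    assume "\<exists>w\<in>Zv. (\<Sum>j<r. real_of_int (D i j) *\<^sub>R B j) = real u *\<^sub>R w"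
    then obtain w where w: "w \<in> Zv" "(\<Sum>j<r. real_of_int (D i j) *\<^sub>R B j) = real u *\<^sub>R w" by blast
    show "\<forall>k. int u dvd (\<Sum>j<r. D i j * b k j)"
    proof
      fix k
      obtain q where q: "w $ k = of_int q" using w(1) by (auto simp: Zv_def elim: Ints_cases)
      have "of_int (\<Sum>j<r. D i j * b k j) = real u * of_int q" using c[of i k] w(2) q by simp
      then have "real_of_int (\<Sum>j<r. D i j * b k j) = real_of_int (int u * q)" by simp
      then have "(\<Sum>j<r. D i j * b k j) = int u * q" by (simp only: of_int_eq_iff)
      then show "int u dvd (\<Sum>j<r. D i j * b k j)" by simp
    qed
  next
    assume a: "\<forall>k. int u dvd (\<Sum>j<r. D i j * b k j)"
    define w :: "real^'n" where "w = (\<chi> k. of_int ((\<Sum>j<r. D i j * b k j) div int u))"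
    have "w \<in> Zv" by (simp add: w_def Zv_def)
    moreover have "(\<Sum>j<r. real_of_int (D i j) *\<^sub>R B j) = real u *\<^sub>R w"
    proof (subst vec_eq_iff, rule allI)
      fix k
      have "(\<Sum>j<r. D i j * b k j) = int u * ((\<Sum>j<r. D i j * b k j) div int u)" using a by simp
      from arg_cong[where f = real_of_int, OF this]
      have "real_of_int (\<Sum>j<r. D i j * b k j) = real u * of_int ((\<Sum>j<r. D i j * b k j) div int u)"
        by (simp only: of_int_mult of_int_of_nat_eq)
      then show "(\<Sum>j<r. real_of_int (D i j) *\<^sub>R B j) $ k = (real u *\<^sub>R w) $ k"
        unfolding c by (simp add: w_def)
    qed
    ultimately show "\<exists>w\<in>Zv. (\<Sum>j<r. real_of_int (D i j) *\<^sub>R B j) = real u *\<^sub>R w" by blast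
  qed
  then show ?thesis by (simp add: Dsol_def)
qed

definition SN :: "nat \<Rightarrow> nat \<Rightarrow> (nat \<Rightarrow> nat \<Rightarrow> int) \<Rightarrow> nat \<Rightarrow> (nat \<Rightarrow> int) set" where
  "SN r n D u = {v. (\<forall>j<r. 0 \<le> v j \<and> v j < int u) \<and> (\<forall>j. r \<le> j \<longrightarrow> v j = 0) \<and>
     (\<forall>i<n. int u dvd (\<Sum>j<r. D i j * v j))}"

lemma card_SN: "card (SN r n D u) = Ncount n r D u"
  by (simp add: SN_def Ncount_def)

text \<open>A tuple of residue vectors amounts to an independent choice of a solution from
  \<open>SN\<close> in every coordinate.\<close>

lemma card_Res:
  "finite (Res r n D u :: (nat \<Rightarrow> real^'n) set)" "card (Res r n D u :: (nat \<Rightarrow> real^'n) set) = Ncount n r D u ^ CARD('n)"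
proof -
  define h where "h \<phi> = restrict (\<lambda>j. (\<chi> i. of_int (\<phi> i j)) :: real^'n) {..<r}" for \<phi> :: "'n \<Rightarrow> nat \<Rightarrow> int"
  let ?P = "PiE (UNIV::'n set) (\<lambda>_. SN r n D u)"
  have bij: "bij_betw h ?P (Res r n D u)"
  proof (rule bij_betw_imageI)
    show "inj_on h ?P"
    proof (rule inj_onI)
      fix \<phi> \<psi> assume p: "\<phi> \<in> ?P" "\<psi> \<in> ?P" "h \<phi> = h \<psi>"
      have "\<phi> i j = \<psi> i j" for i j
      proof (cases "j < r")
        case True
        then have "h \<phi> j $ i = h \<psi> j $ i" using p(3) by simp
        then show ?thesis using True by (simp add: h_def)
      next
        case False
        have "\<phi> i \<in> SN r n D u" "\<psi> i \<in> SN r n D u" using p by auto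
        then show ?thesis using False by (auto simp: SN_def)
      qed
      then show "\<phi> = \<psi>" by (simp add: fun_eq_iff)
    qed
    show "h ` ?P = Res r n D u"
    proof (intro set_eqI iffI)
      fix \<rho> assume "\<rho> \<in> h ` ?P"
      then obtain \<phi> where \<phi>: "\<phi> \<in> ?P" "\<rho> = h \<phi>" by auto
      then have SN: "\<phi> k \<in> SN r n D u" for k by auto
      have "\<rho> \<in> PiE {..<r} (\<lambda>_. cellu u)"
      proof -
        have "real_of_int (\<phi> k j) < real u" if "j < r" for k j
        proof -
          have "\<phi> k j < int u" using SN[of k] that by (auto simp: SN_def)
          then show ?thesis by linarith
        qed
        then show ?thesis using SN unfolding \<phi>(2) by (auto simp: h_def cellu_def Zv_def SN_def)
      qed
      moreover have "Dsol r n D u \<rho>"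
        using SN by (subst Dsol_components[of r \<rho> \<phi>]) (auto simp: \<phi>(2) h_def SN_def)
      ultimately show "\<rho> \<in> Res r n D u" by (simp add: Res_def)
    next
      fix \<rho> :: "nat \<Rightarrow> real^'n" assume \<rho>: "\<rho> \<in> Res r n D u"
      define \<phi> :: "'n \<Rightarrow> nat \<Rightarrow> int" where "\<phi> i j = (if j < r then \<lfloor>\<rho> j $ i\<rfloor> else 0)" for i j
      have c: "\<rho> j \<in> cellu u" if "j < r" for j using \<rho> that by (auto simp: Res_def)
      have f: "\<rho> j $ i = of_int (\<phi> i j)" if "j < r" for i j
        using c[OF that] that by (auto simp: cellu_def Zv_def \<phi>_def)
      have "\<phi> k \<in> SN r n D u" for k
      proof -
        have "0 \<le> \<phi> k j \<and> \<phi> k j < int u" if "j < r" for j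
        proof -
          have "0 \<le> \<rho> j $ k" "\<rho> j $ k < real u" using c[OF that] by (auto simp: cellu_def)
          then show ?thesis unfolding f[OF that] by linarith
        qed
        moreover have "\<forall>i<n. int u dvd (\<Sum>j<r. D i j * \<phi> k j)"
          using \<rho> Dsol_components[of r \<rho> \<phi>, OF f] by (auto simp: Res_def)
        ultimately show ?thesis by (auto simp: SN_def \<phi>_def)
      qed
      then have "\<phi> \<in> ?P" by auto
      moreover have "\<rho> = h \<phi>"
        using \<rho> f by (auto simp: h_def Res_def PiE_def extensional_def fun_eq_iff vec_eq_iff)
      ultimately show "\<rho> \<in> h ` ?P" by blast
    qed
  qed
  have "SN r n D u \<subseteq> (\<lambda>f j. if j < r then f j else 0) ` PiE {..<r} (\<lambda>_. {0..<int u})"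
  proof
    fix v assume v: "v \<in> SN r n D u"
    then have "restrict v {..<r} \<in> PiE {..<r} (\<lambda>_. {0..<int u})" by (auto simp: SN_def)
    moreover have "v = (\<lambda>j. if j < r then restrict v {..<r} j else 0)" using v by (auto simp: SN_def fun_eq_iff)
    ultimately show "v \<in> (\<lambda>f j. if j < r then f j else 0) ` PiE {..<r} (\<lambda>_. {0..<int u})"
      by (intro image_eqI[where x = "restrict v {..<r}"])
  qed
  moreover have "finite (PiE {..<r} (\<lambda>_. {0..<int u}))" by (intro finite_PiE) auto
  ultimately have "finite (SN r n D u)" by (meson finite_imageI finite_subset)
  then have "finite ?P" by (intro finite_PiE) auto
  then show "finite (Res r n D u :: (nat \<Rightarrow> real^'n) set)" using bij_betw_finite[OF bij] by simp
  show "card (Res r n D u :: (nat \<Rightarrow> real^'n) set) = Ncount n r D u ^ CARD('n)"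
    using bij_betw_same_card[OF bij] by (simp add: card_PiE card_SN)
qed

lemma residue_exists:
  assumes u: "u \<ge> 1" and b: "b \<in> Zv"
  shows "\<exists>a\<in>cellu u. \<exists>z\<in>Zv. b = a + real u *\<^sub>R (z::real^'n)"
proof -
  define z :: "real^'n" where "z = (\<chi> i. of_int \<lfloor>b $ i / real u\<rfloor>)"
  have z: "z \<in> Zv" by (simp add: z_def Zv_def)
  have "b - real u *\<^sub>R z \<in> cellu u"
  proof -
    have "0 \<le> b $ i - real u * of_int \<lfloor>b $ i / real u\<rfloor> \<and> b $ i - real u * of_int \<lfloor>b $ i / real u\<rfloor> < real u" for i
    proof -
      have f: "of_int \<lfloor>b $ i / real u\<rfloor> \<le> b $ i / real u" "b $ i / real u < of_int \<lfloor>b $ i / real u\<rfloor> + 1" by linarith+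
      have u0: "real u > 0" using u by simp
      have "of_int \<lfloor>b $ i / real u\<rfloor> * real u \<le> b $ i" using f(1) u0 by (simp only: pos_le_divide_eq)
      moreover have "b $ i < (of_int \<lfloor>b $ i / real u\<rfloor> + 1) * real u" using f(2) u0 by (simp only: pos_divide_less_eq)
      ultimately show ?thesis by (simp add: algebra_simps)
    qed
    moreover have "b - real u *\<^sub>R z \<in> Zv" using b z by (intro Zv_diff Zv_scale) auto
    ultimately show ?thesis by (simp add: cellu_def z_def)
  qed
  then show ?thesis using z by (intro bexI[of _ "b - real u *\<^sub>R z"] bexI[of _ z]) auto
qed

lemma residue_unique:
  assumes u: "u \<ge> 1" and a: "a \<in> cellu u" "a' \<in> cellu u" and z: "z \<in> Zv" "z' \<in> Zv"
    and e: "a + real u *\<^sub>R z = a' + real u *\<^sub>R (z'::real^'n)"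
  shows "a = a'"
proof (subst vec_eq_iff, rule allI)
  fix i
  obtain p q :: int where pq: "z $ i = of_int p" "z' $ i = of_int q"
    using z by (auto simp: Zv_def elim!: Ints_cases dest!: spec[of _ i])
  have "a $ i + real u * of_int p = a' $ i + real u * of_int q"
    using e pq by (auto simp: vec_eq_iff dest!: spec[of _ i])
  then have d: "a $ i - a' $ i = real u * of_int (q - p)" by (simp add: algebra_simps)
  have "0 \<le> a $ i" "a $ i < real u" "0 \<le> a' $ i" "a' $ i < real u" using a by (auto simp: cellu_def)
  then have "\<bar>real u * of_int (q - p)\<bar> < real u * 1" unfolding d[symmetric] by auto
  then have "real u * \<bar>of_int (q - p)\<bar> < real u * 1" by (simp add: abs_mult)
  then have "\<bar>real_of_int (q - p)\<bar> < 1" using u by (subst (asm) mult_less_cancel_left_pos) auto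
  then have "q = p" by linarith
  then show "a $ i = a' $ i" using d by simp
qed

definition Call :: "nat \<Rightarrow> nat \<Rightarrow> (nat \<Rightarrow> nat \<Rightarrow> int) \<Rightarrow> nat \<Rightarrow> real^'n^'n \<Rightarrow> real \<Rightarrow> (nat \<Rightarrow> real^'n) set" where
  "Call r n D u g T = {B \<in> PiE {..<r} (\<lambda>_. Zv). Dsol r n D u B \<and> (\<forall>j<r. norm (B j v* g) \<le> T)}"

text \<open>Divisibility by \<open>u\<close> depends only on the residues of the vectors
  \<open>B j\<close>, so the set is a union of products of residue classes. By
  \<open>residue_unique\<close> the products are disjoint, which is what the count in
  \<open>card_Call\<close> needs.\<close>

lemma Call_decomp:
  fixes g :: "real^'n^'n"
  assumes u: "u \<ge> 1"
  shows "Call r n D u g T = (\<Union>\<rho>\<in>Res r n D u. PiE {..<r} (\<lambda>j. {b \<in> Zv. (\<exists>z\<in>Zv. b = \<rho> j + real u *\<^sub>R z) \<and> norm (b v* g) \<le> T}))"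
    (is "_ = (\<Union>\<rho>\<in>_. ?S \<rho>)")
proof (intro set_eqI iffI)
  fix B assume B: "B \<in> Call r n D u g T"
  have ex: "\<exists>a z. a \<in> cellu u \<and> z \<in> Zv \<and> B j = a + real u *\<^sub>R z" if "j < r" for j
  proof -
    have "B j \<in> Zv" using B that by (auto simp: Call_def PiE_iff)
    from residue_exists[OF u this] show ?thesis by blast
  qed
  define a where "a j = (SOME a. \<exists>z. a \<in> cellu u \<and> z \<in> Zv \<and> B j = a + real u *\<^sub>R z)" for j
  have a: "\<exists>z. a j \<in> cellu u \<and> z \<in> Zv \<and> B j = a j + real u *\<^sub>R z" if "j < r" for j
    unfolding a_def using someI_ex[OF ex[OF that]] .
  define z where "z j = (SOME z. a j \<in> cellu u \<and> z \<in> Zv \<and> B j = a j + real u *\<^sub>R z)" for j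
  have z: "a j \<in> cellu u" "z j \<in> Zv" "B j = a j + real u *\<^sub>R z j" if "j < r" for j
    using someI_ex[OF a[OF that]] unfolding z_def by blast+
  define \<rho> where "\<rho> = restrict a {..<r}"
  have "Dsol r n D u \<rho>" unfolding Dsol_def
  proof (intro allI impI)
    fix i assume "i < n"
    then obtain w where w: "w \<in> Zv" "(\<Sum>j<r. real_of_int (D i j) *\<^sub>R B j) = real u *\<^sub>R w"
      using B by (auto simp: Call_def Dsol_def)
    have "(\<Sum>j<r. real_of_int (D i j) *\<^sub>R B j) = (\<Sum>j<r. real_of_int (D i j) *\<^sub>R \<rho> j) + real u *\<^sub>R (\<Sum>j<r. real_of_int (D i j) *\<^sub>R z j)"
      unfolding scaleR_sum_right sum.distrib[symmetric]
      by (intro sum.cong) (auto simp: z(3) \<rho>_def scaleR_add_right)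
    then have "(\<Sum>j<r. real_of_int (D i j) *\<^sub>R \<rho> j) = real u *\<^sub>R (w - (\<Sum>j<r. real_of_int (D i j) *\<^sub>R z j))"
      unfolding w(2) by (simp add: scaleR_diff_right)
    moreover have "w - (\<Sum>j<r. real_of_int (D i j) *\<^sub>R z j) \<in> Zv"
      using w z by (intro Zv_diff Zv_sum Zv_scale) auto
    ultimately show "\<exists>w\<in>Zv. (\<Sum>j<r. real_of_int (D i j) *\<^sub>R \<rho> j) = real u *\<^sub>R w" by blast
  qed
  then have "\<rho> \<in> Res r n D u" using z(1) by (auto simp: Res_def \<rho>_def)
  moreover have "B \<in> ?S \<rho>"
    unfolding PiE_iff
  proof (intro conjI ballI)
    fix j assume j: "j \<in> {..<r}"
    have "B j \<in> Zv" "norm (B j v* g) \<le> T" using B j by (auto simp: Call_def PiE_iff)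
    moreover have "\<exists>z\<in>Zv. B j = \<rho> j + real u *\<^sub>R z"
      using z(2,3)[of j] j by (intro bexI[of _ "z j"]) (simp_all add: \<rho>_def)
    ultimately show "B j \<in> {b \<in> Zv. (\<exists>z\<in>Zv. b = \<rho> j + real u *\<^sub>R z) \<and> norm (b v* g) \<le> T}"
      by (intro CollectI conjI)
  qed (use B in \<open>simp add: Call_def PiE_iff\<close>)
  ultimately show "B \<in> (\<Union>\<rho>\<in>Res r n D u. ?S \<rho>)" by blast
next
  fix B assume "B \<in> (\<Union>\<rho>\<in>Res r n D u. ?S \<rho>)"
  then obtain \<rho> where \<rho>: "\<rho> \<in> Res r n D u" "B \<in> ?S \<rho>" by blast
  then have BZ: "B \<in> PiE {..<r} (\<lambda>_. Zv)" "\<And>j. j < r \<Longrightarrow> norm (B j v* g) \<le> T" by (auto simp: PiE_iff)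
  have ex: "\<exists>z. z \<in> Zv \<and> B j = \<rho> j + real u *\<^sub>R z" if "j < r" for j
    using PiE_mem[OF \<rho>(2), of j] that by auto
  define z where "z j = (SOME z. z \<in> Zv \<and> B j = \<rho> j + real u *\<^sub>R z)" for j
  have z: "z j \<in> Zv" "B j = \<rho> j + real u *\<^sub>R z j" if "j < r" for j
    using someI_ex[OF ex[OF that]] unfolding z_def by blast+
  have "Dsol r n D u B" unfolding Dsol_def
  proof (intro allI impI)
    fix i assume "i < n"
    then obtain w where w: "w \<in> Zv" "(\<Sum>j<r. real_of_int (D i j) *\<^sub>R \<rho> j) = real u *\<^sub>R w"
      using \<rho>(1) by (auto simp: Res_def Dsol_def)
    have "(\<Sum>j<r. real_of_int (D i j) *\<^sub>R B j) = (\<Sum>j<r. real_of_int (D i j) *\<^sub>R \<rho> j) + real u *\<^sub>R (\<Sum>j<r. real_of_int (D i j) *\<^sub>R z j)"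
      unfolding scaleR_sum_right sum.distrib[symmetric]
      by (intro sum.cong) (auto simp: z(2) scaleR_add_right)
    then have "(\<Sum>j<r. real_of_int (D i j) *\<^sub>R B j) = real u *\<^sub>R (w + (\<Sum>j<r. real_of_int (D i j) *\<^sub>R z j))"
      unfolding w(2) by (simp add: scaleR_add_right)
    moreover have "w + (\<Sum>j<r. real_of_int (D i j) *\<^sub>R z j) \<in> Zv"
      using w z by (intro Zv_add Zv_sum Zv_scale) auto
    ultimately show "\<exists>w\<in>Zv. (\<Sum>j<r. real_of_int (D i j) *\<^sub>R B j) = real u *\<^sub>R w" by blast
  qed
  then show "B \<in> Call r n D u g T" using BZ by (simp add: Call_def)
qed

lemma card_Call:
  fixes g :: "real^'n^'n"
  assumes g: "det g = 1" and u: "u \<ge> 1"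
  shows "finite (Call r n D u g T)" "card (Call r n D u g T) = (\<Sum>\<rho>\<in>Res r n D u. \<Prod>j<r. resc g u (\<rho> j) T)"
proof -
  let ?s = "\<lambda>a. {b \<in> Zv. (\<exists>z\<in>Zv. b = a + real u *\<^sub>R z) \<and> norm (b v* g) \<le> T}"
  have fin: "finite (?s a)" for a by (rule finite_subset[OF _ finite_Nlat[of g T]]) (use g in auto)
  have finP: "finite (PiE {..<r} (\<lambda>j. ?s (\<rho> j)))" for \<rho> :: "nat \<Rightarrow> real^'n" using fin by (intro finite_PiE) auto
  show "finite (Call r n D u g T)" unfolding Call_decomp[OF u] using finP card_Res(1) by blast
  have "card (Call r n D u g T) = (\<Sum>\<rho>\<in>Res r n D u. card (PiE {..<r} (\<lambda>j. ?s (\<rho> j))))"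
    unfolding Call_decomp[OF u]
  proof (rule card_UN_disjoint)
    show "\<forall>i\<in>Res r n D u. \<forall>j\<in>Res r n D u. i \<noteq> j \<longrightarrow> PiE {..<r} (\<lambda>l. ?s (i l)) \<inter> PiE {..<r} (\<lambda>l. ?s (j l)) = {}"
    proof (intro ballI impI)
      fix \<rho> \<rho>' :: "nat \<Rightarrow> real^'n" assume \<rho>: "\<rho> \<in> Res r n D u" "\<rho>' \<in> Res r n D u" "\<rho> \<noteq> \<rho>'"
      show "PiE {..<r} (\<lambda>l. ?s (\<rho> l)) \<inter> PiE {..<r} (\<lambda>l. ?s (\<rho>' l)) = {}"
      proof (rule ccontr)
        assume "\<not> ?thesis"
        then obtain B where B: "B \<in> PiE {..<r} (\<lambda>l. ?s (\<rho> l))" "B \<in> PiE {..<r} (\<lambda>l. ?s (\<rho>' l))" by blast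
        have "\<rho> j = \<rho>' j" if j: "j < r" for j
        proof -
          have "B j \<in> ?s (\<rho> j)" "B j \<in> ?s (\<rho>' j)" using B j by (auto simp: PiE_iff)
          then obtain z z' where z: "z \<in> Zv" "z' \<in> Zv" "B j = \<rho> j + real u *\<^sub>R z" "B j = \<rho>' j + real u *\<^sub>R z'" by blast
          have c: "\<rho> j \<in> cellu u" "\<rho>' j \<in> cellu u" using \<rho> j by (auto simp: Res_def)
          show ?thesis using z by (intro residue_unique[OF u c z(1,2)]) simp
        qed
        then have "\<rho> = \<rho>'" using \<rho> by (intro PiE_ext[of \<rho> "{..<r}" "\<lambda>_. cellu u" \<rho>']) (auto simp: Res_def)
        then show False using \<rho>(3) by simp
      qed
    qed
  qed (use card_Res(1) finP in auto)
  then show "card (Call r n D u g T) = (\<Sum>\<rho>\<in>Res r n D u. \<Prod>j<r. resc g u (\<rho> j) T)"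
    by (simp add: card_PiE resc_def)
qed

text \<open>Each residue tuple contributes a product of \<open>r\<close> counts, each of which grows
  like the volume of the ball divided by \<open>u ^ d\<close>.\<close>

lemma Call_asymptotic:
  fixes g :: "real^'n^'n"
  assumes g: "det g = 1" and u: "u \<ge> 1"
  shows "(\<lambda>k. real (card (Call r n D u g (real k))) / real k ^ (CARD('n) * r)) \<longlonglongrightarrow>
    real (Ncount n r D u) ^ CARD('n) * (unit_ball_vol (real CARD('n)) / real u ^ CARD('n)) ^ r"
proof -
  let ?d = "CARD('n)"
  have "(\<lambda>k. \<Sum>\<rho>\<in>Res r n D u. \<Prod>j<r. real (resc g u (\<rho> j) (real k)) / real k ^ ?d) \<longlonglongrightarrow>
    (\<Sum>\<rho>\<in>(Res r n D u :: (nat \<Rightarrow> real^'n) set). \<Prod>j<r. unit_ball_vol (real ?d) / real u ^ ?d)"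
  proof (intro tendsto_sum tendsto_prod resc_asymptotic g u)
    fix \<rho> :: "nat \<Rightarrow> real^'n" and j assume "\<rho> \<in> Res r n D u" "j \<in> {..<r}"
    then show "\<rho> j \<in> Zv" by (auto simp: Res_def cellu_def PiE_iff)
  qed
  moreover have "(\<Sum>\<rho>\<in>Res r n D u. \<Prod>j<r. real (resc g u (\<rho> j) (real k)) / real k ^ ?d) =
     real (card (Call r n D u g (real k))) / real k ^ (?d * r)" for k
    by (simp add: card_Call[OF g u] prod_dividef sum_divide_distrib power_mult)
  ultimately show ?thesis by (simp add: card_Res)
qed

definition Cdep :: "nat \<Rightarrow> real^'n^'n \<Rightarrow> real \<Rightarrow> (nat \<Rightarrow> real^'n) set" where
  "Cdep r g T = {B \<in> PiE {..<r} (\<lambda>_. Zv). \<not> indep r B \<and> (\<forall>j<r. norm (B j v* g) \<le> T)}"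

text \<open>A dependent tuple has an index \<open>i\<close> with \<open>B i\<close> in the span of
  the earlier vectors, a proper subspace because \<open>i < r \<le> d\<close>. This costs one power
  of \<open>T\<close>, so dependent tuples are negligible in the limit.\<close>

lemma card_Cdep:
  fixes g :: "real^'n^'n"
  assumes g: "det g = 1" and r: "r \<le> CARD('n)"
  shows "\<exists>K\<ge>0. \<forall>T\<ge>1. finite (Cdep r g T) \<and> real (card (Cdep r g T)) \<le> K * T ^ (CARD('n) * r - 1)"
proof -
  let ?d = "CARD('n)"
  obtain g' where g': "g ** g' = mat 1" using det_1_inverse[of g] g by auto
  obtain b where b: "b > 0" "\<And>y. norm (y v* g') \<le> b * norm y"
    using linear_bounded_pos[OF linear_vector_matrix[of g']] by blast
  have inv: "norm z \<le> b * norm (z v* g)" for z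
    using b(2)[of "z v* g"] by (simp add: vector_matrix_mul_assoc g')
  let ?K = "real r * (2 * b + 1) ^ (?d * r - 1)"
  have "finite (Cdep r g T) \<and> real (card (Cdep r g T)) \<le> ?K * T ^ (?d * r - 1)" if T: "T \<ge> 1" for T
  proof -
    define M where "M = b * T"
    define q where "q = 2 * M + 1"
    have M: "M \<ge> 0" using b T by (simp add: M_def)
    have q: "q \<ge> 1" using M by (simp add: q_def)
    let ?Q = "{z::real^'n. z \<in> Zv \<and> (\<forall>i. \<bar>z $ i\<bar> \<le> M)}"
    let ?S = "\<lambda>i. {B \<in> PiE {..<r} (\<lambda>_. ?Q). B i \<in> span (B ` {..<i})}"
    have sub: "Cdep r g T \<subseteq> (\<Union>i<r. ?S i)"
    proof
      fix B assume B: "B \<in> Cdep r g T"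
      have "B j \<in> ?Q" if j: "j < r" for j
      proof -
        have "\<bar>B j $ i\<bar> \<le> M" for i
        proof -
          have "\<bar>B j $ i\<bar> \<le> norm (B j)" by (rule component_le_norm_cart)
          also have "\<dots> \<le> b * norm (B j v* g)" by (rule inv)
          also have "\<dots> \<le> M" using B j b by (auto simp: Cdep_def M_def intro!: mult_left_mono)
          finally show ?thesis .
        qed
        then show ?thesis using B j by (auto simp: Cdep_def PiE_iff)
      qed
      then have "B \<in> PiE {..<r} (\<lambda>_. ?Q)" using B by (auto simp: Cdep_def PiE_iff)
      moreover obtain i where "i < r" "B i \<in> span (B ` {..<i})" using B by (auto simp: Cdep_def indep_def)
      ultimately show "B \<in> (\<Union>i<r. ?S i)" by blast
    qed
    have Si: "finite (?S i) \<and> real (card (?S i)) \<le> q ^ (?d * r - 1)" if i: "i < r" for i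
    proof -
      let ?I = "{..<r} - {i}"
      \<comment> \<open>The hyperplane bound is a real number while fibres are bounded by a natural
        number; rounding down loses nothing for cardinalities.\<close>
      let ?m = "nat \<lfloor>q ^ (?d - 1)\<rfloor>"
      have mq: "real ?m \<le> q ^ (?d - 1)" using q by simp
      have finT: "finite (PiE ?I (\<lambda>_. ?Q))" using finite_Zv_box by (intro finite_PiE) auto
      have im: "(\<lambda>B. restrict B ?I) ` ?S i \<subseteq> PiE ?I (\<lambda>_. ?Q)"
      proof (rule image_subsetI)
        fix B assume "B \<in> ?S i"
        then have B: "B \<in> PiE {..<r} (\<lambda>_. ?Q)" by (simp only: mem_Collect_eq)
        have "B j \<in> ?Q" if "j \<in> ?I" for j using that by (intro PiE_mem[OF B]) simp
        then show "restrict B ?I \<in> PiE ?I (\<lambda>_. ?Q)" by (intro restrict_PiE_iff[THEN iffD2] ballI)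
      qed
      have fib: "finite {B \<in> ?S i. restrict B ?I = t} \<and> card {B \<in> ?S i. restrict B ?I = t} \<le> ?m"
        if t: "t \<in> PiE ?I (\<lambda>_. ?Q)" for t
      proof -
        let ?W = "span (t ` {..<i})"
        let ?H = "{z \<in> ?W. z \<in> Zv \<and> (\<forall>i. \<bar>z $ i\<bar> \<le> M)}"
        have "dim ?W \<le> card (t ` {..<i})" by (intro dim_le_card) auto
        also have "\<dots> \<le> i" using card_image_le[of "{..<i}" t] by simp
        finally have "real (card ?H) \<le> q ^ (?d - 1)"
          unfolding q_def using i r M by (intro card_Zv_box_hyperplane) auto
        then have H: "card ?H \<le> ?m" by linarith
        have finH: "finite ?H" by (rule finite_subset[OF _ finite_Zv_box[of M]]) auto
        have ext: "B = t(i := B i)" if "B \<in> ?S i" "restrict B ?I = t" for B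
        proof (rule ext)
          fix j
          have "restrict B ?I j = t j" using that(2) by (rule fun_cong)
          moreover have "B \<in> PiE {..<r} (\<lambda>_. ?Q)" using that(1) by (simp only: mem_Collect_eq)
          then have "j \<notin> {..<r} \<Longrightarrow> B j = undefined" by (rule PiE_arb)
          ultimately show "B j = (t(i := B i)) j" by (cases "j = i"; cases "j < r") auto
        qed
        have inj: "inj_on (\<lambda>B. B i) {B \<in> ?S i. restrict B ?I = t}"
        proof (rule inj_onI)
          fix B B' assume "B \<in> {B \<in> ?S i. restrict B ?I = t}" "B' \<in> {B \<in> ?S i. restrict B ?I = t}" "B i = B' i"
          then show "B = B'" using ext[of B] ext[of B'] by simp
        qed
        have sub: "(\<lambda>B. B i) ` {B \<in> ?S i. restrict B ?I = t} \<subseteq> ?H"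
        proof
          fix z assume "z \<in> (\<lambda>B. B i) ` {B \<in> ?S i. restrict B ?I = t}"
          then obtain B where B: "B \<in> ?S i" "restrict B ?I = t" "z = B i" by auto
          have "B ` {..<i} = t ` {..<i}" unfolding B(2)[symmetric] using i by (intro image_cong) auto
          then show "z \<in> ?H" using B i by (auto simp: PiE_iff)
        qed
        show ?thesis using finite_imageD[OF finite_subset[OF sub finH] inj] card_inj_on_le[OF inj sub finH] H by linarith
      qed
      have c: "finite (?S i) \<and> card (?S i) \<le> card (PiE ?I (\<lambda>_. ?Q)) * ?m"
        by (rule card_le_fibres[OF finT im fib])
      have "card (PiE ?I (\<lambda>_. ?Q)) = card ?Q ^ (r - 1)" using i by (simp add: card_PiE)
      then have "real (card (?S i)) \<le> real (card ?Q) ^ (r - 1) * real ?m"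
        using of_nat_mono[OF conjunct2[OF c], where 'a = real] by simp
      also have "\<dots> \<le> (q ^ ?d) ^ (r - 1) * q ^ (?d - 1)"
        using card_Zv_box[OF M, where 'n = 'n] mq q by (intro mult_mono power_mono) (auto simp: q_def)
      also have "\<dots> = q ^ (?d * (r - 1) + (?d - 1))" by (simp only: power_mult power_add)
      also have "?d * (r - 1) + (?d - 1) = ?d * r - 1"
      proof -
        obtain r' where "r = Suc r'" using i by (cases r) auto
        then show ?thesis by simp
      qed
      finally show ?thesis using c by blast
    qed
    have fin: "finite (\<Union>i<r. ?S i)" using Si by blast
    have "card (Cdep r g T) \<le> card (\<Union>i<r. ?S i)" using fin sub by (rule card_mono)
    also have "\<dots> \<le> (\<Sum>i<r. card (?S i))" by (rule card_UN_le) simp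
    finally have "real (card (Cdep r g T)) \<le> (\<Sum>i<r. real (card (?S i)))" by (simp flip: of_nat_sum)
    also have "\<dots> \<le> (\<Sum>i<r. q ^ (?d * r - 1))" using Si by (intro sum_mono) auto
    also have "\<dots> = real r * q ^ (?d * r - 1)" by simp
    also have "\<dots> \<le> real r * ((2 * b + 1) * T) ^ (?d * r - 1)"
      using T q by (intro mult_left_mono power_mono) (auto simp: q_def M_def algebra_simps)
    finally show ?thesis using finite_subset[OF sub fin] by (simp add: power_mult_distrib mult.assoc)
  qed
  moreover have "?K \<ge> 0" using b by simp
  ultimately show ?thesis by blast
qed

text \<open>Removing the dependent tuples from \<open>Call\<close> changes the normalised count by
  at most \<open>K / k\<close>.\<close>

lemma CD_asymptotic:
  fixes g :: "real^'n^'n"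
  assumes g: "det g = 1" and u: "u \<ge> 1" and r: "r \<le> CARD('n)"
  shows "(\<lambda>k. real (card {B \<in> CD r n D u. \<forall>j<r. norm (B j v* g) \<le> real k}) / real k ^ (CARD('n) * r)) \<longlonglongrightarrow>
    real (Ncount n r D u) ^ CARD('n) * (unit_ball_vol (real CARD('n)) / real u ^ CARD('n)) ^ r"
proof -
  let ?d = "CARD('n)"
  let ?F = "\<lambda>k. {B \<in> CD r n D u. \<forall>j<r. norm (B j v* g) \<le> real k}"
  let ?A = "\<lambda>k. real (card (Call r n D u g (real k))) / real k ^ (?d * r)"
  obtain K where K: "K \<ge> 0" "\<And>T. T \<ge> 1 \<Longrightarrow> finite (Cdep r g T) \<and> real (card (Cdep r g T)) \<le> K * T ^ (?d * r - 1)"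
    using card_Cdep[OF g r] by blast
  have FC: "?F k \<subseteq> Call r n D u g (real k)" for k by (auto simp: CD_def Call_def)
  have up: "real (card (?F k)) \<le> real (card (Call r n D u g (real k)))" for k
    using card_mono[OF card_Call(1)[OF g u] FC] by simp
  have lo: "real (card (Call r n D u g (real k))) / real k ^ (?d * r) - K / real k \<le> real (card (?F k)) / real k ^ (?d * r)"
    if k: "k \<ge> 1" for k
  proof (cases "r = 0")
    \<comment> \<open>For \<open>r = 0\<close> the exponent \<open>d * r - 1\<close> is truncated to
      \<open>0\<close> and does not save a power of \<open>k\<close>; here the two sets simply
      coincide.\<close>
    case True
    then have "?F k = Call r n D u g (real k)" by (auto simp: CD_def Call_def indep_def)
    then show ?thesis using K(1) by simp
  next
    case False
    have k1: "real k \<ge> 1" using k by simp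
    have "Call r n D u g (real k) \<subseteq> ?F k \<union> Cdep r g (real k)" by (auto simp: CD_def Call_def Cdep_def)
    then have "card (Call r n D u g (real k)) \<le> card (?F k \<union> Cdep r g (real k))"
      using finite_subset[OF FC card_Call(1)[OF g u]] K(2)[OF k1] by (intro card_mono) auto
    also have "\<dots> \<le> card (?F k) + card (Cdep r g (real k))" by (rule card_Un_le)
    finally have "real (card (Call r n D u g (real k))) \<le> real (card (?F k)) + K * real k ^ (?d * r - 1)"
      using K(2)[OF k1] by linarith
    then have "real (card (Call r n D u g (real k))) / real k ^ (?d * r) \<le> (real (card (?F k)) + K * real k ^ (?d * r - 1)) / real k ^ (?d * r)"
      by (intro divide_right_mono) auto
    also have "\<dots> = real (card (?F k)) / real k ^ (?d * r) + K * (real k ^ (?d * r - 1) / real k ^ (?d * r))"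
      by (simp add: add_divide_distrib)
    also have "real k ^ (?d * r - 1) / real k ^ (?d * r) = 1 / real k"
    proof -
      have "real k ^ (?d * r) = real k ^ (?d * r - 1) * real k"
        using False power_minus_mult[of "?d * r" "real k"] by simp
      then show ?thesis using k1 by simp
    qed
    finally show ?thesis by simp
  qed
  show ?thesis
  proof (rule real_tendsto_sandwich)
    have "(\<lambda>k. ?A k - K / real k) \<longlonglongrightarrow> real (Ncount n r D u) ^ ?d * (unit_ball_vol (real ?d) / real u ^ ?d) ^ r - 0"
      by (intro tendsto_diff Call_asymptotic g u lim_const_over_n)
    then show "(\<lambda>k. ?A k - K / real k) \<longlonglongrightarrow> real (Ncount n r D u) ^ ?d * (unit_ball_vol (real ?d) / real u ^ ?d) ^ r" by simp
    show "?A \<longlonglongrightarrow> real (Ncount n r D u) ^ ?d * (unit_ball_vol (real ?d) / real u ^ ?d) ^ r"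
      by (intro Call_asymptotic g u)
    show "\<forall>\<^sub>F k in sequentially. ?A k - K / real k \<le> real (card (?F k)) / real k ^ (?d * r)"
      using eventually_ge_at_top[of 1] by eventually_elim (rule lo)
    show "\<forall>\<^sub>F k in sequentially. real (card (?F k)) / real k ^ (?d * r) \<le> ?A k"
      using up by (intro always_eventually allI divide_right_mono) auto
  qed
qed

section \<open>Rogers' mean value formula\<close>

lemma CD_bounded:
  fixes g :: "real^'n^'n"
  assumes g: "det g = 1"
  shows "finite {B \<in> CD r n D u. \<forall>j<r. norm (B j v* g) \<le> R}"
    and "card {B \<in> CD r n D u. \<forall>j<r. norm (B j v* g) \<le> R} \<le> Nlat g R ^ r"
    and "(\<integral>\<^sup>+ B. indicator (bdd_tuples r R) (tmul r B g) \<partial>count_space (CD r n D u)) = of_nat (card {B \<in> CD r n D u. \<forall>j<r. norm (B j v* g) \<le> R})"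
proof -
  let ?S = "{B \<in> CD r n D u. \<forall>j<r. norm (B j v* g) \<le> R}"
  let ?Z = "{z \<in> Zv. norm (z v* g) \<le> R}"
  have Z: "finite ?Z" using finite_Nlat[of g R] g by simp
  have sub: "?S \<subseteq> PiE {..<r} (\<lambda>_. ?Z)"
  proof (intro subsetI PiE_I)
    fix B j assume B: "B \<in> ?S"
    then have BZ: "B \<in> PiE {..<r} (\<lambda>_. Zv)" by (simp add: CD_def)
    show "j \<in> {..<r} \<Longrightarrow> B j \<in> ?Z" using B PiE_mem[OF BZ] by simp
    show "j \<notin> {..<r} \<Longrightarrow> B j = undefined" by (rule PiE_arb[OF BZ])
  qed
  have fin: "finite (PiE {..<r} (\<lambda>_. ?Z))" using Z by (intro finite_PiE) auto
  show S: "finite ?S" using sub fin by (rule finite_subset)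
  show "card ?S \<le> Nlat g R ^ r" using card_mono[OF fin sub] by (simp add: card_PiE Nlat_def)
  have "(\<integral>\<^sup>+ B. indicator (bdd_tuples r R) (tmul r B g) \<partial>count_space (CD r n D u)) =
    (\<integral>\<^sup>+ B. indicator ?S B \<partial>count_space (CD r n D u))"
    by (intro nn_integral_cong) (auto simp: indicator_def bdd_tuples_def tmul_def PiE_iff)
  also have "\<dots> = of_nat (card ?S)"
    using S by (subst nn_integral_indicator) (auto simp: emeasure_count_space_finite)
  finally show "(\<integral>\<^sup>+ B. indicator (bdd_tuples r R) (tmul r B g) \<partial>count_space (CD r n D u)) = of_nat (card ?S)" .
qed

text \<open>A tuple consists of \<open>r\<close> lattice points in the ball, and
  \<open>Nlat_scale\<close> reduces the ball to the unit ball. Since \<open>Nlat g 1 \<ge> 1\<close>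
  and \<open>r \<le> d - 1\<close>, the result is bounded by the power whose mean is finite,
  uniformly in \<open>T\<close>.\<close>

lemma CD_count_bound:
  fixes g :: "real^'n^'n"
  assumes g: "det g = 1" and r: "r < CARD('n)" and T: "T \<ge> 1"
  shows "real (card {B \<in> CD r n D u. \<forall>j<r. norm (B j v* g) \<le> T}) / T ^ (CARD('n) * r)
    \<le> ((2 * real CARD('n) + 3) ^ CARD('n)) ^ r * real (Nlat g 1) ^ (CARD('n) - 1)"
proof -
  let ?d = "CARD('n)"
  let ?C = "(2 * real ?d + 3) ^ ?d"
  have "0 \<in> {z \<in> Zv. norm (z v* g) \<le> 1}" using Zv_0 by simp
  then have "{z \<in> Zv. norm (z v* g) \<le> 1} \<noteq> {}" by blast
  then have "card {z \<in> Zv. norm (z v* g) \<le> 1} > 0"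
    using finite_Nlat[of g 1] g by (subst card_gt_0_iff) simp
  then have N1: "Nlat g 1 \<ge> 1"
    unfolding Nlat_def by linarith
  have "real (card {B \<in> CD r n D u. \<forall>j<r. norm (B j v* g) \<le> T}) \<le> real (Nlat g T) ^ r"
    using of_nat_mono[OF CD_bounded(2)[OF g, of r n D u T], where 'a = real] by simp
  also have "\<dots> \<le> (?C * T ^ ?d * real (Nlat g 1)) ^ r"
    using Nlat_scale[OF g T] by (intro power_mono) auto
  also have "\<dots> = T ^ (?d * r) * (?C ^ r * real (Nlat g 1) ^ r)"
    by (simp add: power_mult_distrib power_mult)
  also have "\<dots> \<le> T ^ (?d * r) * (?C ^ r * real (Nlat g 1) ^ (?d - 1))"
    using N1 r T by (intro mult_left_mono power_increasing) auto
  finally show ?thesis using T by (simp add: divide_le_eq mult.commute)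
qed

context asl_measure
begin

text \<open>Prepares dominated convergence. The radii are \<open>Suc k\<close>, so that they are at
  least one and the normalising power never vanishes.\<close>

lemma CD_dominated:
  fixes n u :: nat and D :: "nat \<Rightarrow> nat \<Rightarrow> int"
  assumes r: "r < CARD('n)"
  defines "f k q \<equiv> (\<integral>\<^sup>+ B. indicator (bdd_tuples r (real (Suc k))) (tmul r B (fst q)) \<partial>count_space (CD r n D u)) / ennreal (real (Suc k) ^ (CARD('n) * r))"
    and "w q \<equiv> ennreal (((2 * real CARD('n) + 3) ^ CARD('n)) ^ r) * NL (fst q) 1 ^ (CARD('n) - 1)"
  shows "f k \<in> borel_measurable P" and "w \<in> borel_measurable P"
    and "AE q in P. f k q \<le> w q" and "(\<integral>\<^sup>+ q. w q \<partial>P) < \<infinity>"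
    and "det (fst (q::'n asl)) = 1 \<Longrightarrow> f k q = ennreal (real (card {B \<in> CD r n D u. \<forall>j<r. norm (B j v* fst q) \<le> real (Suc k)}) / real (Suc k) ^ (CARD('n) * r))"
proof -
  have fst: "fst \<in> borel_measurable P" using borel_measurable_fst by simp
  have "(\<lambda>g. \<integral>\<^sup>+ B. indicator (bdd_tuples r (real (Suc k))) (tmul r B g) \<partial>count_space (CD r n D u)) \<in> borel_measurable (borel :: (real^'n^'n) measure)"
    by (rule borel_measurable_sum_C[OF SLZ_inv_CD]) simp
  from measurable_compose[OF fst this] show "f k \<in> borel_measurable P" unfolding f_def by measurable
  have NLm: "(\<lambda>q. NL (fst q) 1) \<in> borel_measurable P" using measurable_compose[OF fst borel_measurable_NL] .
  then show "w \<in> borel_measurable P" unfolding w_def by measurable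
  show f: "f k q = ennreal (real (card {B \<in> CD r n D u. \<forall>j<r. norm (B j v* fst q) \<le> real (Suc k)}) / real (Suc k) ^ (CARD('n) * r))"
    if "det (fst q) = 1" for q :: "'n asl"
    unfolding f_def CD_bounded(3)[OF that] by (simp add: ennreal_of_nat_eq_real_of_nat divide_ennreal)
  show "AE q in P. f k q \<le> w q"
  proof (rule eventually_mono[OF AE_det])
    fix q :: "'n asl" assume q: "det (fst q) = 1"
    have w: "w q = ennreal (((2 * real CARD('n) + 3) ^ CARD('n)) ^ r * real (Nlat (fst q) 1) ^ (CARD('n) - 1))"
      using q by (simp add: w_def NL_Nlat ennreal_of_nat_eq_real_of_nat ennreal_power ennreal_mult)
    show "f k q \<le> w q" unfolding f[OF q] w
      by (intro ennreal_leI CD_count_bound q r) simp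
  qed
  have "(\<integral>\<^sup>+ q. w q \<partial>P) = ennreal (((2 * real CARD('n) + 3) ^ CARD('n)) ^ r) * (\<integral>\<^sup>+ q. NL (fst q) 1 ^ (CARD('n) - 1) \<partial>P)"
    unfolding w_def using NLm by (intro nn_integral_cmult) measurable
  then show "(\<integral>\<^sup>+ q. w q \<partial>P) < \<infinity>" using finite_moment by (simp add: ennreal_mult_less_top)
qed

lemma nuC_CD_bdd:
  assumes r: "r < CARD('n)"
  shows "emeasure (nuC r (CD r n D u)) (bdd_tuples r (real (Suc k))) / ennreal (real (Suc k) ^ (CARD('n) * r)) =
    (\<integral>\<^sup>+ q. (\<integral>\<^sup>+ B. indicator (bdd_tuples r (real (Suc k))) (tmul r B (fst q)) \<partial>count_space (CD r n D u)) / ennreal (real (Suc k) ^ (CARD('n) * r)) \<partial>P)"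
    and "emeasure (nuC r (CD r n D u)) (bdd_tuples r (real (Suc k))) < \<infinity>"
proof -
  let ?c = "ennreal (real (Suc k) ^ (CARD('n) * r))"
  have fst: "fst \<in> borel_measurable P" using borel_measurable_fst by simp
  have "(\<lambda>g. \<integral>\<^sup>+ B. indicator (bdd_tuples r (real (Suc k))) (tmul r B g) \<partial>count_space (CD r n D u)) \<in> borel_measurable (borel :: (real^'n^'n) measure)"
    by (rule borel_measurable_sum_C[OF SLZ_inv_CD]) simp
  note m = measurable_compose[OF fst this]
  show e: "emeasure (nuC r (CD r n D u)) (bdd_tuples r (real (Suc k))) / ?c =
    (\<integral>\<^sup>+ q. (\<integral>\<^sup>+ B. indicator (bdd_tuples r (real (Suc k))) (tmul r B (fst q)) \<partial>count_space (CD r n D u)) / ?c \<partial>P)"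
    unfolding emeasure_nuC[OF SLZ_inv_CD sets_bdd_tuples] by (rule nn_integral_divide[OF m, symmetric])
  have "emeasure (nuC r (CD r n D u)) (bdd_tuples r (real (Suc k))) / ?c < \<infinity>"
    unfolding e using nn_integral_mono_AE[OF CD_dominated(3)[OF r, where k = k and n = n and D = D and u = u]] CD_dominated(4)[OF r] by (rule order.strict_trans1)
  then show "emeasure (nuC r (CD r n D u)) (bdd_tuples r (real (Suc k))) < \<infinity>"
    by (auto simp: ennreal_divide_eq_top_iff less_top[symmetric] ennreal_top_divide simp del: of_nat_Suc)
qed

text \<open>Finiteness on bounded sets comes from the moment bound and transitivity from
  \<open>transitive_indep\<close>; both rest on \<open>r < CARD('n)\<close>.\<close>

lemma invariant_pair_CD:
  assumes r: "r < CARD('n)"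
  shows "invariant_pair r (nuC r (CD r n D u)) (TT r) {X \<in> space (TT r). indep r (X :: nat \<Rightarrow> real^'n)}"
proof -
  let ?nu = "nuC r (CD r n D u)"
  let ?Om = "{X \<in> space (TT r). indep r (X :: nat \<Rightarrow> real^'n)}"
  have sf: "sigma_finite_measure ?nu"
  proof (rule sigma_finite_bdd_tuples)
    fix R :: nat
    have "bdd_tuples r (real R) \<subseteq> (bdd_tuples r (real (Suc R)) :: (nat \<Rightarrow> real^'n) set)"
      unfolding bdd_tuples_def by (intro PiE_mono) auto
    then have "emeasure ?nu (bdd_tuples r (real R)) \<le> emeasure ?nu (bdd_tuples r (real (Suc R)))"
      by (rule emeasure_mono) (simp only: sets_nuC sets_bdd_tuples)
    also have "\<dots> < \<infinity>" by (rule nuC_CD_bdd(2)[OF r])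
    finally show "emeasure ?nu (bdd_tuples r (real R)) \<noteq> \<infinity>" by simp
  qed simp
  have nz: "emeasure (TT r) (space (TT r :: (nat \<Rightarrow> real^'n) measure)) \<noteq> 0"
  proof
    assume z: "emeasure (TT r) (space (TT r :: (nat \<Rightarrow> real^'n) measure)) = 0"
    have "emeasure (TT r) (bdd_tuples r 1 :: (nat \<Rightarrow> real^'n) set) \<le> emeasure (TT r) (space (TT r :: (nat \<Rightarrow> real^'n) measure))"
      by (rule emeasure_space)
    then show False using z unit_ball_vol_pos[of "real CARD('n)"] by (simp add: emeasure_bdd_tuples emeasure_cball)
  qed
  have ind: "{X \<in> space (TT r). indep r (X :: nat \<Rightarrow> real^'n)} \<in> sets (TT r)" by measurable
  show ?thesis
  proof
    show "AE X in ?nu. X \<in> ?Om"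
    proof (rule AE_nuC[OF SLZ_inv_CD])
      have "{X \<in> space (TT r). X \<in> ?Om} = ?Om" by blast
      then show "{X \<in> space (TT r). X \<in> ?Om} \<in> sets (TT r)" using ind by (simp only:)
      fix A :: "nat \<Rightarrow> real^'n" and g :: "real^'n^'n" assume A: "A \<in> CD r n D u" and g: "det g = 1"
      have "indep r (tmul r A g)" using A g by (simp add: indep_tmul CD_def)
      then show "tmul r A g \<in> ?Om" by (intro CollectI conjI tmul_in_space)
    qed
    show "AE X in TT r. X \<in> ?Om"
      using AE_space AE_indep[OF less_imp_le[OF r]] by eventually_elim (rule CollectI, rule conjI)
    show "\<And>X Y. X \<in> ?Om \<Longrightarrow> Y \<in> ?Om \<Longrightarrow> \<exists>h. det h = 1 \<and> Y = tmul r X h"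
      by (rule transitive_indep[OF r]) (simp_all add: space_TT)
    show "\<And>h. det h = 1 \<Longrightarrow> distr ?nu (TT r) (\<lambda>X. tmul r X h) = ?nu"
      by (rule nuC_invariant[OF SLZ_inv_CD])
    show "\<And>h::real^'n^'n. det h = 1 \<Longrightarrow> distr (TT r) (TT r) (\<lambda>X. tmul r X h) = TT r"
      by (rule distr_TT_tmul) simp
    show "\<exists>A. countable A \<and> A \<subseteq> sets ?nu \<and> \<Union>A = space ?nu \<and> (\<forall>a\<in>A. emeasure ?nu a \<noteq> \<infinity>)"
      using sf unfolding sigma_finite_measure_def .
    show "\<exists>A. countable A \<and> A \<subseteq> sets (TT r) \<and> \<Union>A = space (TT r) \<and> (\<forall>a\<in>A. emeasure (TT r :: (nat \<Rightarrow> real^'n) measure) a \<noteq> \<infinity>)"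
      using sigma_finite_TT[of r] unfolding sigma_finite_measure_def .
    show "emeasure (TT r) (space (TT r :: (nat \<Rightarrow> real^'n) measure)) \<noteq> 0" by (rule nz)
  qed simp_all
qed

text \<open>By uniqueness the intensity measure is \<open>c\<close> times Lebesgue measure, so the
  normalised mass of a product of balls is the same for every radius. Its limit for growing radius
  is found pointwise by \<open>CD_asymptotic\<close> and dominated convergence, and this identifies
  \<open>c\<close>.\<close>

theorem mean_value_CD:
  assumes r: "r < CARD('n)" and u: "u \<ge> 1" and f: "f \<in> borel_measurable (TT r)"
  shows "(\<integral>\<^sup>+ q. (\<integral>\<^sup>+ B. f (tmul r B (fst q)) \<partial>count_space (CD r n D u)) \<partial>P) =
    ennreal ((real (Ncount n r D u) / real u ^ r) ^ CARD('n)) * (\<integral>\<^sup>+ X. f X \<partial>(TT r :: (nat \<Rightarrow> real^'n) measure))"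
proof -
  let ?d = "CARD('n)"
  let ?nu = "nuC r (CD r n D u)"
  let ?v = "unit_ball_vol (real ?d)"
  let ?N = "(real (Ncount n r D u) / real u ^ r) ^ ?d"
  have v: "?v > 0" by (rule unit_ball_vol_pos) simp
  obtain c where c: "c \<noteq> \<infinity>" "\<And>f. f \<in> borel_measurable (TT r) \<Longrightarrow>
      (\<integral>\<^sup>+ X. f X \<partial>?nu) = c * (\<integral>\<^sup>+ X. f X \<partial>(TT r :: (nat \<Rightarrow> real^'n) measure))"
    using invariant_pair_nn_integral[OF invariant_pair_CD[OF r, of n D u]] by blast
  have const: "emeasure ?nu (bdd_tuples r (real (Suc k))) / ennreal (real (Suc k) ^ (?d * r)) = c * ennreal (?v ^ r)" for k
  proof -
    have "emeasure ?nu (bdd_tuples r (real (Suc k))) = c * emeasure (TT r) (bdd_tuples r (real (Suc k)) :: (nat \<Rightarrow> real^'n) set)"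
      using c(2)[of "indicator (bdd_tuples r (real (Suc k)))"] by simp
    also have "\<dots> = c * ennreal ((?v * real (Suc k) ^ ?d) ^ r)"
      unfolding emeasure_bdd_tuples by (simp add: emeasure_cball ennreal_power)
    also have "(?v * real (Suc k) ^ ?d) ^ r = ?v ^ r * real (Suc k) ^ (?d * r)"
      by (simp only: power_mult_distrib power_mult)
    also have "c * ennreal (?v ^ r * real (Suc k) ^ (?d * r)) = c * ennreal (?v ^ r) * ennreal (real (Suc k) ^ (?d * r))"
      using v by (simp add: ennreal_mult mult.assoc)
    also have "\<dots> / ennreal (real (Suc k) ^ (?d * r)) = c * ennreal (?v ^ r)"
      by (rule ennreal_mult_divide_eq) auto
    finally show ?thesis .
  qed
  have "(\<lambda>k. \<integral>\<^sup>+ q. (\<integral>\<^sup>+ B. indicator (bdd_tuples r (real (Suc k))) (tmul r B (fst q)) \<partial>count_space (CD r n D u)) / ennreal (real (Suc k) ^ (?d * r)) \<partial>P)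
    \<longlonglongrightarrow> (\<integral>\<^sup>+ q. ennreal (?N * ?v ^ r) \<partial>P)"
  proof (rule nn_integral_dominated_convergence[OF CD_dominated(1)[OF r] _ CD_dominated(2)[OF r] CD_dominated(3)[OF r] CD_dominated(4)[OF r]])
    show "AE q in P. (\<lambda>k. (\<integral>\<^sup>+ B. indicator (bdd_tuples r (real (Suc k))) (tmul r B (fst q)) \<partial>count_space (CD r n D u)) / ennreal (real (Suc k) ^ (?d * r)))
      \<longlonglongrightarrow> ennreal (?N * ?v ^ r)"
    proof (rule eventually_mono[OF AE_det])
      fix q :: "'n asl" assume q: "det (fst q) = 1"
      have e: "real (Ncount n r D u) ^ ?d * (?v / real u ^ ?d) ^ r = ?N * ?v ^ r"
        by (simp add: power_divide power_mult[symmetric] mult.commute)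
      show "(\<lambda>k. (\<integral>\<^sup>+ B. indicator (bdd_tuples r (real (Suc k))) (tmul r B (fst q)) \<partial>count_space (CD r n D u)) / ennreal (real (Suc k) ^ (?d * r)))
        \<longlonglongrightarrow> ennreal (?N * ?v ^ r)"
        unfolding CD_dominated(5)[OF r q]
        using LIMSEQ_Suc[OF CD_asymptotic[OF q u less_imp_le[OF r], of n D]] unfolding e
        by (rule tendsto_ennrealI)
    qed
  qed simp
  then have "(\<lambda>k. c * ennreal (?v ^ r)) \<longlonglongrightarrow> ennreal (?N * ?v ^ r)"
    unfolding nuC_CD_bdd(1)[OF r, symmetric] const using emeasure_space_1 by simp
  then have "c * ennreal (?v ^ r) = ennreal (?N * ?v ^ r)" by (rule LIMSEQ_unique[OF tendsto_const])
  also have "\<dots> = ennreal ?N * ennreal (?v ^ r)" using v by (intro ennreal_mult) auto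
  finally have "c * ennreal (?v ^ r) / ennreal (?v ^ r) = ennreal ?N * ennreal (?v ^ r) / ennreal (?v ^ r)" by simp
  moreover have "a * ennreal (?v ^ r) / ennreal (?v ^ r) = a" for a
  proof (rule ennreal_mult_divide_eq)
    show "ennreal (?v ^ r) \<noteq> 0" using zero_less_power[OF v, of r] by (simp only: ennreal_eq_0_iff not_le)
  qed simp
  ultimately have "c = ennreal ?N" by simp
  then show ?thesis using c(2)[OF f] by (simp add: nn_integral_nuC[OF SLZ_inv_CD f])
qed

end

section \<open>Rogers' stratification of integral tuples\<close>

lemma indep_coeff_zero:
  fixes X :: "nat \<Rightarrow> real^'n"
  assumes "indep r X" "(\<Sum>j<r. c j *\<^sub>R X j) = 0" "j < r"
  shows "c j = 0"
  using assms
proof (induction r arbitrary: j)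
  case (Suc r)
  have ind: "indep r X" "X r \<notin> span (X ` {..<r})" using Suc.prems(1) by (auto simp: indep_def)
  have "c r = 0"
  proof (rule ccontr)
    assume c: "c r \<noteq> 0"
    have "c r *\<^sub>R X r = - (\<Sum>j<r. c j *\<^sub>R X j)" using Suc.prems(2) by (simp add: eq_neg_iff_add_eq_0 add.commute)
    also have "\<dots> \<in> span (X ` {..<r})" by (intro span_neg span_sum span_scale span_base) auto
    finally have "(1 / c r) *\<^sub>R (c r *\<^sub>R X r) \<in> span (X ` {..<r})" by (rule span_scale)
    then show False using c ind(2) by simp
  qed
  moreover have "c i = 0" if "i < r" for i using Suc.IH[OF ind(1) _ that] Suc.prems(2) \<open>c r = 0\<close> by simp
  ultimately show ?case using Suc.prems(3) by (cases "j = r") auto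
qed simp

lemma indep_coeff_unique:
  fixes X :: "nat \<Rightarrow> real^'n"
  assumes "indep r X" "(\<Sum>j<r. c j *\<^sub>R X j) = (\<Sum>j<r. c' j *\<^sub>R X j)" "j < r"
  shows "c j = c' j"
proof -
  have "(\<Sum>j<r. (c j - c' j) *\<^sub>R X j) = 0" using assms(2) by (simp add: scaleR_diff_left sum_subtractf)
  from indep_coeff_zero[OF assms(1) this assms(3)] show ?thesis by simp
qed

text \<open>Pigeonhole on the fractional parts of the multiples of the coefficients.\<close>

lemma rational_coeffs:
  fixes X :: "nat \<Rightarrow> real^'n"
  assumes ind: "indep r X" and X: "\<And>j. j < r \<Longrightarrow> X j \<in> Zv" and w: "(\<Sum>j<r. c j *\<^sub>R X j) \<in> Zv"
  shows "\<exists>q\<ge>1::nat. \<forall>j<r. real q * c j \<in> \<int>"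
proof -
  define fr where "fr m = (\<Sum>j<r. frac (real m * c j) *\<^sub>R X j)" for m :: nat
  let ?B = "{z::real^'n. z \<in> Zv \<and> (\<forall>i. \<bar>z $ i\<bar> \<le> (\<Sum>j<r. norm (X j)))}"
  have "fr m \<in> ?B" for m
  proof -
    \<comment> \<open>Taking fractional parts subtracts an integral combination of the
      \<open>X j\<close>, so \<open>fr m\<close> remains integral while its size is bounded
      independently of \<open>m\<close>.\<close>
    have "fr m = real m *\<^sub>R (\<Sum>j<r. c j *\<^sub>R X j) - (\<Sum>j<r. of_int \<lfloor>real m * c j\<rfloor> *\<^sub>R X j)"
      unfolding fr_def scaleR_sum_right sum_subtractf[symmetric]
      by (intro sum.cong) (simp_all add: frac_def scaleR_diff_left)
    also have "\<dots> \<in> Zv"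
    proof (rule Zv_diff)
      show "real m *\<^sub>R (\<Sum>j<r. c j *\<^sub>R X j) \<in> Zv" using w by (rule Zv_scale) simp
      show "(\<Sum>j<r. of_int \<lfloor>real m * c j\<rfloor> *\<^sub>R X j) \<in> Zv" using X by (intro Zv_sum Zv_scale) auto
    qed
    finally have Z: "fr m \<in> Zv" .
    have "\<bar>fr m $ i\<bar> \<le> (\<Sum>j<r. norm (X j))" for i
    proof -
      have "\<bar>fr m $ i\<bar> \<le> norm (fr m)" by (rule component_le_norm_cart)
      also have "\<dots> \<le> (\<Sum>j<r. norm (X j))"
        unfolding fr_def
      proof (rule sum_norm_le)
        fix j
        have "\<bar>frac (real m * c j)\<bar> \<le> 1" using frac_lt_1[of "real m * c j"] frac_ge_0[of "real m * c j"] by linarith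
        then show "norm (frac (real m * c j) *\<^sub>R X j) \<le> norm (X j)"
          by (simp add: mult_left_le_one_le)
      qed
      finally show ?thesis .
    qed
    then show ?thesis using Z by blast
  qed
  then have "finite (range fr)" by (intro finite_subset[OF _ finite_Zv_box]) auto
  then have "\<not> inj fr" using finite_imageD infinite_UNIV_nat by blast
  then obtain m m' where mm: "m < m'" "fr m = fr m'"
    unfolding inj_def by (metis linorder_neqE_nat)
  have "real (m' - m) * c j \<in> \<int>" if j: "j < r" for j
  proof -
    have "frac (real m * c j) = frac (real m' * c j)"
      using mm(2) unfolding fr_def by (rule indep_coeff_unique[OF ind _ j])
    then have "real m' * c j - real m * c j = of_int (\<lfloor>real m' * c j\<rfloor> - \<lfloor>real m * c j\<rfloor>)"
      by (simp add: frac_def)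
    moreover have "real (m' - m) * c j = real m' * c j - real m * c j"
      using mm(1) by (simp add: of_nat_diff left_diff_distrib)
    ultimately show ?thesis by simp
  qed
  then show ?thesis using mm(1) by (intro exI[of _ "m' - m"]) auto
qed

text \<open>The row indices of the identity block in Rogers' notation, read off from the tuple
  itself.\<close>

definition pivots :: "nat \<Rightarrow> (nat \<Rightarrow> real^'n) \<Rightarrow> nat set" where
  "pivots n A = {i. i < n \<and> A i \<notin> span (A ` {..<i})}"

lemma finite_pivots [simp]: "finite (pivots n A)"
  by (simp add: pivots_def)

lemma card_pivots_le: "card (pivots n A) \<le> n"
  using card_mono[of "{..<n}" "pivots n A"] by (auto simp: pivots_def)

lemma span_pivots:
  assumes "i < n" shows "A i \<in> span (A ` (pivots n A \<inter> {..i}))"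
  using assms
proof (induction i rule: less_induct)
  case (less i)
  show ?case
  proof (cases "i \<in> pivots n A")
    case True
    then show ?thesis by (intro span_base) auto
  next
    case False
    then have "A i \<in> span (A ` {..<i})" using less.prems by (simp add: pivots_def)
    also have "span (A ` {..<i}) \<subseteq> span (A ` (pivots n A \<inter> {..i}))"
    proof (rule span_minimal)
      show "A ` {..<i} \<subseteq> span (A ` (pivots n A \<inter> {..i}))"
      proof
        fix v assume "v \<in> A ` {..<i}"
        then obtain l where l: "l < i" "v = A l" by auto
        have "v \<in> span (A ` (pivots n A \<inter> {..l}))" using less.IH[OF l(1)] l less.prems by simp
        also have "\<dots> \<subseteq> span (A ` (pivots n A \<inter> {..i}))" using l by (intro span_mono) auto
        finally show "v \<in> span (A ` (pivots n A \<inter> {..i}))" .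
      qed
    qed (rule subspace_span)
    finally show ?thesis .
  qed
qed

lemma pivots_empty_iff:
  assumes "A \<in> PiE {..<n} (\<lambda>_. Zv)"
  shows "pivots n A = {} \<longleftrightarrow> A = restrict (\<lambda>_. 0) {..<n}"
proof
  assume "pivots n A = {}"
  then have "A i = 0" if "i < n" for i using span_pivots[OF that, of A] by simp
  then show "A = restrict (\<lambda>_. 0) {..<n}" using assms by (auto simp: fun_eq_iff PiE_def extensional_def)
next
  assume "A = restrict (\<lambda>_. 0) {..<n}"
  then have "A i = 0" if "i < n" for i using that by simp
  then show "pivots n A = {}" by (auto simp: pivots_def span_zero)
qed

text \<open>The identity block returns \<open>B\<close> at the rows \<open>pv\<close>, and the zeros
  above it keep each row \<open>i\<close> in the span of the pivots met up to \<open>i\<close>.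
  Hence the tuple alone determines its pivot positions and \<open>B\<close>.\<close>

lemma matapp_pivots:
  fixes B :: "nat \<Rightarrow> real^'n"
  assumes u: "u \<ge> 1" and ind: "indep r B"
    and pv: "\<And>l. l < r \<Longrightarrow> pv l < n" "\<And>l l'. l < l' \<Longrightarrow> l' < r \<Longrightarrow> pv l < pv l'"
    and D: "\<And>l j. l < r \<Longrightarrow> j < r \<Longrightarrow> D (pv l) j = (if j = l then int u else 0)"
      "\<And>j i. j < r \<Longrightarrow> i < pv j \<Longrightarrow> D i j = 0"
  shows "\<And>l. l < r \<Longrightarrow> matapp n r D u B (pv l) = B l" and "pivots n (matapp n r D u B) = pv ` {..<r}"
proof -
  let ?A = "matapp n r D u B"
  show Aidx: "?A (pv l) = B l" if l: "l < r" for l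
  proof -
    have "?A (pv l) = (\<Sum>j<r. (real_of_int (D (pv l) j) / real u) *\<^sub>R B j)" using pv(1)[OF l] by (simp add: matapp_def)
    also have "\<dots> = (\<Sum>j<r. if j = l then B j else 0)" using D(1)[OF l] u by (intro sum.cong) auto
    also have "\<dots> = B l" using l by simp
    finally show ?thesis .
  qed
  have Aspan: "?A i \<in> span (B ` {j. j < r \<and> pv j \<le> i})" if i: "i < n" for i
  proof -
    have "?A i = (\<Sum>j<r. (real_of_int (D i j) / real u) *\<^sub>R B j)" using i by (simp add: matapp_def)
    also have "\<dots> \<in> span (B ` {j. j < r \<and> pv j \<le> i})"
    proof (rule span_sum)
      fix j assume j: "j \<in> {..<r}"
      show "(real_of_int (D i j) / real u) *\<^sub>R B j \<in> span (B ` {j. j < r \<and> pv j \<le> i})"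
      proof (cases "pv j \<le> i")
        case True
        then show ?thesis using j by (intro span_scale span_base) auto
      next
        case False
        then show ?thesis using D(2)[of j i] j by (simp add: span_zero)
      qed
    qed
    finally show ?thesis .
  qed
  have idx_less: "j < l" if "pv j < pv l" "j < r" "l < r" for j l
    using pv(2)[of l j] that by (cases "j = l"; cases "l < j") auto
  show "pivots n ?A = pv ` {..<r}"
  proof (intro set_eqI iffI)
    fix i assume i: "i \<in> pivots n ?A"
    then have i': "i < n" "?A i \<notin> span (?A ` {..<i})" by (auto simp: pivots_def)
    show "i \<in> pv ` {..<r}"
    proof (rule ccontr)
      assume n: "i \<notin> pv ` {..<r}"
      have "B ` {j. j < r \<and> pv j \<le> i} \<subseteq> ?A ` {..<i}"
      proof
        fix b assume "b \<in> B ` {j. j < r \<and> pv j \<le> i}"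
        then obtain j where j: "j < r" "pv j \<le> i" "b = B j" by auto
        then have "pv j < i" using n by (cases "pv j = i") auto
        then show "b \<in> ?A ` {..<i}" using Aidx[OF j(1)] j(3) by (intro image_eqI[of _ _ "pv j"]) auto
      qed
      from span_mono[OF this] show False using Aspan[OF i'(1)] i'(2) by blast
    qed
  next
    fix i assume "i \<in> pv ` {..<r}"
    then obtain l where l: "l < r" "i = pv l" by auto
    have "?A ` {..<i} \<subseteq> span (B ` {..<l})"
    proof
      fix a assume "a \<in> ?A ` {..<i}"
      then obtain i' where i': "i' < i" "a = ?A i'" by auto
      have "{j. j < r \<and> pv j \<le> i'} \<subseteq> {..<l}" using idx_less[OF _ _ l(1)] i' l by auto
      then have "span (B ` {j. j < r \<and> pv j \<le> i'}) \<subseteq> span (B ` {..<l})" by (intro span_mono image_mono)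
      then show "a \<in> span (B ` {..<l})" using Aspan[of i'] i' pv(1)[OF l(1)] l by auto
    qed
    then have "span (?A ` {..<i}) \<subseteq> span (B ` {..<l})" by (rule span_minimal) (rule subspace_span)
    then show "i \<in> pivots n ?A" using ind l Aidx[OF l(1)] pv(1)[OF l(1)] by (auto simp: pivots_def indep_def)
  qed
qed

lemma strict_enum_unique:
  fixes pv pv' :: "nat \<Rightarrow> nat"
  assumes "\<And>l l'. l < l' \<Longrightarrow> l' < r \<Longrightarrow> pv l < (pv l' :: nat)" "\<And>l l'. l < l' \<Longrightarrow> l' < r \<Longrightarrow> pv' l < pv' l'"
    and "pv ` {..<r} = pv' ` {..<r}" and l: "l < r"
  shows "pv l = pv' l"
proof -
  have s: "sorted_wrt (<) (map e [0..<r])" if "\<And>l l'. l < l' \<Longrightarrow> l' < r \<Longrightarrow> e l < (e l' :: nat)" for e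
    using that by (simp add: sorted_wrt_iff_nth_less)
  have "map pv [0..<r] = map pv' [0..<r]"
  proof (rule strict_sorted_equal)
    show "sorted_wrt (<) (map pv' [0..<r])" by (rule s) (rule assms(2))
    show "sorted_wrt (<) (map pv [0..<r])" by (rule s) (rule assms(1))
    show "set (map pv [0..<r]) = set (map pv' [0..<r])" using assms(3) by (simp add: atLeast0LessThan)
  qed
  from arg_cong[where f = "\<lambda>xs. xs ! l", OF this] show ?thesis using l by simp
qed

lemma Gcd_scale_set:
  "Gcd {c * D i j | i j. i < n \<and> j < r} = \<bar>c\<bar> * Gcd {D i j | i j. i < n \<and> j < (r::nat)}" for D :: "nat \<Rightarrow> nat \<Rightarrow> int"
proof -
  have "{c * D i j | i j. i < n \<and> j < r} = (*) c ` {D i j | i j. i < n \<and> j < r}" by auto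
  then show ?thesis by (simp add: Gcd_mult abs_mult)
qed

lemma matapp_in_PiE:
  assumes u: "u \<ge> 1" and B: "B \<in> CD r n D u"
  shows "matapp n r D u B \<in> PiE {..<n} (\<lambda>_. Zv)"
proof (rule PiE_I)
  fix i assume "i \<in> {..<n}"
  then have i: "i < n" by simp
  then obtain w where w: "w \<in> Zv" "(\<Sum>j<r. real_of_int (D i j) *\<^sub>R B j) = real u *\<^sub>R w"
    using B by (auto simp: CD_def Dsol_def)
  have "matapp n r D u B i = (1 / real u) *\<^sub>R (\<Sum>j<r. real_of_int (D i j) *\<^sub>R B j)"
    using i by (simp add: matapp_def scaleR_sum_right)
  also have "\<dots> = w" using u unfolding w(2) by simp
  finally show "matapp n r D u B i \<in> Zv" using w(1) by simp
qed (simp add: matapp_def)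

definition strat :: "nat \<Rightarrow> nat \<Rightarrow> (nat \<times> (nat \<Rightarrow> nat \<Rightarrow> int) \<times> (nat \<Rightarrow> real^'n)) set" where
  "strat n r = Sigma {1..} (\<lambda>u. Sigma (Dset n r u) (\<lambda>D. CD r n D u))"

lemma Dset_pivots:
  assumes "D \<in> Dset n r u"
  shows "\<exists>pv :: nat \<Rightarrow> nat. (\<forall>l<r. pv l < n) \<and> (\<forall>l l'. l < l' \<and> l' < r \<longrightarrow> pv l < pv l') \<and>
      (\<forall>l<r. \<forall>j<r. D (pv l) j = (if j = l then int u else 0)) \<and> (\<forall>j<r. \<forall>i<pv j. D i j = 0)"
  using assms unfolding Dset_def mem_Collect_eq by (elim conjE)

text \<open>The tuple fixes the pivot positions, hence \<open>B\<close>, hence by independence the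
  rational matrix \<open>D / u\<close>. Among the ways of writing this matrix as a quotient, the
  condition that the entries of \<open>D\<close> have gcd one selects a single pair.\<close>

lemma inj_on_strat:
  assumes r: "r \<ge> 1"
  shows "inj_on (\<lambda>(u, D, B). matapp n r D u B) (strat n r :: (nat \<times> (nat \<Rightarrow> nat \<Rightarrow> int) \<times> (nat \<Rightarrow> real^'n)) set)"
proof (rule inj_onI)
  fix s t :: "nat \<times> (nat \<Rightarrow> nat \<Rightarrow> int) \<times> (nat \<Rightarrow> real^'n)"
  assume st: "s \<in> strat n r" "t \<in> strat n r"
    "(case s of (u, D, B) \<Rightarrow> matapp n r D u B) = (case t of (u, D, B) \<Rightarrow> matapp n r D u B)"
  obtain u D B u' D' B' where s: "s = (u, D, B)" and t: "t = (u', D', B')" by (cases s; cases t)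
  have m: "(u, D, B) \<in> strat n r" "(u', D', B') \<in> strat n r" and eq: "matapp n r D u B = matapp n r D' u' B'"
    using st by (simp_all add: s t)
  have u: "u \<ge> 1" "u' \<ge> 1" and D: "D \<in> Dset n r u" "D' \<in> Dset n r u'" and B: "B \<in> CD r n D u" "B' \<in> CD r n D' u'"
    using m by (auto simp: strat_def)
  have ind: "indep r B" "indep r B'" using B by (auto simp: CD_def)
  obtain pv where q1: "\<forall>l<r. pv l < n" "\<forall>l l'. l < l' \<and> l' < r \<longrightarrow> pv l < pv l'"
    "\<forall>l<r. \<forall>j<r. D (pv l) j = (if j = l then int u else 0)" "\<forall>j<r. \<forall>i<pv j. D i j = 0"
    using Dset_pivots[OF D(1)] by (elim exE conjE)
  have pv: "\<And>l. l < r \<Longrightarrow> pv l < n" "\<And>l l'. l < l' \<Longrightarrow> l' < r \<Longrightarrow> pv l < pv l'"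
    "\<And>l j. l < r \<Longrightarrow> j < r \<Longrightarrow> D (pv l) j = (if j = l then int u else 0)"
    "\<And>j i. j < r \<Longrightarrow> i < pv j \<Longrightarrow> D i j = 0"
    using q1 by simp_all
  obtain pv' where q2: "\<forall>l<r. pv' l < n" "\<forall>l l'. l < l' \<and> l' < r \<longrightarrow> pv' l < pv' l'"
    "\<forall>l<r. \<forall>j<r. D' (pv' l) j = (if j = l then int u' else 0)" "\<forall>j<r. \<forall>i<pv' j. D' i j = 0"
    using Dset_pivots[OF D(2)] by (elim exE conjE)
  have pv': "\<And>l. l < r \<Longrightarrow> pv' l < n" "\<And>l l'. l < l' \<Longrightarrow> l' < r \<Longrightarrow> pv' l < pv' l'"
    "\<And>l j. l < r \<Longrightarrow> j < r \<Longrightarrow> D' (pv' l) j = (if j = l then int u' else 0)"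
    "\<And>j i. j < r \<Longrightarrow> i < pv' j \<Longrightarrow> D' i j = 0"
    using q2 by simp_all
  have p: "\<And>l. l < r \<Longrightarrow> matapp n r D u B (pv l) = B l" "pivots n (matapp n r D u B) = pv ` {..<r}"
    by (rule matapp_pivots[where pv = pv and r = r, OF u(1) ind(1)]; simp add: pv)+
  have p': "\<And>l. l < r \<Longrightarrow> matapp n r D' u' B' (pv' l) = B' l" "pivots n (matapp n r D' u' B') = pv' ` {..<r}"
    by (rule matapp_pivots[where pv = pv' and r = r, OF u(2) ind(2)]; simp add: pv')+
  have im: "pv ` {..<r} = pv' ` {..<r}" using p(2) p'(2) eq by simp
  have pv_eq: "pv l = pv' l" if "l < r" for l by (rule strict_enum_unique[where pv = pv and pv' = pv', OF _ _ im that]) (simp_all add: pv pv')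
  have BB: "B l = B' l" if "l < r" for l using p(1)[OF that] p'(1)[OF that] pv_eq[OF that] eq by simp
  then have "B = B'" using B by (intro PiE_ext[of B "{..<r}" "\<lambda>_. Zv" B']) (auto simp: CD_def)
  have DD: "int u' * D i j = int u * D' i j" if i: "i < n" and j: "j < r" for i j
  proof -
    have "matapp n r D u B i = matapp n r D' u' B i" using eq \<open>B = B'\<close> by simp
    then have "(\<Sum>j<r. (real_of_int (D i j) / real u) *\<^sub>R B j) = (\<Sum>j<r. (real_of_int (D' i j) / real u') *\<^sub>R B j)"
      using i by (simp add: matapp_def)
    from indep_coeff_unique[OF ind(1) this j]
    have "real_of_int (D i j) * real u' = real_of_int (D' i j) * real u" using u by (simp add: frac_eq_eq)
    then have "real_of_int (int u' * D i j) = real_of_int (int u * D' i j)" by (simp add: mult.commute)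
    then show ?thesis by (simp only: of_int_eq_iff)
  qed
  have "{int u' * D i j | i j. i < n \<and> j < r} = {int u * D' i j | i j. i < n \<and> j < r}" using DD by (auto 0 4) metis+
  then have "\<bar>int u'\<bar> * Gcd {D i j | i j. i < n \<and> j < r} = \<bar>int u\<bar> * Gcd {D' i j | i j. i < n \<and> j < r}"
    using Gcd_scale_set[of "int u'" D n r] Gcd_scale_set[of "int u" D' n r] by simp
  then have uu: "u = u'" using D by (simp add: Dset_def)
  have "D i j = D' i j" for i j
  proof (cases "i < n \<and> j < r")
    case True
    then show ?thesis using DD[of i j] u uu by simp
  next
    case False
    then show ?thesis using D by (auto simp: Dset_def)
  qed
  then have "D = D'" by (simp add: fun_eq_iff)
  then show "s = t" using uu \<open>B = B'\<close> by (simp add: s t)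
qed

lemma span_image_sum:
  fixes f :: "'b \<Rightarrow> 'a::real_vector"
  assumes "finite S"
  shows "v \<in> span (f ` S) \<longleftrightarrow> (\<exists>c. v = (\<Sum>l\<in>S. c l *\<^sub>R f l))"
proof
  assume "v \<in> span (f ` S)"
  then show "\<exists>c. v = (\<Sum>l\<in>S. c l *\<^sub>R f l)"
  proof (induction rule: span_induct_alt)
    case base
    show ?case by (intro exI[of _ "\<lambda>_. 0"]) simp
  next
    case (step a x y)
    then obtain c l where c: "y = (\<Sum>l\<in>S. c l *\<^sub>R f l)" and l: "l \<in> S" "x = f l" by auto
    have "a *\<^sub>R x + y = (\<Sum>i\<in>S. (c i + (if i = l then a else 0)) *\<^sub>R f i)"
    proof -
      have "(\<Sum>i\<in>S. (if i = l then a else 0) *\<^sub>R f i) = (\<Sum>i\<in>S. if i = l then a *\<^sub>R f i else 0)"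
        by (intro sum.cong) auto
      also have "\<dots> = a *\<^sub>R x" using l assms by simp
      finally show ?thesis using c by (simp add: scaleR_add_left sum.distrib)
    qed
    then show ?case by (intro exI[of _ "\<lambda>i. c i + (if i = l then a else 0)"])
  qed
next
  assume "\<exists>c. v = (\<Sum>l\<in>S. c l *\<^sub>R f l)"
  then show "v \<in> span (f ` S)" by (elim exE, simp only:) (intro span_sum span_scale span_base imageI)
qed

text \<open>To express \<open>A i\<close> only pivots at positions up to \<open>i\<close> are
  needed; the other coefficients can be taken zero, which produces the required zeros above the
  identity block of \<open>D\<close>.\<close>

lemma pivot_coeffs:
  fixes A :: "nat \<Rightarrow> real^'n" and n :: nat
  defines "pv \<equiv> (!) (sorted_list_of_set (pivots n A))"
  assumes r: "r = card (pivots n A)" and i: "i < n"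
  shows "\<exists>c. A i = (\<Sum>l<r. c l *\<^sub>R A (pv l)) \<and> (\<forall>l<r. i < pv l \<longrightarrow> c l = 0)"
proof -
  have bij: "bij_betw pv {..<r} (pivots n A)"
    unfolding pv_def r using bij_betw_nth[of "sorted_list_of_set (pivots n A)" "{..<card (pivots n A)}" "pivots n A"] by simp
  let ?S = "{l. l < r \<and> pv l \<le> i}"
  have "A i \<in> span ((\<lambda>l. A (pv l)) ` ?S)"
  proof -
    have "pivots n A \<inter> {..i} = pv ` ?S" using bij_betw_imp_surj_on[OF bij] by auto
    then show ?thesis using span_pivots[OF i, of A] by (simp add: image_image)
  qed
  then obtain c where c: "A i = (\<Sum>l\<in>?S. c l *\<^sub>R A (pv l))"
    by (auto simp: span_image_sum)
  have "A i = (\<Sum>l<r. (if pv l \<le> i then c l else 0) *\<^sub>R A (pv l))"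
    unfolding c by (intro sum.mono_neutral_cong_left) auto
  then show ?thesis by (intro exI[of _ "\<lambda>l. if pv l \<le> i then c l else 0"]) auto
qed

lemma common_denominator:
  fixes c :: "nat \<Rightarrow> nat \<Rightarrow> real"
  assumes "\<And>i. i < n \<Longrightarrow> \<exists>q\<ge>1::nat. \<forall>j<r. real q * c i j \<in> \<int>"
  shows "\<exists>q\<ge>1::nat. \<forall>i<n. \<forall>j<r. real q * c i j \<in> \<int>"
  using assms
proof (induction n)
  case 0
  show ?case by auto
next
  case (Suc n)
  have "\<exists>q\<ge>1::nat. \<forall>i<n. \<forall>j<r. real q * c i j \<in> \<int>" by (rule Suc.IH) (rule Suc.prems, simp)
  then obtain q where q: "q \<ge> 1" "\<And>i j. i < n \<Longrightarrow> j < r \<Longrightarrow> real q * c i j \<in> \<int>" by blast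
  obtain p where p: "p \<ge> (1::nat)" "\<And>j. j < r \<Longrightarrow> real p * c n j \<in> \<int>" using Suc.prems[of n] by blast
  have "real (p * q) * c i j \<in> \<int>" if "i < Suc n" "j < r" for i j
  proof (cases "i = n")
    case True
    have "real q * (real p * c n j) \<in> \<int>" using p(2)[OF that(2)] by (rule Ints_mult[rotated]) simp
    then show ?thesis using True by (simp add: mult_ac)
  next
    case False
    then have "real p * (real q * c i j) \<in> \<int>" using q(2)[of i j] that by (intro Ints_mult[of "real p"]) auto
    then show ?thesis by (simp add: mult_ac)
  qed
  then show ?case using p(1) q(1) by (intro exI[of _ "p * q"]) (auto simp: mult_ge1_I)
qed

text \<open>The coefficients over the pivots are rational by \<open>rational_coeffs\<close> and get
  a common denominator \<open>q\<close>. Dividing the integral matrix \<open>E\<close> and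
  \<open>q\<close> by the gcd \<open>G\<close> of the entries of \<open>E\<close> yields
  \<open>D\<close> and \<open>u\<close>.\<close>

lemma strat_surj:
  fixes A :: "nat \<Rightarrow> real^'n"
  assumes A: "A \<in> PiE {..<n} (\<lambda>_. Zv)" and r: "r = card (pivots n A)" "r \<ge> 1"
  shows "\<exists>u D B. (u, D, B) \<in> strat n r \<and> A = matapp n r D u B"
proof -
  define pv where "pv = (!) (sorted_list_of_set (pivots n A))"
  have len: "length (sorted_list_of_set (pivots n A)) = r" using r by simp
  have pv: "pv l \<in> pivots n A" if "l < r" for l
    using nth_mem[of l "sorted_list_of_set (pivots n A)"] that len by (simp add: pv_def)
  have pvn: "pv l < n" if "l < r" for l using pv[OF that] by (simp add: pivots_def)
  have mono: "pv l < pv l'" if "l < l'" "l' < r" for l l'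
    unfolding pv_def using that len by (intro sorted_wrt_nth_less[OF strict_sorted_list_of_set]) auto
  define B where "B = restrict (\<lambda>l. A (pv l)) {..<r}"
  have AZ: "A i \<in> Zv" if "i < n" for i using A that by auto
  have ind: "indep r B" unfolding indep_def
  proof (intro allI impI)
    fix l assume l: "l < r"
    have "B ` {..<l} \<subseteq> A ` {..<pv l}" using mono l by (auto simp: B_def)
    then have "span (B ` {..<l}) \<subseteq> span (A ` {..<pv l})" by (rule span_mono)
    moreover have "B l \<notin> span (A ` {..<pv l})" using pv[OF l] l by (simp add: pivots_def B_def)
    ultimately show "B l \<notin> span (B ` {..<l})" by blast
  qed
  have Bpv: "(\<Sum>l<r. c l *\<^sub>R B l) = (\<Sum>l<r. c l *\<^sub>R A (pv l))" for c by (simp add: B_def)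
  have ex: "\<exists>c. A i = (\<Sum>l<r. c l *\<^sub>R B l) \<and> (\<forall>l<r. i < pv l \<longrightarrow> c l = 0)" if "i < n" for i
    unfolding Bpv using pivot_coeffs[OF r(1) that] by (simp only: pv_def)
  define c where "c i = (SOME c. A i = (\<Sum>l<r. c l *\<^sub>R B l) \<and> (\<forall>l<r. i < pv l \<longrightarrow> c l = 0))" for i
  have c: "A i = (\<Sum>l<r. c i l *\<^sub>R B l)" "\<forall>l<r. i < pv l \<longrightarrow> c i l = 0" if "i < n" for i
    using someI_ex[OF ex[OF that]] unfolding c_def by auto
  have cpv: "c (pv l) j = (if j = l then 1 else 0)" if l: "l < r" and j: "j < r" for l j
  proof (rule indep_coeff_unique[OF ind _ j])
    have "(\<Sum>j<r. (if j = l then 1 else 0) *\<^sub>R B j) = (\<Sum>j<r. if j = l then B j else 0)"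
      by (intro sum.cong) auto
    also have "\<dots> = A (pv l)" using l by (simp add: B_def)
    finally show "(\<Sum>j<r. c (pv l) j *\<^sub>R B j) = (\<Sum>j<r. (if j = l then 1 else 0) *\<^sub>R B j)"
      using c(1)[OF pvn[OF l]] by simp
  qed
  have "\<exists>q\<ge>1::nat. \<forall>i<n. \<forall>j<r. real q * c i j \<in> \<int>"
  proof (intro common_denominator rational_coeffs[OF ind])
    show "\<And>j. j < r \<Longrightarrow> B j \<in> Zv" using AZ pvn by (simp add: B_def)
    show "\<And>i. i < n \<Longrightarrow> (\<Sum>j<r. c i j *\<^sub>R B j) \<in> Zv" using c(1) AZ by simp
  qed
  then obtain q :: nat where q: "q \<ge> 1" "\<And>i j. i < n \<Longrightarrow> j < r \<Longrightarrow> real q * c i j \<in> \<int>" by blast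
  define E where "E i j = (if i < n \<and> j < r then \<lfloor>real q * c i j\<rfloor> else 0)" for i j
  have E: "real_of_int (E i j) = real q * c i j" if "i < n" "j < r" for i j
    using q(2)[OF that] that by (simp add: E_def)
  have Epv: "E (pv l) j = (if j = l then int q else 0)" if "l < r" "j < r" for l j
    using pvn that by (simp add: E_def cpv)
  define G where "G = Gcd {E i j | i j. i < n \<and> j < r}"
  have Gdvd: "G dvd E i j" for i j
  proof (cases "i < n \<and> j < r")
    case True
    then show ?thesis unfolding G_def by (intro Gcd_dvd) blast
  next
    case False
    then show ?thesis by (auto simp: E_def)
  qed
  \<comment> \<open>The entry of \<open>E\<close> in the first pivot row and first column is
    \<open>q\<close>, so \<open>G\<close> divides \<open>q\<close>; the hypothesis
    \<open>r \<ge> 1\<close> provides this entry.\<close>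
  have "G dvd int q" using Gdvd[of "pv 0" 0] Epv[of 0 0] r(2) by simp
  moreover have "G \<ge> 0" by (simp add: G_def)
  ultimately have G: "G > 0" using q(1) by (cases "G = 0") auto
  define D where "D i j = E i j div G" for i j
  define u where "u = nat (int q div G)"
  have ED: "E i j = G * D i j" for i j using Gdvd by (simp add: D_def)
  have qu: "int q = G * int u"
    using \<open>G dvd int q\<close> G by (simp add: u_def pos_imp_zdiv_nonneg_iff)
  have u: "u \<ge> 1" using qu q(1) by (cases "u = 0") auto
  have "G = \<bar>G\<bar> * Gcd {D i j | i j. i < n \<and> j < r}"
    unfolding Gcd_scale_set[symmetric] ED[symmetric] by (rule G_def)
  then have gcd1: "Gcd {D i j | i j. i < n \<and> j < r} = 1" using G by simp
  have Dpv: "D (pv l) j = (if j = l then int u else 0)" if "l < r" "j < r" for l j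
    using Epv[OF that] ED[of "pv l" j] G by (auto simp: qu split: if_splits)
  have D0: "D i j = 0" if "j < r" "i < pv j" for i j
  proof -
    have i: "i < n" using that pvn[of j] by simp
    then have "c i j = 0" using c(2)[OF i] that by simp
    then show ?thesis using E[OF i that(1)] by (simp add: D_def)
  qed
  have DD: "D \<in> Dset n r u"
    unfolding Dset_def mem_Collect_eq
  proof (intro conjI exI[of _ pv])
    show "\<forall>i j. n \<le> i \<or> r \<le> j \<longrightarrow> D i j = 0" by (auto simp: D_def E_def)
  qed (use gcd1 pvn mono Dpv D0 in auto)
  have Dc: "real_of_int (D i j) / real u = c i j" if "i < n" "j < r" for i j
  proof -
    have "real_of_int G * real_of_int (D i j) = real_of_int (int q) * c i j"
      using E[OF that] unfolding ED by simp
    also have "\<dots> = real_of_int G * (real u * c i j)" unfolding qu by simp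
    finally have "real_of_int (D i j) = real u * c i j" using G by simp
    then show ?thesis using u by simp
  qed
  have AD: "A i = (\<Sum>j<r. (real_of_int (D i j) / real u) *\<^sub>R B j)" if "i < n" for i
    using c(1)[OF that] that by (simp add: Dc)
  have "A = matapp n r D u B"
    using A AD by (auto simp: fun_eq_iff matapp_def PiE_def extensional_def)
  moreover have "B \<in> CD r n D u"
  proof -
    have "Dsol r n D u B" unfolding Dsol_def
    proof (intro allI impI bexI)
      fix i assume i: "i < n"
      show "(\<Sum>j<r. real_of_int (D i j) *\<^sub>R B j) = real u *\<^sub>R A i"
        unfolding AD[OF i] scaleR_sum_right using u by simp
      show "A i \<in> Zv" by (rule AZ[OF i])
    qed
    moreover have "B \<in> PiE {..<r} (\<lambda>_. Zv)" using AZ pvn by (auto simp: B_def)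
    ultimately show ?thesis using ind by (simp add: CD_def)
  qed
  ultimately show ?thesis using u DD by (auto simp: strat_def)
qed

lemma strat_pivots:
  assumes "(u, D, B) \<in> strat n r"
  shows "card (pivots n (matapp n r D u B)) = r"
proof -
  have m: "u \<ge> 1" "D \<in> Dset n r u" "indep r B" using assms by (auto simp: strat_def CD_def)
  obtain pv where p: "\<forall>l<r. pv l < n" "\<forall>l l'. l < l' \<and> l' < r \<longrightarrow> pv l < (pv l' :: nat)"
    "\<forall>l<r. \<forall>j<r. D (pv l) j = (if j = l then int u else 0)" "\<forall>j<r. \<forall>i<pv j. D i j = 0"
    using Dset_pivots[OF m(2)] by (elim exE conjE)
  have "pivots n (matapp n r D u B) = pv ` {..<r}"
    by (rule matapp_pivots[OF m(1,3)]) (simp_all add: p)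
  moreover have "inj_on pv {..<r}"
  proof (rule inj_onI)
    fix l l' assume l: "l \<in> {..<r}" "l' \<in> {..<r}" "pv l = pv l'"
    show "l = l'"
      using p(2)[rule_format, of l l'] p(2)[rule_format, of l' l] l by (cases l l' rule: linorder_cases) auto
  qed
  ultimately show ?thesis by (simp add: card_image)
qed

lemma bij_betw_strat:
  assumes r: "r \<ge> 1"
  shows "bij_betw (\<lambda>(u, D, B). matapp n r D u B) (strat n r)
    {A \<in> PiE {..<n} (\<lambda>_. Zv :: (real^'n) set). card (pivots n A) = r}"
proof (rule bij_betw_imageI[OF inj_on_strat[OF r]], intro set_eqI iffI)
  fix A :: "nat \<Rightarrow> real^'n" assume "A \<in> (\<lambda>(u, D, B). matapp n r D u B) ` strat n r"
  then obtain u D B where m: "(u, D, B) \<in> strat n r" "A = matapp n r D u B" by auto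
  then have "A \<in> PiE {..<n} (\<lambda>_. Zv)" using matapp_in_PiE[of u B r n D] by (auto simp: strat_def)
  then show "A \<in> {A \<in> PiE {..<n} (\<lambda>_. Zv). card (pivots n A) = r}" using strat_pivots[OF m(1)] m(2) by simp
next
  fix A :: "nat \<Rightarrow> real^'n" assume "A \<in> {A \<in> PiE {..<n} (\<lambda>_. Zv). card (pivots n A) = r}"
  then have A: "A \<in> PiE {..<n} (\<lambda>_. Zv)" "r = card (pivots n A)" by auto
  obtain u D B where m: "(u, D, B) \<in> strat n r" "A = matapp n r D u B" using strat_surj[OF A r] by (elim exE conjE)
  then show "A \<in> (\<lambda>(u, D, B). matapp n r D u B) ` strat n r" by (intro image_eqI[of _ _ "(u, D, B)"]) simp_all
qed

lemma nn_integral_Sigma_count_space: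
  "(\<integral>\<^sup>+ x. (\<integral>\<^sup>+ y. f (x, y) \<partial>count_space (B x)) \<partial>count_space A) = (\<integral>\<^sup>+ p. f p \<partial>count_space (Sigma A B))"
proof -
  have "(\<integral>\<^sup>+ x. (\<integral>\<^sup>+ y. f (x, y) \<partial>count_space (B x)) \<partial>count_space A) =
    (\<integral>\<^sup>+ x. (\<integral>\<^sup>+ y. f (x, y) \<partial>count_space (B x)) * indicator A x \<partial>count_space UNIV)"
    by (cases "A = UNIV") (simp_all add: nn_integral_count_space_indicator)
  also have "\<dots> = (\<integral>\<^sup>+ x. (\<integral>\<^sup>+ y. f (x, y) * indicator (Sigma A B) (x, y) \<partial>count_space UNIV) \<partial>count_space UNIV)"
  proof (rule nn_integral_cong)
    fix x
    have "(\<integral>\<^sup>+ y. f (x, y) \<partial>count_space (B x)) = (\<integral>\<^sup>+ y. f (x, y) * indicator (B x) y \<partial>count_space UNIV)"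
      by (cases "B x = UNIV") (simp_all add: nn_integral_count_space_indicator)
    then show "(\<integral>\<^sup>+ y. f (x, y) \<partial>count_space (B x)) * indicator A x = (\<integral>\<^sup>+ y. f (x, y) * indicator (Sigma A B) (x, y) \<partial>count_space UNIV)"
      by (cases "x \<in> A") (simp_all add: indicator_def)
  qed
  also have "\<dots> = (\<integral>\<^sup>+ p. f p * indicator (Sigma A B) p \<partial>count_space UNIV)"
    by (rule nn_integral_fst_count_space)
  also have "\<dots> = (\<integral>\<^sup>+ p. f p \<partial>count_space (Sigma A B))"
    by (cases "Sigma A B = UNIV") (simp_all add: nn_integral_count_space_indicator)
  finally show ?thesis .
qed

text \<open>Tuples are sorted by rank, that is, by the number of pivots. Rank \<open>0\<close>
  contributes the zero tuple alone, which later becomes the term with all vectors equal.\<close>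

theorem sum_strat:
  fixes f :: "(nat \<Rightarrow> real^'n) \<Rightarrow> ennreal"
  shows "(\<integral>\<^sup>+ A. f A \<partial>count_space (PiE {..<n} (\<lambda>_. Zv))) = f (restrict (\<lambda>_. 0) {..<n}) +
    (\<Sum>r\<in>{1..n}. \<integral>\<^sup>+ u. (\<integral>\<^sup>+ D. (\<integral>\<^sup>+ B. f (matapp n r D u B) \<partial>count_space (CD r n D u)) \<partial>count_space (Dset n r u)) \<partial>count_space {1..})"
proof -
  let ?P = "PiE {..<n} (\<lambda>_. Zv :: (real^'n) set)"
  let ?S = "\<lambda>r. {A \<in> ?P. card (pivots n A) = r}"
  have part: "(\<integral>\<^sup>+ A. f A \<partial>count_space ?P) = (\<Sum>r\<in>{0..n}. \<integral>\<^sup>+ A. f A \<partial>count_space (?S r))"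
  proof -
    have "(\<integral>\<^sup>+ A. f A \<partial>count_space ?P) = (\<integral>\<^sup>+ A. (\<Sum>r\<in>{0..n}. f A * indicator (?S r) A) \<partial>count_space ?P)"
    proof (rule nn_integral_cong)
      fix A assume "A \<in> space (count_space ?P)"
      then have "A \<in> ?P" by simp
      then have "(\<Sum>r\<in>{0..n}. f A * indicator (?S r) A) = (\<Sum>r\<in>{0..n}. if card (pivots n A) = r then f A else 0)"
        by (intro sum.cong) (auto simp: indicator_def)
      then show "f A = (\<Sum>r\<in>{0..n}. f A * indicator (?S r) A)" using card_pivots_le[of n A] by simp
    qed
    also have "\<dots> = (\<Sum>r\<in>{0..n}. \<integral>\<^sup>+ A. f A * indicator (?S r) A \<partial>count_space ?P)"
      by (rule nn_integral_sum) simp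
    also have "\<dots> = (\<Sum>r\<in>{0..n}. \<integral>\<^sup>+ A. f A \<partial>count_space (?S r))"
    proof (rule sum.cong[OF refl])
      fix r
      have "(\<integral>\<^sup>+ A. f A * indicator (?S r) A \<partial>count_space ?P) = (\<integral>\<^sup>+ A. f A \<partial>restrict_space (count_space ?P) (?S r))"
        by (subst nn_integral_restrict_space) auto
      also have "restrict_space (count_space ?P) (?S r) = count_space (?S r)"
        by (subst restrict_count_space, rule arg_cong[where f = count_space]) blast
      finally show "(\<integral>\<^sup>+ A. f A * indicator (?S r) A \<partial>count_space ?P) = (\<integral>\<^sup>+ A. f A \<partial>count_space (?S r))" .
    qed
    finally show ?thesis .
  qed
  have "?S 0 = {restrict (\<lambda>_. 0) {..<n}}"
  proof -
    define z0 where "z0 = restrict (\<lambda>_. 0 :: real^'n) {..<n}"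
    have z: "z0 \<in> ?P" by (simp add: z0_def)
    have e: "card (pivots n A) = 0 \<longleftrightarrow> A = z0" if "A \<in> ?P" for A
      using pivots_empty_iff[OF that] by (simp add: z0_def)
    have "?S 0 = {z0}"
    proof (rule equalityI; rule subsetI)
      fix A assume A: "A \<in> ?S 0"
      have "A = z0" using e[OF CollectD[OF A, THEN conjunct1]] CollectD[OF A, THEN conjunct2] by (rule iffD1)
      then show "A \<in> {z0}" by (rule ssubst) (rule singletonI)
    next
      fix A assume "A \<in> {z0}"
      then have A: "A = z0" by (rule singletonD)
      show "A \<in> ?S 0" unfolding A using z e[OF z, THEN iffD2, OF refl] by (intro CollectI conjI)
    qed
    then show ?thesis unfolding z0_def .
  qed
  then have S0: "(\<integral>\<^sup>+ A. f A \<partial>count_space (?S 0)) = f (restrict (\<lambda>_. 0) {..<n})"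
    by (simp add: nn_integral_count_space_finite)
  have Sr: "(\<integral>\<^sup>+ A. f A \<partial>count_space (?S r)) = (\<integral>\<^sup>+ u. (\<integral>\<^sup>+ D. (\<integral>\<^sup>+ B. f (matapp n r D u B) \<partial>count_space (CD r n D u)) \<partial>count_space (Dset n r u)) \<partial>count_space {1..})"
    if r: "r \<ge> 1" for r
  proof -
    have "(\<integral>\<^sup>+ A. f A \<partial>count_space (?S r)) = (\<integral>\<^sup>+ p. f (case p of (u, D, B) \<Rightarrow> matapp n r D u B) \<partial>count_space (strat n r))"
      by (rule nn_integral_bij_count_space[OF bij_betw_strat[OF r], symmetric])
    also have "\<dots> = (\<integral>\<^sup>+ u. (\<integral>\<^sup>+ s. f (case (u, s) of (u, D, B) \<Rightarrow> matapp n r D u B) \<partial>count_space (Sigma (Dset n r u) (\<lambda>D. CD r n D u))) \<partial>count_space {1..})"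
      unfolding strat_def by (rule nn_integral_Sigma_count_space[symmetric])
    also have "\<dots> = (\<integral>\<^sup>+ u. (\<integral>\<^sup>+ D. (\<integral>\<^sup>+ B. f (matapp n r D u B) \<partial>count_space (CD r n D u)) \<partial>count_space (Dset n r u)) \<partial>count_space {1..})"
    proof (rule nn_integral_cong)
      fix u
      show "(\<integral>\<^sup>+ s. f (case (u, s) of (u, D, B) \<Rightarrow> matapp n r D u B) \<partial>count_space (Sigma (Dset n r u) (\<lambda>D. CD r n D u))) =
        (\<integral>\<^sup>+ D. (\<integral>\<^sup>+ B. f (matapp n r D u B) \<partial>count_space (CD r n D u)) \<partial>count_space (Dset n r u))"
        by (subst nn_integral_Sigma_count_space[symmetric]) simp
    qed
    finally show ?thesis .
  qed
  have "(\<Sum>r\<in>{0..n}. \<integral>\<^sup>+ A. f A \<partial>count_space (?S r)) =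
    (\<integral>\<^sup>+ A. f A \<partial>count_space (?S 0)) + (\<Sum>r\<in>{1..n}. \<integral>\<^sup>+ A. f A \<partial>count_space (?S r))"
    by (simp only: sum.atLeast_Suc_atMost[OF le0] One_nat_def)
  then show ?thesis unfolding part S0
    by (rule trans) (intro arg_cong2[where f = "(+)"] refl sum.cong Sr, simp)
qed

section \<open>Affine tuples\<close>

text \<open>Rebuilds a tuple of \<open>Suc n\<close> points from its first point \<open>y\<close>
  and the \<open>n\<close> differences \<open>X\<close>.\<close>

definition shf :: "nat \<Rightarrow> real^'n \<Rightarrow> (nat \<Rightarrow> real^'n) \<Rightarrow> nat \<Rightarrow> real^'n" where
  "shf n y X = restrict (\<lambda>i. case i of 0 \<Rightarrow> y | Suc j \<Rightarrow> y + X j) {..<Suc n}"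

lemma shf_simps [simp]:
  "shf n y X 0 = y" "j < n \<Longrightarrow> shf n y X (Suc j) = y + X j"
  by (simp_all add: shf_def)

lemma shf_cong: "(\<And>j. j < n \<Longrightarrow> X j = X' j) \<Longrightarrow> shf n y X = shf n y X'"
  by (auto simp: shf_def fun_eq_iff split: nat.split)

lemma measurable_shf:
  assumes "f \<in> borel_measurable M" "\<And>j. j < n \<Longrightarrow> (\<lambda>x. g x j) \<in> borel_measurable M"
  shows "(\<lambda>x. shf n (f x) (g x)) \<in> measurable M (TT (Suc n) :: (nat \<Rightarrow> real^'n) measure)"
  unfolding shf_def
proof (rule measurable_restrict)
  fix i assume i: "i \<in> {..<Suc n}"
  show "(\<lambda>x. case i of 0 \<Rightarrow> f x | Suc j \<Rightarrow> f x + g x j) \<in> measurable M lborel"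
    using i assms by (cases i) (auto intro!: borel_measurable_add)
qed

text \<open>For a fixed first point the passage from differences to points is a translation in each
  factor, so the map preserves Lebesgue measure; this is checked on rectangles.\<close>

lemma nn_integral_TT_Suc:
  fixes f :: "(nat \<Rightarrow> real^'n) \<Rightarrow> ennreal"
  assumes f: "f \<in> borel_measurable (TT (Suc n))"
  shows "(\<integral>\<^sup>+ Y. f Y \<partial>TT (Suc n)) = (\<integral>\<^sup>+ X. (\<integral>\<^sup>+ y. f (shf n y X) \<partial>lborel) \<partial>TT n)"
proof -
  interpret product_sigma_finite "\<lambda>_::nat. lborel :: (real^'n) measure" by (rule product_sigma_finite_lborel)
  interpret T: sigma_finite_measure "TT n :: (nat \<Rightarrow> real^'n) measure" by (rule sigma_finite_TT)
  interpret pair_sigma_finite "lborel :: (real^'n) measure" "TT n :: (nat \<Rightarrow> real^'n) measure" ..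
  let ?L = "lborel :: (real^'n) measure"
  let ?T = "TT n :: (nat \<Rightarrow> real^'n) measure"
  let ?\<Phi> = "\<lambda>(y, X). shf n y X :: nat \<Rightarrow> real^'n"
  have m: "?\<Phi> \<in> measurable (?L \<Otimes>\<^sub>M TT n) (TT (Suc n))"
    unfolding case_prod_beta
  proof (rule measurable_shf)
    show "(\<lambda>p. fst p) \<in> borel_measurable (?L \<Otimes>\<^sub>M ?T)" using measurable_fst[of ?L ?T] by simp
    fix j assume "j < n"
    then have "(\<lambda>X :: nat \<Rightarrow> real^'n. X j) \<in> measurable (TT n) lborel" by (intro measurable_component_singleton) simp
    from measurable_compose[OF measurable_snd[of ?L ?T] this] show "(\<lambda>p. snd p j) \<in> borel_measurable (?L \<Otimes>\<^sub>M ?T)" by simp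
  qed
  have eq: "distr (?L \<Otimes>\<^sub>M TT n) (TT (Suc n)) ?\<Phi> = TT (Suc n)"
  proof (rule PiM_eqI)
    fix A :: "nat \<Rightarrow> (real^'n) set" assume A: "\<And>i. i \<in> {..<Suc n} \<Longrightarrow> A i \<in> sets lborel"
    let ?pre = "?\<Phi> -` PiE {..<Suc n} A \<inter> space (?L \<Otimes>\<^sub>M TT n)"
    have PA: "PiE {..<Suc n} A \<in> sets (TT (Suc n))" using A by (intro sets_PiM_I_finite) auto
    have "emeasure (distr (?L \<Otimes>\<^sub>M TT n) (TT (Suc n)) ?\<Phi>) (PiE {..<Suc n} A) = emeasure (?L \<Otimes>\<^sub>M TT n) ?pre"
      by (rule emeasure_distr[OF m PA])
    also have "\<dots> = (\<integral>\<^sup>+ y. emeasure (TT n) (Pair y -` ?pre) \<partial>?L)"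
      by (rule T.emeasure_pair_measure_alt[OF measurable_sets[OF m PA]])
    also have "\<dots> = (\<integral>\<^sup>+ y. (\<Prod>j<n. emeasure ?L (A (Suc j))) * indicator (A 0) y \<partial>?L)"
    proof (rule nn_integral_cong)
      fix y :: "real^'n"
      show "emeasure (TT n) (Pair y -` ?pre) = (\<Prod>j<n. emeasure ?L (A (Suc j))) * indicator (A 0) y"
      proof (cases "y \<in> A 0")
        case True
        have "Pair y -` ?pre = PiE {..<n} (\<lambda>j. (\<lambda>x. y + x) -` A (Suc j))"
        proof (intro set_eqI iffI)
          fix X assume "X \<in> Pair y -` ?pre"
          then have X: "shf n y X \<in> PiE {..<Suc n} A" "X \<in> PiE {..<n} (\<lambda>_. UNIV)"
            by (simp_all add: space_pair_measure space_TT)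
          show "X \<in> PiE {..<n} (\<lambda>j. (\<lambda>x. y + x) -` A (Suc j))"
          proof (rule PiE_I)
            fix j assume "j \<in> {..<n}"
            then show "X j \<in> (\<lambda>x. y + x) -` A (Suc j)" using PiE_mem[OF X(1), of "Suc j"] by simp
          qed (rule PiE_arb[OF X(2)])
        next
          fix X assume X: "X \<in> PiE {..<n} (\<lambda>j. (\<lambda>x. y + x) -` A (Suc j))"
          have "shf n y X \<in> PiE {..<Suc n} A"
          proof (rule PiE_I)
            fix i assume "i \<in> {..<Suc n}"
            then show "shf n y X i \<in> A i" using True PiE_mem[OF X] by (cases i) auto
          qed (simp add: shf_def)
          moreover have "X \<in> PiE {..<n} (\<lambda>_. UNIV)" by (rule subsetD[OF PiE_mono X]) simp
          ultimately show "X \<in> Pair y -` ?pre" by (simp add: space_pair_measure space_TT)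
        qed
        moreover have "emeasure (TT n) (PiE {..<n} (\<lambda>j. (\<lambda>x. y + x) -` A (Suc j))) = (\<Prod>j<n. emeasure ?L ((\<lambda>x. y + x) -` A (Suc j)))"
        proof (rule emeasure_PiM)
          fix j assume "j \<in> {..<n}"
          then have "A (Suc j) \<in> sets borel" using A[of "Suc j"] by simp
          moreover have "(\<lambda>x. y + x) \<in> borel_measurable borel" by simp
          ultimately show "(\<lambda>x. y + x) -` A (Suc j) \<in> sets ?L"
            using measurable_sets[of "\<lambda>x. y + x" borel borel "A (Suc j)"] by simp
        qed simp
        moreover have "emeasure ?L ((\<lambda>x. y + x) -` A (Suc j)) = emeasure ?L (A (Suc j))" if "j < n" for j
        proof -
          have "emeasure ?L (A (Suc j)) = emeasure (distr ?L borel ((+) y)) (A (Suc j))" by (simp only: lborel_distr_plus)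
          also have "\<dots> = emeasure ?L ((+) y -` A (Suc j) \<inter> space ?L)"
            using A[of "Suc j"] that by (intro emeasure_distr) auto
          finally show ?thesis by simp
        qed
        ultimately show ?thesis using True by simp
      next
        case False
        have "Pair y -` ?pre = {}"
        proof (rule equals0I)
          fix X assume "X \<in> Pair y -` ?pre"
          then have "shf n y X \<in> PiE {..<Suc n} A" by simp
          then have "shf n y X 0 \<in> A 0" by (rule PiE_mem) simp
          then show False using False by simp
        qed
        then show ?thesis using False by simp
      qed
    qed
    also have "\<dots> = (\<Prod>j<n. emeasure ?L (A (Suc j))) * emeasure ?L (A 0)"
      using A[of 0] by (subst nn_integral_cmult_indicator) auto
    also have "\<dots> = (\<Prod>i<Suc n. emeasure ?L (A i))"
      by (simp only: prod.lessThan_Suc_shift mult.commute)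
    finally show "emeasure (distr (?L \<Otimes>\<^sub>M TT n) (TT (Suc n)) ?\<Phi>) (PiE {..<Suc n} A) = (\<Prod>i<Suc n. emeasure ?L (A i))" .
  qed simp_all
  have "(\<integral>\<^sup>+ Y. f Y \<partial>TT (Suc n)) = (\<integral>\<^sup>+ p. f (?\<Phi> p) \<partial>(?L \<Otimes>\<^sub>M TT n))"
    by (subst eq[symmetric], subst nn_integral_distr[OF m]) (use f in simp_all)
  also have "\<dots> = (\<integral>\<^sup>+ X. (\<integral>\<^sup>+ y. f (?\<Phi> (y, X)) \<partial>?L) \<partial>TT n)"
    using measurable_compose[OF m f] by (intro nn_integral_snd[symmetric]) simp
  finally show ?thesis by simp
qed

lemma measurable_matapp:
  assumes "\<And>j. j < r \<Longrightarrow> (\<lambda>x. g x j) \<in> borel_measurable M"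
  shows "(\<lambda>x. matapp n r D u (g x)) \<in> measurable M (TT n :: (nat \<Rightarrow> real^'n) measure)"
  unfolding matapp_def
proof (rule measurable_restrict)
  fix i
  show "(\<lambda>x. \<Sum>j<r. (real_of_int (D i j) / real u) *\<^sub>R g x j) \<in> measurable M lborel"
    using assms by (simp add: borel_measurable_sum borel_measurable_scaleR)
qed

lemma tmul_matapp: "tmul n (matapp n r D u B) g = matapp n r D u (tmul r B g)"
  by (auto simp: tmul_def matapp_def fun_eq_iff vector_matrix_sum scaleR_vector_matrix_assoc)

text \<open>The column operation of \<open>Dtilde\<close> rewrites
  \<open>y + \<Sum> c l * X l\<close> as
  \<open>(1 - \<Sum> c l) * y + \<Sum> c l * (y + X l)\<close>, which turns a relation among
  differences into one among points.\<close>

lemma matapp_Dtilde: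
  assumes u: "u \<ge> 1"
  shows "matapp (Suc n) (Suc r) (Dtilde (Suc n) r u D) u (shf r y X) = shf n y (matapp n r D u X)"
proof (rule ext)
  fix i
  show "matapp (Suc n) (Suc r) (Dtilde (Suc n) r u D) u (shf r y X) i = shf n y (matapp n r D u X) i"
  proof (cases "i < Suc n")
    case True
    have "matapp (Suc n) (Suc r) (Dtilde (Suc n) r u D) u (shf r y X) i =
      (real_of_int (Dtilde (Suc n) r u D i 0) / real u) *\<^sub>R y + (\<Sum>l<r. (real_of_int (Dtilde (Suc n) r u D i (Suc l)) / real u) *\<^sub>R (y + X l))"
      using True by (simp add: matapp_def sum.lessThan_Suc_shift del: sum.lessThan_Suc)
    also have "\<dots> = (real_of_int (int u - (\<Sum>l<r. Dprime (Suc n) r u D i (Suc l))) / real u) *\<^sub>R y + (\<Sum>l<r. (real_of_int (Dprime (Suc n) r u D i (Suc l)) / real u) *\<^sub>R (y + X l))"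
      using True by (simp add: Dtilde_def sum.atLeast1_atMost_eq Dprime_def)
    also have "\<dots> = y + (\<Sum>l<r. (real_of_int (Dprime (Suc n) r u D i (Suc l)) / real u) *\<^sub>R X l)"
      using u by (simp add: diff_divide_distrib scaleR_diff_left scaleR_add_right sum.distrib sum_divide_distrib scaleR_sum_left)
    also have "\<dots> = shf n y (matapp n r D u X) i"
      using True by (cases i) (simp_all add: Dprime_def matapp_def)
    finally show ?thesis .
  qed (simp add: matapp_def shf_def)
qed

text \<open>In terms of \<open>v (Suc l) - v 0\<close> the column operation is undone, and
  \<open>v 0\<close> occurs in every row only with the factor \<open>u\<close>. It is therefore a
  free residue, which accounts for the factor \<open>u\<close>.\<close>

lemma Ncount_Dtilde:
  assumes u: "u \<ge> 1"
  shows "Ncount (Suc n) (Suc r) (Dtilde (Suc n) r u D) u = u * Ncount n r D u"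
proof -
  let ?D = "Dtilde (Suc n) r u D"
  have sum0: "int u dvd (\<Sum>j<Suc r. ?D 0 j * v j)" for v :: "nat \<Rightarrow> int"
    by (simp add: sum.lessThan_Suc_shift Dtilde_def Dprime_def del: sum.lessThan_Suc)
  have sumS: "(\<Sum>j<Suc r. ?D (Suc i) j * v j) = int u * v 0 + (\<Sum>l<r. D i l * (v (Suc l) - v 0))"
    if "i < n" for i and v :: "nat \<Rightarrow> int"
    using that by (simp add: sum.lessThan_Suc_shift Dtilde_def Dprime_def sum.atLeast1_atMost_eq left_diff_distrib right_diff_distrib sum_subtractf sum_distrib_right del: sum.lessThan_Suc)
  have iff: "(\<forall>i<Suc n. int u dvd (\<Sum>j<Suc r. ?D i j * v j)) \<longleftrightarrow> (\<forall>i<n. int u dvd (\<Sum>l<r. D i l * (v (Suc l) - v 0)))" for v :: "nat \<Rightarrow> int"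
  proof
    assume a: "\<forall>i<Suc n. int u dvd (\<Sum>j<Suc r. ?D i j * v j)"
    show "\<forall>i<n. int u dvd (\<Sum>l<r. D i l * (v (Suc l) - v 0))"
    proof (intro allI impI)
      fix i assume i: "i < n"
      then have "int u dvd (\<Sum>j<Suc r. ?D (Suc i) j * v j)" using a by blast
      then show "int u dvd (\<Sum>l<r. D i l * (v (Suc l) - v 0))" unfolding sumS[OF i] by (simp add: dvd_add_right_iff)
    qed
  next
    assume a: "\<forall>i<n. int u dvd (\<Sum>l<r. D i l * (v (Suc l) - v 0))"
    show "\<forall>i<Suc n. int u dvd (\<Sum>j<Suc r. ?D i j * v j)"
    proof (intro allI impI)
      fix i assume i: "i < Suc n"
      show "int u dvd (\<Sum>j<Suc r. ?D i j * v j)"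
      proof (cases i)
        case 0
        show ?thesis unfolding 0 by (rule sum0)
      next
        case (Suc i')
        then have "i' < n" using i by simp
        then show ?thesis using a unfolding Suc sumS[OF \<open>i' < n\<close>] by (intro dvd_add) auto
      qed
    qed
  qed
  have dvd_mod: "int u dvd (\<Sum>l<r. D i l * a l) \<longleftrightarrow> int u dvd (\<Sum>l<r. D i l * b l)"
    if "\<And>l. l < r \<Longrightarrow> a l mod int u = b l mod int u" for i and a b :: "nat \<Rightarrow> int"
  proof -
    have "int u dvd (\<Sum>l<r. D i l * a l) - (\<Sum>l<r. D i l * b l)"
      unfolding sum_subtractf[symmetric] right_diff_distrib[symmetric]
      using that by (intro dvd_sum dvd_mult) (simp add: mod_eq_dvd_iff)
    then show ?thesis using dvd_diff_right_iff dvd_diff_commute by (metis dvd_diff_left_iff)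
  qed
  \<comment> \<open>\<open>?f\<close> and \<open>?g\<close> add and subtract the free residue
    \<open>v 0\<close>, with reduction modulo \<open>u\<close> to return to the range of
    representatives; \<open>dvd_mod\<close> shows that this does not affect the congruences.\<close>
  let ?f = "\<lambda>(v0, w). \<lambda>j. case j of 0 \<Rightarrow> v0 | Suc l \<Rightarrow> if l < r then (w l + v0) mod int u else 0"
  let ?g = "\<lambda>v. (v 0, \<lambda>l. if l < r then (v (Suc l) - v 0) mod int u else 0)"
  have u0: "int u > 0" using u by simp
  have "bij_betw ?f ({0..<int u} \<times> SN r n D u) (SN (Suc r) (Suc n) ?D u)"
  proof (rule bij_betw_byWitness[where f' = ?g])
    show "\<forall>a\<in>{0..<int u} \<times> SN r n D u. ?g (?f a) = a"
    proof (rule ballI)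
      fix a assume "a \<in> {0..<int u} \<times> SN r n D u"
      then obtain v0 w where v: "v0 \<in> {0..<int u}" "w \<in> SN r n D u" and a: "a = (v0, w)" by (rule SigmaE)
      have "((w l + v0) mod int u - v0) mod int u = w l" if "l < r" for l
        using v that by (simp add: mod_diff_left_eq SN_def)
      moreover have "w l = 0" if "\<not> l < r" for l using v that by (simp add: SN_def)
      ultimately show "?g (?f a) = a" unfolding a by (simp add: fun_eq_iff)
    qed
    show "\<forall>v\<in>SN (Suc r) (Suc n) ?D u. ?f (?g v) = v"
    proof (intro ballI ext)
      fix v j assume v: "v \<in> SN (Suc r) (Suc n) ?D u"
      have 2: "((v (Suc l) - v 0) mod int u + v 0) mod int u = v (Suc l)" if "l < r" for l
        using v that by (simp add: mod_add_left_eq SN_def)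
      have 3: "v (Suc l) = 0" if "\<not> l < r" for l using v that by (simp add: SN_def)
      show "?f (?g v) j = v j" using 2 3 by (simp split: nat.split)
    qed
    show "?f ` ({0..<int u} \<times> SN r n D u) \<subseteq> SN (Suc r) (Suc n) ?D u"
    proof (rule image_subsetI)
      fix a assume "a \<in> {0..<int u} \<times> SN r n D u"
      then obtain v0 w where v: "v0 \<in> {0..<int u}" "w \<in> SN r n D u" and a: "a = (v0, w)" by (rule SigmaE)
      let ?v = "?f (v0, w)"
      have "\<forall>i<n. int u dvd (\<Sum>l<r. D i l * (?v (Suc l) - ?v 0))"
      proof (intro allI impI)
        fix i assume "i < n"
        then have "int u dvd (\<Sum>l<r. D i l * w l)" using v by (simp add: SN_def)
        moreover have "int u dvd (\<Sum>l<r. D i l * (?v (Suc l) - ?v 0)) \<longleftrightarrow> int u dvd (\<Sum>l<r. D i l * w l)"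
          by (rule dvd_mod) (simp add: mod_diff_left_eq)
        ultimately show "int u dvd (\<Sum>l<r. D i l * (?v (Suc l) - ?v 0))" by blast
      qed
      then have "\<forall>i<Suc n. int u dvd (\<Sum>j<Suc r. ?D i j * ?v j)" by (simp only: iff)
      moreover have "\<forall>j<Suc r. 0 \<le> ?v j \<and> ?v j < int u" using v u0 by (auto split: nat.split)
      moreover have "\<forall>j. Suc r \<le> j \<longrightarrow> ?v j = 0" by (auto split: nat.split)
      ultimately show "?f a \<in> SN (Suc r) (Suc n) ?D u" unfolding SN_def a by blast
    qed
    show "?g ` SN (Suc r) (Suc n) ?D u \<subseteq> {0..<int u} \<times> SN r n D u"
    proof (rule image_subsetI)
      fix v assume v: "v \<in> SN (Suc r) (Suc n) ?D u"
      let ?w = "\<lambda>l. if l < r then (v (Suc l) - v 0) mod int u else 0"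
      have "\<forall>i<n. int u dvd (\<Sum>l<r. D i l * ?w l)"
      proof (intro allI impI)
        fix i assume "i < n"
        have "\<forall>i<Suc n. int u dvd (\<Sum>j<Suc r. ?D i j * v j)" using v unfolding SN_def by blast
        then have "int u dvd (\<Sum>l<r. D i l * (v (Suc l) - v 0))" using \<open>i < n\<close> by (simp only: iff)
        moreover have "int u dvd (\<Sum>l<r. D i l * ?w l) \<longleftrightarrow> int u dvd (\<Sum>l<r. D i l * (v (Suc l) - v 0))"
          by (rule dvd_mod) simp
        ultimately show "int u dvd (\<Sum>l<r. D i l * ?w l)" by blast
      qed
      then have "?w \<in> SN r n D u" using u0 by (simp add: SN_def)
      moreover have "v 0 \<in> {0..<int u}" using v by (auto simp: SN_def)
      ultimately show "?g v \<in> {0..<int u} \<times> SN r n D u" by simp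
    qed
  qed
  from bij_betw_same_card[OF this] show ?thesis by (simp add: card_SN card_cartesian_product)
qed

lemma inj_on_Dtilde: "inj_on (Dtilde (Suc n) r u) (Dset n r u)"
proof (rule inj_onI)
  fix D D' assume D: "D \<in> Dset n r u" "D' \<in> Dset n r u" and e: "Dtilde (Suc n) r u D = Dtilde (Suc n) r u D'"
  have "D i j = D' i j" for i j
  proof (cases "i < n \<and> j < r")
    case True
    have "Dtilde (Suc n) r u D (Suc i) (Suc j) = Dtilde (Suc n) r u D' (Suc i) (Suc j)" using e by simp
    then show ?thesis using True by (simp add: Dtilde_def Dprime_def)
  next
    case False
    have z: "\<forall>i j. n \<le> i \<or> r \<le> j \<longrightarrow> D i j = 0" "\<forall>i j. n \<le> i \<or> r \<le> j \<longrightarrow> D' i j = 0"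
      using D[unfolded Dset_def mem_Collect_eq, THEN conjunct1] .
    show ?thesis using z(1)[rule_format, of i j] z(2)[rule_format, of i j] False by linarith
  qed
  then show "D = D'" by (simp add: fun_eq_iff)
qed

text \<open>With \<open>n\<close> increasing pivots among \<open>n\<close> rows every row is a
  pivot, so \<open>D\<close> is \<open>u\<close> times the identity, and gcd one forces
  \<open>u = 1\<close>. This is the generic case, which gives the first integral of the
  formula.\<close>

lemma Dset_full:
  assumes n: "n \<ge> 1"
  shows "Dset n n u = (if u = 1 then {\<lambda>i j. if i = j \<and> i < n then 1 else 0} else {})"
proof -
  have id: "D i j = (if j = i then int u else 0)" if D: "D \<in> Dset n n u" and ij: "i < n" "j < n" for D i j
  proof -
    obtain pv where p: "\<forall>l<n. pv l < n" "\<forall>l l'. l < l' \<and> l' < n \<longrightarrow> pv l < (pv l' :: nat)"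
      "\<forall>l<n. \<forall>j<n. D (pv l) j = (if j = l then int u else 0)" "\<forall>j<n. \<forall>i<pv j. D i j = 0"
      using Dset_pivots[OF D] by (elim exE conjE)
    have inj: "inj_on pv {..<n}"
    proof (rule inj_onI)
      fix l l' assume l: "l \<in> {..<n}" "l' \<in> {..<n}" "pv l = pv l'"
      show "l = l'"
        using p(2)[rule_format, of l l'] p(2)[rule_format, of l' l] l by (cases l l' rule: linorder_cases) auto
    qed
    have "pv ` {..<n} = {..<n}" using p(1) inj by (intro endo_inj_surj) auto
    then have "pv i = (\<lambda>l. l) i" using p(2) ij by (intro strict_enum_unique[of n]) auto
    then show ?thesis using p(3)[rule_format, OF ij] by simp
  qed
  let ?I = "\<lambda>i j. if i = j \<and> i < n then 1 else (0::int)"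
  have sub: "u = 1 \<and> D = ?I" if D: "D \<in> Dset n n u" for D
  proof -
    have z: "\<forall>i j. n \<le> i \<or> n \<le> j \<longrightarrow> D i j = 0" and g: "Gcd {D i j | i j. i < n \<and> j < n} = 1"
      using D[unfolded Dset_def mem_Collect_eq, THEN conjunct1]
        D[unfolded Dset_def mem_Collect_eq, THEN conjunct2, THEN conjunct1] .
    have "int u dvd Gcd {D i j | i j. i < n \<and> j < n}"
    proof (rule Gcd_greatest)
      fix x assume "x \<in> {D i j | i j. i < n \<and> j < n}"
      then show "int u dvd x" using id[OF D] by auto
    qed
    then have u: "u = 1" unfolding g by simp
    have "D i j = ?I i j" for i j
    proof (cases "i < n \<and> j < n")
      case True
      then show ?thesis using id[OF D, of i j] u by auto
    next
      case False
      then show ?thesis using z[rule_format, of i j] by auto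
    qed
    then show ?thesis using u by (simp add: fun_eq_iff)
  qed
  have I: "?I \<in> Dset n n 1"
    unfolding Dset_def mem_Collect_eq
  proof (intro conjI)
    have "?I 0 0 \<in> {?I i j | i j. i < n \<and> j < n}"
      using n by (intro CollectI exI[of _ "0::nat"] conjI refl) simp_all
    from Gcd_dvd[OF this] show "Gcd {?I i j | i j. i < n \<and> j < n} = 1" using n by (simp add: zdvd1_eq)
    show "\<exists>pv :: nat \<Rightarrow> nat. (\<forall>l<n. pv l < n) \<and> (\<forall>l l'. l < l' \<and> l' < n \<longrightarrow> pv l < pv l') \<and>
      (\<forall>l<n. \<forall>j<n. ?I (pv l) j = (if j = l then int 1 else 0)) \<and> (\<forall>j<n. \<forall>i<pv j. ?I i j = 0)"
      by (rule exI[of _ "\<lambda>l. l"]) auto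
  qed auto
  show ?thesis
  proof (cases "u = 1")
    case True
    have "Dset n n 1 = {?I}"
    proof (rule equalityI; rule subsetI)
      fix D assume "D \<in> Dset n n 1"
      then have "D = ?I" by (rule sub[unfolded True, THEN conjunct2])
      then show "D \<in> {?I}" by (rule ssubst) (rule singletonI)
    next
      fix D assume "D \<in> {?I}"
      then have "D = ?I" by (rule singletonD)
      then show "D \<in> Dset n n 1" by (rule ssubst) (rule I)
    qed
    then show ?thesis using True by simp
  next
    case False
    then have "Dset n n u = {}" using sub by (intro equals0I) simp
    then show ?thesis using False by simp
  qed
qed

text \<open>A tuple of points of the affine lattice amounts to a first point and \<open>n\<close>
  arbitrary vectors of the linear lattice, and both have unique integral coordinates because
  \<open>g\<close> is invertible.\<close>

lemma bij_betw_affine_tuples: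
  fixes g :: "real^'n^'n"
  assumes g: "det g = 1"
  shows "bij_betw (\<lambda>(z, A). shf n (z v* g + x) (tmul n A g)) (Zv \<times> PiE {..<n} (\<lambda>_. Zv)) (PiE {..<Suc n} (\<lambda>_. affl (g, x)))"
proof (rule bij_betw_imageI)
  have inj: "inj (\<lambda>z. z v* g)" using g by (intro inj_vector_matrix) simp
  have affl: "affl (g, x) = {z v* g + x | z. z \<in> Zv}" by (auto simp: affl_alt lat_def)
  show "inj_on (\<lambda>(z, A). shf n (z v* g + x) (tmul n A g)) (Zv \<times> PiE {..<n} (\<lambda>_. Zv))"
  proof (rule inj_onI)
    fix s t :: "(real^'n) \<times> (nat \<Rightarrow> real^'n)"
    assume st: "s \<in> Zv \<times> PiE {..<n} (\<lambda>_. Zv)" "t \<in> Zv \<times> PiE {..<n} (\<lambda>_. Zv)"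
      "(case s of (z, A) \<Rightarrow> shf n (z v* g + x) (tmul n A g)) = (case t of (z, A) \<Rightarrow> shf n (z v* g + x) (tmul n A g))"
    obtain z A z' A' where s: "s = (z, A)" and t: "t = (z', A')" by (cases s; cases t)
    have A: "A \<in> PiE {..<n} (\<lambda>_. Zv)" "A' \<in> PiE {..<n} (\<lambda>_. Zv)" using st by (simp_all add: s t)
    have e: "shf n (z v* g + x) (tmul n A g) i = shf n (z' v* g + x) (tmul n A' g) i" for i using st(3) by (simp add: s t)
    have "z v* g = z' v* g" using e[of 0] by simp
    then have z: "z = z'" by (rule injD[OF inj])
    have "A j = A' j" if "j \<in> {..<n}" for j
    proof -
      have "A j v* g = A' j v* g" using e[of "Suc j"] that z by (simp add: tmul_def)
      then show ?thesis by (rule injD[OF inj])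
    qed
    then have "A = A'" by (rule PiE_ext[OF A])
    then show "s = t" using z by (simp add: s t)
  qed
  show "(\<lambda>(z, A). shf n (z v* g + x) (tmul n A g)) ` (Zv \<times> PiE {..<n} (\<lambda>_. Zv)) = PiE {..<Suc n} (\<lambda>_. affl (g, x))"
  proof (rule equalityI; rule subsetI)
    fix m assume "m \<in> (\<lambda>(z, A). shf n (z v* g + x) (tmul n A g)) ` (Zv \<times> PiE {..<n} (\<lambda>_. Zv))"
    then obtain z A where z: "z \<in> Zv" and A: "A \<in> PiE {..<n} (\<lambda>_. Zv)" and m: "m = shf n (z v* g + x) (tmul n A g)" by auto
    show "m \<in> PiE {..<Suc n} (\<lambda>_. affl (g, x))"
    proof (rule PiE_I)
      fix i assume i: "i \<in> {..<Suc n}"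
      show "m i \<in> affl (g, x)"
      proof (cases i)
        case 0
        then show ?thesis using z by (auto simp: m affl)
      next
        case (Suc j)
        then have "m i = (z + A j) v* g + x" using i by (simp add: m tmul_def vector_matrix_left_distrib)
        moreover have "z + A j \<in> Zv" using z PiE_mem[OF A, of j] i Suc by (intro Zv_add) auto
        ultimately show ?thesis unfolding affl by blast
      qed
    qed (simp add: m shf_def)
  next
    fix m assume m: "m \<in> PiE {..<Suc n} (\<lambda>_. affl (g, x))"
    have ex: "\<exists>z. z \<in> Zv \<and> m i = z v* g + x" if "i < Suc n" for i
      using PiE_mem[OF m, of i] that unfolding affl by auto
    define w where "w i = (SOME z. z \<in> Zv \<and> m i = z v* g + x)" for i
    have w: "w i \<in> Zv" "m i = w i v* g + x" if "i < Suc n" for i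
      using someI_ex[OF ex[OF that]] unfolding w_def by auto
    let ?A = "restrict (\<lambda>j. w (Suc j) - w 0) {..<n}"
    have A: "?A \<in> PiE {..<n} (\<lambda>_. Zv)" using w(1) by (auto intro!: Zv_diff)
    have "m = shf n (w 0 v* g + x) (tmul n ?A g)"
    proof (rule ext)
      fix i
      show "m i = shf n (w 0 v* g + x) (tmul n ?A g) i"
      proof (cases "i < Suc n")
        case True
        then show ?thesis using w(2)[OF True] by (cases i) (simp_all add: tmul_def linear_diff[OF linear_vector_matrix])
      next
        case False
        then show ?thesis using PiE_arb[OF m, of i] by (simp add: shf_def)
      qed
    qed
    then show "m \<in> (\<lambda>(z, A). shf n (z v* g + x) (tmul n A g)) ` (Zv \<times> PiE {..<n} (\<lambda>_. Zv))"
      using w(1)[of 0] A by (intro image_eqI[of _ _ "(w 0, ?A)"]) auto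
  qed
qed

lemma Fhat_affl:
  fixes q :: "'n::finite asl"
  assumes q: "det (fst q) = 1"
  shows "Fhat (Suc n) F (affl q) =
    (\<integral>\<^sup>+ z. (\<integral>\<^sup>+ A. ennreal (F (shf n (z v* fst q + snd q) (tmul n A (fst q)))) \<partial>count_space (PiE {..<n} (\<lambda>_. Zv))) \<partial>count_space Zv)"
proof -
  have "Fhat (Suc n) F (affl q) = (\<integral>\<^sup>+ p. ennreal (F (case p of (z, A) \<Rightarrow> shf n (z v* fst q + snd q) (tmul n A (fst q)))) \<partial>count_space (Zv \<times> PiE {..<n} (\<lambda>_. Zv)))"
    unfolding Fhat_def
    by (rule nn_integral_bij_count_space[symmetric]) (use bij_betw_affine_tuples[OF q, of n "snd q"] in simp)
  also have "\<dots> = (\<integral>\<^sup>+ z. (\<integral>\<^sup>+ A. ennreal (F (case (z, A) of (z, A) \<Rightarrow> shf n (z v* fst q + snd q) (tmul n A (fst q)))) \<partial>count_space (PiE {..<n} (\<lambda>_. Zv))) \<partial>count_space Zv)"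
    by (rule nn_integral_Sigma_count_space[symmetric])
  finally show ?thesis by simp
qed

lemma countable_Dset: "countable (Dset n r u)"
proof (rule countable_image_inj_on)
  let ?h = "\<lambda>D :: nat \<Rightarrow> nat \<Rightarrow> int. restrict (\<lambda>(i, j). D i j) ({..<n} \<times> {..<r})"
  have "countable (PiE ({..<n} \<times> {..<r}) (\<lambda>_. UNIV :: int set))" by (intro countable_PiE) auto
  then show "countable (?h ` Dset n r u)" by (rule countable_subset[rotated]) (intro image_subsetI restrict_PiE_iff[THEN iffD2] ballI UNIV_I)
  show "inj_on ?h (Dset n r u)"
  proof (rule inj_onI)
    fix D D' assume D: "D \<in> Dset n r u" "D' \<in> Dset n r u" and e: "?h D = ?h D'"
    have z: "\<forall>i j. n \<le> i \<or> r \<le> j \<longrightarrow> D i j = 0" "\<forall>i j. n \<le> i \<or> r \<le> j \<longrightarrow> D' i j = 0"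
      using D[unfolded Dset_def mem_Collect_eq, THEN conjunct1] .
    have "D i j = D' i j" for i j
    proof (cases "i < n \<and> j < r")
      case True
      then show ?thesis using fun_cong[OF e, of "(i, j)"] by simp
    next
      case False
      then show ?thesis using z(1)[rule_format, of i j] z(2)[rule_format, of i j] by linarith
    qed
    then show "D = D'" by (simp add: fun_eq_iff)
  qed
qed

lemma borel_measurable_integral_shf:
  fixes f :: "(nat \<Rightarrow> real^'n) \<Rightarrow> ennreal"
  assumes f: "f \<in> borel_measurable (TT (Suc n))"
  shows "(\<lambda>X. \<integral>\<^sup>+ y. f (shf n y X) \<partial>lborel) \<in> borel_measurable (TT n)"
proof -
  let ?L = "lborel :: (real^'n) measure" and ?T = "TT n :: (nat \<Rightarrow> real^'n) measure"
  have "(\<lambda>p. shf n (snd p) (fst p)) \<in> measurable (?T \<Otimes>\<^sub>M ?L) (TT (Suc n))"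
  proof (rule measurable_shf)
    show "snd \<in> borel_measurable (?T \<Otimes>\<^sub>M ?L)" using measurable_snd[of ?T ?L] by simp
    fix j assume "j < n"
    then have "(\<lambda>X :: nat \<Rightarrow> real^'n. X j) \<in> measurable (TT n) lborel" by (intro measurable_component_singleton) simp
    from measurable_compose[OF measurable_fst[of ?T ?L] this] show "(\<lambda>p. fst p j) \<in> borel_measurable (?T \<Otimes>\<^sub>M ?L)" by simp
  qed
  from measurable_compose[OF this f] have "(\<lambda>(X, y). f (shf n y X)) \<in> borel_measurable (?T \<Otimes>\<^sub>M ?L)"
    by (simp add: case_prod_beta)
  then show ?thesis by (rule lborel.borel_measurable_nn_integral)
qed

lemma SLZ_inv_PiE_Zv: "SLZ_inv r (PiE {..<r} (\<lambda>_. Zv) :: (nat \<Rightarrow> real^'n) set)"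
  unfolding SLZ_inv_def
proof (intro conjI ballI order_refl)
  fix m :: "real^'n^'n" and A :: "nat \<Rightarrow> real^'n" assume m: "m \<in> SLZ" and A: "A \<in> PiE {..<r} (\<lambda>_. Zv)"
  show "tmul r A m \<in> PiE {..<r} (\<lambda>_. Zv)"
  proof (rule PiE_I)
    fix i assume "i \<in> {..<r}"
    then show "tmul r A m i \<in> Zv" using m PiE_mem[OF A, of i] by (simp add: tmul_def SLZ_def Zv_vector_matrix)
  qed (simp add: tmul_def)
qed

context asl_measure
begin

text \<open>\<open>translation_unfold\<close> turns the sum over the first point into a Lebesgue
  integral. The differences are then sorted by \<open>sum_strat\<close> and averaged stratum by
  stratum with \<open>mean_value_CD\<close>, which applies since \<open>r \<le> n < d\<close>. All
  terms are nonnegative, so sums and integrals may be exchanged freely.\<close>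

theorem mean_value_affine:
  fixes f :: "(nat \<Rightarrow> real^'n) \<Rightarrow> ennreal"
  assumes f: "f \<in> borel_measurable (TT (Suc n))" and n: "n < CARD('n)"
  shows "(\<integral>\<^sup>+ q. (\<integral>\<^sup>+ z. (\<integral>\<^sup>+ A. f (shf n (z v* fst q + snd q) (tmul n A (fst q))) \<partial>count_space (PiE {..<n} (\<lambda>_. Zv))) \<partial>count_space Zv) \<partial>P) =
    (\<integral>\<^sup>+ y. f (shf n y (restrict (\<lambda>_. 0) {..<n})) \<partial>lborel) +
    (\<Sum>r\<in>{1..n}. \<integral>\<^sup>+ u. (\<integral>\<^sup>+ D. ennreal ((real (Ncount n r D u) / real u ^ r) ^ CARD('n)) *
      (\<integral>\<^sup>+ X. (\<integral>\<^sup>+ y. f (shf n y (matapp n r D u X)) \<partial>lborel) \<partial>TT r) \<partial>count_space (Dset n r u)) \<partial>count_space {1..})"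
proof -
  let ?C = "PiE {..<n} (\<lambda>_. Zv) :: (nat \<Rightarrow> real^'n) set"
  let ?z = "restrict (\<lambda>_. 0 :: real^'n) {..<n}"
  define Q where "Q p = (\<integral>\<^sup>+ A. f (shf n (snd p) (tmul n A (fst p))) \<partial>count_space ?C)" for p :: "'n asl"
  define H where "H X = (\<integral>\<^sup>+ y. f (shf n y X) \<partial>lborel)" for X
  have H: "H \<in> borel_measurable (TT n)" unfolding H_def by (rule borel_measurable_integral_shf[OF f])
  have mQ: "(\<lambda>p. f (shf n (snd p) (tmul n A (fst p)))) \<in> borel_measurable (borel :: 'n asl measure)" for A
  proof (rule measurable_compose[OF measurable_shf f])
    fix j assume "j < n"
    then show "(\<lambda>p. tmul n A (fst p) j) \<in> borel_measurable (borel :: 'n asl measure)"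
      by (simp add: tmul_def borel_measurable_vector_matrix borel_measurable_fst)
  qed (rule borel_measurable_snd)
  have mQy: "(\<lambda>y. f (shf n y X)) \<in> borel_measurable lborel" for X
    by (rule measurable_compose[OF measurable_shf f]) simp_all
  have Q: "Q \<in> borel_measurable borel"
    unfolding Q_def[abs_def] by (intro borel_measurable_countable_nn_integral countable_PiE_Zv mQ)
  have Qinv: "Q (m ** g, y) = Q (g, y)" if "m \<in> SLZ" "det g = 1" for m g y
    unfolding Q_def fst_conv snd_conv using nn_integral_SLZ_inv[OF SLZ_inv_PiE_Zv that(1), where f = "\<lambda>X. f (shf n y X)"] .
  define W where "W r u D q = (\<integral>\<^sup>+ B. H (matapp n r D u (tmul r B (fst q))) \<partial>count_space (CD r n D u))" for r u D and q :: "'n asl"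
  have Hr: "(\<lambda>X. H (matapp n r D u X)) \<in> borel_measurable (TT r)" for r D u
    by (rule measurable_compose[OF measurable_matapp H]) (rule borel_measurable_TT_component)
  have W: "W r u D \<in> borel_measurable P" for r u D
  proof -
    have fst: "fst \<in> borel_measurable P" using borel_measurable_fst by simp
    from measurable_compose[OF fst borel_measurable_sum_C[OF SLZ_inv_CD Hr]] show ?thesis
      unfolding W_def[abs_def] .
  qed
  have WD: "(\<lambda>q. \<integral>\<^sup>+ D. W r u D q \<partial>count_space (Dset n r u)) \<in> borel_measurable P" for r u
    by (intro borel_measurable_countable_nn_integral countable_Dset W)
  have Wu: "(\<lambda>q. \<integral>\<^sup>+ u. (\<integral>\<^sup>+ D. W r u D q \<partial>count_space (Dset n r u)) \<partial>count_space {1..}) \<in> borel_measurable P" for r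
    by (rule borel_measurable_countable_nn_integral) (auto intro: WD)
  have inner: "(\<integral>\<^sup>+ y. Q (fst q, y) \<partial>lborel) =
    H ?z + (\<Sum>r\<in>{1..n}. \<integral>\<^sup>+ u. (\<integral>\<^sup>+ D. W r u D q \<partial>count_space (Dset n r u)) \<partial>count_space {1..})" for q
  proof -
    have "(\<integral>\<^sup>+ y. Q (fst q, y) \<partial>lborel) = (\<integral>\<^sup>+ A. H (tmul n A (fst q)) \<partial>count_space ?C)"
      unfolding Q_def H_def fst_conv snd_conv
      by (rule nn_integral_count_space_nn_integral[OF countable_PiE_Zv mQy])
    also have "\<dots> = H (tmul n ?z (fst q)) + (\<Sum>r\<in>{1..n}. \<integral>\<^sup>+ u. (\<integral>\<^sup>+ D. (\<integral>\<^sup>+ B. H (tmul n (matapp n r D u B) (fst q))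
        \<partial>count_space (CD r n D u)) \<partial>count_space (Dset n r u)) \<partial>count_space {1..})"
      by (rule sum_strat)
    also have "tmul n ?z (fst q) = ?z" by (auto simp: tmul_def fun_eq_iff)
    finally show ?thesis unfolding tmul_matapp W_def .
  qed
  have "(\<integral>\<^sup>+ q. (\<integral>\<^sup>+ z. (\<integral>\<^sup>+ A. f (shf n (z v* fst q + snd q) (tmul n A (fst q))) \<partial>count_space ?C) \<partial>count_space Zv) \<partial>P) =
    (\<integral>\<^sup>+ q. (\<integral>\<^sup>+ z. Q (fst q, z v* fst q + snd q) \<partial>count_space Zv) \<partial>P)"
    by (simp add: Q_def)
  also have "\<dots> = (\<integral>\<^sup>+ q. (\<integral>\<^sup>+ y. Q (fst q, y) \<partial>lborel) \<partial>P)"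
    by (rule translation_unfold[OF Q Qinv])
  also have "\<dots> = H ?z + (\<integral>\<^sup>+ q. (\<Sum>r\<in>{1..n}. \<integral>\<^sup>+ u. (\<integral>\<^sup>+ D. W r u D q \<partial>count_space (Dset n r u)) \<partial>count_space {1..}) \<partial>P)"
    unfolding inner by (subst nn_integral_add[OF _ borel_measurable_sum[OF Wu]]) (use emeasure_space_1 in simp_all)
  also have "(\<integral>\<^sup>+ q. (\<Sum>r\<in>{1..n}. \<integral>\<^sup>+ u. (\<integral>\<^sup>+ D. W r u D q \<partial>count_space (Dset n r u)) \<partial>count_space {1..}) \<partial>P) =
    (\<Sum>r\<in>{1..n}. \<integral>\<^sup>+ q. (\<integral>\<^sup>+ u. (\<integral>\<^sup>+ D. W r u D q \<partial>count_space (Dset n r u)) \<partial>count_space {1..}) \<partial>P)"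
    by (rule nn_integral_sum) (rule Wu)
  also have "\<dots> = (\<Sum>r\<in>{1..n}. \<integral>\<^sup>+ u. (\<integral>\<^sup>+ D. ennreal ((real (Ncount n r D u) / real u ^ r) ^ CARD('n)) *
      (\<integral>\<^sup>+ X. H (matapp n r D u X) \<partial>TT r) \<partial>count_space (Dset n r u)) \<partial>count_space {1..})"
  proof (rule sum.cong[OF refl])
    fix r assume r: "r \<in> {1..n}"
    have "(\<integral>\<^sup>+ q. (\<integral>\<^sup>+ u. (\<integral>\<^sup>+ D. W r u D q \<partial>count_space (Dset n r u)) \<partial>count_space {1..}) \<partial>P) =
      (\<integral>\<^sup>+ u. (\<integral>\<^sup>+ q. (\<integral>\<^sup>+ D. W r u D q \<partial>count_space (Dset n r u)) \<partial>P) \<partial>count_space {1..})"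
      by (rule nn_integral_count_space_nn_integral) (auto intro: WD)
    also have "\<dots> = (\<integral>\<^sup>+ u. (\<integral>\<^sup>+ D. (\<integral>\<^sup>+ q. W r u D q \<partial>P) \<partial>count_space (Dset n r u)) \<partial>count_space {1..})"
      by (rule nn_integral_cong) (rule nn_integral_count_space_nn_integral[OF countable_Dset W])
    also have "\<dots> = (\<integral>\<^sup>+ u. (\<integral>\<^sup>+ D. ennreal ((real (Ncount n r D u) / real u ^ r) ^ CARD('n)) *
      (\<integral>\<^sup>+ X. H (matapp n r D u X) \<partial>TT r) \<partial>count_space (Dset n r u)) \<partial>count_space {1..})"
    proof (rule nn_integral_cong, rule nn_integral_cong)
      fix u D assume "u \<in> space (count_space {1::nat..})"
      then show "(\<integral>\<^sup>+ q. W r u D q \<partial>P) = ennreal ((real (Ncount n r D u) / real u ^ r) ^ CARD('n)) * (\<integral>\<^sup>+ X. H (matapp n r D u X) \<partial>TT r)"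
        unfolding W_def using r n by (intro mean_value_CD[OF _ _ Hr]) auto
    qed
    finally show "(\<integral>\<^sup>+ q. (\<integral>\<^sup>+ u. (\<integral>\<^sup>+ D. W r u D q \<partial>count_space (Dset n r u)) \<partial>count_space {1..}) \<partial>P) =
      (\<integral>\<^sup>+ u. (\<integral>\<^sup>+ D. ennreal ((real (Ncount n r D u) / real u ^ r) ^ CARD('n)) *
      (\<integral>\<^sup>+ X. H (matapp n r D u X) \<partial>TT r) \<partial>count_space (Dset n r u)) \<partial>count_space {1..})" .
  qed
  finally show ?thesis unfolding H_def .
qed

end

text \<open>By \<open>Dset_full\<close> only \<open>u = 1\<close> with the identity matrix
  contributes, and its factor is one. Then \<open>nn_integral_TT_Suc\<close> reassembles the
  Lebesgue integral over all points.\<close>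

lemma full_rank_term:
  fixes f :: "(nat \<Rightarrow> real^'n) \<Rightarrow> ennreal"
  assumes f: "f \<in> borel_measurable (TT (Suc n))" and n: "n \<ge> 1"
  shows "(\<integral>\<^sup>+ u. (\<integral>\<^sup>+ D. ennreal ((real (Ncount n n D u) / real u ^ n) ^ CARD('n)) *
      (\<integral>\<^sup>+ X. (\<integral>\<^sup>+ y. f (shf n y (matapp n n D u X)) \<partial>lborel) \<partial>TT n) \<partial>count_space (Dset n n u)) \<partial>count_space {1..}) =
    (\<integral>\<^sup>+ Y. f Y \<partial>TT (Suc n))"
proof -
  define G where "G u D = ennreal ((real (Ncount n n D u) / real u ^ n) ^ CARD('n)) *
      (\<integral>\<^sup>+ X. (\<integral>\<^sup>+ y. f (shf n y (matapp n n D u X)) \<partial>lborel) \<partial>TT n)" for u D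
  let ?I = "\<lambda>i j. if i = j \<and> i < n then 1 else (0::int)"
  have "(\<integral>\<^sup>+ u. (\<integral>\<^sup>+ D. G u D \<partial>count_space (Dset n n u)) \<partial>count_space {1..}) =
    (\<integral>\<^sup>+ u. G 1 ?I * indicator {1} u \<partial>count_space {1::nat..})"
  proof (rule nn_integral_cong)
    fix u :: nat
    show "(\<integral>\<^sup>+ D. G u D \<partial>count_space (Dset n n u)) = G 1 ?I * indicator {1} u"
      unfolding Dset_full[OF n] by (cases "u = 1") (simp_all add: nn_integral_count_space_finite)
  qed
  also have "\<dots> = G 1 ?I" by (subst nn_integral_indicator_singleton) auto
  also have "\<dots> = (\<integral>\<^sup>+ X. (\<integral>\<^sup>+ y. f (shf n y (matapp n n ?I 1 X)) \<partial>lborel) \<partial>TT n)"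
  proof -
    have "SN n n ?I 1 = {\<lambda>_. 0}"
    proof (rule equalityI; rule subsetI)
      fix v assume v: "v \<in> SN n n ?I 1"
      have "v j = 0" for j using v by (cases "j < n") (force simp: SN_def)+
      then show "v \<in> {\<lambda>_. 0}" by (simp add: fun_eq_iff)
    qed (simp add: SN_def)
    then have "Ncount n n ?I 1 = 1" using card_SN[of n n ?I 1] by simp
    then show ?thesis by (simp add: G_def)
  qed
  also have "\<dots> = (\<integral>\<^sup>+ X. (\<integral>\<^sup>+ y. f (shf n y X) \<partial>lborel) \<partial>TT n)"
  proof (rule nn_integral_cong)
    fix X :: "nat \<Rightarrow> real^'n"
    have "matapp n n ?I 1 X i = X i" if "i < n" for i
    proof -
      have "matapp n n ?I 1 X i = (\<Sum>j<n. (real_of_int (?I i j) / real 1) *\<^sub>R X j)"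
        using that by (simp only: matapp_def restrict_apply lessThan_iff if_True)
      also have "\<dots> = (\<Sum>j<n. if j = i then X j else 0)"
        using that by (intro sum.cong) auto
      finally show ?thesis using that by simp
    qed
    then have "shf n y (matapp n n ?I 1 X) = shf n y X" for y by (intro shf_cong)
    then show "(\<integral>\<^sup>+ y. f (shf n y (matapp n n ?I 1 X)) \<partial>lborel) = (\<integral>\<^sup>+ y. f (shf n y X) \<partial>lborel)" by simp
  qed
  also have "\<dots> = (\<integral>\<^sup>+ Y. f Y \<partial>TT (Suc n))" by (rule nn_integral_TT_Suc[OF f, symmetric])
  finally show ?thesis unfolding G_def .
qed

text \<open>Rank \<open>r\<close> of the differences corresponds to \<open>m = Suc r\<close> vectors
  for the points. The factors agree because \<open>(u N)^d / u^(d (r + 1)) = (N / u^r)^d\<close>,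
  with \<open>u N\<close> coming from \<open>Ncount_Dtilde\<close>.\<close>

lemma partial_rank_term:
  fixes f :: "(nat \<Rightarrow> real^'n) \<Rightarrow> ennreal"
  assumes f: "f \<in> borel_measurable (TT (Suc n))"
  shows "(\<integral>\<^sup>+ u. (\<integral>\<^sup>+ D. ennreal ((real (Ncount n r D u) / real u ^ r) ^ CARD('n)) *
      (\<integral>\<^sup>+ X. (\<integral>\<^sup>+ y. f (shf n y (matapp n r D u X)) \<partial>lborel) \<partial>TT r) \<partial>count_space (Dset n r u)) \<partial>count_space {1..}) =
    (\<integral>\<^sup>+ u. (\<integral>\<^sup>+ D. ennreal (real (Ncount (Suc n) (Suc r) D u) ^ CARD('n) / real u ^ (CARD('n) * Suc r)) *
      (\<integral>\<^sup>+ Y. f (matapp (Suc n) (Suc r) D u Y) \<partial>TT (Suc r)) \<partial>count_space (Aset (Suc n) (Suc r) u)) \<partial>count_space {1..})"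
proof (rule nn_integral_cong)
  fix u assume "u \<in> space (count_space {1::nat..})"
  then have u: "u \<ge> 1" by simp
  define G where "G D = ennreal (real (Ncount (Suc n) (Suc r) D u) ^ CARD('n) / real u ^ (CARD('n) * Suc r)) *
      (\<integral>\<^sup>+ Y. f (matapp (Suc n) (Suc r) D u Y) \<partial>TT (Suc r))" for D
  have bij: "bij_betw (Dtilde (Suc n) r u) (Dset n r u) (Aset (Suc n) (Suc r) u)"
    unfolding Aset_def by (rule bij_betw_imageI) (simp_all add: inj_on_Dtilde)
  have "(\<integral>\<^sup>+ D. G D \<partial>count_space (Aset (Suc n) (Suc r) u)) = (\<integral>\<^sup>+ D. G (Dtilde (Suc n) r u D) \<partial>count_space (Dset n r u))"
    by (rule nn_integral_bij_count_space[OF bij, symmetric])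
  also have "\<dots> = (\<integral>\<^sup>+ D. ennreal ((real (Ncount n r D u) / real u ^ r) ^ CARD('n)) *
      (\<integral>\<^sup>+ X. (\<integral>\<^sup>+ y. f (shf n y (matapp n r D u X)) \<partial>lborel) \<partial>TT r) \<partial>count_space (Dset n r u))"
  proof (rule nn_integral_cong)
    fix D
    have "(\<lambda>Y. f (matapp (Suc n) (Suc r) (Dtilde (Suc n) r u D) u Y)) \<in> borel_measurable (TT (Suc r))"
      by (rule measurable_compose[OF measurable_matapp f]) (rule borel_measurable_TT_component)
    from nn_integral_TT_Suc[OF this]
    have "(\<integral>\<^sup>+ Y. f (matapp (Suc n) (Suc r) (Dtilde (Suc n) r u D) u Y) \<partial>TT (Suc r)) =
      (\<integral>\<^sup>+ X. (\<integral>\<^sup>+ y. f (shf n y (matapp n r D u X)) \<partial>lborel) \<partial>TT r)"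
      unfolding matapp_Dtilde[OF u] .
    moreover have "real (u * Ncount n r D u) ^ CARD('n) / real u ^ (CARD('n) * Suc r) = (real (Ncount n r D u) / real u ^ r) ^ CARD('n)"
    proof -
      have "real u ^ (CARD('n) * Suc r) = real u ^ CARD('n) * (real u ^ r) ^ CARD('n)"
        by (simp add: power_add power_mult[symmetric] mult.commute)
      then show ?thesis using u by (simp add: power_mult_distrib power_divide)
    qed
    ultimately show "G (Dtilde (Suc n) r u D) = ennreal ((real (Ncount n r D u) / real u ^ r) ^ CARD('n)) *
      (\<integral>\<^sup>+ X. (\<integral>\<^sup>+ y. f (shf n y (matapp n r D u X)) \<partial>lborel) \<partial>TT r)"
      unfolding G_def Ncount_Dtilde[OF u] by (simp only:)
  qed
  finally show "(\<integral>\<^sup>+ D. ennreal ((real (Ncount n r D u) / real u ^ r) ^ CARD('n)) *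
      (\<integral>\<^sup>+ X. (\<integral>\<^sup>+ y. f (shf n y (matapp n r D u X)) \<partial>lborel) \<partial>TT r) \<partial>count_space (Dset n r u)) =
    (\<integral>\<^sup>+ D. ennreal (real (Ncount (Suc n) (Suc r) D u) ^ CARD('n) / real u ^ (CARD('n) * Suc r)) *
      (\<integral>\<^sup>+ Y. f (matapp (Suc n) (Suc r) D u Y) \<partial>TT (Suc r)) \<partial>count_space (Aset (Suc n) (Suc r) u))"
    unfolding G_def by (rule sym)
qed

text \<open>For \<open>k = 1\<close> the diagonal integral is the Lebesgue integral itself and must
  be counted once only, hence the condition \<open>2 \<le> k\<close> on the second term.\<close>

theorem mainTheorem7:
  fixes F :: "(nat \<Rightarrow> real^'n) \<Rightarrow> real" and k :: nat and M :: "(real^'n) set measure"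
  assumes d2: "CARD('n) \<ge> 2"
    and k1: "1 \<le> k" and kd: "k \<le> CARD('n)"
    and muY: "is_muY M"
    and Fmeas: "F \<in> borel_measurable (PiM {..<k} (\<lambda>_. lborel))"
    and Fnonneg: "\<forall>y \<in> PiE {..<k} (\<lambda>_. UNIV). 0 \<le> F y"
    and Fbdd: "\<exists>B. \<forall>y \<in> PiE {..<k} (\<lambda>_. UNIV). F y \<le> B"
    and Fsupp: "\<exists>R. \<forall>y \<in> PiE {..<k} (\<lambda>_. UNIV). F y \<noteq> 0 \<longrightarrow> (\<forall>i<k. norm (y i) \<le> R)"
  shows "(\<integral>\<^sup>+ L. Fhat k F L \<partial>M) =
     (\<integral>\<^sup>+ y. ennreal (F y) \<partial>PiM {..<k} (\<lambda>_. lborel))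
   + (if 2 \<le> k then (\<integral>\<^sup>+ y. ennreal (F (restrict (\<lambda>_. y) {..<k})) \<partial>lborel) else 0)
   + (\<Sum>m\<in>{2..<k}. \<integral>\<^sup>+ u. (\<integral>\<^sup>+ D.
        ennreal (real (Ncount k m D u) ^ CARD('n) / real u ^ (CARD('n) * m))
        * (\<integral>\<^sup>+ y. ennreal (F (matapp k m D u y)) \<partial>PiM {..<m} (\<lambda>_. lborel))
      \<partial>count_space (Aset k m u)) \<partial>count_space {1::nat..})"
proof -
  obtain n where k: "k = Suc n" using k1 by (cases k) auto
  interpret asl_measure "liftm M" by (rule asl_measure_liftm[OF muY])
  define f where "f y = ennreal (F y)" for y
  have f: "f \<in> borel_measurable (TT (Suc n))" using Fmeas unfolding f_def k by measurable
  let ?z = "restrict (\<lambda>_. 0 :: real^'n) {..<n}"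
  define psi where "psi q = (\<integral>\<^sup>+ z. (\<integral>\<^sup>+ A. f (shf n (z v* fst q + snd q) (tmul n A (fst q))) \<partial>count_space (PiE {..<n} (\<lambda>_. Zv))) \<partial>count_space Zv)"
    for q :: "'n asl"
  define T where "T r = (\<integral>\<^sup>+ u. (\<integral>\<^sup>+ D. ennreal ((real (Ncount n r D u) / real u ^ r) ^ CARD('n)) *
      (\<integral>\<^sup>+ X. (\<integral>\<^sup>+ y. f (shf n y (matapp n r D u X)) \<partial>lborel) \<partial>TT r) \<partial>count_space (Dset n r u)) \<partial>count_space {1..})" for r
  define U where "U m = (\<integral>\<^sup>+ u. (\<integral>\<^sup>+ D. ennreal (real (Ncount k m D u) ^ CARD('n) / real u ^ (CARD('n) * m)) *
      (\<integral>\<^sup>+ Y. f (matapp k m D u Y) \<partial>TT m) \<partial>count_space (Aset k m u)) \<partial>count_space {1..})" for m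
  have psi: "psi \<in> borel_measurable borel"
    unfolding psi_def[abs_def]
  proof (intro borel_measurable_countable_nn_integral countable_Zv countable_PiE_Zv)
    fix z :: "real^'n" and A :: "nat \<Rightarrow> real^'n"
    have v: "(\<lambda>q. w v* fst q) \<in> borel_measurable (borel :: 'n asl measure)" for w
      by (intro borel_measurable_vector_matrix borel_measurable_fst) simp
    show "(\<lambda>q. f (shf n (z v* fst q + snd q) (tmul n A (fst q)))) \<in> borel_measurable (borel :: 'n asl measure)"
    proof (rule measurable_compose[OF measurable_shf f])
      show "(\<lambda>q. z v* fst q + snd q) \<in> borel_measurable (borel :: 'n asl measure)"
        by (intro borel_measurable_add v borel_measurable_snd)
      show "(\<lambda>q. tmul n A (fst q) j) \<in> borel_measurable (borel :: 'n asl measure)" if "j < n" for j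
        using that v by (simp add: tmul_def)
    qed
  qed
  have eq: "Fhat k F (affl q) = psi q" if "det (fst q) = 1" for q
    unfolding psi_def f_def k by (rule Fhat_affl[OF that])
  have "(\<integral>\<^sup>+ L. Fhat k F L \<partial>M) = (\<integral>\<^sup>+ q. psi q \<partial>liftm M)"
    by (rule nn_integral_liftm[OF muY psi eq])
  also have "\<dots> = (\<integral>\<^sup>+ y. f (shf n y ?z) \<partial>lborel) + (\<Sum>r\<in>{1..n}. T r)"
    unfolding psi_def T_def by (rule mean_value_affine[OF f]) (use kd k in simp)
  also have "\<dots> = (\<integral>\<^sup>+ y. f y \<partial>TT k)
   + (if 2 \<le> k then (\<integral>\<^sup>+ y. f (restrict (\<lambda>_. y) {..<k}) \<partial>lborel) else 0) + (\<Sum>m\<in>{2..<k}. U m)"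
  \<comment> \<open>Without differences the term of rank zero is already the Lebesgue integral.
    Otherwise rank zero gives the diagonal, rank \<open>n\<close> the Lebesgue integral, and the
    ranks \<open>r\<close> in between give \<open>m = r + 1\<close> from \<open>2\<close> to
    \<open>k - 1\<close>.\<close>
  proof (cases "n = 0")
    case True
    interpret product_sigma_finite "\<lambda>_::nat. lborel :: (real^'n) measure" by (rule product_sigma_finite_lborel)
    have "(\<integral>\<^sup>+ y. f y \<partial>TT k) = (\<integral>\<^sup>+ X. (\<integral>\<^sup>+ y. f (shf n y X) \<partial>lborel) \<partial>TT n)"
      unfolding k by (rule nn_integral_TT_Suc[OF f])
    also have "\<dots> = (\<integral>\<^sup>+ y. f (shf n y (\<lambda>_. undefined)) \<partial>lborel)"
      using True by (simp add: nn_integral_empty)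
    also have "\<dots> = (\<integral>\<^sup>+ y. f (shf n y ?z) \<partial>lborel)"
    proof -
      have "shf n y (\<lambda>_. undefined) = shf n y ?z" for y by (rule shf_cong) (use True in simp)
      then show ?thesis by simp
    qed
    finally show ?thesis using True k by simp
  next
    case False
    then have n: "n \<ge> 1" by simp
    have diag: "shf n y ?z = restrict (\<lambda>_. y) {..<k}" for y
      unfolding k by (auto simp: shf_def fun_eq_iff split: nat.split)
    have "{1..n} = insert n {1..<n}" using n by auto
    then have "(\<Sum>r\<in>{1..n}. T r) = T n + (\<Sum>r\<in>{1..<n}. T r)" by simp
    also have "T n = (\<integral>\<^sup>+ y. f y \<partial>TT k)" unfolding T_def k by (rule full_rank_term[OF f n])
    also have "(\<Sum>r\<in>{1..<n}. T r) = (\<Sum>r\<in>{1..<n}. U (Suc r))"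
      unfolding T_def U_def k by (intro sum.cong refl partial_rank_term[OF f])
    also have "\<dots> = (\<Sum>m\<in>{2..<k}. U m)"
      unfolding k numeral_2_eq_2 One_nat_def by (rule sum.shift_bounds_Suc_ivl[symmetric])
    finally show ?thesis using n k by (simp add: diag ac_simps)
  qed
  finally show ?thesis unfolding f_def U_def .
qed

end
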